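(* Let $s\in(0,1]$, $\nu>0$, $w_0\in H^s_0(\Omega)$, $w_1\in L^2(\Omega)$, $g\in L^2(\Omega)$ and $\beta=\partial I_{[0,+\infty)}$. If $u$ is a penalization weak solution (defined in the context) of the viscous obstacle problem $$\ddot u-D^s\cdot(AD^su)-\nu D^s\cdot(BD^s\dot u)+\beta(u)\ni g\ \text{ in }(0,T)\times\Omega,\quad u=0\text{ on }(0,T)\times(\mathbb R^d\setminus\Omega),\quad u(0)=w_0,\ \dot u(0)=w_1,$$ then $u$ is also a very weak solution (defined in the context) of the same problem.
   Context: Setting. $\Omega\subset\mathbb R^d$ is a bounded open set with Lipschitz boundary and $T>0$. For $s\in(0,1)$, $D^s$ is the Riesz fractional gradient: $D^s\varphi=D(I_{1-s}\varphi)$ for $\varphi\in C_c^\infty(\mathbb R^d)$, where $I_{1-s}$ is the Riesz potential of order $1-s$ (Fourier multiplier $|2\pi\xi|^{-(1-s)}$), extended weakly by $\int_{\mathbb R^d}D^su\cdot\Phi\,dx=-\int_{\mathbb R^d}u\,D^s\cdot\Phi\,dx$ for $\Phi\in C_c^\infty(\mathbb R^d;\mathbb R^d)$, $D^s\cdot$ being the corresponding fractional divergence; $D^1=D$. $H^s(\mathbb R^d)=\{u\in L^2:\ D^su\in L^2\}$ with norm $(\|u\|^2_{L^2}+\|D^su\|^2_{L^2})^{1/2}$, and $H^s_0(\Omega)$ is the closure of $C_c^\infty(\Omega)$ in $H^s(\mathbb R^d)$. $A,B:\mathbb R^d\to\mathbb R^{d\times d}$ are bounded, measurable, with constants $a_*,a^*,b_*,b^*>0$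 such that $a_*|\eta|^2\le A(x)\eta\cdot\eta$, $A(x)\eta\cdot\zeta\le a^*|\eta||\zeta|$, $b_*|\eta|^2\le B(x)\eta\cdot\eta$, $B(x)\eta\cdot\zeta\le b^*|\eta||\zeta|$ for all $\eta,\zeta\in\mathbb R^d$; $B$ is symmetric. $\mathcal V_{s,t}=H^1(0,t;L^2(\Omega))\cap L^2(0,t;H^s_0(\Omega))$, $\mathcal V_s=\mathcal V_{s,T}$, duals $\mathcal V'_{s,t}$, $\mathcal V'_s$; $\overline{\mathcal V}_{s,t}=\{v\in\mathcal V_{s,t}:v(t)=0\}$. $j=I_{[0,+\infty)}$ is the convex indicator function of $[0,+\infty)$, $\beta=\partial j$; $j^\varepsilon$ is the Moreau–Yosida regularization of $j$ and $\beta^\varepsilon=(j^\varepsilon)'$, $\varepsilon\in(0,1)$. With $\mathcal J_t(u)=\int_0^t\int_\Omega j(u)\,dx\,d\tau$: $\xi\in\beta_{s,t}(u)$ iff $u\in\mathcal V_{s,t}$, $\xi\in\mathcal V'_{s,t}$ and $\mathcal J_t(u)-\mathcal J_t(v)\le\langle\xi,u-v\rangle$ for all $v\in\mathcal V_{s,t}$; $\beta_s=\beta_{s,T}$. Weak solution. $(u,\xi)$ (or $u$) is a weak solution if: (a) $u\in H^1(0,T;H^s_0(\Omega))\cap W^{1,\infty}(0,T;L^2(\Omega))$, $u(0)=w_0$, $\dot u(0)=w_1$, $\xi\in\beta_s(u)$; (b) for all $\varphi\in\mathcal V_s$, $$\int_\Omega\dot u(T)\varphi(T)dx-\int_\Omega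 w_1\varphi(0)dx-\int_0^T\!\!\int_\Omega\dot u\dot\varphi\,dxd\tau+\langle\xi,\varphi\rangle_{\mathcal V_s'\times\mathcal V_s}+\int_0^T\!\!\int_{\mathbb R^d}(AD^su\cdot D^s\varphi+\nu BD^s\dot u\cdot D^s\varphi)dxd\tau=\int_0^T\!\!\int_\Omega g\varphi\,dxd\tau;$$ (c) for every $t\in(0,T]$ there is $\xi_t\in\beta_{s,t}(u)$ with $\langle\xi_t,\varphi\rangle=\langle\xi,\tilde\varphi\rangle$ for all $\varphi\in\overline{\mathcal V}_{s,t}$ ($\tilde\varphi$ the extension by $0$ to times larger than $t$), such that the identity in (b) holds with $T$ replaced by $t$, $\xi$ by $\xi_t$, for all $\varphi\in\mathcal V_{s,t}$. Penalization weak solution. $u^\varepsilon$ denotes a function with $u^\varepsilon\in L^\infty(0,T;H^s_0(\Omega))$, $\dot u^\varepsilon\in L^\infty(0,T;L^2(\Omega))\cap L^2(0,T;H^s_0(\Omega))$, $u^\varepsilon(0)=w_0$, $\dot u^\varepsilon(0)=w_1$ satisfying, for every $t\in(0,T]$ and $\varphi\in\mathcal V_{s,t}$, the identity in (b) with $T$ replaced by $t$, $u$ by $u^\varepsilon$ and $\langle\xi,\varphi\rangle$ by $\int_0^t\int_\Omega\beta^\varepsilon(u^\varepsilon)\varphi\,dxd\tau$. A penalization weak solution is a weak solution $(u,\xi)$ such that for some sequence $\varepsilon\to0$: $u^\varepsilon\rightharpoonup u$ in $H^1(0,T;H^s_0(\Omega))$; $u^\varepsilon\overset{*}{\rightharpoonup}u$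 in $W^{1,\infty}(0,T;L^2(\Omega))$; for all $t\in[0,T]$, $u^\varepsilon(t)\rightharpoonup u(t)$ in $H^s_0(\Omega)$, $u^\varepsilon(t)\to u(t)$ in $L^2(\Omega)$, $\dot u^\varepsilon(t)\rightharpoonup\dot u(t)$ in $L^2(\Omega)$ (fixing the everywhere-defined representative of $\dot u$); $\dot u^\varepsilon\to\dot u$ in $L^2(0,T;L^2(\Omega))$; and $\beta^\varepsilon(u^\varepsilon)\rightharpoonup\xi_t$ in $\mathcal V'_{s,t}$ for every $t\in(0,T]$, with $\xi=\xi_T$. Very weak solution of the viscous problem. Fix $k$ so large (depending on $d$) that $L^1(\Omega)\subset H^{-k}(\Omega)$ and $H^{-s}(\Omega)\subset H^{-k}(\Omega)$ for all $s\in(0,1)$, with continuous and compact embeddings. $BV(0,T;X)$ denotes functions $f:[0,T]\to X$ with finite total variation; $f(0^+)$ is the right limit at $0$ in $X$. $u$ is a very weak solution if $u\in H^1(0,T;H^s_0(\Omega))$, $\dot u\in BV(0,T;H^{-k}(\Omega))$, $\dot u(0^+)\in L^2(\Omega)$, $u\ge0$ a.e. in $(0,T)\times\Omega$, $$-\int_0^T\!\!\int_\Omega\dot u\dot\varphi\,dxdt+\int_0^T\!\!\int_{\mathbb R^d}AD^su\cdot D^s\varphi\,dxdt+\nu\int_0^T\!\!\int_{\mathbb R^d}BD^s\dot u\cdot D^s\varphi\,dxdt\ge\int_\Omega w_1\varphi(0)dx+\int_0^T\!\!\int_\Omega g\varphi\,dxdt$$ for all $\varphi\in\mathcal V_s$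 with $\varphi\ge0$ and support in time contained in $[0,T)$, and $u(0,\cdot)=w_0$, $\int_\Omega(\dot u(0^+)-w_1)(\psi-w_0)dx\ge0$ for all $\psi\in H^s_0(\Omega)$, $\psi\ge0$. *)

theory Defs
  imports "HOL-Analysis.Analysis" "HOL-Library.Function_Algebras"
begin

section \<open>Seminormed spaces of functions\<close>

text \<open>
  Functions form a real vector space pointwise. A function space is a pair of a carrier
  \<open>X :: 'b set\<close>, which is a linear subspace of such a vector space, and a seminorm
  \<open>N :: 'b \<Rightarrow> real\<close> which is meaningful on \<open>X\<close> only. Elements are representatives, and two of them
  are the same element of the Banach space when their difference has seminorm zero. Bounded linear
  functionals respect this identification.
\<close>

instantiation "fun" :: (type, scaleR) scaleR
begin
definition scaleR_fun_def: "c *\<^sub>R f = (\<lambda>x. c *\<^sub>R f x)"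
instance ..
end

lemma scaleR_fun_apply [simp]: "(c *\<^sub>R f) x = c *\<^sub>R f x"
  by (simp add: scaleR_fun_def)

instance "fun" :: (type, real_vector) real_vector
  by standard (simp_all add: fun_eq_iff scaleR_add_right scaleR_add_left)

definition dual_on :: "'b::real_vector set \<Rightarrow> ('b \<Rightarrow> real) \<Rightarrow> ('b \<Rightarrow> real) set" where
  "dual_on X N = {F. (\<forall>x\<in>X. \<forall>y\<in>X. F (x + y) = F x + F y) \<and> (\<forall>c. \<forall>x\<in>X. F (c *\<^sub>R x) = c * F x)
                   \<and> (\<exists>C. \<forall>x\<in>X. \<bar>F x\<bar> \<le> C * N x)}"

definition dual_norm :: "'b::real_vector set \<Rightarrow> ('b \<Rightarrow> real) \<Rightarrow> ('b \<Rightarrow> real) \<Rightarrow> real" where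
  "dual_norm X N F = (SUP x\<in>{x\<in>X. N x \<le> 1}. \<bar>F x\<bar>)"

definition weakly_tends ::
  "'b::real_vector set \<Rightarrow> ('b \<Rightarrow> real) \<Rightarrow> (nat \<Rightarrow> 'b) \<Rightarrow> 'b \<Rightarrow> bool" where
  "weakly_tends X N x l \<longleftrightarrow> (\<forall>n. x n \<in> X) \<and> l \<in> X \<and> (\<forall>F\<in>dual_on X N. (\<lambda>n. F (x n)) \<longlonglongrightarrow> F l)"

definition compactly_embedded :: "'b::real_vector set \<Rightarrow> ('b \<Rightarrow> real) \<Rightarrow>
    'c::real_vector set \<Rightarrow> ('c \<Rightarrow> real) \<Rightarrow> ('b \<Rightarrow> 'c) \<Rightarrow> bool" where
  "compactly_embedded X N Y M \<iota> \<longleftrightarrow>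
     (\<forall>x\<in>X. \<iota> x \<in> Y) \<and> (\<exists>C. \<forall>x\<in>X. M (\<iota> x) \<le> C * N x) \<and>
     (\<forall>x C. (\<forall>n. x n \<in> X \<and> N (x n) \<le> C) \<longrightarrow>
        (\<exists>r y. strict_mono (r :: nat \<Rightarrow> nat) \<and> y \<in> Y \<and> (\<lambda>n. M (\<iota> (x (r n)) - y)) \<longlonglongrightarrow> 0))"

section \<open>Bochner spaces over a time interval\<close>

abbreviation time :: "real \<Rightarrow> real measure" where
  "time t \<equiv> lebesgue_on {0..t}"

definition strongly_measurable ::
  "real measure \<Rightarrow> 'b::real_vector set \<Rightarrow> ('b \<Rightarrow> real) \<Rightarrow> (real \<Rightarrow> 'b) \<Rightarrow> bool" where
  "strongly_measurable M X N f \<longleftrightarrow>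
     (\<exists>\<sigma>. (\<forall>n. simple_function M (\<sigma> n) \<and> \<sigma> n ` space M \<subseteq> X) \<and>
          (AE \<tau> in M. f \<tau> \<in> X \<and> (\<lambda>n. N (\<sigma> n \<tau> - f \<tau>)) \<longlonglongrightarrow> 0))"

definition bochner_L1 ::
  "real \<Rightarrow> 'b::real_vector set \<Rightarrow> ('b \<Rightarrow> real) \<Rightarrow> (real \<Rightarrow> 'b) set" where
  "bochner_L1 t X N =
     {f. strongly_measurable (time t) X N f \<and> integrable (time t) (\<lambda>\<tau>. N (f \<tau>))}"

definition bochner_L2 ::
  "real \<Rightarrow> 'b::real_vector set \<Rightarrow> ('b \<Rightarrow> real) \<Rightarrow> (real \<Rightarrow> 'b) set" where
  "bochner_L2 t X N =
     {f. strongly_measurable (time t) X N f \<and> integrable (time t) (\<lambda>\<tau>. (N (f \<tau>))\<^sup>2)}"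

definition bochner_Linf ::
  "real \<Rightarrow> 'b::real_vector set \<Rightarrow> ('b \<Rightarrow> real) \<Rightarrow> (real \<Rightarrow> 'b) set" where
  "bochner_Linf t X N =
     {f. strongly_measurable (time t) X N f \<and> (\<exists>C. AE \<tau> in time t. N (f \<tau>) \<le> C)}"

fun iterated_partial :: "'a::euclidean_space list \<Rightarrow> ('a \<Rightarrow> 'b::real_normed_vector) \<Rightarrow> 'a \<Rightarrow> 'b" where
  "iterated_partial [] f = f"
| "iterated_partial (v # vs) f = (\<lambda>x. frechet_derivative (iterated_partial vs f) (at x) v)"

definition smooth :: "('a::euclidean_space \<Rightarrow> 'b::real_normed_vector) \<Rightarrow> bool" where
  "smooth f \<longleftrightarrow> (\<forall>vs x. set vs \<subseteq> Basis \<longrightarrow> iterated_partial vs f differentiable (at x))"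

definition test_functions ::
  "'a::euclidean_space set \<Rightarrow> ('a \<Rightarrow> 'b::real_normed_vector) set" where
  "test_functions S = {\<phi>. smooth \<phi> \<and> compact (closure {x. \<phi> x \<noteq> 0}) \<and> closure {x. \<phi> x \<noteq> 0} \<subseteq> S}"

text \<open>
  The identity \<open>\<integral> \<theta>' u = - \<integral> \<theta> v\<close> between Bochner integrals in \<open>X\<close> is tested against the dual of
  \<open>X\<close>, which separates points.
\<close>

definition weak_time_deriv :: "real \<Rightarrow> 'b::real_vector set \<Rightarrow> ('b \<Rightarrow> real) \<Rightarrow>
    (real \<Rightarrow> 'b) \<Rightarrow> (real \<Rightarrow> 'b) \<Rightarrow> bool" where
  "weak_time_deriv t X N u v \<longleftrightarrow> u \<in> bochner_L1 t X N \<and> v \<in> bochner_L1 t X N \<and>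
     (\<forall>F\<in>dual_on X N. \<forall>\<theta>\<in>test_functions {0<..<t}.
        (LINT \<tau>|time t. deriv \<theta> \<tau> * F (u \<tau>)) = - (LINT \<tau>|time t. \<theta> \<tau> * F (v \<tau>)))"

definition time_deriv :: "real \<Rightarrow> 'b::real_vector set \<Rightarrow> ('b \<Rightarrow> real) \<Rightarrow>
    (real \<Rightarrow> 'b) \<Rightarrow> real \<Rightarrow> 'b" where
  "time_deriv t X N u = (SOME v. weak_time_deriv t X N u v)"

definition time_continuous ::
  "real \<Rightarrow> 'b::real_vector set \<Rightarrow> ('b \<Rightarrow> real) \<Rightarrow> (real \<Rightarrow> 'b) \<Rightarrow> bool" where
  "time_continuous t X N u \<longleftrightarrow> (\<forall>\<tau>\<in>{0..t}. u \<tau> \<in> X) \<and>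
     (\<forall>\<tau>\<in>{0..t}. ((\<lambda>r. N (u r - u \<tau>)) \<longlongrightarrow> 0) (at \<tau> within {0..t}))"

text \<open>
  An element of \<open>H\<^sup>1(0,t;X)\<close> or \<open>W\<^sup>1\<^sup>,\<^sup>\<infinity>(0,t;X)\<close> is given by its representative in \<open>C([0,t];X)\<close>,
  so that its value at every single time makes sense.
\<close>

definition bochner_H1 ::
  "real \<Rightarrow> 'b::real_vector set \<Rightarrow> ('b \<Rightarrow> real) \<Rightarrow> (real \<Rightarrow> 'b) set" where
  "bochner_H1 t X N = {u. time_continuous t X N u \<and> u \<in> bochner_L2 t X N \<and>
     (\<exists>v\<in>bochner_L2 t X N. weak_time_deriv t X N u v)}"

definition bochner_H1_norm ::
  "real \<Rightarrow> 'b::real_vector set \<Rightarrow> ('b \<Rightarrow> real) \<Rightarrow> (real \<Rightarrow> 'b) \<Rightarrow> real" where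
  "bochner_H1_norm t X N u =
     sqrt ((LINT \<tau>|time t. (N (u \<tau>))\<^sup>2) + (LINT \<tau>|time t. (N (time_deriv t X N u \<tau>))\<^sup>2))"

definition bochner_W1inf ::
  "real \<Rightarrow> 'b::real_vector set \<Rightarrow> ('b \<Rightarrow> real) \<Rightarrow> (real \<Rightarrow> 'b) set" where
  "bochner_W1inf t X N = {u. time_continuous t X N u \<and> u \<in> bochner_Linf t X N \<and>
     (\<exists>v\<in>bochner_Linf t X N. weak_time_deriv t X N u v)}"

definition finite_variation :: "real \<Rightarrow> ('b::real_vector \<Rightarrow> real) \<Rightarrow> (real \<Rightarrow> 'b) \<Rightarrow> bool" where
  "finite_variation t N f \<longleftrightarrow>
     (\<exists>C. \<forall>p n. (\<forall>i<n. p i \<le> p (Suc i)) \<and> 0 \<le> p 0 \<and> p n \<le> t \<longrightarrow>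
        (\<Sum>i<n. N (f (p (Suc i)) - f (p i))) \<le> C)"

definition BV :: "real \<Rightarrow> 'b::real_vector set \<Rightarrow> ('b \<Rightarrow> real) \<Rightarrow> (real \<Rightarrow> 'b) set" where
  "BV t X N = {f. (\<forall>\<tau>\<in>{0..t}. f \<tau> \<in> X) \<and> finite_variation t N f}"

section \<open>Spaces of functions of the space variable\<close>

definition lipschitz_boundary :: "'a::euclidean_space set \<Rightarrow> bool" where
  "lipschitz_boundary \<Omega> \<longleftrightarrow>
     (\<forall>z\<in>frontier \<Omega>. \<exists>e r L \<gamma>. norm e = 1 \<and> r > 0 \<and> L-lipschitz_on UNIV \<gamma> \<and>
        (\<forall>x\<in>ball z r. x \<in> \<Omega> \<longleftrightarrow> \<gamma> (x - (x \<bullet> e) *\<^sub>R e) < x \<bullet> e))"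

definition L2_space :: "'a measure \<Rightarrow> ('a \<Rightarrow> 'b::euclidean_space) set" where
  "L2_space M = {f. f \<in> borel_measurable M \<and> integrable M (\<lambda>x. (norm (f x))\<^sup>2)}"

definition L2_norm :: "'a measure \<Rightarrow> ('a \<Rightarrow> 'b::euclidean_space) \<Rightarrow> real" where
  "L2_norm M f = sqrt (LINT x|M. (norm (f x))\<^sup>2)"

abbreviation L2_on :: "'a::euclidean_space set \<Rightarrow> ('a \<Rightarrow> real) set" where
  "L2_on \<Omega> \<equiv> L2_space (lebesgue_on \<Omega>)"

abbreviation L2_on_norm :: "'a::euclidean_space set \<Rightarrow> ('a \<Rightarrow> real) \<Rightarrow> real" where
  "L2_on_norm \<Omega> \<equiv> L2_norm (lebesgue_on \<Omega>)"

text \<open>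
  The Riesz potential in its usual normalization, for which \<open>I\<^sub>\<alpha>\<close> is the Fourier multiplier
  \<open>|2\<pi>\<xi>|\<^sup>-\<^sup>\<alpha>\<close> when the Fourier transform has kernel \<open>exp (-2\<pi>i x\<cdot>\<xi>)\<close>. \<open>I\<^sub>0\<close> is the identity, so that
  the case \<open>s = 1\<close> below gives the ordinary weak gradient.
\<close>

definition riesz_const :: "nat \<Rightarrow> real \<Rightarrow> real" where
  "riesz_const d \<alpha> = pi powr (real d / 2) * 2 powr \<alpha> * Gamma (\<alpha> / 2) / Gamma ((real d - \<alpha>) / 2)"

definition riesz_potential ::
  "real \<Rightarrow> ('a::euclidean_space \<Rightarrow> 'b::euclidean_space) \<Rightarrow> 'a \<Rightarrow> 'b" where
  "riesz_potential \<alpha> \<phi> x =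
     (if \<alpha> = 0 then \<phi> x
      else (1 / riesz_const DIM('a) \<alpha>) *\<^sub>R
             (LINT y|lebesgue. norm (x - y) powr (\<alpha> - real DIM('a)) *\<^sub>R \<phi> y))"

definition divergence :: "('a::euclidean_space \<Rightarrow> 'a) \<Rightarrow> 'a \<Rightarrow> real" where
  "divergence F x = (\<Sum>b\<in>Basis. frechet_derivative F (at x) b \<bullet> b)"

definition frac_div :: "real \<Rightarrow> ('a::euclidean_space \<Rightarrow> 'a) \<Rightarrow> 'a \<Rightarrow> real" where
  "frac_div s \<Phi> = divergence (riesz_potential (1 - s) \<Phi>)"

definition weak_frac_grad ::
  "real \<Rightarrow> ('a::euclidean_space \<Rightarrow> real) \<Rightarrow> ('a \<Rightarrow> 'a) \<Rightarrow> bool" where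
  "weak_frac_grad s u G \<longleftrightarrow>
     (\<forall>\<Phi>\<in>test_functions UNIV.
        (LINT x|lebesgue. G x \<bullet> \<Phi> x) = - (LINT x|lebesgue. u x * frac_div s \<Phi> x))"

definition frac_grad :: "real \<Rightarrow> ('a::euclidean_space \<Rightarrow> real) \<Rightarrow> 'a \<Rightarrow> 'a" where
  "frac_grad s u = (SOME G. G \<in> L2_space lebesgue \<and> weak_frac_grad s u G)"

definition Hs :: "real \<Rightarrow> ('a::euclidean_space \<Rightarrow> real) set" where
  "Hs s = {u \<in> L2_space lebesgue. \<exists>G\<in>L2_space lebesgue. weak_frac_grad s u G}"

definition Hs_norm :: "real \<Rightarrow> ('a::euclidean_space \<Rightarrow> real) \<Rightarrow> real" where
  "Hs_norm s u = sqrt ((L2_norm lebesgue u)\<^sup>2 + (L2_norm lebesgue (frac_grad s u))\<^sup>2)"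

definition Hs0 :: "real \<Rightarrow> 'a::euclidean_space set \<Rightarrow> ('a \<Rightarrow> real) set" where
  "Hs0 s \<Omega> = {u \<in> Hs s. \<exists>\<phi>. (\<forall>n. \<phi> n \<in> test_functions \<Omega>) \<and> (\<lambda>n. Hs_norm s (\<phi> n - u)) \<longlonglongrightarrow> 0}"

definition Hk_norm :: "nat \<Rightarrow> ('a::euclidean_space \<Rightarrow> real) \<Rightarrow> real" where
  "Hk_norm k \<phi> =
     sqrt (\<Sum>vs\<in>{vs. set vs \<subseteq> Basis \<and> length vs \<le> k}. (L2_norm lebesgue (iterated_partial vs \<phi>))\<^sup>2)"

text \<open>
  \<open>H\<^sup>-\<^sup>k(\<Omega>)\<close> is the dual of the closure of \<open>C\<^sub>c\<^sup>\<infinity>(\<Omega>)\<close> in the \<open>H\<^sup>k\<close> norm. A bounded functional and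
  its norm are determined by the restriction to the dense subspace \<open>C\<^sub>c\<^sup>\<infinity>(\<Omega>)\<close>, so its elements are
  represented as distributions on \<open>\<Omega>\<close>.
\<close>

definition H_neg :: "nat \<Rightarrow> 'a::euclidean_space set \<Rightarrow> (('a \<Rightarrow> real) \<Rightarrow> real) set" where
  "H_neg k \<Omega> = dual_on (test_functions \<Omega>) (Hk_norm k)"

definition H_neg_norm :: "nat \<Rightarrow> 'a::euclidean_space set \<Rightarrow> (('a \<Rightarrow> real) \<Rightarrow> real) \<Rightarrow> real" where
  "H_neg_norm k \<Omega> = dual_norm (test_functions \<Omega>) (Hk_norm k)"

definition as_distribution ::
  "'a::euclidean_space set \<Rightarrow> ('a \<Rightarrow> real) \<Rightarrow> ('a \<Rightarrow> real) \<Rightarrow> real" where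
  "as_distribution \<Omega> f = (\<lambda>\<psi>. LINT x|lebesgue_on \<Omega>. f x * \<psi> x)"

definition negative_order_embeddings :: "nat \<Rightarrow> 'a::euclidean_space set \<Rightarrow> bool" where
  "negative_order_embeddings k \<Omega> \<longleftrightarrow>
     compactly_embedded
       {f. integrable (lebesgue_on \<Omega>) f} (\<lambda>f. LINT x|lebesgue_on \<Omega>. \<bar>f x\<bar>)
       (H_neg k \<Omega>) (H_neg_norm k \<Omega>) (as_distribution \<Omega>) \<and>
     (\<forall>s. 0 < s \<and> s < 1 \<longrightarrow>
        compactly_embedded
          (dual_on (Hs0 s \<Omega>) (Hs_norm s)) (dual_norm (Hs0 s \<Omega>) (Hs_norm s))
          (H_neg k \<Omega>) (H_neg_norm k \<Omega>) (\<lambda>\<xi>. \<xi>))"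

section \<open>The constraint\<close>

definition Vspace :: "real \<Rightarrow> 'a::euclidean_space set \<Rightarrow> real \<Rightarrow> (real \<Rightarrow> 'a \<Rightarrow> real) set" where
  "Vspace s \<Omega> t =
     bochner_H1 t (L2_on \<Omega>) (L2_on_norm \<Omega>) \<inter> bochner_L2 t (Hs0 s \<Omega>) (Hs_norm s)"

definition Vnorm :: "real \<Rightarrow> 'a::euclidean_space set \<Rightarrow> real \<Rightarrow> (real \<Rightarrow> 'a \<Rightarrow> real) \<Rightarrow> real" where
  "Vnorm s \<Omega> t v =
     sqrt ((bochner_H1_norm t (L2_on \<Omega>) (L2_on_norm \<Omega>) v)\<^sup>2 + (LINT \<tau>|time t. (Hs_norm s (v \<tau>))\<^sup>2))"

definition Vspace_end0 :: "real \<Rightarrow> 'a::euclidean_space set \<Rightarrow> real \<Rightarrow> (real \<Rightarrow> 'a \<Rightarrow> real) set" where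
  "Vspace_end0 s \<Omega> t = {v \<in> Vspace s \<Omega> t. AE x in lebesgue_on \<Omega>. v t x = 0}"

definition extend0 :: "real \<Rightarrow> (real \<Rightarrow> 'a \<Rightarrow> real) \<Rightarrow> real \<Rightarrow> 'a \<Rightarrow> real" where
  "extend0 t v = (\<lambda>\<tau>. if \<tau> \<le> t then v \<tau> else 0)"

definition obstacle :: "real \<Rightarrow> ereal" where
  "obstacle r = (if 0 \<le> r then 0 else \<infinity>)"

definition moreau_yosida :: "real \<Rightarrow> (real \<Rightarrow> ereal) \<Rightarrow> real \<Rightarrow> ereal" where
  "moreau_yosida \<epsilon> j r = (INF y. ereal ((r - y)\<^sup>2 / (2 * \<epsilon>)) + j y)"

definition penalty :: "real \<Rightarrow> real \<Rightarrow> real" where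
  "penalty \<epsilon> = deriv (\<lambda>r. real_of_ereal (moreau_yosida \<epsilon> obstacle r))"

definition obstacle_energy ::
  "'a::euclidean_space set \<Rightarrow> real \<Rightarrow> (real \<Rightarrow> 'a \<Rightarrow> real) \<Rightarrow> ereal" where
  "obstacle_energy \<Omega> t u =
     enn2ereal (\<integral>\<^sup>+\<tau>. (\<integral>\<^sup>+x. e2ennreal (obstacle (u \<tau> x)) \<partial>lebesgue_on \<Omega>) \<partial>time t)"

definition beta_V :: "real \<Rightarrow> 'a::euclidean_space set \<Rightarrow> real \<Rightarrow>
    (real \<Rightarrow> 'a \<Rightarrow> real) \<Rightarrow> ((real \<Rightarrow> 'a \<Rightarrow> real) \<Rightarrow> real) set" where
  "beta_V s \<Omega> t u = {\<xi>. u \<in> Vspace s \<Omega> t \<and> \<xi> \<in> dual_on (Vspace s \<Omega> t) (Vnorm s \<Omega> t) \<and>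
     (\<forall>v\<in>Vspace s \<Omega> t. obstacle_energy \<Omega> t u - obstacle_energy \<Omega> t v \<le> ereal (\<xi> (u - v)))}"

section \<open>Notions of solution\<close>

text \<open>
  Functions of time and space are maps \<open>real \<Rightarrow> real^'n \<Rightarrow> real\<close>. A Bochner function selects a
  representative at each time, without joint measurability, so space-time integrals and almost
  everywhere statements are iterated: first over space, then over time.
\<close>

definition elliptic_coefficient ::
  "real \<Rightarrow> real \<Rightarrow> (real^'n \<Rightarrow> real^'n^'n) \<Rightarrow> bool" where
  "elliptic_coefficient lo hi A \<longleftrightarrow> A \<in> borel_measurable lebesgue \<and> bounded (range A) \<and>
     (\<forall>x \<eta> \<zeta>. lo * (norm \<eta>)\<^sup>2 \<le> (A x *v \<eta>) \<bullet> \<eta> \<and> (A x *v \<eta>) \<bullet> \<zeta> \<le> hi * norm \<eta> * norm \<zeta>)"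

definition frac_form :: "real \<Rightarrow> (real^'n \<Rightarrow> real^'n^'n) \<Rightarrow> real \<Rightarrow>
    (real \<Rightarrow> real^'n \<Rightarrow> real) \<Rightarrow> (real \<Rightarrow> real^'n \<Rightarrow> real) \<Rightarrow> real" where
  "frac_form s A t u \<phi> =
     (LINT \<tau>|time t. LINT x|lebesgue. (A x *v frac_grad s (u \<tau>) x) \<bullet> frac_grad s (\<phi> \<tau>) x)"

text \<open>
  In what follows \<open>u'\<close> is an everywhere defined representative of the time derivative of \<open>u\<close>. It
  matters at individual times: the derivative of a solution may jump.
\<close>

definition deriv_representative :: "real \<Rightarrow> 'a::euclidean_space set \<Rightarrow> real \<Rightarrow>
    (real \<Rightarrow> 'a \<Rightarrow> real) \<Rightarrow> (real \<Rightarrow> 'a \<Rightarrow> real) \<Rightarrow> bool" where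
  "deriv_representative s \<Omega> T u u' \<longleftrightarrow>
     (\<forall>\<tau>\<in>{0..T}. u' \<tau> \<in> L2_on \<Omega>) \<and> u' \<in> bochner_L2 T (Hs0 s \<Omega>) (Hs_norm s) \<and>
     weak_time_deriv T (Hs0 s \<Omega>) (Hs_norm s) u u'"

text \<open>The weak formulation on \<open>(0,t)\<close>, where \<open>r\<close> is the value of the reaction term at \<open>\<phi>\<close>.\<close>

definition weak_identity :: "real \<Rightarrow> (real^'n) set \<Rightarrow> real \<Rightarrow>
    (real^'n \<Rightarrow> real^'n^'n) \<Rightarrow> (real^'n \<Rightarrow> real^'n^'n) \<Rightarrow> (real^'n \<Rightarrow> real) \<Rightarrow> (real^'n \<Rightarrow> real) \<Rightarrow> real \<Rightarrow>
    (real \<Rightarrow> real^'n \<Rightarrow> real) \<Rightarrow> (real \<Rightarrow> real^'n \<Rightarrow> real) \<Rightarrow> (real \<Rightarrow> real^'n \<Rightarrow> real) \<Rightarrow> real \<Rightarrow> bool" where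
  "weak_identity s \<Omega> \<nu> A B w1 g t u u' \<phi> r \<longleftrightarrow>
     (LINT x|lebesgue_on \<Omega>. u' t x * \<phi> t x) - (LINT x|lebesgue_on \<Omega>. w1 x * \<phi> 0 x)
     - (LINT \<tau>|time t. LINT x|lebesgue_on \<Omega>.
          u' \<tau> x * time_deriv t (L2_on \<Omega>) (L2_on_norm \<Omega>) \<phi> \<tau> x)
     + r + frac_form s A t u \<phi> + \<nu> * frac_form s B t u' \<phi>
     = (LINT \<tau>|time t. LINT x|lebesgue_on \<Omega>. g x * \<phi> \<tau> x)"

text \<open>\<open>\<Xi> t\<close> is the functional on \<open>(0,t)\<close> required to exist for every \<open>t\<close>.\<close>

definition weak_solution :: "real \<Rightarrow> (real^'n) set \<Rightarrow> real \<Rightarrow> real \<Rightarrow>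
    (real^'n \<Rightarrow> real^'n^'n) \<Rightarrow> (real^'n \<Rightarrow> real^'n^'n) \<Rightarrow>
    (real^'n \<Rightarrow> real) \<Rightarrow> (real^'n \<Rightarrow> real) \<Rightarrow> (real^'n \<Rightarrow> real) \<Rightarrow>
    (real \<Rightarrow> real^'n \<Rightarrow> real) \<Rightarrow> (real \<Rightarrow> real^'n \<Rightarrow> real) \<Rightarrow> ((real \<Rightarrow> real^'n \<Rightarrow> real) \<Rightarrow> real) \<Rightarrow>
    (real \<Rightarrow> (real \<Rightarrow> real^'n \<Rightarrow> real) \<Rightarrow> real) \<Rightarrow> bool" where
  "weak_solution s \<Omega> T \<nu> A B w0 w1 g u u' \<xi> \<Xi> \<longleftrightarrow>
     u \<in> bochner_H1 T (Hs0 s \<Omega>) (Hs_norm s) \<and>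
     u \<in> bochner_W1inf T (L2_on \<Omega>) (L2_on_norm \<Omega>) \<and>
     deriv_representative s \<Omega> T u u' \<and>
     (AE x in lebesgue. u 0 x = w0 x) \<and> (AE x in lebesgue_on \<Omega>. u' 0 x = w1 x) \<and>
     \<xi> \<in> beta_V s \<Omega> T u \<and>
     (\<forall>\<phi>\<in>Vspace s \<Omega> T. weak_identity s \<Omega> \<nu> A B w1 g T u u' \<phi> (\<xi> \<phi>)) \<and>
     (\<forall>t\<in>{0<..T}. \<Xi> t \<in> beta_V s \<Omega> t u \<and>
        (\<forall>\<phi>\<in>Vspace_end0 s \<Omega> t. \<Xi> t \<phi> = \<xi> (extend0 t \<phi>)) \<and>
        (\<forall>\<phi>\<in>Vspace s \<Omega> t. weak_identity s \<Omega> \<nu> A B w1 g t u u' \<phi> (\<Xi> t \<phi>)))"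

definition penalty_functional :: "(real^'n) set \<Rightarrow> real \<Rightarrow> real \<Rightarrow>
    (real \<Rightarrow> real^'n \<Rightarrow> real) \<Rightarrow> (real \<Rightarrow> real^'n \<Rightarrow> real) \<Rightarrow> real" where
  "penalty_functional \<Omega> \<epsilon> t u =
     (\<lambda>\<phi>. LINT \<tau>|time t. LINT x|lebesgue_on \<Omega>. penalty \<epsilon> (u \<tau> x) * \<phi> \<tau> x)"

definition penalized_solution :: "real \<Rightarrow> (real^'n) set \<Rightarrow> real \<Rightarrow> real \<Rightarrow>
    (real^'n \<Rightarrow> real^'n^'n) \<Rightarrow> (real^'n \<Rightarrow> real^'n^'n) \<Rightarrow>
    (real^'n \<Rightarrow> real) \<Rightarrow> (real^'n \<Rightarrow> real) \<Rightarrow> (real^'n \<Rightarrow> real) \<Rightarrow> real \<Rightarrow>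
    (real \<Rightarrow> real^'n \<Rightarrow> real) \<Rightarrow> (real \<Rightarrow> real^'n \<Rightarrow> real) \<Rightarrow> bool" where
  "penalized_solution s \<Omega> T \<nu> A B w0 w1 g \<epsilon> u u' \<longleftrightarrow>
     time_continuous T (Hs0 s \<Omega>) (Hs_norm s) u \<and>
     u \<in> bochner_Linf T (Hs0 s \<Omega>) (Hs_norm s) \<and>
     deriv_representative s \<Omega> T u u' \<and>
     u' \<in> bochner_Linf T (L2_on \<Omega>) (L2_on_norm \<Omega>) \<and>
     (AE x in lebesgue. u 0 x = w0 x) \<and> (AE x in lebesgue_on \<Omega>. u' 0 x = w1 x) \<and>
     (\<forall>t\<in>{0<..T}. \<forall>\<phi>\<in>Vspace s \<Omega> t.
        weak_identity s \<Omega> \<nu> A B w1 g t u u' \<phi> (penalty_functional \<Omega> \<epsilon> t u \<phi>))"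

definition penalization_weak_solution :: "real \<Rightarrow> (real^'n) set \<Rightarrow> real \<Rightarrow> real \<Rightarrow>
    (real^'n \<Rightarrow> real^'n^'n) \<Rightarrow> (real^'n \<Rightarrow> real^'n^'n) \<Rightarrow>
    (real^'n \<Rightarrow> real) \<Rightarrow> (real^'n \<Rightarrow> real) \<Rightarrow> (real^'n \<Rightarrow> real) \<Rightarrow>
    (real \<Rightarrow> real^'n \<Rightarrow> real) \<Rightarrow> bool" where
  "penalization_weak_solution s \<Omega> T \<nu> A B w0 w1 g u \<longleftrightarrow>
     (\<exists>u' \<xi> \<Xi> \<epsilon> ue ue'.
        weak_solution s \<Omega> T \<nu> A B w0 w1 g u u' \<xi> \<Xi> \<and>
        (\<forall>\<phi>\<in>Vspace s \<Omega> T. \<Xi> T \<phi> = \<xi> \<phi>) \<and>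
        (\<forall>n::nat. 0 < \<epsilon> n \<and> \<epsilon> n < 1) \<and> \<epsilon> \<longlonglongrightarrow> 0 \<and>
        (\<forall>n. penalized_solution s \<Omega> T \<nu> A B w0 w1 g (\<epsilon> n) (ue n) (ue' n)) \<and>
        \<comment> \<open>weakly in \<open>H\<^sup>1(0,T;H\<^sup>s\<^sub>0(\<Omega>))\<close>\<close>
        weakly_tends (bochner_H1 T (Hs0 s \<Omega>) (Hs_norm s)) (bochner_H1_norm T (Hs0 s \<Omega>) (Hs_norm s))
          ue u \<and>
        \<comment> \<open>weakly* in \<open>W\<^sup>1\<^sup>,\<^sup>\<infinity>(0,T;L\<^sup>2(\<Omega>))\<close>\<close>
        (\<forall>\<psi>\<in>bochner_L1 T (L2_on \<Omega>) (L2_on_norm \<Omega>).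
           (\<lambda>n. LINT \<tau>|time T. LINT x|lebesgue_on \<Omega>. ue n \<tau> x * \<psi> \<tau> x)
             \<longlonglongrightarrow> (LINT \<tau>|time T. LINT x|lebesgue_on \<Omega>. u \<tau> x * \<psi> \<tau> x) \<and>
           (\<lambda>n. LINT \<tau>|time T. LINT x|lebesgue_on \<Omega>. ue' n \<tau> x * \<psi> \<tau> x)
             \<longlonglongrightarrow> (LINT \<tau>|time T. LINT x|lebesgue_on \<Omega>. u' \<tau> x * \<psi> \<tau> x)) \<and>
        (\<forall>t\<in>{0..T}.
           weakly_tends (Hs0 s \<Omega>) (Hs_norm s) (\<lambda>n. ue n t) (u t) \<and>
           (\<lambda>n. L2_on_norm \<Omega> (ue n t - u t)) \<longlonglongrightarrow> 0 \<and>
           weakly_tends (L2_on \<Omega>) (L2_on_norm \<Omega>) (\<lambda>n. ue' n t) (u' t)) \<and>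
        (\<lambda>n. LINT \<tau>|time T. (L2_on_norm \<Omega> (ue' n \<tau> - u' \<tau>))\<^sup>2) \<longlonglongrightarrow> 0 \<and>
        (\<forall>t\<in>{0<..T}.
           weakly_tends (dual_on (Vspace s \<Omega> t) (Vnorm s \<Omega> t)) (dual_norm (Vspace s \<Omega> t) (Vnorm s \<Omega> t))
             (\<lambda>n. penalty_functional \<Omega> (\<epsilon> n) t (ue n)) (\<Xi> t)))"

text \<open>
  The function \<open>f\<close> below is the representative of the time derivative in \<open>BV(0,T;H\<^sup>-\<^sup>k(\<Omega>))\<close> and \<open>z\<close>
  is its right limit at \<open>0\<close>, which does not depend on the representative.
\<close>

definition very_weak_solution :: "nat \<Rightarrow> real \<Rightarrow> (real^'n) set \<Rightarrow> real \<Rightarrow> real \<Rightarrow>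
    (real^'n \<Rightarrow> real^'n^'n) \<Rightarrow> (real^'n \<Rightarrow> real^'n^'n) \<Rightarrow>
    (real^'n \<Rightarrow> real) \<Rightarrow> (real^'n \<Rightarrow> real) \<Rightarrow> (real^'n \<Rightarrow> real) \<Rightarrow>
    (real \<Rightarrow> real^'n \<Rightarrow> real) \<Rightarrow> bool" where
  "very_weak_solution k s \<Omega> T \<nu> A B w0 w1 g u \<longleftrightarrow>
     (let du = time_deriv T (Hs0 s \<Omega>) (Hs_norm s) u in
      u \<in> bochner_H1 T (Hs0 s \<Omega>) (Hs_norm s) \<and>
      (AE \<tau> in time T. AE x in lebesgue_on \<Omega>. 0 \<le> u \<tau> x) \<and>
      (\<forall>\<phi>\<in>Vspace s \<Omega> T.
         (AE \<tau> in time T. AE x in lebesgue_on \<Omega>. 0 \<le> \<phi> \<tau> x) \<and>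
         (\<exists>\<delta>>0. \<forall>\<tau>\<in>{T-\<delta>..T} \<inter> {0..T}. AE x in lebesgue_on \<Omega>. \<phi> \<tau> x = 0) \<longrightarrow>
         - (LINT \<tau>|time T. LINT x|lebesgue_on \<Omega>.
              du \<tau> x * time_deriv T (L2_on \<Omega>) (L2_on_norm \<Omega>) \<phi> \<tau> x)
         + frac_form s A T u \<phi> + \<nu> * frac_form s B T du \<phi>
         \<ge> (LINT x|lebesgue_on \<Omega>. w1 x * \<phi> 0 x)
           + (LINT \<tau>|time T. LINT x|lebesgue_on \<Omega>. g x * \<phi> \<tau> x)) \<and>
      (AE x in lebesgue. u 0 x = w0 x) \<and>
      (\<exists>f\<in>BV T (H_neg k \<Omega>) (H_neg_norm k \<Omega>). \<exists>z\<in>L2_on \<Omega>.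
         (AE \<tau> in time T. \<forall>\<psi>\<in>test_functions \<Omega>. f \<tau> \<psi> = as_distribution \<Omega> (du \<tau>) \<psi>) \<and>
         ((\<lambda>\<tau>. H_neg_norm k \<Omega> (f \<tau> - as_distribution \<Omega> z)) \<longlongrightarrow> 0) (at_right 0) \<and>
         (\<forall>\<psi>\<in>Hs0 s \<Omega>. (AE x in lebesgue. 0 \<le> \<psi> x) \<longrightarrow>
            0 \<le> (LINT x|lebesgue_on \<Omega>. (z x - w1 x) * (\<psi> x - w0 x)))))"

end

theory Submission
  imports Defs
begin


text \<open>
  Testing the weak identity on \<open>(0,T)\<close> with \<open>\<phi> \<ge> 0\<close> vanishing at \<open>T\<close> gives the variational
  inequality, because the limit \<open>\<xi>\<close> of the penalty terms is nonpositive on nonnegative functions.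

  Testing on \<open>(0,t)\<close> with functions \<open>\<psi>\<close> constant in time expresses \<open>\<integral> u'(t) \<psi>\<close> through integrals over
  \<open>(0,t)\<close> and \<open>\<mu>\<^sub>t(\<psi>) = - \<langle>\<xi>\<^sub>t, \<psi>\<rangle>\<close>, which increases with \<open>t\<close> when \<open>\<psi> \<ge> 0\<close>. A test function in the unit
  ball of \<open>H\<^sup>k\<close> is dominated by a multiple of a member of one increasing sequence of test functions
  which is bounded in \<open>H\<^sup>s\<^sub>0(\<Omega>)\<close>: for large \<open>k\<close> it vanishes at the boundary to high order, so sums over
  dyadic scales \<open>2\<^sup>-\<^sup>j\<close> of bumps of height \<open>2\<^sup>-\<^sup>j\<^sup>m\<close> dominate it. Hence the limit along this sequence
  controls the variation of \<open>\<mu>\<close>, and \<open>u'\<close> has bounded variation in \<open>H\<^sup>-\<^sup>k(\<Omega>)\<close>.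

  The trace \<open>z = u'(0\<^sup>+)\<close> is a weak cluster point in \<open>L\<^sup>2(\<Omega>)\<close> of \<open>u'\<close> along times tending to \<open>0\<close> at which
  \<open>u'\<close> obeys its essential bound. The sign of \<open>\<mu>\<close> gives \<open>\<integral> w\<^sub>1 \<psi> \<le> \<integral> z \<psi>\<close> for \<open>\<psi> \<ge> 0\<close>. Testing with \<open>u\<close>
  itself and \<open>\<langle>\<xi>\<^sub>t, u\<rangle> \<ge> 0\<close>, the subgradient inequality against \<open>0\<close>, gives \<open>\<integral> z w\<^sub>0 \<le> \<integral> w\<^sub>1 w\<^sub>0\<close>.
\<close>

subsection \<open>Smooth functions and test functions\<close>

text \<open>The dominating sequence answers an obstacle at the boundary: the constant 1 is in
  general not in \<open>Hs0\<close> (for instance at \<open>s = 1\<close>), so duality gives no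
  bound on the mass of the reaction up to the boundary. Only test functions weighted by a power of
  the distance to the complement can be compared. In dimension \<open>d\<close> the power is
  \<open>d + 2\<close>: scale \<open>2^-j\<close> carries at most a multiple of
  \<open>2^(d j)\<close> bumps, each of norm at most a multiple of \<open>2^j\<close>, and the
  weight \<open>2^(-j (d + 2))\<close> leaves a convergent geometric series. Decay of that order
  costs \<open>d + 2\<close> derivatives in the sup norm, and each sup bound costs \<open>d\<close>
  more in L2; hence \<open>k \<ge> 2 d + 2\<close>.

  The functionals for different end times are compared before the limit, in the penalized problems,
  where the reaction is a time integral of a density of one sign.

  The assumed embeddings also replace decay estimates for Riesz potentials: they place test
  functions in \<open>Hs0\<close> and bound \<open>frac_grad\<close> by the H^k norm. They cover
  \<open>s < 1\<close>; the local case \<open>s = 1\<close> is done by integration by parts.\<close>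

lemma iterated_partial_append:
  "iterated_partial (vs @ ws) f = iterated_partial vs (iterated_partial ws f)"
  by (induction vs) auto

lemma has_frechet_derivative:
  "f differentiable (at x) \<Longrightarrow> (f has_derivative frechet_derivative f (at x)) (at x)"
  by (simp add: frechet_derivative_works)

text \<open>In \<open>iterated_partial\<close> the head of the list is differentiated last, so list
  induction never exposes the first derivative of a product. Here that derivative is peeled off
  first, and sums, products and compositions go through by induction on the order.\<close>

fun times_differentiable :: "nat \<Rightarrow> ('a::euclidean_space \<Rightarrow> 'b::real_normed_vector) \<Rightarrow> bool" where
  "times_differentiable 0 f = True"
| "times_differentiable (Suc n) f = ((\<forall>x. f differentiable (at x)) \<and>
     (\<forall>b\<in>Basis. times_differentiable n (\<lambda>x. frechet_derivative f (at x) b)))"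

lemma smooth_differentiable: "smooth f \<Longrightarrow> f differentiable (at x)"
  unfolding smooth_def by (drule spec[of _ "[]"]) auto

lemma smooth_iterated_partial:
  assumes "smooth f" "set vs \<subseteq> Basis" shows "smooth (iterated_partial vs f)"
  using assms unfolding smooth_def iterated_partial_append[symmetric] by auto

lemma smooth_partial:
  assumes "smooth f" "b \<in> Basis" shows "smooth (\<lambda>x. frechet_derivative f (at x) b)"
  using smooth_iterated_partial[OF assms(1), of "[b]"] assms(2) by simp

text \<open>Suited to classes given by a formula that differentiation preserves, such as affine
  reparametrizations or polynomial multiples of a flat exponential; no closed form of the higher
  derivatives is required.\<close>

lemma smooth_coinduct:
  assumes "f \<in> A"
    and "\<And>f x. f \<in> A \<Longrightarrow> f differentiable (at x)"
    and "\<And>f b. f \<in> A \<Longrightarrow> b \<in> Basis \<Longrightarrow> (\<lambda>x. frechet_derivative f (at x) b) \<in> A"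
  shows "smooth f"
proof -
  have "iterated_partial vs f \<in> A" if "set vs \<subseteq> Basis" for vs
    using that by (induction vs) (auto simp: assms)
  then show ?thesis unfolding smooth_def using assms(2) by blast
qed

lemma smooth_iff_times_differentiable: "smooth f \<longleftrightarrow> (\<forall>n. times_differentiable n f)"
proof
  assume "smooth f"
  then have "times_differentiable n f" for n
    by (induction n arbitrary: f) (auto intro: smooth_differentiable smooth_partial)
  then show "\<forall>n. times_differentiable n f" by blast
next
  assume "\<forall>n. times_differentiable n f"
  then have "f \<in> {f. \<forall>n. times_differentiable n f}" by simp
  then show "smooth f"
  proof (rule smooth_coinduct)
    fix f x assume "f \<in> {f. \<forall>n. times_differentiable n f}"
    then show "f differentiable (at x)" using times_differentiable.simps(2)[of 0 f] by blast
  next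
    fix f :: "'a \<Rightarrow> 'b" and b :: 'a assume "f \<in> {f. \<forall>n. times_differentiable n f}" "b \<in> Basis"
    then show "(\<lambda>x. frechet_derivative f (at x) b) \<in> {f. \<forall>n. times_differentiable n f}"
      using times_differentiable.simps(2)[of _ f] by blast
  qed
qed

lemma times_differentiable_mono: "times_differentiable (Suc n) f \<Longrightarrow> times_differentiable n f"
  by (induction n arbitrary: f) auto

lemma times_differentiable_const: "times_differentiable n (\<lambda>x. c)"
  by (induction n arbitrary: c) (auto simp: frechet_derivative_const)

lemma times_differentiable_inner_left: "times_differentiable n (\<lambda>x. x \<bullet> v)"
proof (cases n)
  case (Suc m)
  have "((\<lambda>x. x \<bullet> v) has_derivative (\<lambda>h. h \<bullet> v)) (at x)" for x :: 'a
    by (auto intro!: derivative_eq_intros)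
  from frechet_derivative_at[OF this] this show ?thesis
    using Suc by (auto simp: differentiable_def times_differentiable_const)
qed simp

lemma times_differentiable_add:
  "times_differentiable n f \<Longrightarrow> times_differentiable n g \<Longrightarrow> times_differentiable n (\<lambda>x. f x + g x)"
proof (induction n arbitrary: f g)
  case (Suc n)
  have "frechet_derivative (\<lambda>x. f x + g x) (at x) =
      (\<lambda>b. frechet_derivative f (at x) b + frechet_derivative g (at x) b)" for x
    using Suc.prems by (intro frechet_derivative_at[symmetric])
      (auto intro!: has_derivative_add has_frechet_derivative)
  with Suc show ?case by auto
qed simp

lemma times_differentiable_scaleR:
  fixes f :: "'a::euclidean_space \<Rightarrow> real"
  shows "times_differentiable n f \<Longrightarrow> times_differentiable n g \<Longrightarrow>
    times_differentiable n (\<lambda>x. f x *\<^sub>R g x)"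
proof (induction n arbitrary: f g)
  case (Suc n)
  have "frechet_derivative (\<lambda>x. f x *\<^sub>R g x) (at x) =
      (\<lambda>b. f x *\<^sub>R frechet_derivative g (at x) b + frechet_derivative f (at x) b *\<^sub>R g x)" for x
    using Suc.prems by (intro frechet_derivative_at[symmetric] has_derivative_scaleR)
      (auto intro!: has_frechet_derivative)
  with Suc show ?case
    by (auto intro!: times_differentiable_add Suc.IH intro: times_differentiable_mono[of n f]
        times_differentiable_mono[of n g])
qed simp

lemma times_differentiable_compose:
  fixes h :: "real \<Rightarrow> real" and f :: "'a::euclidean_space \<Rightarrow> real"
  shows "times_differentiable n h \<Longrightarrow> times_differentiable n f \<Longrightarrow> times_differentiable n (\<lambda>x. h (f x))"
proof (induction n arbitrary: h f)
  case (Suc n)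
  have "frechet_derivative (\<lambda>x. h (f x)) (at x) =
      (\<lambda>b. frechet_derivative f (at x) b *\<^sub>R frechet_derivative h (at (f x)) 1)" for x
  proof (rule frechet_derivative_at[symmetric])
    have h: "(h has_derivative frechet_derivative h (at (f x))) (at (f x))"
      and f: "(f has_derivative frechet_derivative f (at x)) (at x)"
      using Suc.prems by (auto intro!: has_frechet_derivative)
    interpret bounded_linear "frechet_derivative h (at (f x))" using h by (rule has_derivative_bounded_linear)
    have "frechet_derivative h (at (f x)) y = y *\<^sub>R frechet_derivative h (at (f x)) 1" for y
      using scaleR[of y 1] by simp
    then have eq: "frechet_derivative h (at (f x)) \<circ> frechet_derivative f (at x) =
        (\<lambda>b. frechet_derivative f (at x) b *\<^sub>R frechet_derivative h (at (f x)) 1)"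
      unfolding o_def by blast
    show "((\<lambda>x. h (f x)) has_derivative
        (\<lambda>b. frechet_derivative f (at x) b *\<^sub>R frechet_derivative h (at (f x)) 1)) (at x)"
      using diff_chain_at[OF f h] unfolding eq unfolding o_def .
  qed
  moreover have "times_differentiable n (\<lambda>x. frechet_derivative h (at (f x)) 1)"
    using Suc.prems times_differentiable_mono[of n f] by (intro Suc.IH[of "\<lambda>y. frechet_derivative h (at y) 1"]) auto
  moreover have "(\<lambda>x. h (f x)) differentiable (at x)" for x
    using Suc.prems by (intro differentiable_chain_at[of f x h, unfolded o_def]) auto
  ultimately show ?case using Suc.prems
    by (auto intro!: times_differentiable_scaleR simp del: real_scaleR_def)
qed simp

lemma smooth_const: "smooth (\<lambda>x. c)"
  and smooth_inner_left: "smooth (\<lambda>x. x \<bullet> v)"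
  and smooth_add: "smooth f \<Longrightarrow> smooth g \<Longrightarrow> smooth (\<lambda>x. f x + g x)"
  and smooth_scaleR: "smooth k \<Longrightarrow> smooth f \<Longrightarrow> smooth (\<lambda>x. k x *\<^sub>R f x)"
  and smooth_compose: "smooth h \<Longrightarrow> smooth k \<Longrightarrow> smooth (\<lambda>x. h (k x))"
  for f g :: "'a::euclidean_space \<Rightarrow> 'b::real_normed_vector" and k :: "'a \<Rightarrow> real" and h :: "real \<Rightarrow> real"
  unfolding smooth_iff_times_differentiable
  by (auto intro: times_differentiable_const times_differentiable_inner_left times_differentiable_add
      times_differentiable_scaleR times_differentiable_compose)

lemma smooth_mult:
  fixes k f :: "'a::euclidean_space \<Rightarrow> real"
  shows "smooth k \<Longrightarrow> smooth f \<Longrightarrow> smooth (\<lambda>x. k x * f x)"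
  using smooth_scaleR[of k f] by simp

lemma smooth_sum:
  fixes f :: "'i \<Rightarrow> 'a::euclidean_space \<Rightarrow> 'b::real_normed_vector"
  shows "(\<And>i. i \<in> I \<Longrightarrow> smooth (f i)) \<Longrightarrow> smooth (\<lambda>x. \<Sum>i\<in>I. f i x)"
  by (induction I rule: infinite_finite_induct) (auto intro: smooth_const smooth_add)

lemma smooth_prod:
  fixes f :: "'i \<Rightarrow> 'a::euclidean_space \<Rightarrow> real"
  shows "(\<And>i. i \<in> I \<Longrightarrow> smooth (f i)) \<Longrightarrow> smooth (\<lambda>x. \<Prod>i\<in>I. f i x)"
  by (induction I rule: infinite_finite_induct) (auto intro: smooth_const smooth_mult)

lemma smooth_affine:
  fixes f :: "'a::euclidean_space \<Rightarrow> 'b::real_normed_vector"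
  assumes "smooth f" shows "smooth (\<lambda>x. f (c *\<^sub>R x + z))"
proof (rule smooth_coinduct[where A = "{\<lambda>x. l *\<^sub>R f (c *\<^sub>R x + z) | f l. smooth f}"])
  show "(\<lambda>x. f (c *\<^sub>R x + z)) \<in> {\<lambda>x. l *\<^sub>R f (c *\<^sub>R x + z) | f l. smooth f}"
    using assms by (auto intro!: exI[of _ f] exI[of _ 1])
next
  fix g assume "g \<in> {\<lambda>x. l *\<^sub>R f (c *\<^sub>R x + z) | f l. smooth f}"
  then obtain f l where g: "g = (\<lambda>x. l *\<^sub>R f (c *\<^sub>R x + z))" and f: "smooth f" by auto
  \<comment> \<open>The chain rule contributes one factor \<open>c\<close> per derivative; the free
    factor \<open>l\<close> of the class absorbs it.\<close>
  have D: "(g has_derivative (\<lambda>h. (l * c) *\<^sub>R frechet_derivative f (at (c *\<^sub>R x + z)) h)) (at x)" for x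
  proof -
    let ?D = "frechet_derivative f (at (c *\<^sub>R x + z))"
    have F: "(f has_derivative ?D) (at (c *\<^sub>R x + z))"
      by (intro has_frechet_derivative smooth_differentiable f)
    then interpret bounded_linear ?D by (rule has_derivative_bounded_linear)
    have "((\<lambda>x. c *\<^sub>R x + z) has_derivative (\<lambda>h. c *\<^sub>R h)) (at x)" by (auto intro!: derivative_eq_intros)
    from has_derivative_scaleR_right[OF diff_chain_at[OF this F], of l] show ?thesis
      by (simp add: g o_def scaleR)
  qed
  then show "g differentiable (at x)" for x unfolding differentiable_def by blast
  show "(\<lambda>x. frechet_derivative g (at x) b) \<in> {\<lambda>x. l *\<^sub>R f (c *\<^sub>R x + z) | f l. smooth f}" if "b \<in> Basis" for b
    unfolding frechet_derivative_at[OF D, symmetric] using f that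
    by (auto intro!: exI[of _ "\<lambda>x. frechet_derivative f (at x) b"] exI[of _ "l * c"] smooth_partial)
qed

section \<open>Flat exponential cutoffs\<close>

definition exp_bump :: "real \<Rightarrow> real" where "exp_bump x = (if x > 0 then exp (- (1 / x)) else 0)"

lemma smooth_exp_bump: "smooth exp_bump"
proof -
  define E where "E p x = (if x > 0 then poly p (1 / x) * exp (- (1 / x)) else 0)" for p :: "real poly" and x :: real
  have lim: "((\<lambda>y. poly p y / exp y) \<longlongrightarrow> 0) at_top" for p :: "real poly"
    unfolding poly_altdef sum_divide_distrib times_divide_eq_right[symmetric]
    by (intro tendsto_null_sum tendsto_mult_right_zero tendsto_power_div_exp_0)
  \<comment> \<open>With \<open>y = 1/x\<close>, differentiating \<open>p(y) exp(-y)\<close> in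
    \<open>x\<close> gives \<open>y^2 (p - p')(y) exp(-y)\<close>, so the family \<open>E\<close> is
    closed under differentiation.\<close>
  have D: "(E p has_real_derivative E (monom 1 2 * (p - pderiv p)) x) (at x)" for p x
  proof -
    consider "x > 0" | "x < 0" | "x = 0" by linarith
    then show ?thesis
    proof cases
      case 1
      have "((\<lambda>x. poly p (1 / x) * exp (- (1 / x))) has_real_derivative E (monom 1 2 * (p - pderiv p)) x) (at x)"
        using 1 by (auto intro!: derivative_eq_intros poly_DERIV[THEN DERIV_chain2] simp: E_def poly_monom field_simps power2_eq_square)
      moreover have "\<forall>\<^sub>F y in nhds x. E p y = poly p (1 / y) * exp (- (1 / y))"
        by (rule eventually_mono[OF eventually_nhds_in_open[of "{0<..}"]]) (use 1 in \<open>auto simp: E_def\<close>)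
      ultimately show ?thesis by (simp add: DERIV_cong_ev)
    next
      case 2
      have "\<forall>\<^sub>F y in nhds x. E p y = 0"
        by (rule eventually_mono[OF eventually_nhds_in_open[of "{..<0}"]]) (use 2 in \<open>auto simp: E_def\<close>)
      then have "(E p has_real_derivative 0) (at x) \<longleftrightarrow> ((\<lambda>_. 0) has_real_derivative 0) (at x)"
        by (intro DERIV_cong_ev) auto
      then show ?thesis using 2 by (simp add: E_def)
    next
      case 3
      have "((\<lambda>h. E p h / h) \<longlongrightarrow> 0) (at_right 0)"
      proof -
        \<comment> \<open>\<open>pCons 0 p\<close> is the polynomial \<open>y p(y)\<close>: the
          additional factor is the division by \<open>h = 1/y\<close> in the difference quotient at
          0.\<close>
        have "((\<lambda>h. poly (pCons 0 p) (inverse h) / exp (inverse h)) \<longlongrightarrow> 0) (at_right 0)"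
          by (rule filterlim_compose[OF lim filterlim_inverse_at_top_right])
        then show ?thesis
          by (rule Lim_transform_eventually)
            (auto intro!: eventually_at_rightI[of 0 1] simp: E_def exp_minus field_simps)
      qed
      moreover have "((\<lambda>h. E p h / h) \<longlongrightarrow> 0) (at_left 0)"
        by (rule Lim_transform_eventually[OF tendsto_const])
          (auto intro!: eventually_at_leftI[of "-1" 0] simp: E_def)
      ultimately have "((\<lambda>h. E p h / h) \<longlongrightarrow> 0) (at 0)" by (rule filterlim_split_at[rotated])
      then show ?thesis using 3 by (simp add: DERIV_def E_def)
    qed
  qed
  have "smooth (E p)" for p
  proof (rule smooth_coinduct[where A = "range E"])
    fix f assume "f \<in> range E"
    then obtain p where f: "f = E p" by auto
    have D': "(f has_derivative (\<lambda>h. h * E (monom 1 2 * (p - pderiv p)) x)) (at x)" for x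
      using D[of p x] unfolding f has_field_derivative_def by (simp add: mult.commute[of _ "E _ _"])
    then show "f differentiable (at x)" for x unfolding differentiable_def by blast
    show "(\<lambda>x. frechet_derivative f (at x) b) \<in> range E" if "b \<in> Basis" for b
      unfolding frechet_derivative_at[OF D', symmetric] using that by auto
  qed auto
  moreover have "exp_bump = E [:1:]" by (auto simp: exp_bump_def E_def)
  ultimately show ?thesis by metis
qed

lemma exp_bump_nonneg: "0 \<le> exp_bump x" and exp_bump_pos: "0 < x \<Longrightarrow> 0 < exp_bump x"
  and exp_bump_le_1: "exp_bump x \<le> 1" and exp_bump_eq_0: "x \<le> 0 \<Longrightarrow> exp_bump x = 0"
  by (auto simp: exp_bump_def)

lemma exp_bump_mono: "x \<le> y \<Longrightarrow> exp_bump x \<le> exp_bump y"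
  by (auto simp: exp_bump_def frac_le)

section \<open>Smooth functions of compact support\<close>

lemma test_functions_mono: "S \<subseteq> S' \<Longrightarrow> test_functions S \<subseteq> test_functions S'"
  by (auto simp: test_functions_def)

lemma test_functionsI:
  assumes "smooth f" "compact K" "K \<subseteq> S" "\<And>x. x \<notin> K \<Longrightarrow> f x = 0" shows "f \<in> test_functions S"
proof -
  have "closure {x. f x \<noteq> 0} \<subseteq> K"
    using assms by (intro closure_minimal compact_imp_closed) auto
  moreover from this have "compact (closure {x. f x \<noteq> 0})"
    using assms(2) by (metis closed_closure compact_Int_closed inf.absorb2)
  ultimately show ?thesis using assms by (auto simp: test_functions_def)
qed

lemma test_functionsE:
  assumes "f \<in> test_functions S"
  obtains K where "smooth f" "compact K" "K \<subseteq> S" "\<And>x. x \<notin> K \<Longrightarrow> f x = 0"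
proof -
  have "f x = 0" if "x \<notin> closure {x. f x \<noteq> 0}" for x
    using that closure_subset[of "{x. f x \<noteq> 0}"] by blast
  moreover have "smooth f" "compact (closure {x. f x \<noteq> 0})" "closure {x. f x \<noteq> 0} \<subseteq> S"
    using assms unfolding test_functions_def by blast+
  ultimately show ?thesis using that by blast
qed

lemma test_functions_add:
  assumes "f \<in> test_functions S" "g \<in> test_functions S" shows "f + g \<in> test_functions S"
proof -
  obtain K where K: "smooth f" "compact K" "K \<subseteq> S" "\<And>x. x \<notin> K \<Longrightarrow> f x = 0" by (rule test_functionsE[OF assms(1)]) blast
  obtain L where L: "smooth g" "compact L" "L \<subseteq> S" "\<And>x. x \<notin> L \<Longrightarrow> g x = 0" by (rule test_functionsE[OF assms(2)]) blast
  show ?thesis by (rule test_functionsI[of _ "K \<union> L"]) (use K L in \<open>auto simp: plus_fun_def intro: smooth_add\<close>)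
qed

lemma test_functions_scaleR:
  assumes "f \<in> test_functions S" shows "c *\<^sub>R f \<in> test_functions S"
proof (rule test_functionsE[OF assms])
  fix K assume K: "smooth f" "compact K" "K \<subseteq> S" "\<And>x. x \<notin> K \<Longrightarrow> f x = 0"
  show ?thesis
    by (rule test_functionsI[of _ K]) (use K in \<open>auto simp: scaleR_fun_def intro: smooth_scaleR[OF smooth_const]\<close>)
qed

lemma test_functions_0: "0 \<in> test_functions S"
  by (rule test_functionsI[of _ "{}"]) (auto simp: zero_fun_def smooth_const)

lemma test_functions_sum:
  "(\<And>i. i \<in> I \<Longrightarrow> f i \<in> test_functions S) \<Longrightarrow> (\<Sum>i\<in>I. f i) \<in> test_functions S"
  by (induction I rule: infinite_finite_induct) (auto intro: test_functions_0 test_functions_add)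

lemma test_functions_partial:
  fixes f :: "'a::euclidean_space \<Rightarrow> 'b::real_normed_vector"
  assumes "f \<in> test_functions S" "b \<in> Basis"
  shows "(\<lambda>x. frechet_derivative f (at x) b) \<in> test_functions S"
proof (rule test_functionsE[OF assms(1)])
  fix K assume K: "smooth f" "compact K" "K \<subseteq> S" "\<And>x. x \<notin> K \<Longrightarrow> f x = 0"
  show ?thesis
  proof (rule test_functionsI[of _ K])
    fix x assume x: "x \<notin> K"
    have "(f has_derivative (\<lambda>_. 0)) (at x)"
      by (rule has_derivative_transform_within_open[of "\<lambda>_. 0" _ _ _ "- K"])
        (use x K compact_imp_closed[OF K(2)] in auto)
    then show "frechet_derivative f (at x) b = 0" by (metis frechet_derivative_at)
  qed (use K assms in \<open>auto intro: smooth_partial\<close>)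
qed

lemma test_functions_iterated_partial:
  "f \<in> test_functions S \<Longrightarrow> set vs \<subseteq> Basis \<Longrightarrow> iterated_partial vs f \<in> test_functions S"
  by (induction vs) (auto intro: test_functions_partial)

lemma continuous_on_test_function: "f \<in> test_functions S \<Longrightarrow> continuous_on A f"
  by (intro differentiable_imp_continuous_on differentiable_at_imp_differentiable_on)
     (auto simp: test_functions_def intro: smooth_differentiable)

lemma borel_measurable_test_function: "f \<in> test_functions S \<Longrightarrow> f \<in> borel_measurable borel"
  by (intro borel_measurable_continuous_onI continuous_on_test_function)

lemma bounded_test_function: 
  assumes "f \<in> test_functions S" obtains C where "C > 0" "\<And>x. norm (f x) \<le> C"
proof (rule test_functionsE[OF assms])
  fix K assume K: "compact K" "\<And>x. x \<notin> K \<Longrightarrow> f x = 0"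
  have "bounded (f ` K)"
    by (intro compact_imp_bounded compact_continuous_image K continuous_on_test_function[OF assms])
  then obtain C where "C > 0" "\<And>x. x \<in> K \<Longrightarrow> norm (f x) \<le> C" unfolding bounded_pos by auto
  then show ?thesis using K(2) by (intro that[of C]) (auto, metis less_eq_real_def norm_zero)
qed

text \<open>Increasing bounded approximation of the indicator of a box: \<open>1 - (1 - \<eta>)\<^sup>n\<close> for a bump \<open>\<eta>\<close>.\<close>

definition box_bump :: "'a::euclidean_space \<Rightarrow> 'a \<Rightarrow> 'a \<Rightarrow> real" where
  "box_bump a c x = (\<Prod>b\<in>Basis. exp_bump ((x - a) \<bullet> b) * exp_bump ((c - x) \<bullet> b))"

definition box_approx :: "'a::euclidean_space \<Rightarrow> 'a \<Rightarrow> nat \<Rightarrow> 'a \<Rightarrow> real" where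
  "box_approx a c n x = 1 - (1 - box_bump a c x) ^ n"

lemma box_bump_range: "0 \<le> box_bump a c x" "box_bump a c x \<le> 1"
  unfolding box_bump_def
  by (auto intro!: prod_nonneg prod_le_1 mult_le_one simp: exp_bump_nonneg exp_bump_le_1)

lemma box_bump_pos: "x \<in> box a c \<Longrightarrow> 0 < box_bump a c x"
  unfolding box_bump_def by (intro prod_pos) (auto simp: mem_box inner_diff_left exp_bump_pos)

lemma box_bump_eq_0: "x \<notin> box a c \<Longrightarrow> box_bump a c x = 0"
  unfolding box_bump_def 
  by (intro prod_zero finite_Basis) (force simp: mem_box inner_diff_left not_less intro: exp_bump_eq_0)

lemma smooth_exp_bump_inner: "smooth (\<lambda>x. exp_bump ((x - a) \<bullet> b))" "smooth (\<lambda>x. exp_bump ((a - x) \<bullet> b))"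
proof -
  have "smooth (\<lambda>x. x \<bullet> b + - (a \<bullet> b))" "smooth (\<lambda>x. x \<bullet> (- b) + a \<bullet> b)"
    by (intro smooth_add smooth_inner_left smooth_const)+
  from this[THEN smooth_compose[OF smooth_exp_bump]]
  show "smooth (\<lambda>x. exp_bump ((x - a) \<bullet> b))" "smooth (\<lambda>x. exp_bump ((a - x) \<bullet> b))"
    by (simp_all add: algebra_simps)
qed

lemma box_approx_test_function: "cbox a c \<subseteq> U \<Longrightarrow> box_approx a c n \<in> test_functions U"
proof (rule test_functionsI[of _ "cbox a c"])
  have *: "smooth (box_bump a c)"
    unfolding box_bump_def by (intro smooth_prod smooth_mult smooth_exp_bump_inner)
  have **: "smooth (\<lambda>x. (-1) * (\<Prod>i<n. 1 + (-1) * box_bump a c x) + 1)" 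
    by (intro smooth_add smooth_const smooth_mult smooth_prod *)
  show "smooth (box_approx a c n)" 
    using ** by (simp add: box_approx_def[abs_def])
  show "box_approx a c n x = 0" if "x \<notin> cbox a c" for x

  proof -
    have "x \<notin> box a c" using that box_subset_cbox[of a c] by blast
    then show ?thesis by (simp add: box_approx_def box_bump_eq_0)
  qed
qed auto

lemma box_approx_range: "norm (box_approx a c n x) \<le> 1"
  using box_bump_range[of a c x] power_le_one[of "1 - box_bump a c x" n] by (auto simp: box_approx_def)

lemma box_approx_tendsto: "(\<lambda>n. box_approx a c n x) \<longlonglongrightarrow> indicator (box a c) x"
proof (cases "x \<in> box a c")
  case True
  have "(\<lambda>n. 1 - (1 - box_bump a c x) ^ n) \<longlonglongrightarrow> 1 - 0"
    using box_bump_range[of a c x] box_bump_pos[OF True]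
    by (intro tendsto_diff tendsto_const LIMSEQ_power_zero) auto
  with True show ?thesis by (simp add: box_approx_def)
qed (simp add: box_approx_def box_bump_eq_0)

text \<open>\<open>exp_bump 3\<close> is the least value of the numerator on the unit ball. Dividing
  by it gives a function that is at least 1 there, which suffices for domination; a plateau is not
  asked for.\<close>

definition radial_bump :: "'a::euclidean_space \<Rightarrow> real" where
  "radial_bump x = exp_bump (4 - x \<bullet> x) / exp_bump 3"

lemma radial_bump:
  shows "smooth (radial_bump :: 'a::euclidean_space \<Rightarrow> real)" "\<And>x::'a. 0 \<le> radial_bump x"
    "\<And>x::'a. norm x \<le> 1 \<Longrightarrow> 1 \<le> radial_bump x" "\<And>x::'a. 2 \<le> norm x \<Longrightarrow> radial_bump x = 0"
proof -
  have "smooth (\<lambda>x::'a. (-1) * (\<Sum>b\<in>Basis. (x \<bullet> b) * (x \<bullet> b)) + 4)"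
    by (intro smooth_add smooth_const smooth_mult smooth_sum smooth_inner_left)
  from smooth_compose[OF smooth_exp_bump this]
  have "smooth (\<lambda>x::'a. (1 / exp_bump 3) * exp_bump (4 - x \<bullet> x))"
    by (intro smooth_mult smooth_const) (simp add: euclidean_inner[symmetric])
  then show "smooth (radial_bump :: 'a \<Rightarrow> real)" by (simp add: radial_bump_def[abs_def])
  show "0 \<le> radial_bump x" for x :: 'a by (simp add: radial_bump_def exp_bump_nonneg)
  show "1 \<le> radial_bump x" if "norm x \<le> 1" for x :: 'a
  proof -
    have "x \<bullet> x \<le> 1" using that by (simp add: dot_square_norm abs_square_le_1)
    then have "exp_bump 3 \<le> exp_bump (4 - x \<bullet> x)" by (intro exp_bump_mono) simp
    then show ?thesis by (simp add: radial_bump_def exp_bump_pos)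
  qed
  show "radial_bump x = 0" if "2 \<le> norm x" for x :: 'a
  proof -
    have "2^2 \<le> x \<bullet> x" unfolding dot_square_norm using that by (intro power_mono) auto
    then show ?thesis by (simp add: radial_bump_def exp_bump_eq_0)
  qed
qed


subsection \<open>Lebesgue integration\<close>

lemma AE_lebesgue_on_iff:
  "S \<in> sets lebesgue \<Longrightarrow> (AE x in lebesgue_on S. P x) \<longleftrightarrow> (AE x in lebesgue. x \<in> S \<longrightarrow> P x)"
  by (rule AE_restrict_space_iff) simp

text \<open>Lebesgue measure is complete. Weak gradients and time derivatives are chosen by
  \<open>SOME\<close> and known only up to null sets, so measurability has to pass between such
  choices.\<close>

lemma borel_measurable_cong_AE_lebesgue_on:
  fixes f g :: "'a::euclidean_space \<Rightarrow> 'b::euclidean_space"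
  assumes S: "S \<in> sets lebesgue" and ae: "AE x in lebesgue_on S. f x = g x"
    and f: "f \<in> borel_measurable (lebesgue_on S)"
  shows "g \<in> borel_measurable (lebesgue_on S)"
proof -
  have *: "(\<lambda>x. indicator S x *\<^sub>R h x) \<in> borel_measurable lebesgue \<longleftrightarrow> h \<in> borel_measurable (lebesgue_on S)"
    for h :: "'a \<Rightarrow> 'b"
    using S by (subst borel_measurable_restrict_space_iff) (auto simp: mult.commute)
  have "AE x in lebesgue. indicator S x *\<^sub>R f x = indicator S x *\<^sub>R g x"
    using ae unfolding AE_lebesgue_on_iff[OF S] by eventually_elim (auto split: split_indicator)
  from borel_measurable_AE[OF _ this] show ?thesis using f unfolding * .
qed

lemma integrable_cong_AE_lebesgue_on:
  fixes f g :: "'a::euclidean_space \<Rightarrow> 'b::euclidean_space"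
  assumes "S \<in> sets lebesgue" "AE x in lebesgue_on S. f x = g x" "integrable (lebesgue_on S) f"
  shows "integrable (lebesgue_on S) g"
  using assms borel_measurable_cong_AE_lebesgue_on[OF assms(1,2)]
  by (subst integrable_cong_AE[where g = f]) (auto simp: eq_commute)

text \<open>No measurability is needed, since \<open>lebesgue_on S\<close> is complete.\<close>

lemma integral_cong_AE_lebesgue_on:
  fixes f g :: "'a::euclidean_space \<Rightarrow> 'b::euclidean_space"
  assumes S: "S \<in> sets lebesgue" and ae: "AE x in lebesgue_on S. f x = g x"
  shows "(LINT x|lebesgue_on S. f x) = (LINT x|lebesgue_on S. g x)"
proof (cases "f \<in> borel_measurable (lebesgue_on S)")
  case True
  then show ?thesis
    using assms borel_measurable_cong_AE_lebesgue_on[OF assms] by (intro integral_cong_AE) auto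
next
  case False
  have "AE x in lebesgue_on S. g x = f x" using ae by eventually_elim simp
  with False have "g \<notin> borel_measurable (lebesgue_on S)"
    using borel_measurable_cong_AE_lebesgue_on[OF S, of g f] by blast
  with False show ?thesis
    by (metis borel_measurable_integrable not_integrable_integral_eq)
qed

lemmas integral_cong_AE_lebesgue = integral_cong_AE_lebesgue_on[of UNIV, unfolded lebesgue_on_UNIV_eq, simplified]

text \<open>A function that is not integrable has integral 0 by convention, and \<open>h\<close> has
  nonnegative integral. Thus the energy estimates apply to iterated integrals whose inner integral
  involves an arbitrarily chosen derivative.\<close>

lemma integral_abs_le_integral:
  fixes f h :: "'a \<Rightarrow> real"
  assumes "integrable M h" "AE x in M. \<bar>f x\<bar> \<le> h x"
  shows "\<bar>LINT x|M. f x\<bar> \<le> (LINT x|M. h x)"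
proof (cases "integrable M f")
  case True
  have "\<bar>LINT x|M. f x\<bar> \<le> (LINT x|M. \<bar>f x\<bar>)" by (rule integral_abs_bound)
  also have "\<dots> \<le> (LINT x|M. h x)" using True assms by (intro integral_mono_AE) auto
  finally show ?thesis .
next
  case False
  have "0 \<le> (LINT x|M. h x)"
    using assms(2) by (intro integral_nonneg_AE) (auto elim!: eventually_mono)
  with False show ?thesis by (simp add: not_integrable_integral_eq)
qed

text \<open>The affine map and its inverse both preserve Lebesgue measurability, so \<open>f\<close>
  and its pullback are integrable together, and otherwise both integrals are 0 by convention.
  Translations and dilations of Riesz potentials reduce to this.\<close>

lemma lebesgue_integral_affine:
  fixes f :: "'a::euclidean_space \<Rightarrow> 'b::euclidean_space"
  assumes c: "c \<noteq> 0"
  shows "(LINT x|lebesgue. f (z + c *\<^sub>R x)) = (1 / \<bar>c\<bar> ^ DIM('a)) *\<^sub>R (LINT x|lebesgue. f x)" (is ?A)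
    and "integrable lebesgue (\<lambda>x. f (z + c *\<^sub>R x)) \<longleftrightarrow> integrable lebesgue f" (is ?B)
    and "(\<lambda>x. f (z + c *\<^sub>R x)) \<in> borel_measurable lebesgue \<longleftrightarrow> f \<in> borel_measurable lebesgue" (is ?C)
proof -
  have T: "(\<lambda>x. z + c *\<^sub>R x) \<in> lebesgue \<rightarrow>\<^sub>M lebesgue" if "c \<noteq> 0" for z :: 'a and c
    using lebesgue_affine_measurable[of "\<lambda>_. c" z] that
    unfolding scaleR_scaleR[symmetric] scaleR_sum_right[symmetric] euclidean_representation by blast
  have M: "(\<lambda>x. g (z + c *\<^sub>R x)) \<in> borel_measurable lebesgue"
    if "g \<in> borel_measurable lebesgue" "c \<noteq> 0" for g :: "'a \<Rightarrow> 'b" and z c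
    by (rule measurable_compose[OF T[OF that(2)] that(1)])
  have eq: "f (z + c *\<^sub>R ((- 1/c) *\<^sub>R z + (1/c) *\<^sub>R x)) = f x" for x
    using c by (simp add: scaleR_diff_right)
  have "1 / c \<noteq> 0" using c by simp
  show C: ?C
  proof
    assume "(\<lambda>x. f (z + c *\<^sub>R x)) \<in> borel_measurable lebesgue"
    from M[OF this \<open>1 / c \<noteq> 0\<close>, of "(- 1/c) *\<^sub>R z"] show "f \<in> borel_measurable lebesgue"
      unfolding eq .
  qed (rule M[OF _ c])
  define D where "D = distr lebesgue lebesgue (\<lambda>x. z + c *\<^sub>R x)"
  have L: "lebesgue = density D (\<lambda>_. ennreal (\<bar>c\<bar> ^ DIM('a)))"
    using lebesgue_affine_euclidean[of "\<lambda>_. c" z] c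
    unfolding scaleR_scaleR[symmetric] scaleR_sum_right[symmetric] euclidean_representation D_def by simp
  have MD: "f \<in> borel_measurable D \<longleftrightarrow> f \<in> borel_measurable lebesgue" by (simp add: D_def)
  have k: "\<bar>c\<bar> ^ DIM('a) \<noteq> 0" using c by simp
  have I: "integrable lebesgue f \<longleftrightarrow> integrable lebesgue (\<lambda>x. f (z + c *\<^sub>R x))"
    if f: "f \<in> borel_measurable lebesgue"
  proof -
    have "integrable lebesgue f \<longleftrightarrow> integrable D (\<lambda>x. \<bar>c\<bar> ^ DIM('a) *\<^sub>R f x)"
      by (subst L, subst integrable_density) (use f MD in \<open>auto\<close>)
    also have "\<dots> \<longleftrightarrow> integrable D f" 
      using k integrable_scaleR_right[of "1 / \<bar>c\<bar> ^ DIM('a)" D "\<lambda>x. \<bar>c\<bar> ^ DIM('a) *\<^sub>R f x"]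
      by (auto simp del: power_abs)
    also have "\<dots> \<longleftrightarrow> integrable lebesgue (\<lambda>x. f (z + c *\<^sub>R x))"
      unfolding D_def by (rule integrable_distr_eq) (use T c f in auto)
    finally show ?thesis .
  qed
  show ?B
    using C I borel_measurable_integrable by blast
  show ?A
  proof (cases "f \<in> borel_measurable lebesgue")
    case f: True
    have "(LINT x|lebesgue. f x) = (LINT x|D. \<bar>c\<bar> ^ DIM('a) *\<^sub>R f x)"
      by (subst L, subst integral_density) (use f MD in auto)
    also have "\<dots> = \<bar>c\<bar> ^ DIM('a) *\<^sub>R (LINT x|D. f x)" by simp
    also have "(LINT x|D. f x) = (LINT x|lebesgue. f (z + c *\<^sub>R x))"
      unfolding D_def by (rule integral_distr) (use T c f in auto)
    finally show ?thesis using k by simp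
  next
    case False
    then show ?thesis using C
      by (metis borel_measurable_integrable not_integrable_integral_eq scaleR_zero_right)
  qed
qed

subsection \<open>The fundamental lemma of the calculus of variations\<close>

text \<open>On the set where the function is positive it is nonnegative with integral 0; the
  negative part is the same argument for \<open>- v\<close>.\<close>

lemma AE_zero_of_set_integral:
  fixes v :: "'a \<Rightarrow> real"
  assumes v: "integrable M v" and 0: "\<And>A. A \<in> sets M \<Longrightarrow> set_lebesgue_integral M A v = 0"
  shows "AE x in M. v x = 0"
proof -
  have *: "AE x in M. w x \<le> 0" if w: "integrable M w" and "\<And>A. A \<in> sets M \<Longrightarrow> set_lebesgue_integral M A w = 0" for w :: "'a \<Rightarrow> real"
  proof -
    have A: "{x \<in> space M. 0 < w x} \<in> sets M" using w by measurable
    have "AE x in M. indicator {x \<in> space M. 0 < w x} x *\<^sub>R w x = 0"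
      using that(2)[OF A] integrable_mult_indicator[OF A w]
      by (subst integral_nonneg_eq_0_iff_AE[symmetric])
        (auto simp: set_lebesgue_integral_def intro!: AE_I2 split: split_indicator)
    then show ?thesis using AE_space by eventually_elim (auto split: split_indicator_asm)
  qed
  have "set_lebesgue_integral M A (\<lambda>x. - v x) = 0" if "A \<in> sets M" for A
    using 0[OF that] by (simp add: set_lebesgue_integral_def)
  from *[OF v 0] *[OF _ this] v show ?thesis by (auto elim: eventually_elim2)
qed

text \<open>Boxes are stable under intersection and generate the Borel sets, so Dynkin's theorem
  extends the vanishing from boxes to Borel sets. The complement step uses the integral over the
  whole space, obtained by exhausting it with cubes.\<close>

lemma AE_zero_of_integral_boxes:
  fixes v :: "'a::euclidean_space \<Rightarrow> real"
  assumes v: "integrable lebesgue v" and 0: "\<And>a b. (LINT x|lebesgue. indicator (box a b) x * v x) = 0"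
  shows "AE x in lebesgue. v x = 0"
proof -
  let ?I = "\<lambda>A. set_lebesgue_integral lebesgue A v"
  have si: "set_integrable lebesgue A v" if "A \<in> sets borel" for A
    using v that by (auto simp: set_integrable_def intro!: integrable_real_mult_indicator 
        integrable_mult_indicator[of A lebesgue v, simplified])
  have UN: "(\<lambda>n. ?I (A n)) \<longlonglongrightarrow> ?I (\<Union>n. A n)" if "\<And>n. A n \<in> sets borel" "incseq A" for A
    using that si by (intro set_integral_cont_up) (auto intro!: sets.countable_UN)
  have U0: "?I UNIV = 0"
  proof -
    let ?A = "\<lambda>n::nat. box (- (real n *\<^sub>R One)) (real n *\<^sub>R One) :: 'a set"
    have "incseq ?A"
    proof (intro incseq_SucI)
      fix n show "?A n \<subseteq> ?A (Suc n)"
        by (force simp: mem_box)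
    qed
    from UN[OF _ this] have "(\<lambda>n. ?I (?A n)) \<longlonglongrightarrow> ?I UNIV" by (simp add: UN_box_eq_UNIV)
    moreover have "?I (?A n) = 0" for n using 0 by (simp add: set_lebesgue_integral_def)
    ultimately show ?thesis by (simp add: LIMSEQ_const_iff)
  qed
  have B0: "?I A = 0" if "A \<in> sets borel" for A
  proof -
    have "Int_stable (range (\<lambda>(a, b). box a b :: 'a set))"
      by (auto simp: Int_stable_def box_Int_box)
    moreover have "range (\<lambda>(a, b). box a b :: 'a set) \<subseteq> Pow UNIV" by simp
    moreover have "A \<in> sigma_sets UNIV (range (\<lambda>(a, b). box a b))"
      using that by (simp add: borel_eq_box)
    ultimately show ?thesis
    proof (induction rule: sigma_sets_induct_disjoint)
      case (basic A) then show ?case using 0 by (auto simp: set_lebesgue_integral_def)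
    next
      case empty show ?case by (simp add: set_lebesgue_integral_def)
    next
      case (compl A)
      have A: "A \<in> sets borel" using compl by (simp add: borel_eq_box)
      have "?I (A \<union> (UNIV - A)) = ?I A + ?I (UNIV - A)"
        using A by (intro set_integral_Un si) auto
      then show ?case using compl U0 by simp
    next
      case (union A)
      have A: "A i \<in> sets borel" for i using union by (auto simp: borel_eq_box)
      have "?I (\<Union>i. A i) = (\<Sum>i. ?I (A i))"
        using union A by (intro lebesgue_integral_countable_add si) (auto simp: disjoint_family_on_def)
      then show ?case using union by simp
    qed
  qed
  show ?thesis
  proof (rule AE_zero_of_set_integral[OF v])
    fix A :: "'a set" assume "A \<in> sets lebesgue"
    \<comment> \<open>A Lebesgue set is a Borel set up to a subset of a Borel null set, which the
      integral does not see.\<close>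
    then obtain S N N' where A: "A = S \<union> N" "N \<subseteq> N'" "N' \<in> null_sets lborel" "S \<in> sets lborel"
      by (rule sets_completionE)
    have "AE x in lebesgue. x \<notin> N'"
      using A(3) by (metis AE_not_in null_sets_completionI)
    then have "AE x in lebesgue. indicator A x *\<^sub>R v x = indicator S x *\<^sub>R v x"
      by eventually_elim (use A(1,2) in \<open>auto split: split_indicator\<close>)
    then have "?I A = ?I S" unfolding set_lebesgue_integral_def by (rule integral_cong_AE_lebesgue)
    then show "?I A = 0" using B0 A(4) by simp
  qed
qed

text \<open>Dominated convergence along \<open>box_approx\<close> turns testing with smooth
  functions into integrals over open boxes. Countably many closed boxes cover \<open>U\<close>; the
  argument works on their interiors, and the frontiers are null.\<close>

lemma fundamental_lemma:
  fixes w :: "'a::euclidean_space \<Rightarrow> real"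
  assumes U: "open U"
    and int: "\<And>a b. cbox a b \<subseteq> U \<Longrightarrow> integrable lebesgue (\<lambda>x. indicator (cbox a b) x * w x)"
    and 0: "\<And>\<theta>. \<theta> \<in> test_functions U \<Longrightarrow> (LINT x|lebesgue. \<theta> x * w x) = 0"
  shows "AE x in lebesgue. x \<in> U \<longrightarrow> w x = 0"
proof -
  have box0: "(LINT x|lebesgue. indicator (box a c) x * w x) = 0" if ac: "cbox a c \<subseteq> U" for a c
  proof -
    have mw: "(\<lambda>x. indicator (cbox a c) x * w x) \<in> borel_measurable lebesgue"
      using int[OF ac] by blast
    \<comment> \<open>Since \<open>box_approx\<close> vanishes off the box, the indicator of the
      closed box can be inserted for free; it makes the dominating function integrable although
      \<open>w\<close> is integrable only locally.\<close>
    have eq: "box_approx a c n x * w x = box_approx a c n x * (indicator (cbox a c) x * w x)" for n x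
      using box_subset_cbox[of a c]
      by (cases "x \<in> box a c") (auto simp: box_approx_def box_bump_eq_0)
    have "(\<lambda>n. LINT x|lebesgue. box_approx a c n x * (indicator (cbox a c) x * w x)) \<longlonglongrightarrow>
        (LINT x|lebesgue. indicator (box a c) x * (indicator (cbox a c) x * w x))"
    proof (rule integral_dominated_convergence[where w = "\<lambda>x. norm (indicator (cbox a c) x * w x)"])
      show "(\<lambda>x. box_approx a c n x * (indicator (cbox a c) x * w x)) \<in> borel_measurable lebesgue" for n
        using borel_measurable_test_function[OF box_approx_test_function[OF ac]] mw 
        by (intro borel_measurable_times[OF _ mw] measurable_completion) auto
      show "AE x in lebesgue. norm (box_approx a c n x * (indicator (cbox a c) x * w x))
          \<le> norm (indicator (cbox a c) x * w x)" for n
        unfolding norm_mult[of "box_approx a c n _"]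
        by (intro AE_I2 mult_left_le_one_le norm_ge_zero box_approx_range)
      show "(\<lambda>x. indicator (box a c) x * (indicator (cbox a c) x * w x)) \<in> borel_measurable lebesgue"
        by (intro borel_measurable_times[OF _ mw] borel_measurable_indicator) auto
    qed (use int[OF ac] in \<open>auto intro!: tendsto_intros box_approx_tendsto simp del: norm_mult\<close>)
    moreover have "(LINT x|lebesgue. box_approx a c n x * (indicator (cbox a c) x * w x)) = 0" for n
      using 0[OF box_approx_test_function[OF ac], of n] unfolding eq .
    ultimately have "(LINT x|lebesgue. indicator (box a c) x * (indicator (cbox a c) x * w x)) = 0"
      by (simp add: LIMSEQ_const_iff)
    moreover have "indicator (box a c) x * (indicator (cbox a c) x * w x) = indicator (box a c) x * w x" for x
      using box_subset_cbox[of a c] by (auto split: split_indicator)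
    ultimately show ?thesis by simp
  qed
  have cb: "AE x in lebesgue. x \<in> box a c \<longrightarrow> w x = 0" if ac: "cbox a c \<subseteq> U" for a c
  proof -
    define v where "v x = indicator (box a c) x * w x" for x
    have "integrable lebesgue (\<lambda>x. indicator (box a c) x *\<^sub>R (indicator (cbox a c) x * w x))"
      by (rule integrable_mult_indicator) (use int[OF ac] in auto)
    also have "(\<lambda>x. indicator (box a c) x *\<^sub>R (indicator (cbox a c) x * w x)) = v"
      using box_subset_cbox[of a c] by (auto simp: v_def fun_eq_iff split: split_indicator)
    finally have "AE x in lebesgue. v x = 0"
    proof (rule AE_zero_of_integral_boxes)
      fix p q :: 'a
      obtain p' q' where pq: "box p q \<inter> box a c = box p' q'"
        using that[OF box_Int_box] .
      have "(\<lambda>x. indicator (box p q) x * v x) = (\<lambda>x. indicator (box p' q') x * w x)"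
        unfolding v_def pq[symmetric] by (auto simp: fun_eq_iff split: split_indicator)
      moreover have "(LINT x|lebesgue. indicator (box p' q') x * w x) = 0"
      proof (cases "box p' q' = {}")
        case False
        \<comment> \<open>A nonempty open box has its closed box as closure, which keeps the closed
          intersection inside \<open>cbox a c\<close> and hence inside \<open>U\<close>.\<close>
        then have "cbox p' q' = closure (box p' q')" by simp
        also have "\<dots> \<subseteq> closure (box a c)" unfolding pq[symmetric] by (intro closure_mono) auto
        also have "\<dots> \<subseteq> cbox a c" by (intro closure_minimal box_subset_cbox closed_cbox)
        finally show ?thesis using ac by (intro box0) auto
      qed simp
      ultimately show "(LINT x|lebesgue. indicator (box p q) x * v x) = 0" by simp
    qed
    then show ?thesis by eventually_elim (auto simp: v_def)
  qed
  obtain D where D: "countable D" "D \<subseteq> Pow U" "\<And>X. X \<in> D \<Longrightarrow> \<exists>a b. X = cbox a b" "\<Union>D = U"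
    using open_countable_Union_open_cbox[OF U] by metis
  define N where "N X = (SOME p. X = cbox (fst p) (snd p))" for X :: "'a set"
  have N: "X = cbox (fst (N X)) (snd (N X))" if X: "X \<in> D" for X
  proof -
    obtain a b where "X = cbox a b" using D(3)[OF X] by blast
    then have "X = cbox (fst (a, b)) (snd (a, b))" by simp
    then show ?thesis unfolding N_def by (rule someI)
  qed
  have "AE x in lebesgue. \<forall>X\<in>D. x \<in> box (fst (N X)) (snd (N X)) \<longrightarrow> w x = 0"
    unfolding AE_ball_countable[OF D(1)]
  proof
    fix X assume "X \<in> D"
    then have "cbox (fst (N X)) (snd (N X)) \<subseteq> U" using D(2) N[of X] by (metis PowD subsetD)
    then show "AE x in lebesgue. x \<in> box (fst (N X)) (snd (N X)) \<longrightarrow> w x = 0" by (rule cb)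
  qed
  \<comment> \<open>The closed boxes cover \<open>U\<close>, their interiors need not; the countably
    many frontiers are removed as a null set.\<close>
  moreover have "AE x in lebesgue. \<forall>X\<in>D. x \<notin> cbox (fst (N X)) (snd (N X)) - box (fst (N X)) (snd (N X))"
    unfolding AE_ball_countable[OF D(1)]
  proof
    fix X
    have "negligible (cbox (fst (N X)) (snd (N X)) - box (fst (N X)) (snd (N X)))"
      by (rule negligible_frontier_interval)
    then show "AE x in lebesgue. x \<notin> cbox (fst (N X)) (snd (N X)) - box (fst (N X)) (snd (N X))"
      unfolding negligible_iff_null_sets by (rule AE_not_in)
  qed
  ultimately show ?thesis
  proof eventually_elim
    case (elim x)
    show ?case
    proof
      assume "x \<in> U"
      then obtain X where X: "X \<in> D" "x \<in> X" using D(4) by blast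
      have "x \<in> cbox (fst (N X)) (snd (N X))" using X(2) N[OF X(1)] by (rule back_subst[where P = "\<lambda>X. x \<in> X"])
      then show "w x = 0" using elim X(1) by blast
    qed
  qed
qed


subsection \<open>Square integrable functions\<close>

lemma L2_spaceD:
  assumes "f \<in> L2_space M"
  shows "f \<in> borel_measurable M" "integrable M (\<lambda>x. (norm (f x))\<^sup>2)"
  using assms by (auto simp: L2_space_def)

lemma L2_norm_nonneg: "0 \<le> L2_norm M f" by (simp add: L2_norm_def)

lemma L2_norm_sq: "(L2_norm M f)\<^sup>2 = (LINT x|M. (norm (f x))\<^sup>2)"
  by (simp add: L2_norm_def)

lemma L2_space_dominated:
  assumes "f \<in> borel_measurable M" "integrable M h" "AE x in M. (norm (f x))\<^sup>2 \<le> h x"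
  shows "f \<in> L2_space M"
  unfolding L2_space_def using assms
  by (auto intro!: Bochner_Integration.integrable_bound[of M h])

lemma L2_space_add:
  assumes "f \<in> L2_space M" "g \<in> L2_space M" shows "f + g \<in> L2_space M"
proof (rule L2_space_dominated)
  show "integrable M (\<lambda>x. 2 * (norm (f x))\<^sup>2 + 2 * (norm (g x))\<^sup>2)"
    using assms by (auto simp: L2_space_def)
  have "(norm (f x + g x))\<^sup>2 \<le> 2 * (norm (f x))\<^sup>2 + 2 * (norm (g x))\<^sup>2" for x
  proof -
    have "(norm (f x + g x))\<^sup>2 \<le> (norm (f x) + norm (g x))\<^sup>2"
      by (intro power_mono norm_triangle_ineq) simp
    then show ?thesis using sum_squares_bound[of "norm (f x)" "norm (g x)"] by (simp add: power2_sum)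
  qed
  then show "AE x in M. (norm ((f + g) x))\<^sup>2 \<le> 2 * (norm (f x))\<^sup>2 + 2 * (norm (g x))\<^sup>2" by simp
qed (use assms in \<open>auto simp: L2_space_def plus_fun_def\<close>)

lemma L2_space_scaleR: "f \<in> L2_space M \<Longrightarrow> c *\<^sub>R f \<in> L2_space M"
  by (auto simp: L2_space_def scaleR_fun_def power_mult_distrib)

lemma L2_space_diff: "f \<in> L2_space M \<Longrightarrow> g \<in> L2_space M \<Longrightarrow> f - g \<in> L2_space M"
  using L2_space_add[of f M "(-1) *\<^sub>R g"] L2_space_scaleR[of g M "-1"] by simp

lemma L2_space_0: "0 \<in> L2_space M" by (simp add: L2_space_def zero_fun_def)

lemma L2_norm_0: "L2_norm M 0 = 0" by (simp add: L2_norm_def zero_fun_def)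

lemma L2_norm_scaleR: "L2_norm M (c *\<^sub>R f) = \<bar>c\<bar> * L2_norm M f"
  by (simp add: L2_norm_def power_mult_distrib real_sqrt_mult)

lemma L2_norm_minus_commute: "L2_norm M (f - g) = L2_norm M (g - f)"
  by (simp add: L2_norm_def norm_minus_commute)

lemma L2_norm_eq_0_iff:
  assumes "f \<in> L2_space M" shows "L2_norm M f = 0 \<longleftrightarrow> (AE x in M. f x = 0)"
  using integral_nonneg_eq_0_iff_AE[OF L2_spaceD(2)[OF assms]] by (simp add: L2_norm_def)

lemma L2_norm_cong_AE:
  fixes f g :: "'a::euclidean_space \<Rightarrow> 'b::euclidean_space"
  assumes "S \<in> sets lebesgue" "AE x in lebesgue_on S. f x = g x"
  shows "L2_norm (lebesgue_on S) f = L2_norm (lebesgue_on S) g"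
  unfolding L2_norm_def
  by (subst integral_cong_AE_lebesgue_on[OF assms(1)]) (use assms(2) in \<open>auto elim!: eventually_mono\<close>)

lemma L2_mult_integrable:
  assumes "f \<in> L2_space M" "g \<in> L2_space M"
  shows "integrable M (\<lambda>x. norm (f x) * norm (g x))"
proof (rule Bochner_Integration.integrable_bound)
  show "integrable M (\<lambda>x. (norm (f x))\<^sup>2 + (norm (g x))\<^sup>2)" using assms by (auto simp: L2_space_def)
  have "norm (f x) * norm (g x) \<le> (norm (f x))\<^sup>2 + (norm (g x))\<^sup>2" for x
  proof -
    have "0 \<le> norm (f x) * norm (g x)" by simp
    then show ?thesis using sum_squares_bound[of "norm (f x)" "norm (g x)"] by linarith
  qed
  then show "AE x in M. norm (norm (f x) * norm (g x)) \<le> norm ((norm (f x))\<^sup>2 + (norm (g x))\<^sup>2)" 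
    by (auto simp: abs_mult)
qed (use assms in \<open>auto simp: L2_space_def\<close>)

lemma L2_inner_integrable:
  assumes "f \<in> L2_space M" "g \<in> L2_space M"
  shows "integrable M (\<lambda>x. f x \<bullet> g x)"
  by (rule Bochner_Integration.integrable_bound[OF L2_mult_integrable[OF assms]])
    (use assms in \<open>auto simp: L2_space_def Cauchy_Schwarz_ineq2\<close>)

lemma L2_Cauchy_Schwarz_norm:
  assumes "f \<in> L2_space M" "g \<in> L2_space M"
  shows "(LINT x|M. norm (f x) * norm (g x)) \<le> L2_norm M f * L2_norm M g"
proof (cases "L2_norm M f = 0 \<or> L2_norm M g = 0")
  case True
  then have "AE x in M. norm (f x) * norm (g x) = 0"
    using L2_norm_eq_0_iff[OF assms(1)] L2_norm_eq_0_iff[OF assms(2)] by (auto elim!: eventually_mono)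
  then have "(LINT x|M. norm (f x) * norm (g x)) = 0" by (rule integral_eq_zero_AE)
  then show ?thesis by (simp add: L2_norm_nonneg)
next
  case False
  define a b where "a = L2_norm M f" and "b = L2_norm M g"
  have ab: "0 < a" "0 < b" using False L2_norm_nonneg[of M f] L2_norm_nonneg[of M g] by (auto simp: a_def b_def)
  \<comment> \<open>Young's inequality, weighted so that each of the two terms integrates to
    \<open>a * b / 2\<close>.\<close>
  have "norm (f x) * norm (g x) \<le> (b / (2 * a)) * (norm (f x))\<^sup>2 + (a / (2 * b)) * (norm (g x))\<^sup>2" for x
  proof -
    have "0 \<le> (b * norm (f x) - a * norm (g x))\<^sup>2" by simp
    then have "2 * a * b * (norm (f x) * norm (g x)) \<le> b\<^sup>2 * (norm (f x))\<^sup>2 + a\<^sup>2 * (norm (g x))\<^sup>2"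
      by (simp add: power2_eq_square algebra_simps)
    then show ?thesis using ab by (simp add: field_simps power2_eq_square)
  qed
  then have "(LINT x|M. norm (f x) * norm (g x)) \<le>
      (LINT x|M. (b / (2 * a)) * (norm (f x))\<^sup>2 + (a / (2 * b)) * (norm (g x))\<^sup>2)"
    using assms by (intro integral_mono L2_mult_integrable) (auto simp: L2_space_def)
  also have "\<dots> = (b / (2 * a)) * a\<^sup>2 + (a / (2 * b)) * b\<^sup>2"
    using assms by (subst Bochner_Integration.integral_add) (auto simp: a_def b_def L2_norm_sq L2_space_def)
  also have "\<dots> = a * b" using ab by (simp add: field_simps power2_eq_square)
  finally show ?thesis by (simp add: a_def b_def)
qed

lemma L2_Cauchy_Schwarz:
  assumes "f \<in> L2_space M" "g \<in> L2_space M"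
  shows "\<bar>LINT x|M. f x \<bullet> g x\<bar> \<le> L2_norm M f * L2_norm M g"
  using integral_abs_le_integral[OF L2_mult_integrable[OF assms], of "\<lambda>x. f x \<bullet> g x"]
    L2_Cauchy_Schwarz_norm[OF assms] by (auto simp: Cauchy_Schwarz_ineq2)

lemma L2_norm_add_sq:
  assumes "f \<in> L2_space M" "g \<in> L2_space M"
  shows "(L2_norm M (f + g))\<^sup>2 = (L2_norm M f)\<^sup>2 + 2 * (LINT x|M. f x \<bullet> g x) + (L2_norm M g)\<^sup>2"
proof -
  have "(LINT x|M. (norm (f x + g x))\<^sup>2) = (LINT x|M. (norm (f x))\<^sup>2 + 2 * (f x \<bullet> g x) + (norm (g x))\<^sup>2)"
    by (simp add: power2_norm_eq_inner inner_add_left inner_add_right inner_commute algebra_simps)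
  also have "\<dots> = (LINT x|M. (norm (f x))\<^sup>2) + 2 * (LINT x|M. f x \<bullet> g x) + (LINT x|M. (norm (g x))\<^sup>2)"
    using assms by (simp add: L2_spaceD L2_inner_integrable)
  finally show ?thesis by (simp add: L2_norm_sq)
qed

lemma L2_norm_triangle:
  assumes "f \<in> L2_space M" "g \<in> L2_space M"
  shows "L2_norm M (f + g) \<le> L2_norm M f + L2_norm M g"
proof (rule power2_le_imp_le)
  show "(L2_norm M (f + g))\<^sup>2 \<le> (L2_norm M f + L2_norm M g)\<^sup>2"
    unfolding L2_norm_add_sq[OF assms] power2_sum using L2_Cauchy_Schwarz[OF assms] by linarith
qed (simp add: L2_norm_nonneg)

lemma L2_norm_triangle_diff:
  assumes "f \<in> L2_space M" "g \<in> L2_space M"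
  shows "\<bar>L2_norm M f - L2_norm M g\<bar> \<le> L2_norm M (f - g)"
  using L2_norm_triangle[OF L2_space_diff[OF assms] assms(2)]
    L2_norm_triangle[OF L2_space_diff[OF assms(2,1)] assms(1)] L2_norm_minus_commute[of M f g]
  by simp

lemma L2_space_subset_L1:
  fixes f :: "'a::euclidean_space \<Rightarrow> real"
  assumes "bounded S" "S \<in> sets lebesgue" "f \<in> L2_on S"
  shows "integrable (lebesgue_on S) f"
    and "(LINT x|lebesgue_on S. \<bar>f x\<bar>) \<le> sqrt (measure lebesgue S) * L2_on_norm S f"
proof -
  have "S \<in> lmeasurable" using assms by (simp add: bounded_set_imp_lmeasurable)
  then have 1: "integrable (lebesgue_on S) (\<lambda>_. 1::real)" "(LINT x|lebesgue_on S. 1) = measure lebesgue S"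
  proof -
    interpret finite_measure "lebesgue_on S"
      using \<open>S \<in> lmeasurable\<close> by (rule finite_measure_lebesgue_on)
    show "integrable (lebesgue_on S) (\<lambda>_. 1::real)" "(LINT x|lebesgue_on S. 1) = measure lebesgue S"
      using assms(2) by (auto simp: measure_restrict_space)
  qed
  then have "(\<lambda>_. 1) \<in> L2_on S" by (simp add: L2_space_def)
  from L2_mult_integrable[OF this assms(3)] L2_Cauchy_Schwarz_norm[OF this assms(3)]
  show "(LINT x|lebesgue_on S. \<bar>f x\<bar>) \<le> sqrt (measure lebesgue S) * L2_on_norm S f"
    and "integrable (lebesgue_on S) f"
    using assms(3) 1 by (auto simp: L2_norm_def L2_space_def integrable_abs_iff)
qed

text \<open>On a bounded set an L2 Cauchy sequence is L1 Cauchy, so a subsequence converges almost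
  everywhere. Fatou's lemma then carries the L2 Cauchy bound over to the distance from the pointwise
  limit.\<close>

lemma L2_complete:
  fixes y :: "nat \<Rightarrow> 'a::euclidean_space \<Rightarrow> real"
  assumes S: "bounded S" "S \<in> sets lebesgue" and y: "\<And>n. y n \<in> L2_on S"
    and C: "\<And>e. e > 0 \<Longrightarrow> \<exists>N. \<forall>m\<ge>N. \<forall>n\<ge>N. L2_on_norm S (y m - y n) < e"
  obtains z where "z \<in> L2_on S" "(\<lambda>n. L2_on_norm S (y n - z)) \<longlonglongrightarrow> 0"
proof -
  let ?M = "lebesgue_on S"
  \<comment> \<open>The summand 1 keeps the divisor positive when \<open>S\<close> is a null
    set.\<close>
  define V where "V = sqrt (measure lebesgue S) + 1"
  have V: "V > 0" by (simp add: V_def add_nonneg_pos)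
  have "\<exists>N. \<forall>i\<ge>N. \<forall>j\<ge>N. (LINT x|?M. norm (y i x - y j x)) < e" if "e > 0" for e
  proof -
    obtain N where N: "\<And>m n. m \<ge> N \<Longrightarrow> n \<ge> N \<Longrightarrow> L2_norm ?M (y m - y n) < e / V"
      using C[OF divide_pos_pos[OF \<open>e > 0\<close> V]] by blast
    have "(LINT x|?M. norm (y i x - y j x)) < e" if "i \<ge> N" "j \<ge> N" for i j
    proof -
      have "(LINT x|?M. norm (y i x - y j x)) \<le> sqrt (measure lebesgue S) * L2_norm ?M (y i - y j)"
        using L2_space_subset_L1(2)[OF S L2_space_diff[OF y y]] by simp
      also have "\<dots> \<le> V * L2_norm ?M (y i - y j)"
        by (intro mult_right_mono) (auto simp: V_def L2_norm_nonneg)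
      also have "\<dots> < V * (e / V)" using N[OF that] V by (intro mult_strict_left_mono) auto
      finally show ?thesis using V by simp
    qed
    then show ?thesis by blast
  qed
  with L2_space_subset_L1(1)[OF S y] obtain r where r: "strict_mono r" "AE x in ?M. Cauchy (\<lambda>i. y (r i) x)"
    using cauchy_L1_AE_cauchy_subseq[of ?M y] by blast
  define z where "z x = lim (\<lambda>i. y (r i) x)" for x
  have lim: "AE x in ?M. (\<lambda>i. y (r i) x) \<longlonglongrightarrow> z x"
    using r(2) by eventually_elim (simp add: z_def Cauchy_convergent_iff convergent_LIMSEQ_iff)
  have zm: "z \<in> borel_measurable ?M"
    unfolding z_def using y by (intro borel_measurable_lim_metric) (auto simp: L2_space_def)
  have key: "(\<integral>\<^sup>+x. ennreal ((norm (z x - y n x))\<^sup>2) \<partial>?M) \<le> ennreal (e\<^sup>2)"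
    if e: "e > 0" and N: "\<And>m. m \<ge> n \<Longrightarrow> L2_norm ?M (y m - y n) < e" for e n
  proof -
    have "(\<integral>\<^sup>+x. ennreal ((norm (z x - y n x))\<^sup>2) \<partial>?M) =
        (\<integral>\<^sup>+x. liminf (\<lambda>i. ennreal ((norm (y (r i) x - y n x))\<^sup>2)) \<partial>?M)"
    proof (rule nn_integral_cong_AE)
      show "AE x in ?M. ennreal ((norm (z x - y n x))\<^sup>2) = liminf (\<lambda>i. ennreal ((norm (y (r i) x - y n x))\<^sup>2))"
        using lim
      proof eventually_elim
        case (elim x)
        have "(\<lambda>i. ennreal ((norm (y (r i) x - y n x))\<^sup>2)) \<longlonglongrightarrow> ennreal ((norm (z x - y n x))\<^sup>2)"
          by (intro tendsto_intros elim)
        from lim_imp_Liminf[OF sequentially_bot this] show ?case by (rule sym)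
      qed
    qed
    also have "\<dots> \<le> liminf (\<lambda>i. \<integral>\<^sup>+x. ennreal ((norm (y (r i) x - y n x))\<^sup>2) \<partial>?M)"
      using L2_spaceD(1)[OF y] by (intro nn_integral_liminf) measurable
    also have "\<dots> \<le> liminf (\<lambda>i. ennreal (e\<^sup>2))"
    proof (rule Liminf_mono)
      show "\<forall>\<^sub>F i in sequentially. (\<integral>\<^sup>+x. ennreal ((norm (y (r i) x - y n x))\<^sup>2) \<partial>?M) \<le> ennreal (e\<^sup>2)"
        using eventually_ge_at_top[of n]
      proof eventually_elim
        case (elim i)
        then have "n \<le> r i" using seq_suble[OF r(1), of i] by linarith
        have "(\<integral>\<^sup>+x. ennreal ((norm (y (r i) x - y n x))\<^sup>2) \<partial>?M) = ennreal ((L2_norm ?M (y (r i) - y n))\<^sup>2)"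
          using L2_spaceD(2)[OF L2_space_diff[OF y[of "r i"] y[of n]]]
          by (simp add: nn_integral_eq_integral L2_norm_sq)
        also have "\<dots> \<le> ennreal (e\<^sup>2)"
          using N[OF \<open>n \<le> r i\<close>] by (intro ennreal_leI power_mono) (auto simp: L2_norm_nonneg)
        finally show ?case .
      qed
    qed
    also have "\<dots> = ennreal (e\<^sup>2)" by (simp add: Liminf_const)
    finally show ?thesis .
  qed
  have L: "z - y n \<in> L2_space ?M \<and> L2_norm ?M (z - y n) \<le> e"
    if e: "e > 0" and N: "\<And>m. m \<ge> n \<Longrightarrow> L2_norm ?M (y m - y n) < e" for e n
  proof -
    have int: "integrable ?M (\<lambda>x. (norm (z x - y n x))\<^sup>2)"
      using key[OF e N] zm y[of n] order_le_less_trans[OF key[OF e N] ennreal_less_top]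
      by (intro integrableI_bounded) (auto simp: L2_space_def)
    then have *: "ennreal (LINT x|?M. (norm (z x - y n x))\<^sup>2) \<le> ennreal (e\<^sup>2)"
      using key[OF e N] by (simp add: nn_integral_eq_integral)
    then have "(L2_norm ?M (z - y n))\<^sup>2 \<le> e\<^sup>2" unfolding L2_norm_sq by simp
    then show ?thesis using int zm y[of n] e
      by (auto simp: L2_space_def fun_diff_def power2_le_iff_abs_le L2_norm_nonneg dest: power2_le_imp_le)
  qed
  show ?thesis
  proof
    obtain N where "\<And>m n. m \<ge> N \<Longrightarrow> n \<ge> N \<Longrightarrow> L2_norm ?M (y m - y n) < 1" using C[OF zero_less_one] by blast
    then have "z - y N \<in> L2_space ?M" using L[of 1 N] by simp
    from L2_space_add[OF this y[of N]] show "z \<in> L2_space ?M" by simp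
    show "(\<lambda>n. L2_norm ?M (y n - z)) \<longlonglongrightarrow> 0"
    proof (rule LIMSEQ_I)
      fix e :: real assume "e > 0"
      then obtain N where N: "\<And>m n. m \<ge> N \<Longrightarrow> n \<ge> N \<Longrightarrow> L2_norm ?M (y m - y n) < e / 2" using C[OF half_gt_zero] by blast
      have "norm (L2_norm ?M (y n - z) - 0) < e" if "n \<ge> N" for n
      proof -
        have "L2_norm ?M (z - y n) \<le> e / 2" using L[of "e/2" n] N that \<open>e > 0\<close> by auto
        then show ?thesis using \<open>e > 0\<close> L2_norm_nonneg[of ?M "y n - z"] by (simp add: L2_norm_minus_commute)
      qed
      then show "\<exists>N. \<forall>n\<ge>N. norm (L2_norm ?M (y n - z) - 0) < e" by blast
    qed
  qed
qed

text \<open>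
  Near-minimizers of the norm in the convex hulls of the tails form a Cauchy sequence, by the
  parallelogram law.
\<close>

lemma L2_weak_cluster_point:
  fixes x :: "nat \<Rightarrow> 'a::euclidean_space \<Rightarrow> real"
  assumes S: "bounded S" "S \<in> sets lebesgue" and x: "\<And>n. x n \<in> L2_on S" and C: "\<And>n. L2_on_norm S (x n) \<le> C"
  obtains z where "z \<in> L2_on S"
    "\<And>h a. h \<in> L2_on S \<Longrightarrow> \<forall>\<^sub>F n in sequentially. a \<le> (LINT \<xi>|lebesgue_on S. x n \<xi> * h \<xi>) \<Longrightarrow>
      a \<le> (LINT \<xi>|lebesgue_on S. z \<xi> * h \<xi>)"
proof -
  let ?M = "lebesgue_on S"
  define K where "K n = convex hull (x ` {n..})" for n
  have hull: "K n \<subseteq> P" if "convex P" "\<And>i. i \<ge> n \<Longrightarrow> x i \<in> P" for P n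
    unfolding K_def by (rule hull_minimal) (use that in auto)
  have cL: "convex (L2_space ?M)"
    unfolding convex_def by (auto intro: L2_space_add L2_space_scaleR)
  have KL: "y \<in> L2_space ?M" if "y \<in> K n" for y n using hull[OF cL x] that by blast
  have cK: "convex (K n)" for n by (simp add: K_def convex_convex_hull)
  have xK: "x n \<in> K n" for n unfolding K_def by (rule hull_inc) auto
  have KM: "K m \<subseteq> K n" if "n \<le> m" for m n unfolding K_def using that by (intro hull_mono) auto
  define d where "d n = Inf ((\<lambda>y. (L2_norm ?M y)\<^sup>2) ` K n)" for n
  have bb: "bdd_below ((\<lambda>y. (L2_norm ?M y)\<^sup>2) ` K n)" for n by (rule bdd_belowI[of _ 0]) auto
  have dle: "d n \<le> (L2_norm ?M y)\<^sup>2" if "y \<in> K n" for y n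
    unfolding d_def using bb that by (intro cInf_lower) auto
  have C0: "0 \<le> C" using C[of 0] L2_norm_nonneg[of ?M "x 0"] by linarith
  have "d n \<le> C\<^sup>2" for n
    using dle[OF xK] power_mono[OF C L2_norm_nonneg, of n 2] by (rule order_trans)
  \<comment> \<open>The hulls of the tails shrink, so their least squared norms increase; being
    bounded by \<open>C\<^sup>2\<close>, they converge, and the gap \<open>D - d N\<close> controls
    the parallelogram estimate below.\<close>
  moreover have "incseq d"
    unfolding incseq_def d_def 
    by (intro allI impI cInf_superset_mono image_mono KM bb) (use xK in blast)+
  ultimately obtain D where D: "d \<longlonglongrightarrow> D" "\<And>n. d n \<le> D"
    using incseq_convergent[of d "C\<^sup>2"] by auto
  have "\<exists>y\<in>K n. (L2_norm ?M y)\<^sup>2 < d n + 1 / real (Suc n)" for n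
  proof -
    have "Inf ((\<lambda>y. (L2_norm ?M y)\<^sup>2) ` K n) < d n + 1 / real (Suc n)" by (simp add: d_def)
    then show ?thesis using bb[of n] xK[of n] by (subst (asm) cInf_less_iff) auto
  qed
  then obtain y where y: "\<And>n. y n \<in> K n" "\<And>n. (L2_norm ?M (y n))\<^sup>2 < d n + 1 / real (Suc n)" by metis
  have yL: "y n \<in> L2_space ?M" for n using KL y(1) by blast
  have est: "(L2_norm ?M (y m - y n))\<^sup>2 \<le> 4 * (D - d N) + 4 * (1 / real (Suc N))" if "m \<ge> N" "n \<ge> N" for m n N
  proof -
    have "(1/2) *\<^sub>R y m + (1/2) *\<^sub>R y n \<in> K N"
      using convexD[OF cK, of "y m" N "y n" "1/2" "1/2"] KM[OF that(1)] KM[OF that(2)] y(1) by auto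
    from dle[OF this] have "d N \<le> (L2_norm ?M ((1/2) *\<^sub>R (y m + y n)))\<^sup>2" by (simp add: scaleR_add_right)
    also have "\<dots> = (L2_norm ?M (y m + y n))\<^sup>2 / 4" by (simp add: L2_norm_scaleR power_mult_distrib power2_eq_square)
    finally have 1: "4 * d N \<le> (L2_norm ?M (y m))\<^sup>2 + 2 * (LINT x|?M. y m x \<bullet> y n x) + (L2_norm ?M (y n))\<^sup>2"
      using L2_norm_add_sq[OF yL yL, of m n] by simp
    have "(L2_norm ?M (y m + (-1) *\<^sub>R y n))\<^sup>2 = (L2_norm ?M (y m))\<^sup>2 - 2 * (LINT x|?M. y m x \<bullet> y n x) + (L2_norm ?M (y n))\<^sup>2"
      using L2_norm_add_sq[OF yL L2_space_scaleR[OF yL], of m "-1" n]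
      using L2_norm_scaleR[of ?M "-1" "y n"] by simp
    then have 2: "(L2_norm ?M (y m - y n))\<^sup>2 = (L2_norm ?M (y m))\<^sup>2 - 2 * (LINT x|?M. y m x \<bullet> y n x) + (L2_norm ?M (y n))\<^sup>2" by simp
    have "1 / real (Suc m) \<le> 1 / real (Suc N)" "1 / real (Suc n) \<le> 1 / real (Suc N)"
      using that by (auto simp: divide_simps)
    then have "(L2_norm ?M (y m))\<^sup>2 \<le> D + 1 / real (Suc N)" "(L2_norm ?M (y n))\<^sup>2 \<le> D + 1 / real (Suc N)"
      using y(2)[of m] y(2)[of n] D(2)[of m] D(2)[of n] by linarith+
    moreover have "L \<le> 4 * (D - e) + 4 * q"
      if "4 * e \<le> A + 2 * I + B" "L = A - 2 * I + B" "A \<le> D + q" "B \<le> D + q" for e A I B L q :: real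
      using that by argo
    ultimately show ?thesis using 1 2 by blast
  qed
  have "(\<lambda>N. 4 * (D - d N) + 4 * (1 / real (Suc N))) \<longlonglongrightarrow> 4 * (D - D) + 4 * 0"
    by (intro tendsto_intros D LIMSEQ_Suc[OF lim_const_over_n])
  then have e0: "(\<lambda>N. 4 * (D - d N) + 4 * (1 / real (Suc N))) \<longlonglongrightarrow> 0" by simp
  obtain z where z: "z \<in> L2_space ?M" "(\<lambda>n. L2_norm ?M (y n - z)) \<longlonglongrightarrow> 0"
  proof (rule L2_complete[OF S yL])
    fix e :: real assume "e > 0"
    then have "e\<^sup>2 > 0" by simp
    from order_tendstoD(2)[OF e0 this] obtain N where N: "4 * (D - d N) + 4 * (1 / real (Suc N)) < e\<^sup>2"
      unfolding eventually_sequentially by blast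
    have "L2_norm ?M (y m - y n) < e" if "m \<ge> N" "n \<ge> N" for m n
      using est[OF that] N \<open>e > 0\<close> by (intro power2_less_imp_less[of _ e]) auto
    then show "\<exists>N. \<forall>m\<ge>N. \<forall>n\<ge>N. L2_norm ?M (y m - y n) < e" by blast
  qed blast
  show ?thesis
  proof (rule that[OF z(1)])
    fix h a assume h: "h \<in> L2_space ?M" and "\<forall>\<^sub>F n in sequentially. a \<le> (LINT \<xi>|?M. x n \<xi> * h \<xi>)"
    then obtain n0 where n0: "\<And>n. n \<ge> n0 \<Longrightarrow> a \<le> (LINT \<xi>|?M. x n \<xi> * h \<xi>)"
      unfolding eventually_sequentially by blast
    \<comment> \<open>A half space is convex, so it contains the hull of every tail that starts late
      enough. The strong limit of the near-minimizers then stays in it.\<close>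
    define P where "P = {w \<in> L2_space ?M. a \<le> (LINT \<xi>|?M. w \<xi> * h \<xi>)}"
    have i: "integrable ?M (\<lambda>\<xi>. w \<xi> * h \<xi>)" if "w \<in> L2_space ?M" for w
      using L2_inner_integrable[OF that h] by simp
    have "convex P"
      unfolding convex_def
    proof safe
      fix w w' and p q :: real assume w: "w \<in> P" "w' \<in> P" and pq: "0 \<le> p" "0 \<le> q" "p + q = 1"
      have "(LINT \<xi>|?M. (p *\<^sub>R w + q *\<^sub>R w') \<xi> * h \<xi>) = (LINT \<xi>|?M. p * (w \<xi> * h \<xi>) + q * (w' \<xi> * h \<xi>))"
        by (simp add: algebra_simps)
      also have "\<dots> = p * (LINT \<xi>|?M. w \<xi> * h \<xi>) + q * (LINT \<xi>|?M. w' \<xi> * h \<xi>)"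
        using w i by (subst Bochner_Integration.integral_add) (auto simp: P_def)
      also have "\<dots> \<ge> p * a + q * a"
        using w pq by (intro add_mono mult_left_mono) (auto simp: P_def)
      finally have "a \<le> (LINT \<xi>|?M. (p *\<^sub>R w + q *\<^sub>R w') \<xi> * h \<xi>)"
        using pq by (simp add: distrib_right[symmetric])
      moreover have "p *\<^sub>R w + q *\<^sub>R w' \<in> L2_space ?M"
        using w by (auto simp: P_def intro: L2_space_add L2_space_scaleR)
      ultimately show "p *\<^sub>R w + q *\<^sub>R w' \<in> P" unfolding P_def by blast
    qed
    then have KP: "K n0 \<subseteq> P" using n0 x by (intro hull) (auto simp: P_def)
    have ya: "a \<le> (LINT \<xi>|?M. y n \<xi> * h \<xi>)" if "n \<ge> n0" for n
      using y(1)[of n] KM[OF that] KP by (auto simp: P_def)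
    have t0: "(\<lambda>n. L2_norm ?M (y n - z) * L2_norm ?M h) \<longlonglongrightarrow> 0"
      by (rule tendsto_mult_left_zero[OF z(2)])
    have bd: "norm ((LINT \<xi>|?M. y n \<xi> * h \<xi>) - (LINT \<xi>|?M. z \<xi> * h \<xi>)) \<le> L2_norm ?M (y n - z) * L2_norm ?M h" for n
      using L2_Cauchy_Schwarz[OF L2_space_diff[OF yL z(1)] h, of n] i[OF yL, of n] i[OF z(1)]
      by (simp add: left_diff_distrib)
    have "(\<lambda>n. (LINT \<xi>|?M. y n \<xi> * h \<xi>) - (LINT \<xi>|?M. z \<xi> * h \<xi>)) \<longlonglongrightarrow> 0"
      by (rule Lim_null_comparison[OF always_eventually[OF allI[OF bd]] t0])
    then have "(\<lambda>n. (LINT \<xi>|?M. y n \<xi> * h \<xi>)) \<longlonglongrightarrow> (LINT \<xi>|?M. z \<xi> * h \<xi>)" by (rule LIM_zero_cancel)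
    then show "a \<le> (LINT \<xi>|?M. z \<xi> * h \<xi>)" by (rule LIMSEQ_le_const) (use ya in blast)
  qed
qed


subsection \<open>Riesz potentials of test functions\<close>

lemma test_function_support:
  assumes "f \<in> test_functions S"
  obtains R where "R > 0" "\<And>x. R \<le> norm x \<Longrightarrow> f x = 0"
proof -
  obtain K where K: "compact K" "\<And>x. x \<notin> K \<Longrightarrow> f x = 0"
    using assms by (rule test_functionsE) blast
  obtain R where R: "R > 0" "\<And>x. x \<in> K \<Longrightarrow> norm x < R"
    using compact_imp_bounded[OF K(1)] by (metis bounded_pos_less)
  show ?thesis by (rule that[OF R(1)]) (use K(2) R(2) in \<open>meson leD\<close>)
qed

lemma borel_measurable_lebesgue_test_function:
  "f \<in> test_functions S \<Longrightarrow> f \<in> borel_measurable lebesgue"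
  using borel_measurable_test_function by (intro measurable_completion) auto

lemma integrable_indicator_cball:
  "integrable lebesgue (\<lambda>x. indicator (cball (z::'a::euclidean_space) R) x :: real)"
  using emeasure_lborel_cball_finite[of z R] by (intro integrable_real_indicator) auto

lemma test_function_dominated:
  assumes "f \<in> test_functions S"
  obtains C R where "0 \<le> C" "0 < R" "\<And>x. norm (f x) \<le> C * indicator (cball 0 R) x"
proof -
  obtain R where R: "R > 0" "\<And>x. R \<le> norm x \<Longrightarrow> f x = 0"
    using assms by (rule test_function_support) blast
  obtain C where C: "C > 0" "\<And>x. norm (f x) \<le> C"
    using assms by (rule bounded_test_function) blast
  have "norm (f x) \<le> C * indicator (cball 0 R) x" for x
  proof (cases "norm x \<le> R")
    case True then show ?thesis using C(2)[of x] by simp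
  next
    case False then show ?thesis using R(2)[of x] by simp
  qed
  then show ?thesis using that[of C R] C(1) R(1) by auto
qed

lemma integrable_test_function:
  fixes f :: "'a::euclidean_space \<Rightarrow> 'b::euclidean_space"
  assumes "f \<in> test_functions S" shows "integrable lebesgue f"
proof -
  obtain C R where C: "0 \<le> C" "\<And>x. norm (f x) \<le> C * indicator (cball 0 R) x"
    using assms by (rule test_function_dominated) blast
  have "integrable lebesgue (\<lambda>x. C * indicator (cball (0::'a) R) x)"
    by (intro integrable_mult_right integrable_indicator_cball)
  then show ?thesis
    by (rule Bochner_Integration.integrable_bound)
      (use C borel_measurable_lebesgue_test_function[OF assms] in \<open>auto intro!: AE_I2 simp del: indicator_simps\<close>)
qed

lemma test_function_L2:
  fixes f :: "'a::euclidean_space \<Rightarrow> 'b::euclidean_space"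
  assumes "f \<in> test_functions S" shows "f \<in> L2_space lebesgue"
proof -
  obtain C R where C: "0 \<le> C" "\<And>x. norm (f x) \<le> C * indicator (cball 0 R) x"
    using assms by (rule test_function_dominated) blast
  have "integrable lebesgue (\<lambda>x. C\<^sup>2 * indicator (cball (0::'a) R) x)"
    by (intro integrable_mult_right integrable_indicator_cball)
  moreover have "(norm (f x))\<^sup>2 \<le> C\<^sup>2 * indicator (cball 0 R) x" for x
    using power_mono[OF C(2)[of x] norm_ge_zero, of 2] by (auto simp: indicator_def)
  ultimately show ?thesis
    by (rule L2_space_dominated[OF borel_measurable_lebesgue_test_function[OF assms] _ AE_I2])
qed

lemma frechet_derivative_eq_sum_partials:
  fixes f :: "'a::euclidean_space \<Rightarrow> 'b::real_normed_vector"
  assumes "f differentiable (at x)"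
  shows "frechet_derivative f (at x) h = (\<Sum>b\<in>Basis. (h \<bullet> b) *\<^sub>R frechet_derivative f (at x) b)"
proof -
  interpret bounded_linear "frechet_derivative f (at x)"
    using has_frechet_derivative[OF assms] by (rule has_derivative_bounded_linear)
  have "frechet_derivative f (at x) h = frechet_derivative f (at x) (\<Sum>b\<in>Basis. (h \<bullet> b) *\<^sub>R b)"
    by (simp only: euclidean_representation)
  then show ?thesis by (simp add: sum scaleR)
qed

lemma test_function_differentiable: "f \<in> test_functions S \<Longrightarrow> f differentiable (at x)"
  by (auto simp: test_functions_def intro: smooth_differentiable)

lemma test_function_lipschitz:
  fixes f :: "'a::euclidean_space \<Rightarrow> 'b::euclidean_space"
  assumes f: "f \<in> test_functions S"
  obtains L where "0 \<le> L" "\<And>x y. norm (f y - f x) \<le> L * norm (y - x)"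
proof -
  have "\<exists>C>0. \<forall>x. norm (frechet_derivative f (at x) b) \<le> C" if "b \<in> Basis" for b
    using bounded_test_function[OF test_functions_partial[OF f that]] by metis
  then obtain C where C: "\<And>b. b \<in> Basis \<Longrightarrow> C b > 0"
    "\<And>b x. b \<in> Basis \<Longrightarrow> norm (frechet_derivative f (at x) b) \<le> C b" by metis
  have "norm (f y - f x) \<le> sum C Basis * norm (y - x)" for x y
  proof (rule differentiable_bound[of UNIV f "\<lambda>x. frechet_derivative f (at x)"])
    fix x
    show "(f has_derivative frechet_derivative f (at x)) (at x within UNIV)"
      using has_frechet_derivative[OF test_function_differentiable[OF f]] .
    show "onorm (frechet_derivative f (at x)) \<le> sum C Basis"
    proof (rule onorm_le)
      fix h
      have "norm (frechet_derivative f (at x) h) \<le> (\<Sum>b\<in>Basis. \<bar>h \<bullet> b\<bar> * norm (frechet_derivative f (at x) b))"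
        unfolding frechet_derivative_eq_sum_partials[OF test_function_differentiable[OF f], of x h]
        by (rule order_trans[OF norm_sum]) simp
      also have "\<dots> \<le> (\<Sum>b\<in>Basis. norm h * C b)"
        by (intro sum_mono mult_mono Basis_le_norm C) auto
      finally show "norm (frechet_derivative f (at x) h) \<le> sum C Basis * norm h"
        by (simp add: sum_distrib_left mult.commute)
    qed
  qed auto
  moreover have "0 \<le> sum C Basis" using C(1) by (intro sum_nonneg) (simp add: less_imp_le)
  ultimately show ?thesis using that by blast
qed

text \<open>The first partials are Lipschitz, so the mean value inequality applies to
  \<open>f\<close> minus its linearization. The constant is uniform in \<open>x\<close>, which
  permits integration of the remainder against the Riesz kernel.\<close>

lemma test_function_second_order:
  fixes f :: "'a::euclidean_space \<Rightarrow> 'b::euclidean_space"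
  assumes f: "f \<in> test_functions S"
  obtains C where "0 \<le> C"
    "\<And>x h. norm (f (x + h) - f x - frechet_derivative f (at x) h) \<le> C * (norm h)\<^sup>2"
proof -
  have "\<exists>L\<ge>0. \<forall>x y. norm (frechet_derivative f (at y) b - frechet_derivative f (at x) b) \<le> L * norm (y - x)"
    if "b \<in> Basis" for b
    using test_function_lipschitz[OF test_functions_partial[OF f that]] by metis
  then obtain L where L: "\<And>b. b \<in> Basis \<Longrightarrow> L b \<ge> 0"
    "\<And>b x y. b \<in> Basis \<Longrightarrow> norm (frechet_derivative f (at y) b - frechet_derivative f (at x) b) \<le> L b * norm (y - x)"
    by metis
  define C where "C = sum L Basis"
  have C0: "0 \<le> C" unfolding C_def using L(1) by (rule sum_nonneg)
  have "norm (f (x + h) - f x - frechet_derivative f (at x) h) \<le> C * (norm h)\<^sup>2" for x h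
  proof -
    let ?D = "\<lambda>z. frechet_derivative f (at z)"
    interpret D: bounded_linear "?D x"
      using has_frechet_derivative[OF test_function_differentiable[OF f]] by (rule has_derivative_bounded_linear)
    have "norm ((f (x + h) - ?D x (x + h)) - (f x - ?D x x)) \<le> (C * norm h) * norm ((x + h) - x)"
    proof (rule differentiable_bound[of "cball x (norm h)" "\<lambda>z. f z - ?D x z" "\<lambda>z v. ?D z v - ?D x v"])
      fix z assume z: "z \<in> cball x (norm h)"
      have "((\<lambda>z. f z - ?D x z) has_derivative (\<lambda>v. ?D z v - ?D x v)) (at z)"
        by (intro has_derivative_diff has_frechet_derivative test_function_differentiable[OF f]
            D.has_derivative has_derivative_ident)
      then show "((\<lambda>z. f z - ?D x z) has_derivative (\<lambda>v. ?D z v - ?D x v)) (at z within cball x (norm h))"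
        by (rule has_derivative_at_withinI)
      show "onorm (\<lambda>v. ?D z v - ?D x v) \<le> C * norm h"
      proof (rule onorm_le)
        fix v
        have "?D z v - ?D x v = (\<Sum>b\<in>Basis. (v \<bullet> b) *\<^sub>R (?D z b - ?D x b))"
          unfolding frechet_derivative_eq_sum_partials[OF test_function_differentiable[OF f], of _ v]
          by (simp add: scaleR_diff_right sum_subtractf)
        also have "norm \<dots> \<le> (\<Sum>b\<in>Basis. \<bar>v \<bullet> b\<bar> * norm (?D z b - ?D x b))"
          by (rule order_trans[OF norm_sum]) simp
        also have "\<dots> \<le> (\<Sum>b\<in>Basis. norm v * (L b * norm h))"
        proof (intro sum_mono mult_mono Basis_le_norm)
          fix b :: 'a assume b: "b \<in> Basis"
          have "norm (?D z b - ?D x b) \<le> L b * norm (z - x)" by (rule L(2)[OF b])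
          also have "\<dots> \<le> L b * norm h"
            using z L(1)[OF b] by (intro mult_left_mono) (auto simp: dist_norm norm_minus_commute)
          finally show "norm (?D z b - ?D x b) \<le> L b * norm h" .
        qed auto
        also have "\<dots> = C * norm h * norm v"
          by (simp add: C_def sum_distrib_left sum_distrib_right mult_ac)
        finally show "norm (?D z v - ?D x v) \<le> C * norm h * norm v" .
      qed
    qed (auto simp: dist_norm)
    then show ?thesis by (simp add: D.add power2_eq_square algebra_simps)
  qed
  with C0 show ?thesis by (rule that)
qed

section \<open>The Riesz kernel and differentiation of potentials\<close>

lemma riesz_kernel_measurable: "(\<lambda>y::'a::euclidean_space. norm y powr p) \<in> borel_measurable lebesgue"
proof -
  have "(\<lambda>y::'a. norm y powr p) \<in> borel_measurable borel" by measurable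
  then show ?thesis by (intro measurable_completion) simp
qed

text \<open>The ball is cut into dyadic shells. The kernel on a shell is at most its value at the
  inner radius, and this value times the volume of the ball of the outer radius forms a geometric
  sequence with ratio \<open>2 powr (- \<alpha>)\<close>.\<close>

lemma integrable_riesz_kernel:
  assumes \<alpha>: "0 < \<alpha>" "\<alpha> < real DIM('a)" and R: "0 < R"
  shows "integrable lebesgue (\<lambda>y. indicator (cball (0::'a::euclidean_space) R) y * norm y powr (\<alpha> - real DIM('a)))"
proof (rule integrableI_bounded)
  let ?d = "DIM('a)"
  define c where "c n = (R / 2 ^ Suc n) powr (\<alpha> - ?d)" for n :: nat
  define B where "B n = cball (0::'a) (R / 2 ^ n)" for n :: nat
  show "(\<lambda>y. indicator (cball (0::'a) R) y * norm y powr (\<alpha> - ?d)) \<in> borel_measurable lebesgue"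
    by (intro borel_measurable_times riesz_kernel_measurable borel_measurable_indicator) auto
  have pw: "ennreal (norm (indicator (cball (0::'a) R) y * norm y powr (\<alpha> - ?d)))
      \<le> (\<Sum>n. ennreal (c n) * indicator (B n) y)" for y :: 'a
  proof (cases "y \<noteq> 0 \<and> norm y \<le> R")
    case True
    define P where "P n \<longleftrightarrow> R / 2 ^ Suc n < norm y" for n :: nat
    have "\<exists>n. P n"
    proof -
      obtain n where "(1/2)^n < norm y / R" using real_arch_pow_inv[of "norm y / R" "1/2"] True R by auto
      then have "R / 2 ^ n < norm y" using R by (simp add: field_simps power_divide)
      moreover have "R / 2 ^ Suc n \<le> R / 2 ^ n" using R by (simp add: field_simps)
      ultimately show ?thesis unfolding P_def by (intro exI[of _ n]) linarith
    qed
    \<comment> \<open>\<open>P n\<close> bounds \<open>norm y\<close> from below by half the radius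
      of \<open>B n\<close>; minimality of \<open>n\<close> puts \<open>y\<close> into
      \<open>B n\<close>.\<close>
    define n where "n = (LEAST n. P n)"
    have Pn: "P n" unfolding n_def using \<open>\<exists>n. P n\<close> by (rule LeastI_ex)
    have Bn: "y \<in> B n"
    proof (cases n)
      case 0 then show ?thesis using True by (simp add: B_def)
    next
      case (Suc m)
      then have "\<not> P m" unfolding n_def using not_less_Least[of m P] by simp
      then show ?thesis using Suc by (simp add: P_def B_def)
    qed
    have "norm y powr (\<alpha> - ?d) \<le> c n"
      unfolding c_def using Pn \<alpha> R by (intro powr_mono2') (auto simp: P_def)
    then have "ennreal (norm (indicator (cball (0::'a) R) y * norm y powr (\<alpha> - ?d))) \<le> ennreal (c n) * indicator (B n) y"
      using True Bn by (simp add: ennreal_leI)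
    also have "\<dots> \<le> (\<Sum>n. ennreal (c n) * indicator (B n) y)"
    proof -
      define g where "g n = ennreal (c n) * indicator (B n) y" for n
      have "sum g {n} \<le> suminf g" by (intro sum_le_suminf) auto
      then have "g n \<le> suminf g" by simp
      then show ?thesis unfolding g_def .
    qed
    finally show ?thesis .
  qed (auto split: split_indicator)
  have "(\<integral>\<^sup>+y. ennreal (norm (indicator (cball (0::'a) R) y * norm y powr (\<alpha> - ?d))) \<partial>lebesgue)
      \<le> (\<integral>\<^sup>+y. (\<Sum>n. ennreal (c n) * indicator (B n) y) \<partial>lebesgue)"
    by (intro nn_integral_mono pw)
  also have "\<dots> = (\<Sum>n. \<integral>\<^sup>+y. ennreal (c n) * indicator (B n) y \<partial>lebesgue)"
    by (intro nn_integral_suminf borel_measurable_times_ennreal borel_measurable_const borel_measurable_indicator)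
      (auto simp: B_def)
  also have "\<dots> = (\<Sum>n. ennreal (c n) * emeasure lborel (B n))"
    by (intro suminf_cong) (simp add: B_def nn_integral_cmult_indicator)
  also have "\<dots> = (\<Sum>n. ennreal (unit_ball_vol ?d * R powr \<alpha> * 2 powr (?d - \<alpha>) * (2 powr (- \<alpha>)) ^ n))"
  proof (intro suminf_cong)
    fix n
    have pos: "0 < R / 2 ^ n" using R by simp
    have 1: "c n = (R / 2^n) powr (\<alpha> - ?d) * (1/2) powr (\<alpha> - ?d)"
      unfolding c_def using pos by (subst powr_mult[symmetric]) (auto simp: field_simps)
    have 2: "(R / 2^n) ^ ?d = (R / 2^n) powr (real ?d)" using pos by (simp add: powr_realpow)
    have 3: "(R / 2^n) powr (\<alpha> - ?d) * (R / 2^n) powr (real ?d) = (R / 2^n) powr \<alpha>"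
      by (simp only: powr_add[symmetric]) simp
    have 4: "(R / 2^n) powr \<alpha> = R powr \<alpha> * (2 powr (- \<alpha>)) ^ n"
    proof -
      have "(2 ^ n) powr \<alpha> = (2::real) powr (\<alpha> * n)"
        by (simp add: powr_powr powr_realpow[symmetric] mult.commute)
      moreover have "(2 powr (- \<alpha>)) ^ n = (2::real) powr (- (\<alpha> * n))"
        by (simp add: powr_powr powr_realpow[symmetric])
      ultimately show ?thesis using R by (simp add: powr_divide powr_minus_divide)
    qed
    have 5: "(1/2::real) powr (\<alpha> - ?d) = 2 powr (?d - \<alpha>)"
    proof -
      have "(2 powr (-1)) powr (\<alpha> - ?d) = (2::real) powr (?d - \<alpha>)" by (simp only: powr_powr) simp
      moreover have "(2::real) powr (-1) = 1/2" by (simp add: powr_minus_divide)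
      ultimately show ?thesis by (simp only:)
    qed
    have "c n * (unit_ball_vol ?d * (R / 2^n) ^ ?d) =
        unit_ball_vol ?d * ((R / 2^n) powr (\<alpha> - ?d) * (R / 2^n) powr (real ?d)) * (1/2) powr (\<alpha> - ?d)"
      unfolding 1 2 by (simp only: mult_ac)
    also have "\<dots> = unit_ball_vol ?d * R powr \<alpha> * 2 powr (?d - \<alpha>) * (2 powr (- \<alpha>)) ^ n"
      unfolding 3 4 5 by (simp only: mult_ac)
    finally have 6: "c n * (unit_ball_vol ?d * (R / 2^n) ^ ?d) =
        unit_ball_vol ?d * R powr \<alpha> * 2 powr (?d - \<alpha>) * (2 powr (- \<alpha>)) ^ n" .
    have 7: "emeasure lborel (B n) = ennreal (unit_ball_vol ?d * (R / 2^n) ^ ?d)"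
      unfolding B_def using pos by (intro emeasure_cball) simp
    have "0 \<le> c n" by (simp add: c_def)
    then show "ennreal (c n) * emeasure lborel (B n) =
        ennreal (unit_ball_vol ?d * R powr \<alpha> * 2 powr (?d - \<alpha>) * (2 powr (- \<alpha>)) ^ n)"
      unfolding 6[symmetric] 7 by (rule ennreal_mult'[symmetric])
  qed
  also have "\<dots> < \<infinity>"
  proof -
    have "summable (\<lambda>n. unit_ball_vol ?d * R powr \<alpha> * 2 powr (?d - \<alpha>) * (2 powr (- \<alpha>)) ^ n)"
      using \<alpha> powr_less_mono[of "-\<alpha>" 0 2] by (intro summable_mult summable_geometric) auto
    then show ?thesis by (subst suminf_ennreal2) (auto simp: unit_ball_vol_nonneg)
  qed
  finally show "(\<integral>\<^sup>+y. ennreal (norm (indicator (cball (0::'a) R) y * norm y powr (\<alpha> - ?d))) \<partial>lebesgue) < \<infinity>" .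
qed

lemma riesz_kernel_dominated:
  fixes f :: "'a::euclidean_space \<Rightarrow> 'b::euclidean_space"
  assumes \<alpha>: "0 < \<alpha>" "\<alpha> < real DIM('a)" and R: "0 < R" and fm: "f \<in> borel_measurable lebesgue"
    and f: "\<And>y. norm (f y) \<le> C * indicator (cball 0 R) y"
  shows "integrable lebesgue (\<lambda>y. norm y powr (\<alpha> - real DIM('a)) *\<^sub>R f y)"
    and "norm (LINT y|lebesgue. norm y powr (\<alpha> - real DIM('a)) *\<^sub>R f y) \<le>
      C * (LINT y|lebesgue. indicator (cball (0::'a) R) y * norm y powr (\<alpha> - real DIM('a)))"
proof -
  let ?k = "\<lambda>y::'a. norm y powr (\<alpha> - real DIM('a))"
  have k: "integrable lebesgue (\<lambda>y. C * (indicator (cball (0::'a) R) y * ?k y))"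
    by (intro integrable_mult_right integrable_riesz_kernel \<alpha> R)
  have km: "?k \<in> borel_measurable lebesgue" by (rule riesz_kernel_measurable)
  have b: "norm (?k y *\<^sub>R f y) \<le> C * (indicator (cball (0::'a) R) y * ?k y)" for y
    using mult_left_mono[OF f[of y], of "?k y"] by (simp add: mult_ac)
  show i: "integrable lebesgue (\<lambda>y. ?k y *\<^sub>R f y)"
  proof (rule Bochner_Integration.integrable_bound[OF k])
    show "AE y in lebesgue. norm (?k y *\<^sub>R f y) \<le> norm (C * (indicator (cball (0::'a) R) y * ?k y))"
      by (intro AE_I2) (use b in \<open>simp only: real_norm_def\<close>, meson abs_ge_self order_trans b)
  qed (use km fm in auto)
  show "norm (LINT y|lebesgue. ?k y *\<^sub>R f y) \<le> C * (LINT y|lebesgue. indicator (cball (0::'a) R) y * ?k y)"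
    using Bochner_Integration.integral_norm_bound_integral[OF i k b] by simp
qed

text \<open>After the substitution the singular factor no longer depends on \<open>x\<close>, so
  derivatives in \<open>x\<close> fall on \<open>f\<close>.\<close>

lemma riesz_potential_translate:
  fixes f :: "'a::euclidean_space \<Rightarrow> 'b::euclidean_space"
  assumes "\<alpha> \<noteq> 0"
  shows "riesz_potential \<alpha> f x = (1 / riesz_const DIM('a) \<alpha>) *\<^sub>R
    (LINT y|lebesgue. norm y powr (\<alpha> - real DIM('a)) *\<^sub>R f (x + y))"
  using lebesgue_integral_affine(1)[of 1 "\<lambda>y. norm (x - y) powr (\<alpha> - real DIM('a)) *\<^sub>R f y" x] assms
  by (simp add: riesz_potential_def)

text \<open>Linearizing \<open>f\<close> under the integral leaves a remainder that is quadratic in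
  \<open>h\<close> and supported in a fixed ball, where the kernel is integrable.\<close>

lemma riesz_potential_has_derivative:
  fixes f :: "'a::euclidean_space \<Rightarrow> 'b::euclidean_space"
  assumes \<alpha>: "0 \<le> \<alpha>" "\<alpha> < 1" and f: "f \<in> test_functions S"
  shows "(riesz_potential \<alpha> f has_derivative
    (\<lambda>h. \<Sum>b\<in>Basis. (h \<bullet> b) *\<^sub>R riesz_potential \<alpha> (\<lambda>x. frechet_derivative f (at x) b) x)) (at x)"
proof (cases "\<alpha> = 0")
  case True
  have "riesz_potential \<alpha> g = g" for g :: "'a \<Rightarrow> 'b" by (simp add: True riesz_potential_def fun_eq_iff)
  then show ?thesis
    using has_frechet_derivative[OF test_function_differentiable[OF f], of x]
    by (simp add: frechet_derivative_eq_sum_partials[OF test_function_differentiable[OF f], symmetric])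
next
  case False
  \<comment> \<open>\<open>\<alpha> < 1\<close> lies below every dimension, so the kernel is locally
    integrable even on the line.\<close>
  have d1: "1 \<le> real DIM('a)" using DIM_positive[where 'a = 'a] by linarith
  have \<alpha>': "0 < \<alpha>" "\<alpha> < real DIM('a)" using False \<alpha> d1 by linarith+
  let ?k = "\<lambda>y::'a. norm y powr (\<alpha> - real DIM('a))"
  let ?c = "1 / riesz_const DIM('a) \<alpha>"
  let ?P = "\<lambda>b x. frechet_derivative f (at x) b"
  have int: "integrable lebesgue (\<lambda>y. ?k y *\<^sub>R g (z + y))" if g: "g \<in> test_functions S" for g :: "'a \<Rightarrow> 'b" and z
  proof -
    obtain C R where C: "0 \<le> C" "0 < R" "\<And>x. norm (g x) \<le> C * indicator (cball 0 R) x"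
      using g by (rule test_function_dominated) blast
    have "norm (g (z + y)) \<le> C * indicator (cball 0 (R + norm z)) y" for y
    proof (rule order_trans[OF C(3)[of "z + y"]])
      have "norm y \<le> norm (z + y) + norm z" using norm_triangle_ineq4[of "z + y" z] by simp
      then show "C * indicator (cball 0 R) (z + y) \<le> C * indicator (cball 0 (R + norm z)) y"
        using C(1) by (intro mult_left_mono) (auto simp: indicator_def)
    qed
    moreover have "(\<lambda>y. g (z + y)) \<in> borel_measurable lebesgue"
      using borel_measurable_lebesgue_test_function[OF g] lebesgue_integral_affine(3)[of 1 g z] by simp
    ultimately show ?thesis
      using C(2) by (intro riesz_kernel_dominated(1)[OF \<alpha>', of "R + norm z" _ C]) (auto intro: add_pos_nonneg)
  qed
  obtain C where C: "0 \<le> C" "\<And>x h. norm (f (x + h) - f x - frechet_derivative f (at x) h) \<le> C * (norm h)\<^sup>2"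
    using f by (rule test_function_second_order) blast
  obtain R where R: "R > 0" "\<And>x. R \<le> norm x \<Longrightarrow> f x = 0"
    using f by (rule test_function_support) blast
  have R': "frechet_derivative f (at x) h = 0" if "R < norm x" for x h
  proof -
    have "(f has_derivative (\<lambda>_. 0)) (at x)"
      by (rule has_derivative_transform_within_open[of "\<lambda>_. 0" _ _ _ "- cball 0 R"])
        (use that R in auto)
    then show ?thesis by (metis frechet_derivative_at)
  qed
  \<comment> \<open>Outside this radius in \<open>y\<close>, the points \<open>x + y\<close> and
    \<open>x + y + h\<close> with \<open>norm h \<le> 1\<close> are both beyond the support of
    \<open>f\<close>; the 1 is the room for \<open>h\<close>.\<close>
  define \<rho> where "\<rho> = R + norm x + 1"
  have \<rho>: "0 < \<rho>" using R by (simp add: \<rho>_def add_pos_nonneg)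
  define J where "J = (LINT y|lebesgue. indicator (cball (0::'a) \<rho>) y * ?k y)"
  define F where "F z = (LINT y|lebesgue. ?k y *\<^sub>R f (z + y))" for z
  define D where "D h = (\<Sum>b\<in>Basis. (h \<bullet> b) *\<^sub>R (LINT y|lebesgue. ?k y *\<^sub>R ?P b (x + y)))" for h
  have est: "norm (F (x + h) - F x - D h) \<le> (C * (norm h)\<^sup>2) * J" if h: "norm h \<le> 1" for h
  proof -
    let ?r = "\<lambda>y. f (x + y + h) - f (x + y) - frechet_derivative f (at (x + y)) h"
    have P: "?P b \<in> test_functions S" if "b \<in> Basis" for b using f that by (rule test_functions_partial)
    have "D h = (LINT y|lebesgue. (\<Sum>b\<in>Basis. (h \<bullet> b) *\<^sub>R (?k y *\<^sub>R ?P b (x + y))))"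
      unfolding D_def by (subst Bochner_Integration.integral_sum) (auto intro!: int P integrable_scaleR_right simp del: scaleR_scaleR)
    also have "\<dots> = (LINT y|lebesgue. ?k y *\<^sub>R frechet_derivative f (at (x + y)) h)"
      by (subst frechet_derivative_eq_sum_partials[OF test_function_differentiable[OF f], of _ h])
        (simp add: scaleR_sum_right mult.commute)
    finally have D: "D h = (LINT y|lebesgue. ?k y *\<^sub>R frechet_derivative f (at (x + y)) h)" .
    have Di: "integrable lebesgue (\<lambda>y. ?k y *\<^sub>R frechet_derivative f (at (x + y)) h)"
      by (subst frechet_derivative_eq_sum_partials[OF test_function_differentiable[OF f], of _ h])
        (auto simp: scaleR_sum_right scaleR_left_commute[of "norm _ powr _"] intro!: Bochner_Integration.integrable_sum integrable_scaleR_right int P simp del: scaleR_scaleR)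
    have "F (x + h) - F x - D h = (LINT y|lebesgue. ?k y *\<^sub>R f (x + h + y) - ?k y *\<^sub>R f (x + y) - ?k y *\<^sub>R frechet_derivative f (at (x + y)) h)"
      unfolding F_def D using Di int[OF f] by simp
    also have "\<dots> = (LINT y|lebesgue. ?k y *\<^sub>R ?r y)"
      by (simp add: scaleR_diff_right add_ac)
    also have "norm \<dots> \<le> (C * (norm h)\<^sup>2) * J"
      unfolding J_def
    proof (rule riesz_kernel_dominated(2)[OF \<alpha>' \<rho>])
      have m: "(\<lambda>y. g (x + y)) \<in> borel_measurable lebesgue" if "g \<in> test_functions S" for x and g :: "'a \<Rightarrow> 'b"
        using borel_measurable_lebesgue_test_function[OF that] lebesgue_integral_affine(3)[of 1 g x] by simp
      show "?r \<in> borel_measurable lebesgue"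
        unfolding frechet_derivative_eq_sum_partials[OF test_function_differentiable[OF f], of _ h]
        using m[OF f, of x] m[OF f, of "x + h"] m[OF P, of _ x]
        by (intro borel_measurable_diff borel_measurable_sum borel_measurable_scaleR) (auto simp: add_ac)
      fix y :: 'a
      show "norm (?r y) \<le> (C * (norm h)\<^sup>2) * indicator (cball 0 \<rho>) y"
      proof (cases "norm y \<le> \<rho>")
        case True then show ?thesis using C(2)[of "x + y" h] by simp
      next
        case False
        then have "R < norm (x + y) - norm h"
          using norm_triangle_ineq4[of "x + y" x] h by (simp add: \<rho>_def)
        moreover have "norm (x + y) \<le> norm (x + y + h) + norm h"
          using norm_triangle_ineq4[of "x + y + h" h] by simp
        ultimately have "R < norm (x + y)" "R \<le> norm (x + y + h)" using norm_ge_zero[of h] by linarith+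
        then show ?thesis using R(2) R' False by simp
      qed
    qed
    finally show ?thesis .
  qed
  have "(F has_derivative D) (at x)"
    unfolding has_derivative_at
  proof
    show "bounded_linear D" unfolding D_def
      by (intro bounded_linear_sum bounded_linear_scaleR_left[THEN bounded_linear_compose] bounded_linear_inner_left)
    have lim: "((\<lambda>h. (C * J) * norm h) \<longlongrightarrow> 0) (at 0)"
      by (intro tendsto_mult_right_zero tendsto_norm_zero tendsto_ident_at)
    have "\<forall>\<^sub>F h in at 0. norm (norm (F (x + h) - F x - D h) / norm h) \<le> C * J * norm h"
      unfolding eventually_at
    proof (intro exI[of _ 1] conjI ballI impI)
      fix h :: 'a assume "h \<noteq> 0 \<and> dist h 0 < 1"
      then have h: "norm h > 0" "norm h \<le> 1" by auto
      show "norm (norm (F (x + h) - F x - D h) / norm h) \<le> C * J * norm h"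
        using est[OF h(2)] h(1) by (simp add: divide_le_eq power2_eq_square mult_ac)
    qed auto
    then show "((\<lambda>h. norm (F (x + h) - F x - D h) / norm h) \<longlongrightarrow> 0) (at 0)"
      by (rule Lim_null_comparison[OF _ lim])
  qed
  from has_derivative_scaleR_right[OF this, of ?c] show ?thesis
    by (simp add: F_def D_def scaleR_sum_right riesz_potential_translate[OF False, abs_def] mult.commute)
qed

lemma riesz_potential_continuous:
  fixes f :: "'a::euclidean_space \<Rightarrow> 'b::euclidean_space"
  assumes "0 \<le> \<alpha>" "\<alpha> < 1" "f \<in> test_functions S"
  shows "continuous_on UNIV (riesz_potential \<alpha> f)"
  using has_derivative_continuous[OF riesz_potential_has_derivative[OF assms]]
  by (simp add: continuous_at_imp_continuous_on)

lemma frac_div_eq: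
  fixes \<Phi> :: "'a::euclidean_space \<Rightarrow> 'a"
  assumes s: "0 < s" "s \<le> 1" and \<Phi>: "\<Phi> \<in> test_functions S"
  shows "frac_div s \<Phi> x =
    (\<Sum>b\<in>Basis. riesz_potential (1 - s) (\<lambda>x. frechet_derivative \<Phi> (at x) b) x \<bullet> b)"
proof -
  have "(riesz_potential (1 - s) \<Phi> has_derivative
    (\<lambda>h. \<Sum>b\<in>Basis. (h \<bullet> b) *\<^sub>R riesz_potential (1 - s) (\<lambda>x. frechet_derivative \<Phi> (at x) b) x)) (at x)"
    using s by (intro riesz_potential_has_derivative[OF _ _ \<Phi>]) auto
  from frechet_derivative_at[OF this, symmetric] show ?thesis
    unfolding frac_div_def divergence_def
    by (simp add: inner_Basis if_distrib[of "\<lambda>c. c *\<^sub>R _"] sum.delta' cong: if_cong)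
qed

lemma frac_div_continuous:
  fixes \<Phi> :: "'a::euclidean_space \<Rightarrow> 'a"
  assumes s: "0 < s" "s \<le> 1" and \<Phi>: "\<Phi> \<in> test_functions S"
  shows "continuous_on UNIV (frac_div s \<Phi>)"
  unfolding frac_div_eq[OF assms, abs_def]
  using s by (intro continuous_on_sum continuous_on_inner continuous_on_const
      riesz_potential_continuous[OF _ _ test_functions_partial[OF \<Phi>]]) auto

text \<open>The kernel is homogeneous of degree \<open>\<alpha> - d\<close> and the substitution
  contributes \<open>\<mu>^-d\<close>; together they leave the power
  \<open>- \<alpha>\<close>.\<close>

lemma riesz_potential_dilation:
  fixes f :: "'a::euclidean_space \<Rightarrow> 'b::euclidean_space"
  assumes \<mu>: "0 < \<mu>"
  shows "riesz_potential \<alpha> (\<lambda>y. f (z + \<mu> *\<^sub>R y)) x = \<mu> powr (- \<alpha>) *\<^sub>R riesz_potential \<alpha> f (z + \<mu> *\<^sub>R x)"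
proof (cases "\<alpha> = 0")
  case True then show ?thesis using \<mu> by (simp add: riesz_potential_def)
next
  case False
  let ?d = "real DIM('a)"
  have "norm (x - y) powr (\<alpha> - ?d) = \<mu> powr (?d - \<alpha>) * norm ((z + \<mu> *\<^sub>R x) - (z + \<mu> *\<^sub>R y)) powr (\<alpha> - ?d)" for y
  proof -
    have "norm ((z + \<mu> *\<^sub>R x) - (z + \<mu> *\<^sub>R y)) = \<mu> * norm (x - y)"
      using \<mu> by (simp add: scaleR_diff_right[symmetric])
    then show ?thesis using \<mu> by (simp add: powr_mult powr_add[symmetric] mult.assoc[symmetric])
  qed
  then have "(LINT y|lebesgue. norm (x - y) powr (\<alpha> - ?d) *\<^sub>R f (z + \<mu> *\<^sub>R y)) =
      (LINT y|lebesgue. \<mu> powr (?d - \<alpha>) *\<^sub>R (norm ((z + \<mu> *\<^sub>R x) - (z + \<mu> *\<^sub>R y)) powr (\<alpha> - ?d) *\<^sub>R f (z + \<mu> *\<^sub>R y)))"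
    by simp
  also have "\<dots> = \<mu> powr (?d - \<alpha>) *\<^sub>R (1 / \<mu> ^ DIM('a)) *\<^sub>R
      (LINT y|lebesgue. norm ((z + \<mu> *\<^sub>R x) - y) powr (\<alpha> - ?d) *\<^sub>R f y)"
    using lebesgue_integral_affine(1)[of \<mu> "\<lambda>y. norm ((z + \<mu> *\<^sub>R x) - y) powr (\<alpha> - ?d) *\<^sub>R f y" z] \<mu>
    by (subst integral_scaleR_right) (auto simp del: scaleR_scaleR)
  also have "\<dots> = \<mu> powr (- \<alpha>) *\<^sub>R (LINT y|lebesgue. norm ((z + \<mu> *\<^sub>R x) - y) powr (\<alpha> - ?d) *\<^sub>R f y)"
  proof -
    have "\<mu> powr (?d - \<alpha>) * (1 / \<mu> ^ DIM('a)) = \<mu> powr (- \<alpha>)"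
      using \<mu> by (simp add: powr_realpow[symmetric] powr_diff powr_minus field_simps)
    then show ?thesis by (simp only: scaleR_scaleR)
  qed
  finally show ?thesis using False by (simp add: riesz_potential_def mult.commute)
qed

lemma frechet_derivative_dilation:
  fixes f :: "'a::euclidean_space \<Rightarrow> 'b::real_normed_vector"
  assumes "f differentiable (at (z + \<mu> *\<^sub>R y))"
  shows "frechet_derivative (\<lambda>y. f (z + \<mu> *\<^sub>R y)) (at y) b = \<mu> *\<^sub>R frechet_derivative f (at (z + \<mu> *\<^sub>R y)) b"
proof -
  let ?D = "frechet_derivative f (at (z + \<mu> *\<^sub>R y))"
  have F: "(f has_derivative ?D) (at (z + \<mu> *\<^sub>R y))" by (rule has_frechet_derivative[OF assms])
  then interpret bounded_linear ?D by (rule has_derivative_bounded_linear)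
  have "((\<lambda>y. z + \<mu> *\<^sub>R y) has_derivative (\<lambda>h. \<mu> *\<^sub>R h)) (at y)" by (auto intro!: derivative_eq_intros)
  from fun_cong[OF frechet_derivative_at[OF diff_chain_at[OF this F]], of b] show ?thesis
    unfolding o_def scaleR by (rule sym)
qed

lemma test_function_dilation:
  assumes f: "f \<in> test_functions UNIV" and "\<mu> \<noteq> 0"
  shows "(\<lambda>y. f (z + \<mu> *\<^sub>R y)) \<in> test_functions UNIV"
proof -
  obtain K where K: "smooth f" "compact K" "\<And>x. x \<notin> K \<Longrightarrow> f x = 0"
    using f by (rule test_functionsE) blast
  show ?thesis
  proof (rule test_functionsI)
    show "smooth (\<lambda>y. f (z + \<mu> *\<^sub>R y))" using smooth_affine[OF K(1), of \<mu> z] by (simp add: add.commute)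
    show "compact ((\<lambda>x. (1 / \<mu>) *\<^sub>R (x - z)) ` K)"
      by (intro compact_continuous_image K continuous_intros)
    fix y assume "y \<notin> (\<lambda>x. (1 / \<mu>) *\<^sub>R (x - z)) ` K"
    then have "z + \<mu> *\<^sub>R y \<notin> K" using \<open>\<mu> \<noteq> 0\<close> by (force simp: image_iff)
    then show "f (z + \<mu> *\<^sub>R y) = 0" by (rule K(3))
  qed auto
qed

lemma frac_div_dilation:
  fixes \<Phi> :: "'a::euclidean_space \<Rightarrow> 'a"
  assumes s: "0 < s" "s \<le> 1" and \<Phi>: "\<Phi> \<in> test_functions UNIV" and \<mu>: "0 < \<mu>"
  shows "frac_div s (\<lambda>y. \<Phi> (z + \<mu> *\<^sub>R y)) x = \<mu> powr s * frac_div s \<Phi> (z + \<mu> *\<^sub>R x)"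
proof -
  have t: "(\<lambda>y. \<Phi> (z + \<mu> *\<^sub>R y)) \<in> test_functions UNIV" using \<Phi> \<mu> by (intro test_function_dilation) auto
  have sc: "riesz_potential \<alpha> (\<lambda>x. c *\<^sub>R g x) x = c *\<^sub>R riesz_potential \<alpha> g x" for \<alpha> c x and g :: "'a \<Rightarrow> 'a"
  proof -
    have "(LINT y|lebesgue. norm (x - y) powr (\<alpha> - real DIM('a)) *\<^sub>R c *\<^sub>R g y) =
       (LINT y|lebesgue. c *\<^sub>R (norm (x - y) powr (\<alpha> - real DIM('a)) *\<^sub>R g y))"
      by (simp only: scaleR_left_commute)
    also have "\<dots> = c *\<^sub>R (LINT y|lebesgue. norm (x - y) powr (\<alpha> - real DIM('a)) *\<^sub>R g y)"
      by (rule integral_scaleR_right)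
    finally show ?thesis by (simp add: riesz_potential_def)
  qed
  \<comment> \<open>One factor \<open>\<mu>\<close> from the derivative, the other from the
    potential of order \<open>1 - s\<close>: the fractional divergence is homogeneous of order
    \<open>s\<close>.\<close>
  have "\<mu> * \<mu> powr (- (1 - s)) = \<mu> powr s" using \<mu> by (simp add: powr_diff)
  then show ?thesis
    unfolding frac_div_eq[OF s t] frac_div_eq[OF s \<Phi>]
    unfolding frechet_derivative_dilation[OF test_function_differentiable[OF \<Phi>]] sc
      riesz_potential_dilation[OF \<mu>, of _ "\<lambda>x. frechet_derivative \<Phi> (at x) _"]
    by (simp add: sum_distrib_left mult.assoc[symmetric])
qed


subsection \<open>Fractional gradients\<close>

lemmas L2_norm_cong_AE_lebesgue = L2_norm_cong_AE[of UNIV, unfolded lebesgue_on_UNIV_eq, simplified]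
  and integrable_cong_AE_lebesgue = integrable_cong_AE_lebesgue_on[of UNIV, unfolded lebesgue_on_UNIV_eq, simplified]

text \<open>Testing with the fields \<open>\<theta> x *\<^sub>R b\<close> for scalar
  \<open>\<theta>\<close> reduces the claim to the fundamental lemma, one component at a
  time.\<close>

lemma weak_frac_grad_unique:
  fixes u :: "'a::euclidean_space \<Rightarrow> real"
  assumes G: "G \<in> L2_space lebesgue" "G' \<in> L2_space lebesgue"
    and w: "weak_frac_grad s u G" "weak_frac_grad s u G'"
  shows "AE x in lebesgue. G x = G' x"
proof -
  have each: "AE x in lebesgue. (G x - G' x) \<bullet> b = 0" if b: "b \<in> Basis" for b
  proof -
    have "AE x in lebesgue. x \<in> UNIV \<longrightarrow> (G x - G' x) \<bullet> b = 0"
    proof (rule fundamental_lemma)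
      fix p q :: 'a
      have I: "integrable lebesgue (\<lambda>x. indicator (cbox p q) x :: real)"
        using emeasure_lborel_cbox_finite[of p q] by (intro integrable_real_indicator) auto
      have "(\<lambda>x. indicator (cbox p q) x *\<^sub>R b) \<in> L2_space lebesgue"
      proof (rule L2_space_dominated[OF _ I])
        show "(\<lambda>x. indicator (cbox p q) x *\<^sub>R b) \<in> borel_measurable lebesgue"
          by (intro borel_measurable_scaleR borel_measurable_indicator) auto
      qed (use b in \<open>auto simp: indicator_def\<close>)
      from L2_inner_integrable[OF L2_space_diff[OF G] this]
      show "integrable lebesgue (\<lambda>x. indicator (cbox p q) x * ((G x - G' x) \<bullet> b))" by simp
    next
      fix \<theta> :: "'a \<Rightarrow> real" assume \<theta>: "\<theta> \<in> test_functions UNIV"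
      obtain K where K: "smooth \<theta>" "compact K" "\<And>x. x \<notin> K \<Longrightarrow> \<theta> x = 0"
        using \<theta> by (rule test_functionsE) blast
      have t: "(\<lambda>x. \<theta> x *\<^sub>R b) \<in> test_functions UNIV"
        by (rule test_functionsI[of _ K]) (use K in \<open>auto intro: smooth_scaleR smooth_const\<close>)
      have "(LINT x|lebesgue. G x \<bullet> (\<theta> x *\<^sub>R b)) = (LINT x|lebesgue. G' x \<bullet> (\<theta> x *\<^sub>R b))"
        using w t unfolding weak_frac_grad_def by metis
      then show "(LINT x|lebesgue. \<theta> x * ((G x - G' x) \<bullet> b)) = 0"
        using L2_inner_integrable[OF G(1) test_function_L2[OF t]] L2_inner_integrable[OF G(2) test_function_L2[OF t]]
        by (simp add: inner_diff_left right_diff_distrib)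
    qed simp
    then show ?thesis by simp
  qed
  have "AE x in lebesgue. \<forall>b\<in>Basis. (G x - G' x) \<bullet> b = 0"
    by (rule AE_finite_allI[OF finite_Basis each])
  then show ?thesis
  proof eventually_elim
    case (elim x)
    have "G x - G' x = 0" by (rule euclidean_eqI) (use elim in simp)
    then show ?case by simp
  qed
qed

lemma frac_grad_Hs:
  assumes "u \<in> Hs s" shows "frac_grad s u \<in> L2_space lebesgue" "weak_frac_grad s u (frac_grad s u)"
  using someI_ex[of "\<lambda>G. G \<in> L2_space lebesgue \<and> weak_frac_grad s u G"] assms
  unfolding Hs_def frac_grad_def by blast+

lemma frac_grad_AE_eq:
  assumes "u \<in> L2_space lebesgue" "G \<in> L2_space lebesgue" "weak_frac_grad s u G"
  shows "u \<in> Hs s" "AE x in lebesgue. frac_grad s u x = G x"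
proof -
  show u: "u \<in> Hs s" using assms unfolding Hs_def by blast
  show "AE x in lebesgue. frac_grad s u x = G x"
    using weak_frac_grad_unique[OF frac_grad_Hs(1)[OF u] assms(2) frac_grad_Hs(2)[OF u] assms(3)] .
qed

text \<open>The chosen gradient depends on the class of the function only, so this is an equality of functions.\<close>

lemma frac_grad_cong_AE:
  assumes "AE x in lebesgue. u x = v x" shows "frac_grad s u = frac_grad s v"
proof -
  have "(LINT x|lebesgue. u x * frac_div s \<Phi> x) = (LINT x|lebesgue. v x * frac_div s \<Phi> x)" for \<Phi>
    by (rule integral_cong_AE_lebesgue) (use assms in eventually_elim, simp)
  then show ?thesis unfolding frac_grad_def weak_frac_grad_def by simp
qed

lemma L2_norm_le_Hs_norm: "L2_norm lebesgue u \<le> Hs_norm s u"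
  unfolding Hs_norm_def by (rule real_le_rsqrt) (simp add: L2_norm_sq)

lemma frac_grad_le_Hs_norm: "L2_norm lebesgue (frac_grad s u) \<le> Hs_norm s u"
  unfolding Hs_norm_def by (rule real_le_rsqrt) (simp add: L2_norm_sq)

lemma Hs_norm_nonneg: "0 \<le> Hs_norm s u" by (simp add: Hs_norm_def)

lemma Hs_norm_sq: "(Hs_norm s u)\<^sup>2 = (L2_norm lebesgue u)\<^sup>2 + (L2_norm lebesgue (frac_grad s u))\<^sup>2"
  by (simp add: Hs_norm_def)

lemma Hs_scaleR:
  fixes u :: "'a::euclidean_space \<Rightarrow> real"
  assumes u: "u \<in> Hs s"
  shows "c *\<^sub>R u \<in> Hs s" "AE x in lebesgue. frac_grad s (c *\<^sub>R u) x = c *\<^sub>R frac_grad s u x"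
    "Hs_norm s (c *\<^sub>R u) = \<bar>c\<bar> * Hs_norm s u"
proof -
  have "weak_frac_grad s (c *\<^sub>R u) (c *\<^sub>R frac_grad s u)"
    using frac_grad_Hs(2)[OF u] unfolding weak_frac_grad_def by (simp add: mult.assoc)
  moreover have "u \<in> L2_space lebesgue" using u by (simp add: Hs_def)
  ultimately show "c *\<^sub>R u \<in> Hs s" and ae: "AE x in lebesgue. frac_grad s (c *\<^sub>R u) x = c *\<^sub>R frac_grad s u x"
    using frac_grad_AE_eq[OF L2_space_scaleR L2_space_scaleR[OF frac_grad_Hs(1)[OF u]], of u s c c] by auto
  have "L2_norm lebesgue (frac_grad s (c *\<^sub>R u)) = L2_norm lebesgue (c *\<^sub>R frac_grad s u)"
    by (rule L2_norm_cong_AE_lebesgue) (use ae in simp)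
  then have "(Hs_norm s (c *\<^sub>R u))\<^sup>2 = (\<bar>c\<bar> * Hs_norm s u)\<^sup>2"
    by (simp add: Hs_norm_sq L2_norm_scaleR power_mult_distrib distrib_left)
  then show "Hs_norm s (c *\<^sub>R u) = \<bar>c\<bar> * Hs_norm s u"
    by (simp add: power2_eq_iff_nonneg Hs_norm_nonneg)
qed

lemma Hs_0:
  "(0 :: 'a::euclidean_space \<Rightarrow> real) \<in> Hs s" "Hs_norm s (0 :: 'a::euclidean_space \<Rightarrow> real) = 0"
proof -
  have "weak_frac_grad s (0 :: 'a \<Rightarrow> real) 0" by (simp add: weak_frac_grad_def zero_fun_def)
  then show 0: "(0 :: 'a \<Rightarrow> real) \<in> Hs s" unfolding Hs_def by (intro CollectI conjI bexI[of _ 0] L2_space_0)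
  from Hs_scaleR(3)[OF 0, of 0] show "Hs_norm s (0 :: 'a \<Rightarrow> real) = 0" by simp
qed

text \<open>
  Additivity of the weak gradient needs \<open>u * frac_div s \<Phi>\<close> to be integrable. For functions vanishing
  outside a bounded set the continuity of \<open>frac_div s \<Phi>\<close> is enough.
\<close>

definition Hs_vanishing :: "real \<Rightarrow> 'a::euclidean_space set \<Rightarrow> ('a \<Rightarrow> real) set" where
  "Hs_vanishing s \<Omega> = {u \<in> Hs s. AE x in lebesgue. x \<notin> \<Omega> \<longrightarrow> u x = 0}"

lemma frac_div_mult_integrable:
  fixes \<Phi> :: "'a::euclidean_space \<Rightarrow> 'a"
  assumes s: "0 < s" "s \<le> 1" and \<Phi>: "\<Phi> \<in> test_functions UNIV" and \<Omega>: "bounded \<Omega>"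
    and u: "u \<in> Hs_vanishing s \<Omega>"
  shows "integrable lebesgue (\<lambda>x. u x * frac_div s \<Phi> x)"
proof -
  obtain R where "\<forall>x\<in>\<Omega>. norm x \<le> R" using \<Omega> unfolding bounded_iff by blast
  then have R: "\<Omega> \<subseteq> cball 0 R" by auto
  have cont: "continuous_on (cball 0 R) (frac_div s \<Phi>)"
    using frac_div_continuous[OF s \<Phi>] by (rule continuous_on_subset) simp
  have "bounded (frac_div s \<Phi> ` cball 0 R)"
    by (intro compact_imp_bounded compact_continuous_image cont compact_cball)
  then obtain C where C: "C > 0" "\<And>x. x \<in> cball 0 R \<Longrightarrow> \<bar>frac_div s \<Phi> x\<bar> \<le> C"
    unfolding bounded_pos by auto
  let ?f = "\<lambda>x. indicator (cball 0 R) x * frac_div s \<Phi> x"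
  have fm: "frac_div s \<Phi> \<in> borel_measurable lebesgue"
    using borel_measurable_continuous_onI[OF frac_div_continuous[OF s \<Phi>]]
    by (intro measurable_completion) simp
  have "?f \<in> L2_space lebesgue"
  proof (rule L2_space_dominated)
    show "integrable lebesgue (\<lambda>x. C\<^sup>2 * indicator (cball (0::'a) R) x)"
      by (intro integrable_mult_right integrable_indicator_cball)
    have "(norm (?f x))\<^sup>2 \<le> C\<^sup>2 * indicator (cball 0 R) x" for x
    proof (cases "x \<in> cball 0 R")
      case True
      from power_mono[OF C(2)[OF this], of 2] True show ?thesis by simp
    qed simp
    then show "AE x in lebesgue. (norm (?f x))\<^sup>2 \<le> C\<^sup>2 * indicator (cball 0 R) x" by simp
    show "?f \<in> borel_measurable lebesgue" by (intro borel_measurable_times borel_measurable_indicator fm) auto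
  qed
  moreover have "u \<in> L2_space lebesgue" using u by (simp add: Hs_vanishing_def Hs_def)
  ultimately have "integrable lebesgue (\<lambda>x. u x * ?f x)"
    using L2_inner_integrable[of u lebesgue ?f] by simp
  moreover have "AE x in lebesgue. u x * ?f x = u x * frac_div s \<Phi> x"
  proof -
    have "AE x in lebesgue. x \<notin> \<Omega> \<longrightarrow> u x = 0" using u by (simp add: Hs_vanishing_def)
    then show ?thesis by eventually_elim (use R in \<open>auto simp: indicator_def\<close>)
  qed
  ultimately show ?thesis
    by (rule integrable_cong_AE_lebesgue[rotated])
qed

lemma Hs_vanishing_L2: "u \<in> Hs_vanishing s \<Omega> \<Longrightarrow> u \<in> L2_space lebesgue"
  by (simp add: Hs_vanishing_def Hs_def)

lemma Hs_vanishing_Hs: "u \<in> Hs_vanishing s \<Omega> \<Longrightarrow> u \<in> Hs s"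
  by (simp add: Hs_vanishing_def)

lemma Hs_vanishing_add:
  assumes s: "0 < s" "s \<le> 1" and \<Omega>: "bounded \<Omega>" and u: "u \<in> Hs_vanishing s \<Omega>" and v: "v \<in> Hs_vanishing s \<Omega>"
  shows "u + v \<in> Hs_vanishing s \<Omega>"
    and "AE x in lebesgue. frac_grad s (u + v) x = frac_grad s u x + frac_grad s v x"
proof -
  note U = frac_grad_Hs[OF Hs_vanishing_Hs[OF u]] and V = frac_grad_Hs[OF Hs_vanishing_Hs[OF v]]
  have "weak_frac_grad s (u + v) (frac_grad s u + frac_grad s v)"
    unfolding weak_frac_grad_def
  proof
    fix \<Phi> :: "'a \<Rightarrow> 'a" assume \<Phi>: "\<Phi> \<in> test_functions UNIV"
    have "(LINT x|lebesgue. (frac_grad s u + frac_grad s v) x \<bullet> \<Phi> x) =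
        (LINT x|lebesgue. frac_grad s u x \<bullet> \<Phi> x) + (LINT x|lebesgue. frac_grad s v x \<bullet> \<Phi> x)"
      using L2_inner_integrable[OF U(1) test_function_L2[OF \<Phi>]] L2_inner_integrable[OF V(1) test_function_L2[OF \<Phi>]]
      by (simp add: inner_add_left)
    also have "\<dots> = - (LINT x|lebesgue. u x * frac_div s \<Phi> x) - (LINT x|lebesgue. v x * frac_div s \<Phi> x)"
      using U(2) V(2) \<Phi> unfolding weak_frac_grad_def by simp
    also have "\<dots> = - (LINT x|lebesgue. (u + v) x * frac_div s \<Phi> x)"
      using frac_div_mult_integrable[OF s \<Phi> \<Omega> u] frac_div_mult_integrable[OF s \<Phi> \<Omega> v]
      by (simp add: distrib_right)
    finally show "(LINT x|lebesgue. (frac_grad s u + frac_grad s v) x \<bullet> \<Phi> x) = - (LINT x|lebesgue. (u + v) x * frac_div s \<Phi> x)" .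
  qed
  from frac_grad_AE_eq[OF L2_space_add[OF Hs_vanishing_L2[OF u] Hs_vanishing_L2[OF v]] L2_space_add[OF U(1) V(1)] this]
  have 1: "u + v \<in> Hs s" and 2: "AE x in lebesgue. frac_grad s (u + v) x = (frac_grad s u + frac_grad s v) x" by auto
  have "AE x in lebesgue. x \<notin> \<Omega> \<longrightarrow> u x = 0" "AE x in lebesgue. x \<notin> \<Omega> \<longrightarrow> v x = 0"
    using u v by (auto simp: Hs_vanishing_def)
  then have "AE x in lebesgue. x \<notin> \<Omega> \<longrightarrow> (u + v) x = 0" by eventually_elim simp
  with 1 show "u + v \<in> Hs_vanishing s \<Omega>" by (simp add: Hs_vanishing_def)
  show "AE x in lebesgue. frac_grad s (u + v) x = frac_grad s u x + frac_grad s v x" using 2 by simp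
qed

lemma Hs_vanishing_scaleR: "u \<in> Hs_vanishing s \<Omega> \<Longrightarrow> c *\<^sub>R u \<in> Hs_vanishing s \<Omega>"
  unfolding Hs_vanishing_def using Hs_scaleR(1) by auto

lemma frac_grad_diff:
  assumes s: "0 < s" "s \<le> 1" and \<Omega>: "bounded \<Omega>" and u: "u \<in> Hs_vanishing s \<Omega>" and v: "v \<in> Hs_vanishing s \<Omega>"
  shows "AE x in lebesgue. frac_grad s (u - v) x = frac_grad s u x - frac_grad s v x"
  using Hs_vanishing_add(2)[OF s \<Omega> u Hs_vanishing_scaleR[OF v, of "-1"]] Hs_scaleR(2)[OF Hs_vanishing_Hs[OF v], of "-1"]
  by eventually_elim simp

lemma L2_space_restrict:
  assumes S: "S \<in> sets lebesgue" and f: "f \<in> L2_space lebesgue"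
  shows "f \<in> L2_space (lebesgue_on S)" "L2_norm (lebesgue_on S) f \<le> L2_norm lebesgue f"
proof -
  have i: "integrable lebesgue (\<lambda>x. indicator S x *\<^sub>R (norm (f x))\<^sup>2)"
    using f S by (intro integrable_mult_indicator) (auto simp: L2_space_def)
  then show "f \<in> L2_space (lebesgue_on S)"
    using f S by (auto simp: L2_space_def integrable_restrict_space intro: measurable_restrict_space1)
  have "(LINT x|lebesgue_on S. (norm (f x))\<^sup>2) = (LINT x|lebesgue. indicator S x *\<^sub>R (norm (f x))\<^sup>2)"
    using S by (subst integral_restrict_space) auto
  also have "\<dots> \<le> (LINT x|lebesgue. (norm (f x))\<^sup>2)"
    using i f by (intro integral_mono) (auto simp: L2_space_def indicator_def)
  finally show "L2_norm (lebesgue_on S) f \<le> L2_norm lebesgue f" unfolding L2_norm_def by simp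
qed

text \<open>Subtracting an approximating test function does not change the L2 norm over the
  complement of \<Omega>, and that norm is then bounded by a null sequence.\<close>

lemma Hs0_subset_vanishing:
  fixes \<Omega> :: "'a::euclidean_space set"
  assumes \<Omega>: "open \<Omega>" shows "Hs0 s \<Omega> \<subseteq> Hs_vanishing s \<Omega>"
proof
  fix u assume u: "u \<in> Hs0 s \<Omega>"
  then obtain \<phi> where \<phi>: "\<And>n. \<phi> n \<in> test_functions \<Omega>" "(\<lambda>n. Hs_norm s (\<phi> n - u)) \<longlonglongrightarrow> 0" and uH: "u \<in> Hs s"
    by (auto simp: Hs0_def)
  have uL: "u \<in> L2_space lebesgue" using uH by (simp add: Hs_def)
  have S: "- \<Omega> \<in> sets lebesgue" using \<Omega> by (simp add: Compl_in_sets_lebesgue)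
  have "L2_norm (lebesgue_on (- \<Omega>)) u \<le> Hs_norm s (\<phi> n - u)" for n
  proof -
    have "\<phi> n x = 0" if "x \<notin> \<Omega>" for x
      using \<phi>(1)[of n] that by (elim test_functionsE) blast
    then have "L2_norm (lebesgue_on (- \<Omega>)) u = L2_norm (lebesgue_on (- \<Omega>)) (\<phi> n - u)"
      unfolding L2_norm_def by (intro arg_cong[of _ _ sqrt] Bochner_Integration.integral_cong) auto
    also have "\<dots> \<le> L2_norm lebesgue (\<phi> n - u)"
      by (intro L2_space_restrict(2) S L2_space_diff uL test_function_L2[OF \<phi>(1)])
    also have "\<dots> \<le> Hs_norm s (\<phi> n - u)" by (rule L2_norm_le_Hs_norm)
    finally show ?thesis .
  qed
  then have "L2_norm (lebesgue_on (- \<Omega>)) u \<le> 0" by (intro LIMSEQ_le_const[OF \<phi>(2)]) auto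
  then have "L2_norm (lebesgue_on (- \<Omega>)) u = 0" using L2_norm_nonneg[of "lebesgue_on (- \<Omega>)" u] by simp
  then have "AE x in lebesgue_on (- \<Omega>). u x = 0"
    using L2_norm_eq_0_iff[OF L2_space_restrict(1)[OF S uL]] by simp
  then show "u \<in> Hs_vanishing s \<Omega>"
    using uH unfolding AE_lebesgue_on_iff[OF S] by (simp add: Hs_vanishing_def)
qed

lemma test_function_vanishing:
  assumes "\<psi> \<in> test_functions \<Omega>" "\<psi> \<in> Hs s" shows "\<psi> \<in> Hs_vanishing s \<Omega>" "\<psi> \<in> Hs0 s \<Omega>"
proof -
  have "\<psi> x = 0" if "x \<notin> \<Omega>" for x using assms(1) that by (elim test_functionsE) blast
  then show "\<psi> \<in> Hs_vanishing s \<Omega>" using assms(2) by (auto simp: Hs_vanishing_def)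
  show "\<psi> \<in> Hs0 s \<Omega>"
    unfolding Hs0_def using assms by (auto intro!: exI[of _ "\<lambda>n. \<psi>"] simp: Hs_0(2))
qed

section \<open>The H^s norm under dilations\<close>

lemma L2_dilation:
  fixes f :: "'a::euclidean_space \<Rightarrow> 'b::euclidean_space"
  assumes "0 < \<mu>"
  shows "f \<in> L2_space lebesgue \<Longrightarrow> (\<lambda>x. f (z + \<mu> *\<^sub>R x)) \<in> L2_space lebesgue"
    and "(L2_norm lebesgue (\<lambda>x. f (z + \<mu> *\<^sub>R x)))\<^sup>2 = (L2_norm lebesgue f)\<^sup>2 / \<mu> ^ DIM('a)"
  using lebesgue_integral_affine[of \<mu> "\<lambda>x. (norm (f x))\<^sup>2" z] lebesgue_integral_affine(3)[of \<mu> f z] assms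
  by (auto simp: L2_space_def L2_norm_sq)

lemma Hs_dilation:
  fixes u :: "'a::euclidean_space \<Rightarrow> real"
  assumes s: "0 < s" "s \<le> 1" and u: "u \<in> Hs s" and \<mu>: "0 < \<mu>"
  shows "(\<lambda>x. u (z + \<mu> *\<^sub>R x)) \<in> Hs s"
    and "(Hs_norm s (\<lambda>x. u (z + \<mu> *\<^sub>R x)))\<^sup>2 =
      ((L2_norm lebesgue u)\<^sup>2 + (\<mu> powr s)\<^sup>2 * (L2_norm lebesgue (frac_grad s u))\<^sup>2) / \<mu> ^ DIM('a)"
proof -
  note sc = L2_dilation(1)[OF \<mu>, of _ z] and ns = L2_dilation(2)[OF \<mu>, of _ z]
  let ?u = "\<lambda>x. u (z + \<mu> *\<^sub>R x)" and ?G = "\<lambda>x. \<mu> powr s *\<^sub>R frac_grad s u (z + \<mu> *\<^sub>R x)"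
  have uL: "u \<in> L2_space lebesgue" using u by (simp add: Hs_def)
  note G = frac_grad_Hs[OF u]
  have GL: "?G \<in> L2_space lebesgue"
    using L2_space_scaleR[OF sc[OF G(1)], of "\<mu> powr s"] by (simp add: scaleR_fun_def)
  have "weak_frac_grad s ?u ?G"
    unfolding weak_frac_grad_def
  proof
    fix \<Phi> :: "'a \<Rightarrow> 'a" assume \<Phi>: "\<Phi> \<in> test_functions UNIV"
    \<comment> \<open>The test field is dilated backwards, so a change of variables carries the weak
      identity for \<open>u\<close> into the one for its dilation; the gradient of \<open>u\<close>
      needs no pointwise description.\<close>
    define \<Psi> where "\<Psi> y = \<Phi> ((- 1 / \<mu>) *\<^sub>R z + (1 / \<mu>) *\<^sub>R y)" for y
    have \<Psi>: "\<Psi> \<in> test_functions UNIV"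
      unfolding \<Psi>_def[abs_def] using \<mu> by (intro test_function_dilation[OF \<Phi>]) auto
    have eq: "\<Psi> (z + \<mu> *\<^sub>R x) = \<Phi> x" for x using \<mu> by (simp add: \<Psi>_def scaleR_add_right)
    have fd: "frac_div s \<Phi> x = \<mu> powr s * frac_div s \<Psi> (z + \<mu> *\<^sub>R x)" for x
      using frac_div_dilation[OF s \<Psi> \<mu>, of z x] unfolding eq by simp
    have "(LINT x|lebesgue. ?G x \<bullet> \<Phi> x) = (LINT x|lebesgue. \<mu> powr s * (frac_grad s u (z + \<mu> *\<^sub>R x) \<bullet> \<Psi> (z + \<mu> *\<^sub>R x)))"
      by (simp add: eq)
    also have "\<dots> = \<mu> powr s * (1 / \<mu> ^ DIM('a) * (LINT x|lebesgue. frac_grad s u x \<bullet> \<Psi> x))"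
      using lebesgue_integral_affine(1)[of \<mu> "\<lambda>x. frac_grad s u x \<bullet> \<Psi> x" z] \<mu> by simp
    also have "(LINT x|lebesgue. frac_grad s u x \<bullet> \<Psi> x) = - (LINT x|lebesgue. u x * frac_div s \<Psi> x)"
      using G(2) \<Psi> unfolding weak_frac_grad_def by simp
    also have "\<mu> powr s * (1 / \<mu> ^ DIM('a) * (- (LINT x|lebesgue. u x * frac_div s \<Psi> x))) =
        - (LINT x|lebesgue. \<mu> powr s * (u (z + \<mu> *\<^sub>R x) * frac_div s \<Psi> (z + \<mu> *\<^sub>R x)))"
      using lebesgue_integral_affine(1)[of \<mu> "\<lambda>x. u x * frac_div s \<Psi> x" z] \<mu> by simp
    also have "\<dots> = - (LINT x|lebesgue. ?u x * frac_div s \<Phi> x)" by (simp add: fd mult_ac)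
    finally show "(LINT x|lebesgue. ?G x \<bullet> \<Phi> x) = - (LINT x|lebesgue. ?u x * frac_div s \<Phi> x)" .
  qed
  from frac_grad_AE_eq[OF sc[OF uL] GL this] have uH: "?u \<in> Hs s" and ae: "AE x in lebesgue. frac_grad s ?u x = ?G x" by auto
  show "?u \<in> Hs s" by (rule uH)
  have "L2_norm lebesgue (frac_grad s ?u) = L2_norm lebesgue ?G"
    by (rule L2_norm_cong_AE_lebesgue[OF ae])
  also have "\<dots> = \<mu> powr s * L2_norm lebesgue (\<lambda>x. frac_grad s u (z + \<mu> *\<^sub>R x))"
    using L2_norm_scaleR[of lebesgue "\<mu> powr s" "\<lambda>x. frac_grad s u (z + \<mu> *\<^sub>R x)"] by (simp add: scaleR_fun_def)
  finally have "(L2_norm lebesgue (frac_grad s ?u))\<^sup>2 = (\<mu> powr s)\<^sup>2 * ((L2_norm lebesgue (frac_grad s u))\<^sup>2 / \<mu> ^ DIM('a))"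
    by (simp only: power_mult_distrib ns)
  then show "(Hs_norm s ?u)\<^sup>2 =
      ((L2_norm lebesgue u)\<^sup>2 + (\<mu> powr s)\<^sup>2 * (L2_norm lebesgue (frac_grad s u))\<^sup>2) / \<mu> ^ DIM('a)"
    unfolding Hs_norm_sq ns by (simp add: add_divide_distrib)
qed

subsection \<open>The local case\<close>

text \<open>Integrals of difference quotients vanish by translation invariance.\<close>

lemma integral_partial_zero:
  fixes f :: "'a::euclidean_space \<Rightarrow> real"
  assumes f: "f \<in> test_functions S" and b: "b \<in> Basis"
  shows "(LINT x|lebesgue. frechet_derivative f (at x) b) = 0"
proof -
  obtain L where L: "0 \<le> L" "\<And>x y. norm (f y - f x) \<le> L * norm (y - x)"
    using f by (rule test_function_lipschitz) blast
  obtain R where R: "R > 0" "\<And>x. R \<le> norm x \<Longrightarrow> f x = 0"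
    using f by (rule test_function_support) blast
  define q where "q n x = real (Suc n) * (f (x + (1 / real (Suc n)) *\<^sub>R b) - f x)" for n x
  have tr: "(LINT x|lebesgue. f (x + v)) = (LINT x|lebesgue. f x)" "integrable lebesgue (\<lambda>x. f (x + v))" for v
    using lebesgue_integral_affine(1,2)[of 1 f v] integrable_test_function[OF f] by (simp_all add: add.commute)
  have "(\<lambda>n. LINT x|lebesgue. q n x) \<longlonglongrightarrow> (LINT x|lebesgue. frechet_derivative f (at x) b)"
  proof (rule integral_dominated_convergence[where w = "\<lambda>x. L * indicator (cball (0::'a) (R + 1)) x"])
    show "integrable lebesgue (\<lambda>x. L * indicator (cball (0::'a) (R + 1)) x)"
      by (intro integrable_mult_right integrable_indicator_cball)
    show "(\<lambda>x. frechet_derivative f (at x) b) \<in> borel_measurable lebesgue"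
      by (rule borel_measurable_lebesgue_test_function[OF test_functions_partial[OF f b]])
    show "q n \<in> borel_measurable lebesgue" for n
      unfolding q_def[abs_def] using tr(2) integrable_test_function[OF f]
      by (intro borel_measurable_times borel_measurable_diff borel_measurable_const) blast+
    show "AE x in lebesgue. norm (q n x) \<le> L * indicator (cball 0 (R + 1)) x" for n
    proof (rule AE_I2)
      fix x
      have nb: "norm ((1 / real (Suc n)) *\<^sub>R b) = 1 / real (Suc n)" using b by simp
      show "norm (q n x) \<le> L * indicator (cball 0 (R + 1)) x"
      proof (cases "norm x \<le> R + 1")
        case True
        have "norm (q n x) = real (Suc n) * norm (f (x + (1 / real (Suc n)) *\<^sub>R b) - f x)"
          by (simp add: q_def abs_mult)
        also have "\<dots> \<le> real (Suc n) * (L * (1 / real (Suc n)))"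
          using L(2)[where x = x and y = "x + (1 / real (Suc n)) *\<^sub>R b"] nb by (intro mult_left_mono) auto
        finally show ?thesis using True by simp
      next
        case False
        have "norm x \<le> norm (x + (1 / real (Suc n)) *\<^sub>R b) + norm ((1 / real (Suc n)) *\<^sub>R b)"
          using norm_triangle_ineq4[of "x + (1 / real (Suc n)) *\<^sub>R b" "(1 / real (Suc n)) *\<^sub>R b"] by simp
        moreover have "1 / real (Suc n) \<le> 1" by simp
        ultimately have "R \<le> norm (x + (1 / real (Suc n)) *\<^sub>R b)" using False unfolding nb by linarith
        then show ?thesis using False R(2)[of x] R(2)[of "x + (1 / real (Suc n)) *\<^sub>R b"] by (simp add: q_def)
      qed
    qed
    show "AE x in lebesgue. (\<lambda>n. q n x) \<longlonglongrightarrow> frechet_derivative f (at x) b"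
    proof (rule AE_I2)
      fix x
      have "((\<lambda>t. f (x + t *\<^sub>R b)) has_vector_derivative frechet_derivative f (at x) b) (at 0)"
      proof -
        interpret bounded_linear "frechet_derivative f (at x)"
          using has_frechet_derivative[OF test_function_differentiable[OF f]] by (rule has_derivative_bounded_linear)
        have "((\<lambda>t. x + t *\<^sub>R b) has_derivative (\<lambda>t. t *\<^sub>R b)) (at 0)" by (auto intro!: derivative_eq_intros)
        moreover have "(f has_derivative frechet_derivative f (at x)) (at (x + 0 *\<^sub>R b))"
          using has_frechet_derivative[OF test_function_differentiable[OF f]] by simp
        ultimately show ?thesis
          using diff_chain_at[of "\<lambda>t. x + t *\<^sub>R b" "\<lambda>t. t *\<^sub>R b" 0 f "frechet_derivative f (at x)"]
          by (simp add: has_vector_derivative_def o_def scaleR)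
      qed
      then have "((\<lambda>t. (f (x + t *\<^sub>R b) - f x) / t) \<longlongrightarrow> frechet_derivative f (at x) b) (at 0)"
        by (simp add: has_real_derivative_iff_has_vector_derivative[symmetric] DERIV_def)
      moreover have "filterlim (\<lambda>n. 1 / real (Suc n)) (at 0) sequentially"
        unfolding filterlim_at using LIMSEQ_Suc[OF lim_1_over_n] by auto
      ultimately have "(\<lambda>n. (f (x + (1 / real (Suc n)) *\<^sub>R b) - f x) / (1 / real (Suc n))) \<longlonglongrightarrow> frechet_derivative f (at x) b"
        by (rule filterlim_compose)
      then show "(\<lambda>n. q n x) \<longlonglongrightarrow> frechet_derivative f (at x) b" by (simp add: q_def[abs_def] mult.commute)
    qed
  qed
  moreover have "(LINT x|lebesgue. q n x) = 0" for n
    unfolding q_def using tr integrable_test_function[OF f] by simp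
  ultimately show ?thesis by (simp add: LIMSEQ_const_iff)
qed

lemma test_function_inner_Basis:
  fixes \<Phi> :: "'a::euclidean_space \<Rightarrow> 'b::euclidean_space"
  assumes \<Phi>: "\<Phi> \<in> test_functions S"
  shows "(\<lambda>x. \<Phi> x \<bullet> v) \<in> test_functions S"
    and "frechet_derivative (\<lambda>x. \<Phi> x \<bullet> v) (at x) h = frechet_derivative \<Phi> (at x) h \<bullet> v"
proof -
  have D: "((\<lambda>x. f x \<bullet> v) has_derivative (\<lambda>h. frechet_derivative f (at x) h \<bullet> v)) (at x)"
    if "smooth f" for f :: "'a \<Rightarrow> 'b" and x
    using that by (intro has_derivative_inner_left has_frechet_derivative smooth_differentiable)
  obtain K where K: "smooth \<Phi>" "compact K" "K \<subseteq> S" "\<And>x. x \<notin> K \<Longrightarrow> \<Phi> x = 0"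
    using \<Phi> by (rule test_functionsE) blast
  show "frechet_derivative (\<lambda>x. \<Phi> x \<bullet> v) (at x) h = frechet_derivative \<Phi> (at x) h \<bullet> v"
    using frechet_derivative_at[OF D[OF K(1)], symmetric] by (rule fun_cong)
  have "smooth (\<lambda>x. \<Phi> x \<bullet> v)"
  proof (rule smooth_coinduct[where A = "{\<lambda>x. f x \<bullet> v | f. smooth f}"])
    fix g assume "g \<in> {\<lambda>x. f x \<bullet> v | f :: 'a \<Rightarrow> 'b. smooth f}"
    then obtain f :: "'a \<Rightarrow> 'b" where g: "g = (\<lambda>x. f x \<bullet> v)" "smooth f" by blast
    show "g differentiable (at x)" for x unfolding g(1) differentiable_def using D[OF g(2)] by blast
    show "(\<lambda>x. frechet_derivative g (at x) b) \<in> {\<lambda>x. f x \<bullet> v | f :: 'a \<Rightarrow> 'b. smooth f}" if "b \<in> Basis" for b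
      unfolding g(1) frechet_derivative_at[OF D[OF g(2)], symmetric]
      by (intro CollectI exI[of _ "\<lambda>x. frechet_derivative f (at x) b"] conjI refl smooth_partial[OF g(2) that])
  qed (intro CollectI exI[of _ \<Phi>] conjI refl K(1))
  then show "(\<lambda>x. \<Phi> x \<bullet> v) \<in> test_functions S"
    by (rule test_functionsI[OF _ K(2,3)]) (simp add: K(4))
qed

text \<open>Integration by parts in each coordinate, since the partial derivative of a compactly
  supported product has integral 0. It supplies at \<open>s = 1\<close> what
  \<open>negative_order_embeddings\<close> supplies for \<open>s < 1\<close>.\<close>

lemma weak_frac_grad_1:
  fixes \<psi> :: "'a::euclidean_space \<Rightarrow> real"
  assumes \<psi>: "\<psi> \<in> test_functions S"
  shows "weak_frac_grad 1 \<psi> (\<lambda>x. \<Sum>b\<in>Basis. frechet_derivative \<psi> (at x) b *\<^sub>R b)"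
  unfolding weak_frac_grad_def
proof
  fix \<Phi> :: "'a \<Rightarrow> 'a" assume \<Phi>: "\<Phi> \<in> test_functions UNIV"
  let ?P = "\<lambda>b x. frechet_derivative \<psi> (at x) b" and ?Q = "\<lambda>b x. frechet_derivative \<Phi> (at x) b \<bullet> b"
  have parts: "integrable lebesgue (\<lambda>x. ?P b x * (\<Phi> x \<bullet> b))" "integrable lebesgue (\<lambda>x. \<psi> x * ?Q b x)"
    "(LINT x|lebesgue. ?P b x * (\<Phi> x \<bullet> b)) = - (LINT x|lebesgue. \<psi> x * ?Q b x)" if b: "b \<in> Basis" for b
  proof -
    let ?\<phi> = "\<lambda>x. \<Phi> x \<bullet> b"
    have \<phi>: "?\<phi> \<in> test_functions UNIV" by (rule test_function_inner_Basis[OF \<Phi>])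
    have Q: "?Q b \<in> test_functions UNIV" by (rule test_function_inner_Basis[OF test_functions_partial[OF \<Phi> b]])
    have \<psi>': "\<psi> \<in> test_functions UNIV" using \<psi> test_functions_mono[of S UNIV] by blast
    show i1: "integrable lebesgue (\<lambda>x. ?P b x * (\<Phi> x \<bullet> b))"
      using L2_inner_integrable[OF test_function_L2[OF test_functions_partial[OF \<psi> b]] test_function_L2[OF \<phi>]] by simp
    show i2: "integrable lebesgue (\<lambda>x. \<psi> x * ?Q b x)"
      using L2_inner_integrable[OF test_function_L2[OF \<psi>] test_function_L2[OF Q]] by simp
    obtain K where K: "smooth \<psi>" "compact K" "\<And>x. x \<notin> K \<Longrightarrow> \<psi> x = 0"
      using \<psi> by (rule test_functionsE) blast
    have p: "(\<lambda>x. \<psi> x * ?\<phi> x) \<in> test_functions UNIV"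
      by (rule test_functionsI[of _ K]) (use K \<phi> in \<open>auto intro: smooth_mult simp: test_functions_def\<close>)
    have D: "((\<lambda>x. \<psi> x * ?\<phi> x) has_derivative (\<lambda>h. \<psi> x * (frechet_derivative \<Phi> (at x) h \<bullet> b) + frechet_derivative \<psi> (at x) h * ?\<phi> x)) (at x)" for x
      using has_derivative_mult[OF has_frechet_derivative[OF test_function_differentiable[OF \<psi>], of x]
          has_frechet_derivative[OF test_function_differentiable[OF \<phi>], of x]]
      by (simp add: test_function_inner_Basis(2)[OF \<Phi>])
    have "(LINT x|lebesgue. \<psi> x * ?Q b x + ?P b x * ?\<phi> x) = 0"
      using integral_partial_zero[OF p b] unfolding frechet_derivative_at[OF D, symmetric] .
    then show "(LINT x|lebesgue. ?P b x * (\<Phi> x \<bullet> b)) = - (LINT x|lebesgue. \<psi> x * ?Q b x)"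
      using i1 i2 by simp
  qed
  have rp: "riesz_potential 0 g = g" for g :: "'a \<Rightarrow> 'a" by (simp add: riesz_potential_def fun_eq_iff)
  have "(LINT x|lebesgue. (\<Sum>b\<in>Basis. ?P b x *\<^sub>R b) \<bullet> \<Phi> x) = (LINT x|lebesgue. (\<Sum>b\<in>Basis. ?P b x * (\<Phi> x \<bullet> b)))"
    by (simp add: inner_sum_left inner_commute[of "\<Phi> x" b for x b])
  also have "\<dots> = (\<Sum>b\<in>Basis. LINT x|lebesgue. ?P b x * (\<Phi> x \<bullet> b))"
    by (intro Bochner_Integration.integral_sum parts)
  also have "\<dots> = - (\<Sum>b\<in>Basis. LINT x|lebesgue. \<psi> x * ?Q b x)" by (simp add: parts(3) sum_negf)
  also have "(\<Sum>b\<in>Basis. LINT x|lebesgue. \<psi> x * ?Q b x) = (LINT x|lebesgue. (\<Sum>b\<in>Basis. \<psi> x * ?Q b x))"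
    by (intro Bochner_Integration.integral_sum[symmetric] parts)
  also have "\<dots> = (LINT x|lebesgue. \<psi> x * frac_div 1 \<Phi> x)"
    by (simp add: frac_div_def divergence_def rp sum_distrib_left)
  finally show "(LINT x|lebesgue. (\<Sum>b\<in>Basis. ?P b x *\<^sub>R b) \<bullet> \<Phi> x) = - (LINT x|lebesgue. \<psi> x * frac_div 1 \<Phi> x)" .
qed

subsection \<open>The norms of integer order\<close>

lemma sum_fun_apply: "(\<Sum>i\<in>I. f i) x = (\<Sum>i\<in>I. f i x)"
  by (induction I rule: infinite_finite_induct) auto

lemma finite_partial_lists: "finite {vs. set vs \<subseteq> (Basis :: 'a::euclidean_space set) \<and> length vs \<le> k}"
  by (rule finite_lists_length_le) simp

lemma Hk_norm_nonneg: "0 \<le> Hk_norm k \<psi>" by (simp add: Hk_norm_def sum_nonneg)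

lemma sum_partials_le_Hk_norm:
  fixes \<psi> :: "'a::euclidean_space \<Rightarrow> real"
  assumes "A \<subseteq> {vs. set vs \<subseteq> Basis \<and> length vs \<le> k}"
  shows "(\<Sum>vs\<in>A. (L2_norm lebesgue (iterated_partial vs \<psi>))\<^sup>2) \<le> (Hk_norm k \<psi>)\<^sup>2"
  using assms by (simp add: Hk_norm_def sum_nonneg sum_mono2 finite_partial_lists)

lemma L2_partial_le_Hk_norm:
  fixes \<psi> :: "'a::euclidean_space \<Rightarrow> real"
  assumes "set vs \<subseteq> Basis" "length vs \<le> k"
  shows "L2_norm lebesgue (iterated_partial vs \<psi>) \<le> Hk_norm k \<psi>"
  using sum_partials_le_Hk_norm[of "{vs}" k \<psi>] assms
  by (intro power2_le_imp_le[OF _ Hk_norm_nonneg]) simp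

lemma iterated_partial_scaleR:
  assumes "smooth \<psi>" "set vs \<subseteq> Basis"
  shows "iterated_partial vs (c *\<^sub>R \<psi>) = c *\<^sub>R iterated_partial vs \<psi>"
  using assms(2)
proof (induction vs)
  case (Cons v vs)
  have "iterated_partial vs \<psi> differentiable (at x)" for x
    using Cons.prems smooth_iterated_partial[OF assms(1)] by (intro smooth_differentiable) auto
  then have "frechet_derivative (c *\<^sub>R iterated_partial vs \<psi>) (at x) v = c *\<^sub>R frechet_derivative (iterated_partial vs \<psi>) (at x) v" for x
    using fun_cong[OF frechet_derivative_at[OF has_derivative_scaleR_right[OF has_frechet_derivative]], of "iterated_partial vs \<psi>" x c v]
    by (simp add: scaleR_fun_def)
  then show ?case using Cons by (simp add: scaleR_fun_def)
qed simp

lemma Hk_norm_scaleR: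
  assumes "\<psi> \<in> test_functions S" shows "Hk_norm k (c *\<^sub>R \<psi>) = \<bar>c\<bar> * Hk_norm k \<psi>"
proof -
  have "smooth \<psi>" using assms by (simp add: test_functions_def)
  then have "(\<Sum>vs\<in>{vs. set vs \<subseteq> Basis \<and> length vs \<le> k}. (L2_norm lebesgue (iterated_partial vs (c *\<^sub>R \<psi>)))\<^sup>2)
     = c\<^sup>2 * (\<Sum>vs\<in>{vs. set vs \<subseteq> Basis \<and> length vs \<le> k}. (L2_norm lebesgue (iterated_partial vs \<psi>))\<^sup>2)"
    by (simp add: iterated_partial_scaleR L2_norm_scaleR power_mult_distrib sum_distrib_left)
  then show ?thesis by (simp add: Hk_norm_def real_sqrt_mult)
qed

section \<open>Dual norms and what the negative order embeddings imply\<close>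

lemma dual_norm_upper:
  assumes F: "F \<in> dual_on X N" and N: "\<And>x. 0 \<le> N x" and x: "x \<in> X" "N x \<le> 1"
  shows "\<bar>F x\<bar> \<le> dual_norm X N F"
proof -
  have "\<exists>C. \<forall>x\<in>X. \<bar>F x\<bar> \<le> C * N x" using F unfolding dual_on_def by blast
  then obtain C where C: "\<And>x. x \<in> X \<Longrightarrow> \<bar>F x\<bar> \<le> C * N x" by blast
  have "bdd_above ((\<lambda>x. \<bar>F x\<bar>) ` {x \<in> X. N x \<le> 1})"
  proof (rule bdd_aboveI2)
    fix x assume x: "x \<in> {x \<in> X. N x \<le> 1}"
    have "C * N x \<le> \<bar>C\<bar> * 1" using x N[of x] by (intro mult_mono) auto
    then show "\<bar>F x\<bar> \<le> \<bar>C\<bar>" using C[of x] x by simp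
  qed
  then show ?thesis unfolding dual_norm_def using x by (intro cSUP_upper) auto
qed

text \<open>Normalizing \<open>x\<close> works unless its seminorm is 0, and in that case
  boundedness of \<open>F\<close> forces \<open>F x = 0\<close>.\<close>

lemma dual_norm_bound:
  assumes F: "F \<in> dual_on X N" and N: "\<And>x. 0 \<le> N x" and x: "x \<in> X"
    and c: "\<And>c. c *\<^sub>R x \<in> X" "\<And>c. N (c *\<^sub>R x) = \<bar>c\<bar> * N x"
  shows "\<bar>F x\<bar> \<le> dual_norm X N F * N x"
proof (cases "N x = 0")
  case True
  have "\<exists>C. \<forall>x\<in>X. \<bar>F x\<bar> \<le> C * N x" using F unfolding dual_on_def by blast
  then show ?thesis using x True by auto
next
  case False
  then have "0 < N x" using N[of x] by simp
  have hom: "F (c *\<^sub>R x) = c * F x" for c using F x by (auto simp: dual_on_def)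
  have "\<bar>F ((1 / N x) *\<^sub>R x)\<bar> \<le> dual_norm X N F"
    by (rule dual_norm_upper[OF F N c(1)]) (use \<open>0 < N x\<close> in \<open>simp add: c(2)\<close>)
  then show ?thesis using \<open>0 < N x\<close> by (simp add: hom abs_mult divide_le_eq)
qed

lemma dual_norm_le:
  assumes "x0 \<in> X" "N x0 \<le> 1" "\<And>x. x \<in> X \<Longrightarrow> \<bar>F x\<bar> \<le> C * N x" "0 \<le> C"
  shows "dual_norm X N F \<le> C"
  unfolding dual_norm_def
proof (rule cSUP_least)
  show "{x \<in> X. N x \<le> 1} \<noteq> {}" using assms by blast
  fix x assume "x \<in> {x \<in> X. N x \<le> 1}"
  then show "\<bar>F x\<bar> \<le> C" using assms(3)[of x] mult_left_mono[of "N x" 1 C] assms(4) by auto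
qed

text \<open>
  The embeddings \<open>H\<^sup>-\<^sup>s(\<Omega>) \<subseteq> H\<^sup>-\<^sup>k(\<Omega>)\<close> force \<open>C\<^sub>c\<^sup>\<infinity>(\<Omega>) \<subseteq> H\<^sup>s\<^sub>0(\<Omega>)\<close>: otherwise the indicator of a missing
  test function would be a functional on \<open>H\<^sup>s\<^sub>0(\<Omega>)\<close> which is not linear on test functions.
\<close>

lemma test_functions_subset_Hs0:
  fixes \<Omega> :: "'a::euclidean_space set"
  assumes \<Omega>: "open \<Omega>" "bounded \<Omega>" and emb: "negative_order_embeddings k \<Omega>" and s: "0 < s" "s \<le> 1"
    and \<psi>: "\<psi> \<in> test_functions \<Omega>"
  shows "\<psi> \<in> Hs0 s \<Omega>"
proof (rule test_function_vanishing(2)[OF \<psi>])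
  show "\<psi> \<in> Hs s"
  proof (cases "s = 1")
    case True
    have P: "(\<lambda>x. frechet_derivative \<psi> (at x) b *\<^sub>R b) \<in> L2_space lebesgue" if "b \<in> Basis" for b
      using test_function_L2[OF test_functions_partial[OF \<psi> that]] that by (auto simp: L2_space_def)
    have "(\<Sum>b\<in>B. (\<lambda>x. frechet_derivative \<psi> (at x) b *\<^sub>R b)) \<in> L2_space lebesgue" if "finite B" "B \<subseteq> Basis" for B
      using that by (induction B rule: finite_induct) (auto intro: L2_space_0 L2_space_add P)
    from this[of Basis] have "(\<lambda>x. \<Sum>b\<in>Basis. frechet_derivative \<psi> (at x) b *\<^sub>R b) \<in> L2_space lebesgue"
      by (simp add: sum_fun_apply[abs_def]) 
    then show ?thesis
      unfolding True by (rule frac_grad_AE_eq(1)[OF test_function_L2[OF \<psi>] _ weak_frac_grad_1[OF \<psi>]])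
  next
    case False
    show ?thesis
    proof (rule ccontr)
      assume nH: "\<psi> \<notin> Hs s"
      then have n0: "\<psi> \<noteq> 0" using Hs_0(1) by auto
      define \<xi> where "\<xi> w = (if w = \<psi> then 1 else 0 :: real)" for w
      \<comment> \<open>\<open>Hs_vanishing\<close> is a linear space which contains
        \<open>Hs0\<close> and misses \<psi>, so on \<open>Hs0\<close> all conditions on a
        functional read \<open>0 = 0\<close>.\<close>
      have z: "\<xi> w = 0" if "w \<in> Hs_vanishing s \<Omega>" for w using that nH by (auto simp: \<xi>_def Hs_vanishing_def)
      have "\<xi> \<in> dual_on (Hs0 s \<Omega>) (Hs_norm s)"
        unfolding dual_on_def
      proof (intro CollectI conjI ballI allI exI[of _ 0])
        fix x y assume "x \<in> Hs0 s \<Omega>" "y \<in> Hs0 s \<Omega>"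
        then have "x \<in> Hs_vanishing s \<Omega>" "y \<in> Hs_vanishing s \<Omega>" using Hs0_subset_vanishing[OF \<Omega>(1)] by auto
        then show "\<xi> (x + y) = \<xi> x + \<xi> y" using z Hs_vanishing_add(1)[OF s \<Omega>(2)] by simp
      next
        fix c x assume "x \<in> Hs0 s \<Omega>"
        then have "x \<in> Hs_vanishing s \<Omega>" using Hs0_subset_vanishing[OF \<Omega>(1)] by auto
        then show "\<xi> (c *\<^sub>R x) = c * \<xi> x" using z[of x] z[of "c *\<^sub>R x"] Hs_vanishing_scaleR[of x s \<Omega> c] by simp
      next
        fix x assume "x \<in> Hs0 s \<Omega>"
        then have "x \<in> Hs_vanishing s \<Omega>" using Hs0_subset_vanishing[OF \<Omega>(1)] by auto
        then show "\<bar>\<xi> x\<bar> \<le> 0 * Hs_norm s x" using z by simp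
      qed
      then have "\<xi> \<in> H_neg k \<Omega>"
        using emb s False unfolding negative_order_embeddings_def compactly_embedded_def by auto
      then have "\<xi> (2 *\<^sub>R \<psi>) = 2 * \<xi> \<psi>" using \<psi> by (auto simp: H_neg_def dual_on_def)
      moreover have "2 *\<^sub>R \<psi> \<noteq> \<psi>" using n0 by (simp add: scaleR_2)
      ultimately show False by (simp add: \<xi>_def)
    qed
  qed
qed

text \<open>The elliptic forms see a test function through its fractional gradient, while the
  variation is measured against the H^k norm. For \<open>s = 1\<close> the gradient consists of
  first partials, which are summands of \<open>Hk_norm\<close>. For \<open>s < 1\<close> the bound
  is dual to the embedding, applied to the functional that pairs gradients with the gradient of
  \<psi>.\<close>

lemma frac_grad_le_Hk_norm:
  fixes \<Omega> :: "'a::euclidean_space set"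
  assumes \<Omega>: "open \<Omega>" "bounded \<Omega>" and emb: "negative_order_embeddings k \<Omega>" and s: "0 < s" "s \<le> 1" and k: "1 \<le> k"
  obtains C where "0 \<le> C" "\<And>\<psi>. \<psi> \<in> test_functions \<Omega> \<Longrightarrow> L2_norm lebesgue (frac_grad s \<psi>) \<le> C * Hk_norm k \<psi>"
proof (cases "s = 1")
  case True
  have "L2_norm lebesgue (frac_grad s \<psi>) \<le> 1 * Hk_norm k \<psi>" if \<psi>: "\<psi> \<in> test_functions \<Omega>" for \<psi>
  proof (rule power2_le_imp_le)
    let ?G = "\<lambda>x. \<Sum>b\<in>Basis. frechet_derivative \<psi> (at x) b *\<^sub>R b"
    have H: "\<psi> \<in> Hs s" using test_functions_subset_Hs0[OF \<Omega> emb s \<psi>] by (simp add: Hs0_def)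
    have n: "(norm (?G x))\<^sup>2 = (\<Sum>b\<in>Basis. (frechet_derivative \<psi> (at x) b)\<^sup>2)" for x
      unfolding power2_norm_eq_inner by (subst euclidean_inner) (simp add: power2_eq_square)
    have i: "integrable lebesgue (\<lambda>x. (frechet_derivative \<psi> (at x) b)\<^sup>2)" if "b \<in> Basis" for b
      using test_function_L2[OF test_functions_partial[OF \<psi> that]] by (simp add: L2_space_def)
    have "?G \<in> L2_space lebesgue"
      unfolding L2_space_def using i borel_measurable_lebesgue_test_function[OF test_functions_partial[OF \<psi>]]
      by (auto simp: n intro!: borel_measurable_sum borel_measurable_scaleR)
    from weak_frac_grad_unique[OF frac_grad_Hs(1)[OF H] this frac_grad_Hs(2)[OF H]] weak_frac_grad_1[OF \<psi>] True
    have "AE x in lebesgue. frac_grad s \<psi> x = ?G x" by simp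
    from L2_norm_cong_AE_lebesgue[OF this] have "(L2_norm lebesgue (frac_grad s \<psi>))\<^sup>2 = (L2_norm lebesgue ?G)\<^sup>2"
      by simp
    also have "\<dots> = (\<Sum>b\<in>Basis. (L2_norm lebesgue (iterated_partial [b] \<psi>))\<^sup>2)"
      unfolding L2_norm_sq n using i by (subst Bochner_Integration.integral_sum) auto
    also have "\<dots> = (\<Sum>vs\<in>(\<lambda>b. [b]) ` Basis. (L2_norm lebesgue (iterated_partial vs \<psi>))\<^sup>2)"
      by (subst sum.reindex) (auto simp: inj_on_def)
    also have "\<dots> \<le> (Hk_norm k \<psi>)\<^sup>2" by (rule sum_partials_le_Hk_norm) (use k in auto)
    finally show "(L2_norm lebesgue (frac_grad s \<psi>))\<^sup>2 \<le> (1 * Hk_norm k \<psi>)\<^sup>2" by simp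
  qed (simp add: Hk_norm_nonneg)
  then show ?thesis using that[of 1] by simp
next
  case False
  then obtain C where C: "\<And>\<xi>. \<xi> \<in> dual_on (Hs0 s \<Omega>) (Hs_norm s) \<Longrightarrow> \<xi> \<in> H_neg k \<Omega>"
      "\<And>\<xi>. \<xi> \<in> dual_on (Hs0 s \<Omega>) (Hs_norm s) \<Longrightarrow> H_neg_norm k \<Omega> \<xi> \<le> C * dual_norm (Hs0 s \<Omega>) (Hs_norm s) \<xi>"
    using emb s unfolding negative_order_embeddings_def compactly_embedded_def by (metis less_eq_real_def)
  \<comment> \<open>The embedding constant comes without a sign, hence the maximum with 0.\<close>
  have "L2_norm lebesgue (frac_grad s \<psi>) \<le> max C 0 * Hk_norm k \<psi>" if \<psi>: "\<psi> \<in> test_functions \<Omega>" for \<psi>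
  proof -
    let ?q = "L2_norm lebesgue (frac_grad s \<psi>)"
    have \<psi>H: "\<psi> \<in> Hs0 s \<Omega>" by (rule test_functions_subset_Hs0[OF \<Omega> emb s \<psi>])
    have van: "w \<in> Hs_vanishing s \<Omega>" if "w \<in> Hs0 s \<Omega>" for w using Hs0_subset_vanishing[OF \<Omega>(1)] that by auto
    have L: "frac_grad s w \<in> L2_space lebesgue" if "w \<in> Hs0 s \<Omega>" for w
      using frac_grad_Hs(1) that by (auto simp: Hs0_def)
    define \<xi> where "\<xi> w = (LINT x|lebesgue. frac_grad s w x \<bullet> frac_grad s \<psi> x)" for w
    have bd: "\<bar>\<xi> w\<bar> \<le> ?q * Hs_norm s w" if "w \<in> Hs0 s \<Omega>" for w
    proof -
      have "\<bar>\<xi> w\<bar> \<le> L2_norm lebesgue (frac_grad s w) * ?q"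
        unfolding \<xi>_def by (rule L2_Cauchy_Schwarz[OF L[OF that] L[OF \<psi>H]])
      also have "\<dots> \<le> Hs_norm s w * ?q" by (intro mult_right_mono frac_grad_le_Hs_norm L2_norm_nonneg)
      finally show ?thesis by (simp add: mult.commute)
    qed
    have \<xi>: "\<xi> \<in> dual_on (Hs0 s \<Omega>) (Hs_norm s)"
      unfolding dual_on_def
    proof (intro CollectI conjI ballI allI exI[of _ ?q] bd)
      fix v w assume v: "v \<in> Hs0 s \<Omega>" and w: "w \<in> Hs0 s \<Omega>"
      have "\<xi> (v + w) = (LINT x|lebesgue. frac_grad s v x \<bullet> frac_grad s \<psi> x + frac_grad s w x \<bullet> frac_grad s \<psi> x)"
        unfolding \<xi>_def using Hs_vanishing_add(2)[OF s \<Omega>(2) van[OF v] van[OF w]]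
        by (intro integral_cong_AE_lebesgue) (auto elim!: eventually_mono simp: inner_add_left)
      then show "\<xi> (v + w) = \<xi> v + \<xi> w"
        unfolding \<xi>_def using L2_inner_integrable[OF L[OF v] L[OF \<psi>H]] L2_inner_integrable[OF L[OF w] L[OF \<psi>H]] by simp
    next
      fix c w assume w: "w \<in> Hs0 s \<Omega>"
      have "\<xi> (c *\<^sub>R w) = (LINT x|lebesgue. c * (frac_grad s w x \<bullet> frac_grad s \<psi> x))"
        unfolding \<xi>_def using Hs_scaleR(2)[OF Hs_vanishing_Hs[OF van[OF w]], of c]
        by (intro integral_cong_AE_lebesgue) (auto elim!: eventually_mono)
      then show "\<xi> (c *\<^sub>R w) = c * \<xi> w" by (simp add: \<xi>_def)
    qed
    have zH: "0 \<in> Hs0 s \<Omega>" by (rule test_functions_subset_Hs0[OF \<Omega> emb s test_functions_0])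
    have qle: "dual_norm (Hs0 s \<Omega>) (Hs_norm s) \<xi> \<le> ?q"
      by (rule dual_norm_le[OF zH]) (use bd in \<open>auto simp: Hs_0(2) L2_norm_nonneg\<close>)
    have n1: "H_neg_norm k \<Omega> \<xi> \<le> max C 0 * ?q"
    proof -
      have d0: "0 \<le> dual_norm (Hs0 s \<Omega>) (Hs_norm s) \<xi>"
        using dual_norm_upper[OF \<xi> Hs_norm_nonneg zH] by (simp add: Hs_0(2) order_trans[OF abs_ge_zero])
      have "H_neg_norm k \<Omega> \<xi> \<le> C * dual_norm (Hs0 s \<Omega>) (Hs_norm s) \<xi>" by (rule C(2)[OF \<xi>])
      also have "\<dots> \<le> max C 0 * dual_norm (Hs0 s \<Omega>) (Hs_norm s) \<xi>" using d0 by (intro mult_right_mono) auto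
      also have "\<dots> \<le> max C 0 * ?q" using qle by (intro mult_left_mono) auto
      finally show ?thesis .
    qed
    have "\<bar>\<xi> \<psi>\<bar> \<le> H_neg_norm k \<Omega> \<xi> * Hk_norm k \<psi>"
      unfolding H_neg_norm_def
    proof (rule dual_norm_bound)
      show "\<xi> \<in> dual_on (test_functions \<Omega>) (Hk_norm k)" using C(1)[OF \<xi>] by (simp add: H_neg_def)
    qed (use \<psi> in \<open>auto intro: test_functions_scaleR Hk_norm_scaleR simp: Hk_norm_nonneg\<close>)
    also have "\<dots> \<le> (max C 0 * ?q) * Hk_norm k \<psi>" using n1 by (intro mult_right_mono Hk_norm_nonneg)
    finally have "\<bar>\<xi> \<psi>\<bar> \<le> max C 0 * ?q * Hk_norm k \<psi>" .
    \<comment> \<open>The functional has dual norm at most \<open>?q\<close> and takes the value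
      \<open>?q\<^sup>2\<close> at \<psi>; one factor is cancelled below.\<close>
    have qq: "?q * ?q \<le> (max C 0 * Hk_norm k \<psi>) * ?q"
    proof -
      have "\<xi> \<psi> = ?q\<^sup>2" by (simp only: \<xi>_def L2_norm_sq power2_norm_eq_inner)
      moreover have "\<bar>\<xi> \<psi>\<bar> \<le> max C 0 * ?q * Hk_norm k \<psi>" by fact
      ultimately show ?thesis by (simp add: power2_eq_square mult_ac)
    qed
    show ?thesis
    proof (cases "?q = 0")
      case False
      then have "?q > 0" using L2_norm_nonneg[of lebesgue "frac_grad s \<psi>"] by simp
      with qq show ?thesis by (simp add: mult_le_cancel_right)
    qed (simp add: Hk_norm_nonneg)
  qed
  then show ?thesis using that[of "max C 0"] by simp
qed


subsection \<open>Sup bounds by Sobolev norms\<close>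

text \<open>The fundamental theorem of calculus on a segment from \<open>y\<close> in direction
  \<open>b\<close> that ends outside the support.\<close>

lemma test_function_line_bound:
  fixes g :: "'a::euclidean_space \<Rightarrow> real"
  assumes g: "g \<in> test_functions S" and b: "b \<in> Basis"
  shows "ennreal \<bar>g y\<bar> \<le> (\<integral>\<^sup>+r. ennreal \<bar>frechet_derivative g (at (y + r *\<^sub>R b)) b\<bar> \<partial>lborel)"
proof -
  let ?f = "\<lambda>r. frechet_derivative g (at (y + r *\<^sub>R b)) b"
  obtain R where R: "R > 0" "\<And>x. R \<le> norm x \<Longrightarrow> g x = 0"
    using g by (rule test_function_support) blast
  define \<rho> where "\<rho> = R + norm y"
  have \<rho>0: "0 \<le> \<rho>" using R(1) by (simp add: \<rho>_def)
  have D: "((\<lambda>t. g (y + t *\<^sub>R b)) has_real_derivative ?f t) (at t)" for t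
  proof -
    interpret bounded_linear "frechet_derivative g (at (y + t *\<^sub>R b))"
      using has_frechet_derivative[OF test_function_differentiable[OF g]] by (rule has_derivative_bounded_linear)
    have "((\<lambda>t. y + t *\<^sub>R b) has_derivative (\<lambda>t. t *\<^sub>R b)) (at t)" by (auto intro!: derivative_eq_intros)
    from diff_chain_at[OF this has_frechet_derivative[OF test_function_differentiable[OF g]]]
    show ?thesis unfolding has_field_derivative_def o_def
      by (rule has_derivative_eq_rhs) (simp add: scaleR fun_eq_iff)
  qed
  have cont: "continuous_on A ?f" for A
    by (rule continuous_on_compose2[OF continuous_on_test_function[OF test_functions_partial[OF g b], of UNIV]])
      (auto intro!: continuous_on_add continuous_on_const continuous_on_scaleR continuous_on_id)
  have i: "set_integrable lborel {0..\<rho>} ?f"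
    using borel_integrable_atLeastAtMost'[OF cont] by simp
  have "(LBINT r:{0..\<rho>}. ?f r) = g (y + \<rho> *\<^sub>R b) - g (y + 0 *\<^sub>R b)"
    unfolding set_lebesgue_integral_def
    using integral_FTC_atLeastAtMost[of 0 \<rho> "\<lambda>t. g (y + t *\<^sub>R b)" ?f] \<rho>0 cont D
    by (simp add: has_real_derivative_iff_has_vector_derivative has_vector_derivative_at_within)
  moreover have "g (y + \<rho> *\<^sub>R b) = 0"
  proof (rule R(2))
    have "\<rho> = norm (\<rho> *\<^sub>R b)" using b \<rho>0 by simp
    also have "\<dots> \<le> norm (y + \<rho> *\<^sub>R b) + norm y" using norm_triangle_ineq4[of "y + \<rho> *\<^sub>R b" y] by simp
    finally show "R \<le> norm (y + \<rho> *\<^sub>R b)" by (simp add: \<rho>_def)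
  qed
  ultimately have "\<bar>g y\<bar> = \<bar>LBINT r:{0..\<rho>}. ?f r\<bar>" by simp
  also have "ennreal \<dots> \<le> (\<integral>\<^sup>+r. ennreal (norm (indicator {0..\<rho>} r *\<^sub>R ?f r)) \<partial>lborel)"
    using integral_norm_bound_ennreal[OF i[unfolded set_integrable_def]]
    by (simp add: set_lebesgue_integral_def)
  also have "\<dots> \<le> (\<integral>\<^sup>+r. ennreal \<bar>?f r\<bar> \<partial>lborel)"
    by (intro nn_integral_mono) (auto split: split_indicator)
  finally show ?thesis .
qed

text \<open>Each direction in the list is differentiated once and integrated once. Nonnegative
  integrals allow Tonelli's theorem on the product without separate integrability proofs.\<close>

lemma test_function_sup_le_nn_integral:
  fixes \<phi> :: "'a::euclidean_space \<Rightarrow> real"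
  assumes "\<phi> \<in> test_functions S" "distinct bs" "set bs \<subseteq> Basis"
  shows "ennreal \<bar>\<phi> x\<bar> \<le>
    (\<integral>\<^sup>+t. ennreal \<bar>iterated_partial bs \<phi> (x + (\<Sum>b\<in>set bs. t b *\<^sub>R b))\<bar> \<partial>(\<Pi>\<^sub>M b\<in>set bs. lborel))"
  using assms(2,3)
proof (induction bs)
  case Nil
  interpret product_sigma_finite "\<lambda>b::'a. lborel :: real measure" by standard
  show ?case by (simp add: nn_integral_empty del: nn_integral_const)
next
  case (Cons b bs)
  interpret product_sigma_finite "\<lambda>b::'a. lborel :: real measure" by standard
  let ?g = "iterated_partial bs \<phi>"
  have g: "?g \<in> test_functions S" using assms(1) Cons.prems by (intro test_functions_iterated_partial) auto
  have b: "b \<in> Basis" "b \<notin> set bs" using Cons.prems by auto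
  have mg: "(\<lambda>x. frechet_derivative ?g (at x) b) \<in> borel_measurable borel"
    by (rule borel_measurable_test_function[OF test_functions_partial[OF g b(1)]])
  have m: "(\<lambda>t. ennreal \<bar>frechet_derivative ?g (at (x + (\<Sum>c\<in>insert b (set bs). t c *\<^sub>R c))) b\<bar>)
      \<in> borel_measurable (\<Pi>\<^sub>M b\<in>insert b (set bs). lborel)"
  proof -
    have "(\<lambda>t. x + (\<Sum>c\<in>insert b (set bs). t c *\<^sub>R c)) \<in> borel_measurable (\<Pi>\<^sub>M b\<in>insert b (set bs). lborel)"
      by (intro borel_measurable_add borel_measurable_const borel_measurable_sum borel_measurable_scaleR)
        (auto intro!: measurable_component_singleton simp flip: measurable_lborel1)
    from measurable_compose[OF this mg] show ?thesis
      by (intro measurable_compose[OF _ measurable_ennreal] borel_measurable_abs)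
  qed
  have "ennreal \<bar>\<phi> x\<bar> \<le> (\<integral>\<^sup>+t. ennreal \<bar>?g (x + (\<Sum>b\<in>set bs. t b *\<^sub>R b))\<bar> \<partial>(\<Pi>\<^sub>M b\<in>set bs. lborel))"
    using Cons by auto
  also have "\<dots> \<le> (\<integral>\<^sup>+t. (\<integral>\<^sup>+r. ennreal \<bar>frechet_derivative ?g (at (x + (\<Sum>c\<in>insert b (set bs). (t(b := r)) c *\<^sub>R c))) b\<bar>
      \<partial>lborel) \<partial>(\<Pi>\<^sub>M b\<in>set bs. lborel))"
  proof (rule nn_integral_mono)
    fix t :: "'a \<Rightarrow> real"
    have "(\<Sum>c\<in>insert b (set bs). (t(b := r)) c *\<^sub>R c) = (\<Sum>c\<in>set bs. t c *\<^sub>R c) + r *\<^sub>R b" for r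
    proof -
      have "(\<Sum>c\<in>set bs. (t(b := r)) c *\<^sub>R c) = (\<Sum>c\<in>set bs. t c *\<^sub>R c)"
        using b(2) by (intro sum.cong) auto
      then show ?thesis using b(2) by (simp add: add.commute)
    qed
    then show "ennreal \<bar>?g (x + (\<Sum>b\<in>set bs. t b *\<^sub>R b))\<bar> \<le>
        (\<integral>\<^sup>+r. ennreal \<bar>frechet_derivative ?g (at (x + (\<Sum>c\<in>insert b (set bs). (t(b := r)) c *\<^sub>R c))) b\<bar> \<partial>lborel)"
      using test_function_line_bound[OF g b(1), of "x + (\<Sum>c\<in>set bs. t c *\<^sub>R c)"] by (simp add: add.assoc)
  qed
  also have "\<dots> = (\<integral>\<^sup>+t. ennreal \<bar>frechet_derivative ?g (at (x + (\<Sum>c\<in>insert b (set bs). t c *\<^sub>R c))) b\<bar>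
      \<partial>(\<Pi>\<^sub>M b\<in>insert b (set bs). lborel))"
    by (rule product_nn_integral_insert[OF _ b(2) m, symmetric]) simp
  finally show ?case by simp
qed

text \<open>A crude Sobolev inequality: one derivative per coordinate direction bounds the function
  by an L1 norm, and the bounded support turns L1 into L2. These are the \<open>d\<close>
  derivatives added to the order of decay in the bound on \<open>k\<close>.\<close>

lemma test_function_sup_bound:
  fixes \<phi> :: "'a::euclidean_space \<Rightarrow> real"
  assumes \<Omega>: "open \<Omega>" "bounded \<Omega>" and \<phi>: "\<phi> \<in> test_functions \<Omega>" and bs: "distinct bs" "set bs = Basis"
  shows "\<bar>\<phi> x\<bar> \<le> sqrt (measure lebesgue \<Omega>) * L2_norm lebesgue (iterated_partial bs \<phi>)"
proof -
  let ?g = "iterated_partial bs \<phi>"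
  have g: "?g \<in> test_functions \<Omega>" using \<phi> bs by (intro test_functions_iterated_partial) auto
  have gi: "integrable lebesgue (\<lambda>y. \<bar>?g y\<bar>)" by (intro integrable_abs integrable_test_function[OF g])
  have gb: "(\<lambda>y. ennreal \<bar>?g (x + y)\<bar>) \<in> borel_measurable borel"
    using borel_measurable_test_function[OF g] by measurable
  have "ennreal \<bar>\<phi> x\<bar> \<le> (\<integral>\<^sup>+t. ennreal \<bar>?g (x + (\<Sum>b\<in>Basis. t b *\<^sub>R b))\<bar> \<partial>(\<Pi>\<^sub>M b\<in>(Basis::'a set). lborel))"
    using test_function_sup_le_nn_integral[OF \<phi> bs(1)] bs(2) by simp
  also have "\<dots> = (\<integral>\<^sup>+y. ennreal \<bar>?g (x + y)\<bar> \<partial>distr (\<Pi>\<^sub>M b\<in>(Basis::'a set). lborel) borel (\<lambda>t. \<Sum>b\<in>Basis. t b *\<^sub>R b))"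
    using gb by (subst nn_integral_distr) (auto intro!: borel_measurable_sum borel_measurable_scaleR
        measurable_component_singleton simp flip: measurable_lborel1)
  also have "\<dots> = (\<integral>\<^sup>+y. ennreal \<bar>?g (x + y)\<bar> \<partial>lebesgue)"
    unfolding lborel_eq[symmetric] by (rule nn_integral_completion[symmetric])
  also have "\<dots> = ennreal (LINT y|lebesgue. \<bar>?g (x + y)\<bar>)"
    using gi lebesgue_integral_affine(2)[of 1 "\<lambda>y. \<bar>?g y\<bar>" x] by (intro nn_integral_eq_integral) auto
  also have "(LINT y|lebesgue. \<bar>?g (x + y)\<bar>) = (LINT y|lebesgue. \<bar>?g y\<bar>)"
    using lebesgue_integral_affine(1)[of 1 "\<lambda>y. \<bar>?g y\<bar>" x] by simp
  also have "\<dots> = (LINT y|lebesgue_on \<Omega>. \<bar>?g y\<bar>)"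
  proof -
    have "?g y = 0" if "y \<notin> \<Omega>" for y using g that by (elim test_functionsE) blast
    then have "\<bar>?g y\<bar> = indicator \<Omega> y *\<^sub>R \<bar>?g y\<bar>" for y by (cases "y \<in> \<Omega>") auto
    then have "(LINT y|lebesgue. \<bar>?g y\<bar>) = (LINT y|lebesgue. indicator \<Omega> y *\<^sub>R \<bar>?g y\<bar>)"
      by (intro Bochner_Integration.integral_cong refl)
    also have "\<dots> = (LINT y|lebesgue_on \<Omega>. \<bar>?g y\<bar>)" using \<Omega> by (subst integral_restrict_space) auto
    finally show ?thesis .
  qed
  finally have "\<bar>\<phi> x\<bar> \<le> (LINT y|lebesgue_on \<Omega>. \<bar>?g y\<bar>)" by simp
  also have "\<dots> \<le> sqrt (measure lebesgue \<Omega>) * L2_on_norm \<Omega> ?g"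
    using \<Omega> L2_space_restrict(1)[OF _ test_function_L2[OF g]] by (intro L2_space_subset_L1) auto
  also have "\<dots> \<le> sqrt (measure lebesgue \<Omega>) * L2_norm lebesgue ?g"
    using \<Omega> L2_space_restrict(2)[OF _ test_function_L2[OF g], of \<Omega>] by (intro mult_left_mono) auto
  finally show ?thesis .
qed

lemma partial_sup_le_Hk_norm:
  fixes \<psi> :: "'a::euclidean_space \<Rightarrow> real"
  assumes \<Omega>: "open \<Omega>" "bounded \<Omega>" and \<psi>: "\<psi> \<in> test_functions \<Omega>" and vs: "set vs \<subseteq> Basis" "length vs + DIM('a) \<le> k"
  shows "\<bar>iterated_partial vs \<psi> x\<bar> \<le> sqrt (measure lebesgue \<Omega>) * Hk_norm k \<psi>"
proof -
  obtain bs where bs: "distinct bs" "set bs = (Basis :: 'a set)" using finite_distinct_list[OF finite_Basis] by blast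
  have len: "length bs = DIM('a)" using distinct_card[OF bs(1)] bs(2) by simp
  have "\<bar>iterated_partial vs \<psi> x\<bar> \<le> sqrt (measure lebesgue \<Omega>) * L2_norm lebesgue (iterated_partial bs (iterated_partial vs \<psi>))"
    by (rule test_function_sup_bound[OF \<Omega> test_functions_iterated_partial[OF \<psi> vs(1)] bs])
  also have "\<dots> \<le> sqrt (measure lebesgue \<Omega>) * Hk_norm k \<psi>"
    unfolding iterated_partial_append[symmetric] using bs vs len by (intro mult_left_mono L2_partial_le_Hk_norm) auto
  finally show ?thesis .
qed

text \<open>Taylor expansion at a point outside \<open>\<Omega>\<close>, where all derivatives vanish.\<close>

lemma partial_boundary_decay:
  fixes \<psi> :: "'a::euclidean_space \<Rightarrow> real"
  assumes \<psi>: "\<psi> \<in> test_functions \<Omega>" and z: "z \<notin> \<Omega>" and M0: "0 \<le> M"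
    and M: "\<And>vs x. set vs \<subseteq> Basis \<Longrightarrow> length vs = m \<Longrightarrow> \<bar>iterated_partial vs \<psi> x\<bar> \<le> M"
  shows "set vs \<subseteq> Basis \<Longrightarrow> length vs + j = m \<Longrightarrow> \<bar>iterated_partial vs \<psi> y\<bar> \<le> M * DIM('a) ^ j * norm (y - z) ^ j"
proof (induction j arbitrary: vs y)
  case 0 then show ?case using M by simp
next
  case (Suc j)
  let ?f = "iterated_partial vs \<psi>"
  have f: "?f \<in> test_functions \<Omega>" by (rule test_functions_iterated_partial[OF \<psi> Suc.prems(1)])
  have fz: "?f z = 0" using f z by (elim test_functionsE) blast
  let ?B = "M * DIM('a) ^ j * norm (y - z) ^ j"
  have B0: "0 \<le> ?B" using M0 by simp
  \<comment> \<open>The mean value inequality is used on the ball around \<open>z\<close> through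
    \<open>y\<close>, where the induction hypothesis bounds all next partials by the bound at radius
    \<open>norm (y - z)\<close>.\<close>
  have "norm (?f y - ?f z) \<le> (DIM('a) * ?B) * norm (y - z)"
  proof (rule differentiable_bound[of "cball z (norm (y - z))" ?f "\<lambda>x. frechet_derivative ?f (at x)"])
    fix x assume x: "x \<in> cball z (norm (y - z))"
    show "(?f has_derivative frechet_derivative ?f (at x)) (at x within cball z (norm (y - z)))"
      by (rule has_derivative_at_withinI[OF has_frechet_derivative[OF test_function_differentiable[OF f]]])
    show "onorm (frechet_derivative ?f (at x)) \<le> DIM('a) * ?B"
    proof (rule onorm_le)
      fix h
      have "norm (frechet_derivative ?f (at x) h) \<le> (\<Sum>b\<in>Basis. norm ((h \<bullet> b) *\<^sub>R frechet_derivative ?f (at x) b))"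
        unfolding frechet_derivative_eq_sum_partials[OF test_function_differentiable[OF f], of x h] by (rule norm_sum)
      also have "\<dots> \<le> (\<Sum>b\<in>(Basis::'a set). norm h * ?B)"
      proof (rule sum_mono)
        fix b :: 'a assume b: "b \<in> Basis"
        have "\<bar>iterated_partial (b # vs) \<psi> x\<bar> \<le> M * DIM('a) ^ j * norm (x - z) ^ j"
          by (rule Suc.IH) (use Suc.prems b in auto)
        also have "\<dots> \<le> ?B"
          using x M0 by (intro mult_left_mono power_mono) (auto simp: dist_norm norm_minus_commute)
        finally have "\<bar>frechet_derivative ?f (at x) b\<bar> \<le> ?B" by simp
        then show "norm ((h \<bullet> b) *\<^sub>R frechet_derivative ?f (at x) b) \<le> norm h * ?B"
          unfolding norm_scaleR[of "h \<bullet> b"] by (intro mult_mono Basis_le_norm[OF b]) auto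
      qed
      finally show "norm (frechet_derivative ?f (at x) h) \<le> DIM('a) * ?B * norm h" by (simp add: mult_ac)
    qed
  qed (auto simp: dist_norm norm_minus_commute)
  then show ?case by (simp add: fz mult_ac)
qed

lemma test_function_boundary_decay:
  fixes \<psi> :: "'a::euclidean_space \<Rightarrow> real"
  assumes \<Omega>: "open \<Omega>" "bounded \<Omega>" and \<psi>: "\<psi> \<in> test_functions \<Omega>" and k: "m + DIM('a) \<le> k" and z: "z \<notin> \<Omega>"
  shows "\<bar>\<psi> x\<bar> \<le> sqrt (measure lebesgue \<Omega>) * DIM('a) ^ m * Hk_norm k \<psi> * norm (x - z) ^ m"
proof -
  have "\<bar>iterated_partial [] \<psi> x\<bar> \<le> (sqrt (measure lebesgue \<Omega>) * Hk_norm k \<psi>) * DIM('a) ^ m * norm (x - z) ^ m"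
    by (rule partial_boundary_decay[OF \<psi> z])
      (use partial_sup_le_Hk_norm[OF \<Omega> \<psi>] k Hk_norm_nonneg[of k \<psi>] in auto)
  then show ?thesis by (simp add: mult_ac)
qed

subsection \<open>A dominating family of test functions\<close>

lemma Hs_norm_triangle:
  assumes s: "0 < s" "s \<le> 1" and \<Omega>: "bounded \<Omega>" and u: "u \<in> Hs_vanishing s \<Omega>" and v: "v \<in> Hs_vanishing s \<Omega>"
  shows "Hs_norm s (u + v) \<le> Hs_norm s u + Hs_norm s v"
proof -
  note L = frac_grad_Hs(1)[OF Hs_vanishing_Hs]
  have "L2_norm lebesgue (frac_grad s (u + v)) = L2_norm lebesgue (frac_grad s u + frac_grad s v)"
    by (rule L2_norm_cong_AE_lebesgue) (use Hs_vanishing_add(2)[OF s \<Omega> u v] in simp)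
  also have "\<dots> \<le> L2_norm lebesgue (frac_grad s u) + L2_norm lebesgue (frac_grad s v)"
    by (rule L2_norm_triangle[OF L[OF u] L[OF v]])
  finally have "Hs_norm s (u + v) \<le> sqrt ((L2_norm lebesgue u + L2_norm lebesgue v)\<^sup>2 +
      (L2_norm lebesgue (frac_grad s u) + L2_norm lebesgue (frac_grad s v))\<^sup>2)"
    unfolding Hs_norm_def
    by (intro real_sqrt_le_mono add_mono power_mono L2_norm_nonneg L2_norm_triangle[OF Hs_vanishing_L2[OF u] Hs_vanishing_L2[OF v]])
  also have "\<dots> \<le> Hs_norm s u + Hs_norm s v"
    unfolding Hs_norm_def by (rule real_sqrt_sum_squares_triangle_ineq)
  finally show ?thesis .
qed

lemma Hs_norm_sum_le:
  assumes s: "0 < s" "s \<le> 1" and \<Omega>: "bounded \<Omega>" and u: "\<And>i. i \<in> I \<Longrightarrow> u i \<in> Hs_vanishing s \<Omega>"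
  shows "(\<Sum>i\<in>I. u i) \<in> Hs_vanishing s \<Omega> \<and> Hs_norm s (\<Sum>i\<in>I. u i) \<le> (\<Sum>i\<in>I. Hs_norm s (u i))"
  using u
proof (induction I rule: infinite_finite_induct)
  case (insert i I)
  have IH: "(\<Sum>i\<in>I. u i) \<in> Hs_vanishing s \<Omega>" "Hs_norm s (\<Sum>i\<in>I. u i) \<le> (\<Sum>i\<in>I. Hs_norm s (u i))"
    using insert.IH insert.prems by (simp_all add: insert.hyps)
  have ui: "u i \<in> Hs_vanishing s \<Omega>" using insert.prems by simp
  have "Hs_norm s (u i + (\<Sum>i\<in>I. u i)) \<le> Hs_norm s (u i) + (\<Sum>i\<in>I. Hs_norm s (u i))"
    using Hs_norm_triangle[OF s \<Omega> ui IH(1)] IH(2) by linarith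
  then show ?case
    unfolding sum.insert[OF insert.hyps] using Hs_vanishing_add(1)[OF s \<Omega> ui IH(1)] by blast
qed (simp_all add: Hs_0 Hs_vanishing_def)

text \<open>The mesh carries the factor \<open>1 / DIM('a)\<close> so that rounding every coordinate
  moves a point by at most \<open>1 / 2 ^ j\<close>, already in the sum norm of coordinates.\<close>

definition lattice :: "nat \<Rightarrow> 'a::euclidean_space set" where
  "lattice j = {z. \<forall>b\<in>Basis. \<exists>i::int. z \<bullet> b = of_int i / (real DIM('a) * 2 ^ j)}"

lemma lattice_near:
  fixes x :: "'a::euclidean_space"
  obtains z where "z \<in> lattice j" "norm (x - z) \<le> 1 / 2 ^ j"
proof -
  let ?D = "real DIM('a) * 2 ^ j"
  have D: "?D > 0" by simp
  define z where "z = (\<Sum>b\<in>Basis. (of_int \<lfloor>x \<bullet> b * ?D\<rfloor> / ?D) *\<^sub>R b)"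
  have zb: "z \<bullet> b = of_int \<lfloor>x \<bullet> b * ?D\<rfloor> / ?D" if "b \<in> Basis" for b using that by (simp add: z_def)
  have "norm (x - z) \<le> (\<Sum>b\<in>Basis. \<bar>(x - z) \<bullet> b\<bar>)" by (rule norm_le_l1)
  also have "\<dots> \<le> (\<Sum>b\<in>(Basis::'a set). 1 / ?D)"
  proof (rule sum_mono)
    fix b :: 'a assume b: "b \<in> Basis"
    have "(x - z) \<bullet> b = (x \<bullet> b * ?D - of_int \<lfloor>x \<bullet> b * ?D\<rfloor>) / ?D"
      using D by (simp add: inner_diff_left zb[OF b] diff_divide_distrib)
    moreover have "\<bar>x \<bullet> b * ?D - of_int \<lfloor>x \<bullet> b * ?D\<rfloor>\<bar> \<le> 1" by linarith
    ultimately show "\<bar>(x - z) \<bullet> b\<bar> \<le> 1 / ?D" using D by (simp only: abs_divide) (simp add: divide_right_mono)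
  qed
  also have "\<dots> = 1 / 2 ^ j" by simp
  finally show ?thesis using that[of z] zb by (auto simp: lattice_def)
qed

lemma lattice_card:
  fixes S :: "'a::euclidean_space set"
  assumes S: "S \<subseteq> lattice j" and r: "\<And>z. z \<in> S \<Longrightarrow> norm z \<le> real r" and "1 \<le> r"
  shows "finite S" "real (card S) \<le> (3 * real r * real DIM('a)) ^ DIM('a) * (2 ^ DIM('a)) ^ j"
proof -
  let ?D = "DIM('a) * 2 ^ j"
  define N where "N = r * ?D"
  have N1: "1 \<le> N" using \<open>1 \<le> r\<close> DIM_positive[where 'a = 'a] by (simp add: N_def)
  define Q where "Q = (\<lambda>i. of_int i / real ?D) ` {- int N..int N}"
  have fQ: "finite Q" "card Q \<le> 3 * N"
  proof -
    show "finite Q" by (simp add: Q_def)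
    have "card Q \<le> card {- int N..int N}" unfolding Q_def by (rule card_image_le) simp
    \<comment> \<open>The interval has \<open>2 N + 1\<close> elements, and \<open>N \<ge> 1\<close>
      absorbs the last one.\<close>
    also have "\<dots> \<le> 3 * N" using N1 by simp
    finally show "card Q \<le> 3 * N" .
  qed
  let ?c = "\<lambda>z::'a. restrict (\<lambda>b. z \<bullet> b) Basis"
  have inj: "inj_on ?c S"
  proof (rule inj_onI)
    fix x y assume "?c x = ?c y"
    then have "x \<bullet> b = y \<bullet> b" if "b \<in> Basis" for b using that by (metis restrict_apply')
    then show "x = y" by (rule euclidean_eqI)
  qed
  have sub: "?c ` S \<subseteq> Basis \<rightarrow>\<^sub>E Q"
  proof (safe intro!: restrict_PiE_iff[THEN iffD2] ballI)
    fix z b assume z: "z \<in> S" and b: "b \<in> (Basis::'a set)"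
    obtain i :: int where i: "z \<bullet> b = of_int i / real ?D" using S z b by (auto simp: lattice_def)
    have "\<bar>z \<bullet> b\<bar> \<le> real r" using Basis_le_norm[OF b, of z] r[OF z] by simp
    then have "\<bar>of_int i\<bar> \<le> real r * real ?D" unfolding i by (simp add: abs_divide divide_le_eq)
    also have "\<dots> = real N" by (simp add: N_def)
    finally have "\<bar>i\<bar> \<le> int N" by linarith
    then show "z \<bullet> b \<in> Q" unfolding Q_def i by (intro imageI) auto
  qed
  have fP: "finite (Basis \<rightarrow>\<^sub>E Q :: ('a \<Rightarrow> real) set)" using fQ by (intro finite_PiE) auto
  show "finite S" using inj_on_finite[OF inj sub fP] .
  have "card S \<le> card (Basis \<rightarrow>\<^sub>E Q :: ('a \<Rightarrow> real) set)" by (rule card_inj_on_le[OF inj sub fP])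
  also have "\<dots> = card Q ^ DIM('a)" by (simp add: card_PiE)
  also have "\<dots> \<le> (3 * N) ^ DIM('a)" using fQ by (intro power_mono) auto
  finally have "real (card S) \<le> real ((3 * N) ^ DIM('a))" by (simp only: of_nat_le_iff)
  also have "\<dots> = (3 * real r * real DIM('a)) ^ DIM('a) * (2 ^ DIM('a)) ^ j"
    by (simp add: N_def power_mult_distrib power_mult[symmetric] mult_ac)
  finally show "real (card S) \<le> (3 * real r * real DIM('a)) ^ DIM('a) * (2 ^ DIM('a)) ^ j" .
qed

definition scaled_bump :: "nat \<Rightarrow> 'a::euclidean_space \<Rightarrow> 'a \<Rightarrow> real" where
  "scaled_bump j z x = radial_bump (2 ^ j *\<^sub>R (x - z))"

lemma scaled_bump:
  shows "0 \<le> scaled_bump j z x" "norm (x - z) \<le> 1 / 2 ^ j \<Longrightarrow> 1 \<le> scaled_bump j z x"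
    "cball z (2 / 2 ^ j) \<subseteq> \<Omega> \<Longrightarrow> scaled_bump j z \<in> test_functions \<Omega>"
proof -
  show "0 \<le> scaled_bump j z x" by (simp add: scaled_bump_def radial_bump)
  show "1 \<le> scaled_bump j z x" if "norm (x - z) \<le> 1 / 2 ^ j"
    unfolding scaled_bump_def
  proof (rule radial_bump)
    have "norm (2 ^ j *\<^sub>R (x - z)) = 2 ^ j * norm (x - z)" by (simp only: norm_scaleR) simp
    also have "\<dots> \<le> 2 ^ j * (1 / 2 ^ j)" using that by (intro mult_left_mono) auto
    finally show "norm (2 ^ j *\<^sub>R (x - z)) \<le> 1" by simp
  qed
  show "scaled_bump j z \<in> test_functions \<Omega>" if "cball z (2 / 2 ^ j) \<subseteq> \<Omega>"
  proof (rule test_functionsI[OF _ compact_cball that])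
    have "(\<lambda>x. radial_bump (2 ^ j *\<^sub>R x + - (2 ^ j *\<^sub>R z))) = scaled_bump j z"
      by (simp add: scaled_bump_def fun_eq_iff scaleR_diff_right)
    then show "smooth (scaled_bump j z)" using smooth_affine[OF radial_bump(1)] by metis
    fix x assume "x \<notin> cball z (2 / 2 ^ j)"
    then have "2 / 2 ^ j \<le> norm (x - z)" by (simp add: dist_norm norm_minus_commute)
    then have "2 ^ j * (2 / 2 ^ j) \<le> 2 ^ j * norm (x - z)" by (intro mult_left_mono) auto
    also have "\<dots> = norm (2 ^ j *\<^sub>R (x - z))" by (simp only: norm_scaleR) simp
    finally have "2 \<le> norm (2 ^ j *\<^sub>R (x - z))" by simp
    then show "scaled_bump j z x = 0" unfolding scaled_bump_def by (rule radial_bump)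
  qed
qed

text \<open>All bumps are dilations of a fixed one, so no estimate of the Riesz potential is needed.\<close>

lemma scaled_bump_Hs_norm:
  fixes \<Omega> :: "'a::euclidean_space set"
  assumes \<Omega>: "open \<Omega>" "bounded \<Omega>" and emb: "negative_order_embeddings k \<Omega>" and s: "0 < s" "s \<le> 1"
  obtains C where "0 \<le> C" "\<And>j z. cball z (2 / 2 ^ j) \<subseteq> \<Omega> \<Longrightarrow> Hs_norm s (scaled_bump j z) \<le> C * 2 ^ j"
proof (cases "\<exists>j z. cball z (2 / 2 ^ j) \<subseteq> \<Omega>")
  case False
  then show ?thesis using that[of 0] by auto
next
  case True
  \<comment> \<open>Any bump that fits into \<Omega> serves as the reference: it is a test function,
    hence in \<open>Hs\<close>, and all others are dilated translates of it.\<close>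
  then obtain i w where iw: "cball w (2 / 2 ^ i) \<subseteq> \<Omega>" by blast
  let ?u = "scaled_bump i w"
  have u: "?u \<in> Hs s"
    using test_functions_subset_Hs0[OF \<Omega> emb s scaled_bump(3)[OF iw]] by (simp add: Hs0_def)
  define C where "C = sqrt ((2 ^ i) ^ DIM('a) * (Hs_norm s ?u)\<^sup>2)"
  have "Hs_norm s (scaled_bump j z) \<le> C * 2 ^ j" for j and z :: 'a
  proof (rule power2_le_imp_le)
    define \<mu> :: real where "\<mu> = 2 ^ j / 2 ^ i"
    have \<mu>: "0 < \<mu>" by (simp add: \<mu>_def)
    have eq: "scaled_bump j z = (\<lambda>x. ?u ((w - \<mu> *\<^sub>R z) + \<mu> *\<^sub>R x))"
      by (simp add: scaled_bump_def \<mu>_def fun_eq_iff scaleR_diff_right algebra_simps)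
    have "(Hs_norm s (scaled_bump j z))\<^sup>2 =
        ((L2_norm lebesgue ?u)\<^sup>2 + (\<mu> powr s)\<^sup>2 * (L2_norm lebesgue (frac_grad s ?u))\<^sup>2) / \<mu> ^ DIM('a)"
      unfolding eq by (rule Hs_dilation(2)[OF s u \<mu>])
    also have "\<dots> \<le> (4 ^ j * (L2_norm lebesgue ?u)\<^sup>2 + 4 ^ j * (L2_norm lebesgue (frac_grad s ?u))\<^sup>2) * (2 ^ i) ^ DIM('a)"
    proof -
      \<comment> \<open>For ratios above 1 this uses \<open>s \<le> 1\<close>; for the others the
        power is at most 1.\<close>
      have "\<mu> powr s \<le> 2 ^ j"
      proof (cases "\<mu> \<le> 1")
        case True
        then have "\<mu> powr s \<le> 1" using \<mu> s by (intro powr_le1) auto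
        also have "1 \<le> (2::real) ^ j" by simp
        finally show ?thesis .
      next
        case False
        then have "\<mu> powr s \<le> \<mu> powr 1" using s by (intro powr_mono) auto
        also have "\<dots> \<le> 2 ^ j" using \<mu> by (simp add: \<mu>_def divide_le_eq)
        finally show ?thesis .
      qed
      then have "(\<mu> powr s)\<^sup>2 \<le> (2 ^ j)\<^sup>2" by (intro power_mono) auto
      then have 1: "(\<mu> powr s)\<^sup>2 \<le> 4 ^ j" by (simp add: power2_eq_square power_mult_distrib[symmetric])
      \<comment> \<open>The gain \<open>2^(-j d)\<close> from the small volume of the bump is given
        away; the weights in \<open>dominating_bump\<close> afford it.\<close>
      have 2: "1 / \<mu> ^ DIM('a) \<le> (2 ^ i) ^ DIM('a)"
      proof -
        have "1 / \<mu> \<le> 2 ^ i" by (simp add: \<mu>_def divide_le_eq)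
        then have "(1 / \<mu>) ^ DIM('a) \<le> (2 ^ i) ^ DIM('a)" using \<mu> by (intro power_mono) auto
        then show ?thesis by (simp add: power_divide)
      qed
      have 3: "1 * (L2_norm lebesgue ?u)\<^sup>2 \<le> 4 ^ j * (L2_norm lebesgue ?u)\<^sup>2" by (intro mult_right_mono) auto
      have "((L2_norm lebesgue ?u)\<^sup>2 + (\<mu> powr s)\<^sup>2 * (L2_norm lebesgue (frac_grad s ?u))\<^sup>2) * (1 / \<mu> ^ DIM('a))
        \<le> (4 ^ j * (L2_norm lebesgue ?u)\<^sup>2 + 4 ^ j * (L2_norm lebesgue (frac_grad s ?u))\<^sup>2) * (2 ^ i) ^ DIM('a)"
        using 1 2 3 \<mu> by (intro mult_mono add_mono mult_right_mono add_nonneg_nonneg) auto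
      then show ?thesis by simp
    qed
    also have "\<dots> = (C * 2 ^ j)\<^sup>2"
      by (simp add: C_def Hs_norm_sq power_mult_distrib power2_eq_square[of "2 ^ j"] distrib_left mult_ac flip: power_mult_distrib[of 2 2])
    finally show "(Hs_norm s (scaled_bump j z))\<^sup>2 \<le> (C * 2 ^ j)\<^sup>2" .
  qed (simp add: C_def)
  then show ?thesis using that[of C] by (simp add: C_def)
qed

definition bump_points :: "'a::euclidean_space set \<Rightarrow> nat \<Rightarrow> 'a set" where
  "bump_points \<Omega> j = {z \<in> lattice j. cball z (2 / 2 ^ j) \<subseteq> \<Omega>}"

text \<open>From below a stand-in for the \<open>m\<close>-th power of the distance to the
  complement, with deeper scales resolving points nearer to it. Instead of a Whitney decomposition
  every lattice ball that fits is used at every scale, overlaps included.\<close>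

definition dominating_bump :: "'a::euclidean_space set \<Rightarrow> nat \<Rightarrow> nat \<Rightarrow> 'a \<Rightarrow> real" where
  "dominating_bump \<Omega> m N = (\<Sum>j<N. \<Sum>z\<in>bump_points \<Omega> j. (1 / 2 ^ (j * m)) *\<^sub>R scaled_bump j z)"

lemma dominating_bump_test: "dominating_bump \<Omega> m N \<in> test_functions \<Omega>"
  unfolding dominating_bump_def
  by (intro test_functions_sum test_functions_scaleR scaled_bump) (simp add: bump_points_def)

lemma dominating_bump_apply:
  "dominating_bump \<Omega> m N x = (\<Sum>j<N. \<Sum>z\<in>bump_points \<Omega> j. (1 / 2 ^ (j * m)) * scaled_bump j z x)"
  by (simp add: dominating_bump_def sum_fun_apply)

lemma dominating_bump_nonneg: "0 \<le> dominating_bump \<Omega> m N x"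
  unfolding dominating_bump_apply by (intro sum_nonneg mult_nonneg_nonneg scaled_bump) auto

lemma dominating_bump_mono: "N \<le> N' \<Longrightarrow> dominating_bump \<Omega> m N x \<le> dominating_bump \<Omega> m N' x"
  unfolding dominating_bump_apply
  by (rule sum_mono2) (auto intro!: sum_nonneg divide_nonneg_nonneg scaled_bump)

lemma bump_points_finite:
  fixes \<Omega> :: "'a::euclidean_space set"
  assumes \<Omega>: "bounded \<Omega>"
  obtains r :: nat where "1 \<le> r" "\<And>j. finite (bump_points \<Omega> j)"
    "\<And>j. real (card (bump_points \<Omega> j)) \<le> (3 * real r * real DIM('a)) ^ DIM('a) * (2 ^ DIM('a)) ^ j"
proof -
  obtain R where R: "\<forall>x\<in>\<Omega>. norm x \<le> R" using \<Omega> unfolding bounded_iff by blast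
  obtain r0 :: nat where r0: "R \<le> real r0" using real_arch_simple by blast
  define r where "r = max r0 1"
  have r: "norm z \<le> real r" if "z \<in> bump_points \<Omega> j" for z j
  proof -
    have "z \<in> cball z (2 / 2 ^ j)" by simp
    then have "z \<in> \<Omega>" using that unfolding bump_points_def by blast
    then show ?thesis using R r0 by (force simp: r_def)
  qed
  have sub: "bump_points \<Omega> j \<subseteq> lattice j" for j by (auto simp: bump_points_def)
  have "1 \<le> r" by (simp add: r_def)
  note c = lattice_card[OF sub r this]
  show ?thesis by (rule that[OF \<open>1 \<le> r\<close> c])
qed

text \<open>Scale \<open>j\<close> has at most a multiple of \<open>2^(d j)\<close> bumps of norm at
  most a multiple of \<open>2^j\<close>. The weight \<open>2^(-j (d + 2))\<close> leaves
  \<open>2^-j\<close>, so the triangle inequality alone gives a bound that is uniform in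
  \<open>N\<close>.\<close>

lemma dominating_bump_Hs_norm:
  fixes \<Omega> :: "'a::euclidean_space set"
  assumes \<Omega>: "open \<Omega>" "bounded \<Omega>" and emb: "negative_order_embeddings k \<Omega>" and s: "0 < s" "s \<le> 1"
    and m: "m = DIM('a) + 2"
  obtains C where "\<And>N. Hs_norm s (dominating_bump \<Omega> m N) \<le> C"
proof -
  obtain C where C: "0 \<le> C" "\<And>j z. cball z (2 / 2 ^ j) \<subseteq> \<Omega> \<Longrightarrow> Hs_norm s (scaled_bump j z) \<le> C * 2 ^ j"
    using scaled_bump_Hs_norm[OF \<Omega> emb s] by blast
  obtain r where r: "1 \<le> r" "\<And>j. finite (bump_points \<Omega> j)"
    "\<And>j. real (card (bump_points \<Omega> j)) \<le> (3 * real r * real DIM('a)) ^ DIM('a) * (2 ^ DIM('a)) ^ j"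
    using bump_points_finite[OF \<Omega>(2)] by blast
  define c where "c = (3 * real r * real DIM('a)) ^ DIM('a)"
  have c0: "0 \<le> c" by (simp add: c_def)
  have van: "f \<in> Hs_vanishing s \<Omega>" if "f \<in> test_functions \<Omega>" for f
    using test_functions_subset_Hs0[OF \<Omega> emb s that] that by (intro test_function_vanishing) (auto simp: Hs0_def)
  have t: "(1 / 2 ^ (j * m)) *\<^sub>R scaled_bump j z \<in> test_functions \<Omega>" if "z \<in> bump_points \<Omega> j" for j z
    using that by (intro test_functions_scaleR scaled_bump) (simp add: bump_points_def)
  have layer: "Hs_norm s (\<Sum>z\<in>bump_points \<Omega> j. (1 / 2 ^ (j * m)) *\<^sub>R scaled_bump j z) \<le> c * C * (1/2) ^ j" for j
  proof -
    have "Hs_norm s (\<Sum>z\<in>bump_points \<Omega> j. (1 / 2 ^ (j * m)) *\<^sub>R scaled_bump j z)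
        \<le> (\<Sum>z\<in>bump_points \<Omega> j. Hs_norm s ((1 / 2 ^ (j * m)) *\<^sub>R scaled_bump j z))"
      by (rule conjunct2[OF Hs_norm_sum_le[OF s \<Omega>(2) van[OF t]]])
    also have "\<dots> \<le> (\<Sum>z\<in>bump_points \<Omega> j. (1 / 2 ^ (j * m)) * (C * 2 ^ j))"
    proof (rule sum_mono)
      fix z assume z: "z \<in> bump_points \<Omega> j"
      then have "scaled_bump j z \<in> Hs s"
        using van[OF scaled_bump(3)] by (simp add: bump_points_def Hs_vanishing_def)
      from Hs_scaleR(3)[OF this, of "1 / 2 ^ (j * m)"]
      have "Hs_norm s ((1 / 2 ^ (j * m)) *\<^sub>R scaled_bump j z) = (1 / 2 ^ (j * m)) * Hs_norm s (scaled_bump j z)" by simp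
      also have "\<dots> \<le> (1 / 2 ^ (j * m)) * (C * 2 ^ j)"
        using z by (intro mult_left_mono C) (auto simp: bump_points_def)
      finally show "Hs_norm s ((1 / 2 ^ (j * m)) *\<^sub>R scaled_bump j z) \<le> (1 / 2 ^ (j * m)) * (C * 2 ^ j)" .
    qed
    also have "\<dots> = real (card (bump_points \<Omega> j)) * ((1 / 2 ^ (j * m)) * (C * 2 ^ j))" by simp
    also have "\<dots> \<le> (c * (2 ^ DIM('a)) ^ j) * ((1 / 2 ^ (j * m)) * (C * 2 ^ j))"
      using r(3)[of j] C(1) unfolding c_def by (intro mult_right_mono) auto
    also have "\<dots> = c * C * (1/2) ^ j"
    proof -
      have "(2::real) ^ (j * m) = (2 ^ DIM('a)) ^ j * 2 ^ j * 2 ^ j"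
        by (simp add: m power_mult[symmetric] power_add[symmetric] algebra_simps)
      then show ?thesis by (simp add: power_divide)
    qed
    finally show ?thesis .
  qed
  have "Hs_norm s (dominating_bump \<Omega> m N) \<le> c * C * 2" for N
  proof -
    have "Hs_norm s (dominating_bump \<Omega> m N) \<le> (\<Sum>j<N. Hs_norm s (\<Sum>z\<in>bump_points \<Omega> j. (1 / 2 ^ (j * m)) *\<^sub>R scaled_bump j z))"
      unfolding dominating_bump_def
      by (rule conjunct2[OF Hs_norm_sum_le[OF s \<Omega>(2) van[OF test_functions_sum[OF t]]]])
    also have "\<dots> \<le> (\<Sum>j<N. c * C * (1/2) ^ j)" by (intro sum_mono layer)
    also have "\<dots> = c * C * (\<Sum>j<N. (1/2) ^ j)" by (simp add: sum_distrib_left)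
    also have "\<dots> \<le> c * C * 2"
    proof -
      have "(\<Sum>j<N. (1/2::real) ^ j) \<le> (\<Sum>j. (1/2) ^ j)" by (intro sum_le_suminf summable_geometric) auto
      then show ?thesis using c0 C(1) by (intro mult_left_mono) (auto simp: suminf_geometric)
    qed
    finally show ?thesis .
  qed
  then show ?thesis by (rule that)
qed

lemma dominating_bump_dominates:
  fixes \<Omega> :: "'a::euclidean_space set"
  assumes \<Omega>: "open \<Omega>" "bounded \<Omega>" and k: "m + DIM('a) \<le> k"
  obtains C where "0 \<le> C"
    "\<And>\<psi>. \<psi> \<in> test_functions \<Omega> \<Longrightarrow> \<exists>N. \<forall>x. \<bar>\<psi> x\<bar> \<le> C * Hk_norm k \<psi> * dominating_bump \<Omega> m N x"
proof -
  obtain R where R: "R > 0" "\<And>x. x \<in> \<Omega> \<Longrightarrow> norm x \<le> R" using \<Omega>(2) unfolding bounded_pos by blast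
  \<comment> \<open>It has to cover two cases: \<open>2 R + 1\<close>, the largest distance to
    \<open>y0\<close>, at scale 0, and 6, from the failure of the preceding scale, at all
    others.\<close>
  define Q where "Q = 2 * R + 7"
  have Q: "0 < Q" using R(1) by (simp add: Q_def)
  define M where "M = sqrt (measure lebesgue \<Omega>) * DIM('a) ^ m"
  have M0: "0 \<le> M" by (simp add: M_def)
  obtain b0 :: 'a where b0: "b0 \<in> Basis" using nonempty_Basis by blast
  \<comment> \<open>A concrete point outside \<Omega>: it makes the complement nonempty, so that a
    nearest point exists, and bounds the distance to it.\<close>
  define y0 where "y0 = (R + 1) *\<^sub>R b0"
  have y0: "y0 \<notin> \<Omega>" "norm y0 = R + 1" using R b0 by (auto simp: y0_def dest!: R(2))
  have main: "\<exists>N. \<forall>x. \<bar>\<psi> x\<bar> \<le> (M * Q ^ m) * Hk_norm k \<psi> * dominating_bump \<Omega> m N x"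
    if \<psi>: "\<psi> \<in> test_functions \<Omega>" for \<psi>
  proof -
    obtain K where K: "compact K" "K \<subseteq> \<Omega>" "\<And>x. x \<notin> K \<Longrightarrow> \<psi> x = 0" using \<psi> by (rule test_functionsE) blast
    \<comment> \<open>The support of \<psi> keeps a positive distance from the complement, so
      finitely many scales suffice; their number depends on \<psi>, the constant in the bound does
      not.\<close>
    obtain \<delta> where \<delta>: "\<delta> > 0" "\<And>x y. x \<in> K \<Longrightarrow> y \<in> - \<Omega> \<Longrightarrow> \<delta> \<le> dist x y"
    proof -
      have "closed (- \<Omega>)" "K \<inter> - \<Omega> = {}" using \<Omega>(1) K(2) by (auto simp: closed_Compl)
      from separate_compact_closed[OF K(1) this] show ?thesis using that by blast
    qed
    obtain J where J: "3 / 2 ^ J < \<delta>"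
    proof -
      obtain J where "(1/2) ^ J < \<delta> / 3" using real_arch_pow_inv[of "\<delta> / 3" "1/2"] \<delta>(1) by auto
      then show ?thesis using that[of J] by (simp add: power_divide field_simps)
    qed
    have "\<bar>\<psi> x\<bar> \<le> (M * Q ^ m) * Hk_norm k \<psi> * dominating_bump \<Omega> m (Suc J) x" for x
    proof (cases "x \<in> K")
      case False
      then show ?thesis using K(3) M0 Q by (simp add: Hk_norm_nonneg dominating_bump_nonneg)
    next
      case True
      obtain z where z: "z \<in> - \<Omega>" "\<And>y. y \<in> - \<Omega> \<Longrightarrow> dist x z \<le> dist x y"
        using distance_attains_inf[of "- \<Omega>" x] \<Omega>(1) y0(1) by (auto simp: closed_Compl)
      \<comment> \<open>The 3 adds the distance 1 from \<open>x\<close> to the lattice point and the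
        support radius 2, in units of \<open>2^-j\<close>. The first scale with this property is
        comparable to the distance of \<open>x\<close> from the complement.\<close>
      define P where "P j \<longleftrightarrow> 3 / 2 ^ j < dist x z" for j :: nat
      have PJ: "P J" using J \<delta>(2)[OF True z(1)] by (simp add: P_def)
      define j where "j = (LEAST j. P j)"
      have Pj: "P j" unfolding j_def using PJ by (rule LeastI)
      have jJ: "j \<le> J" unfolding j_def using PJ by (rule Least_le)
      have dz: "dist x z \<le> Q / 2 ^ j"
      proof (cases j)
        case 0
        have "dist x z \<le> dist x y0" using y0(1) by (intro z(2)) simp
        also have "\<dots> \<le> norm x + norm y0" unfolding dist_norm by (rule norm_triangle_ineq4)
        also have "\<dots> \<le> Q" using R(2)[of x] True K(2) y0(2) by (auto simp: Q_def)
        finally show ?thesis using 0 by simp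
      next
        case (Suc i)
        then have "\<not> P i" unfolding j_def using not_less_Least[of i P] by simp
        then have "dist x z \<le> 6 / 2 ^ j" using Suc by (simp add: P_def field_simps)
        also have "\<dots> \<le> Q / 2 ^ j" using R(1) by (intro divide_right_mono) (auto simp: Q_def)
        finally show ?thesis .
      qed
      obtain w where w: "w \<in> lattice j" "norm (x - w) \<le> 1 / 2 ^ j" by (rule lattice_near)
      have wB: "w \<in> bump_points \<Omega> j"
      proof -
        have "y \<in> \<Omega>" if y: "y \<in> cball w (2 / 2 ^ j)" for y
        proof (rule ccontr)
          assume "y \<notin> \<Omega>"
          then have "dist x z \<le> dist x y" by (intro z(2)) simp
          also have "\<dots> \<le> dist x w + dist w y" by (rule dist_triangle)
          also have "\<dots> \<le> 1 / 2 ^ j + 2 / 2 ^ j" using w(2) y by (intro add_mono) (auto simp: dist_norm)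
          finally show False using Pj by (simp add: P_def)
        qed
        then show ?thesis using w(1) by (auto simp: bump_points_def)
      qed
      have fin: "finite (bump_points \<Omega> i)" for i using bump_points_finite[OF \<Omega>(2)] by blast
      have "1 / 2 ^ (j * m) \<le> (1 / 2 ^ (j * m)) * scaled_bump j w x"
        using scaled_bump(2)[OF w(2)] by (simp add: divide_right_mono)
      also have "\<dots> \<le> (\<Sum>z\<in>bump_points \<Omega> j. (1 / 2 ^ (j * m)) * scaled_bump j z x)"
        by (rule member_le_sum[OF wB _ fin, where f = "\<lambda>z. (1 / 2 ^ (j * m)) * scaled_bump j z x"]) (simp add: scaled_bump)
      also have "\<dots> \<le> dominating_bump \<Omega> m (Suc J) x"
        unfolding dominating_bump_apply
        by (rule member_le_sum[where f = "\<lambda>j. \<Sum>z\<in>bump_points \<Omega> j. (1 / 2 ^ (j * m)) * scaled_bump j z x"])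
          (use jJ in \<open>auto intro!: sum_nonneg simp: scaled_bump\<close>)
      finally have lower: "1 / 2 ^ (j * m) \<le> dominating_bump \<Omega> m (Suc J) x" .
      have "\<bar>\<psi> x\<bar> \<le> M * Hk_norm k \<psi> * norm (x - z) ^ m"
        unfolding M_def using test_function_boundary_decay[OF \<Omega> \<psi> k, of z x] z(1) by simp
      also have "\<dots> \<le> M * Hk_norm k \<psi> * (Q / 2 ^ j) ^ m"
        using dz M0 by (intro mult_left_mono power_mono mult_nonneg_nonneg) (auto simp: dist_norm Hk_norm_nonneg)
      also have "\<dots> = (M * Q ^ m) * Hk_norm k \<psi> * (1 / 2 ^ (j * m))"
        by (simp add: power_divide power_mult)
      also have "\<dots> \<le> (M * Q ^ m) * Hk_norm k \<psi> * dominating_bump \<Omega> m (Suc J) x"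
        using lower M0 Q by (intro mult_left_mono mult_nonneg_nonneg) (auto simp: Hk_norm_nonneg)
      finally show ?thesis .
    qed
    then show ?thesis by blast
  qed
  show ?thesis by (rule that[OF _ main]) (use M0 Q in auto)
qed


subsection \<open>Bochner spaces\<close>

lemma finite_measure_time: "finite_measure (time t)"
  by (intro finite_measure_lebesgue_on) simp

lemma integrable_time_const: "integrable (time t) (\<lambda>_. c :: real)"
  by (intro finite_measure.integrable_const finite_measure_time)

lemma measure_time: "0 \<le> t \<Longrightarrow> measure (time t) {0..t} = t"
  by (simp add: measure_restrict_space)

lemma sets_time: "{0..t::real} \<in> sets lebesgue"
  by simp

lemma simple_function_time_mono:
  assumes "t \<le> T" "simple_function (time T) \<sigma>" shows "simple_function (time t) \<sigma>"
  unfolding simple_function_def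
proof (intro conjI ballI)
  have sub: "space (time t) \<subseteq> space (time T)" using assms(1) by auto
  show "finite (\<sigma> ` space (time t))"
    by (rule finite_subset[OF image_mono[OF sub] simple_functionD(1)[OF assms(2)]])
  fix x
  have "\<sigma> -` {x} \<inter> space (time T) \<in> sets (time T)" using simple_functionD(2)[OF assms(2)] by blast
  then have "(\<sigma> -` {x} \<inter> {0..T}) \<inter> {0..t} \<in> sets lebesgue"
    using sets_restrict_space_iff[of "{0..T}" lebesgue] by auto
  moreover have "(\<sigma> -` {x} \<inter> {0..T}) \<inter> {0..t} = \<sigma> -` {x} \<inter> {0..t}" using assms(1) by auto
  ultimately show "\<sigma> -` {x} \<inter> space (time t) \<in> sets (time t)"
    using sets_restrict_space_iff[of "{0..t}" lebesgue "\<sigma> -` {x} \<inter> {0..t}"] by auto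
qed

lemma AE_time_mono: "t \<le> T \<Longrightarrow> AE \<tau> in time T. P \<tau> \<Longrightarrow> AE \<tau> in time t. P \<tau>"
  unfolding AE_lebesgue_on_iff[OF sets_time] by (auto elim!: eventually_mono)

lemma strongly_measurable_time_mono:
  assumes "t \<le> T" "strongly_measurable (time T) X N f" shows "strongly_measurable (time t) X N f"
proof -
  obtain \<sigma> where \<sigma>: "\<And>n. simple_function (time T) (\<sigma> n)" "\<And>n. \<sigma> n ` space (time T) \<subseteq> X"
    "AE \<tau> in time T. f \<tau> \<in> X \<and> (\<lambda>n. N (\<sigma> n \<tau> - f \<tau>)) \<longlonglongrightarrow> 0"
    using assms(2) unfolding strongly_measurable_def by blast
  have "simple_function (time t) (\<sigma> n)" for n by (rule simple_function_time_mono[OF assms(1) \<sigma>(1)])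
  moreover have "\<sigma> n ` space (time t) \<subseteq> X" for n using \<sigma>(2)[of n] assms(1) by force
  ultimately show ?thesis unfolding strongly_measurable_def using AE_time_mono[OF assms(1) \<sigma>(3)] by blast
qed

lemma strongly_measurable_weaken:
  assumes f: "strongly_measurable M X N f" and X: "X \<subseteq> Y"
    and N: "\<And>x y. x \<in> X \<Longrightarrow> y \<in> X \<Longrightarrow> 0 \<le> N' (x - y) \<and> N' (x - y) \<le> N (x - y)"
  shows "strongly_measurable M Y N' f"
proof -
  obtain \<sigma> where \<sigma>: "\<And>n. simple_function M (\<sigma> n)" "\<And>n. \<sigma> n ` space M \<subseteq> X"
    "AE \<tau> in M. f \<tau> \<in> X \<and> (\<lambda>n. N (\<sigma> n \<tau> - f \<tau>)) \<longlonglongrightarrow> 0"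
    using f unfolding strongly_measurable_def by blast
  have "AE \<tau> in M. f \<tau> \<in> Y \<and> (\<lambda>n. N' (\<sigma> n \<tau> - f \<tau>)) \<longlonglongrightarrow> 0"
    using \<sigma>(3) AE_space
  proof eventually_elim
    case (elim \<tau>)
    have bd: "norm (N' (\<sigma> n \<tau> - f \<tau>)) \<le> N (\<sigma> n \<tau> - f \<tau>)" for n
    proof -
      have "\<sigma> n \<tau> \<in> X" using \<sigma>(2)[of n] elim(2) by blast
      then show ?thesis using N[of "\<sigma> n \<tau>" "f \<tau>"] elim(1) by simp
    qed
    have lim: "(\<lambda>n. N (\<sigma> n \<tau> - f \<tau>)) \<longlonglongrightarrow> 0" using elim by blast
    have "(\<lambda>n. N' (\<sigma> n \<tau> - f \<tau>)) \<longlonglongrightarrow> 0"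
      by (rule Lim_null_comparison[OF always_eventually[OF allI[OF bd]] lim])
    then show ?case using elim X by blast
  qed
  then show ?thesis unfolding strongly_measurable_def using \<sigma>(1,2) X by blast
qed

text \<open>A Lipschitz functional passes to the limit along simple functions, and completeness
  absorbs the exceptional times. \<open>G\<close> is not assumed linear: norms and penalty integrals
  are among its uses.\<close>

lemma strongly_measurable_functional:
  fixes G :: "'b::real_vector \<Rightarrow> real"
  assumes f: "strongly_measurable (time t) X N f"
    and G: "\<And>x y. x \<in> X \<Longrightarrow> y \<in> X \<Longrightarrow> \<bar>G x - G y\<bar> \<le> C * N (x - y)"
  shows "(\<lambda>\<tau>. G (f \<tau>)) \<in> borel_measurable (time t)"
proof -
  obtain \<sigma> where \<sigma>: "\<And>n. simple_function (time t) (\<sigma> n)" "\<And>n. \<sigma> n ` space (time t) \<subseteq> X"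
    "AE \<tau> in time t. f \<tau> \<in> X \<and> (\<lambda>n. N (\<sigma> n \<tau> - f \<tau>)) \<longlonglongrightarrow> 0"
    using f unfolding strongly_measurable_def by blast
  have "AE \<tau> in time t. lim (\<lambda>n. G (\<sigma> n \<tau>)) = G (f \<tau>)"
    using \<sigma>(3) AE_space
  proof eventually_elim
    case (elim \<tau>)
    have bd: "norm (G (\<sigma> n \<tau>) - G (f \<tau>)) \<le> C * N (\<sigma> n \<tau> - f \<tau>)" for n
    proof -
      have "\<sigma> n \<tau> \<in> X" using \<sigma>(2)[of n] elim(2) by blast
      then show ?thesis using G[of "\<sigma> n \<tau>" "f \<tau>"] elim(1) by simp
    qed
    have lim: "(\<lambda>n. C * N (\<sigma> n \<tau> - f \<tau>)) \<longlonglongrightarrow> 0" using elim by (intro tendsto_mult_right_zero) blast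
    have "(\<lambda>n. G (\<sigma> n \<tau>) - G (f \<tau>)) \<longlonglongrightarrow> 0"
      by (rule Lim_null_comparison[OF always_eventually[OF allI[OF bd]] lim])
    then show ?case by (rule limI[OF LIM_zero_cancel])
  qed
  moreover have "(\<lambda>\<tau>. lim (\<lambda>n. G (\<sigma> n \<tau>))) \<in> borel_measurable (time t)"
    by (rule borel_measurable_lim_metric[OF borel_measurable_simple_function[OF simple_function_compose1[OF \<sigma>(1)]]])
  ultimately show ?thesis by (rule borel_measurable_cong_AE_lebesgue_on[OF sets_time])
qed

lemma bochner_L2_functional_integrable:
  fixes G :: "'b::real_vector \<Rightarrow> real"
  assumes f: "f \<in> bochner_L2 t X N"
    and G: "\<And>x y. x \<in> X \<Longrightarrow> y \<in> X \<Longrightarrow> \<bar>G x - G y\<bar> \<le> C * N (x - y)" and G0: "\<And>x. x \<in> X \<Longrightarrow> \<bar>G x\<bar> \<le> C' * N x"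
  shows "integrable (time t) (\<lambda>\<tau>. G (f \<tau>))"
proof (rule Bochner_Integration.integrable_bound)
  have f': "strongly_measurable (time t) X N f" "integrable (time t) (\<lambda>\<tau>. (N (f \<tau>))\<^sup>2)"
    using f by (auto simp: bochner_L2_def)
  show "integrable (time t) (\<lambda>\<tau>. C'\<^sup>2 + (N (f \<tau>))\<^sup>2)"
    using f'(2) integrable_time_const by (intro Bochner_Integration.integrable_add)
  show "(\<lambda>\<tau>. G (f \<tau>)) \<in> borel_measurable (time t)"
    by (rule strongly_measurable_functional[OF f'(1) G])
  have "AE \<tau> in time t. f \<tau> \<in> X" using f'(1) unfolding strongly_measurable_def by (auto elim!: eventually_mono)
  then show "AE \<tau> in time t. norm (G (f \<tau>)) \<le> norm (C'\<^sup>2 + (N (f \<tau>))\<^sup>2)"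
  proof eventually_elim
    case (elim \<tau>)
    have "C' * N (f \<tau>) \<le> C'\<^sup>2 + (N (f \<tau>))\<^sup>2"
      using sum_squares_bound[of C' "N (f \<tau>)"] sum_power2_ge_zero[of C' "N (f \<tau>)"] by linarith
    then show ?case using G0[OF elim] by simp
  qed
qed

lemma bochner_L1_functional_integrable:
  fixes G :: "'b::real_vector \<Rightarrow> real"
  assumes f: "f \<in> bochner_L1 t X N"
    and G: "\<And>x y. x \<in> X \<Longrightarrow> y \<in> X \<Longrightarrow> \<bar>G x - G y\<bar> \<le> C * N (x - y)" and G0: "\<And>x. x \<in> X \<Longrightarrow> \<bar>G x\<bar> \<le> C' * N x"
  shows "integrable (time t) (\<lambda>\<tau>. G (f \<tau>))"
proof (rule Bochner_Integration.integrable_bound)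
  have f': "strongly_measurable (time t) X N f" "integrable (time t) (\<lambda>\<tau>. N (f \<tau>))"
    using f by (auto simp: bochner_L1_def)
  show "integrable (time t) (\<lambda>\<tau>. C' * N (f \<tau>))" using f'(2) by simp
  show "(\<lambda>\<tau>. G (f \<tau>)) \<in> borel_measurable (time t)"
    by (rule strongly_measurable_functional[OF f'(1) G])
  have "AE \<tau> in time t. f \<tau> \<in> X" using f'(1) unfolding strongly_measurable_def by (auto elim!: eventually_mono)
  then show "AE \<tau> in time t. norm (G (f \<tau>)) \<le> norm (C' * N (f \<tau>))"
    by eventually_elim (use G0 in \<open>force simp del: abs_mult\<close>)
qed

lemma strongly_measurable_const:
  assumes "x \<in> X" "N 0 = 0" shows "strongly_measurable M X N (\<lambda>_. x)"
  unfolding strongly_measurable_def using assms by (intro exI[of _ "\<lambda>n _. x"]) auto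

lemma bochner_const:
  assumes "x \<in> X" "N 0 = 0"
  shows "(\<lambda>_. x) \<in> bochner_L1 t X N" "(\<lambda>_. x) \<in> bochner_L2 t X N"
  unfolding bochner_L1_def bochner_L2_def
  using strongly_measurable_const[of x X N, OF assms] integrable_time_const by auto

lemma strongly_measurable_scaleR:
  assumes f: "strongly_measurable M X N f" and X: "\<And>x. x \<in> X \<Longrightarrow> c *\<^sub>R x \<in> X"
    and N: "\<And>x y. x \<in> X \<Longrightarrow> y \<in> X \<Longrightarrow> N (c *\<^sub>R (x - y)) = \<bar>c\<bar> * N (x - y)"
  shows "strongly_measurable M X N (\<lambda>\<tau>. c *\<^sub>R f \<tau>)"
proof -
  obtain \<sigma> where \<sigma>: "\<And>n. simple_function M (\<sigma> n)" "\<And>n. \<sigma> n ` space M \<subseteq> X"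
    "AE \<tau> in M. f \<tau> \<in> X \<and> (\<lambda>n. N (\<sigma> n \<tau> - f \<tau>)) \<longlonglongrightarrow> 0"
    using f unfolding strongly_measurable_def by blast
  have "AE \<tau> in M. c *\<^sub>R f \<tau> \<in> X \<and> (\<lambda>n. N (c *\<^sub>R \<sigma> n \<tau> - c *\<^sub>R f \<tau>)) \<longlonglongrightarrow> 0"
    using \<sigma>(3) AE_space
  proof eventually_elim
    case (elim \<tau>)
    have "N (c *\<^sub>R \<sigma> n \<tau> - c *\<^sub>R f \<tau>) = \<bar>c\<bar> * N (\<sigma> n \<tau> - f \<tau>)" for n
    proof -
      have "\<sigma> n \<tau> \<in> X" using \<sigma>(2)[of n] elim(2) by blast
      then show ?thesis using N[of "\<sigma> n \<tau>" "f \<tau>"] elim(1) by (simp add: scaleR_diff_right)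
    qed
    then show ?case using elim X by (auto intro: tendsto_mult_right_zero)
  qed
  moreover have "simple_function M (\<lambda>\<tau>. c *\<^sub>R \<sigma> n \<tau>)" for n by (rule simple_function_compose1[OF \<sigma>(1)])
  moreover have "(\<lambda>\<tau>. c *\<^sub>R \<sigma> n \<tau>) ` space M \<subseteq> X" for n using \<sigma>(2)[of n] X by blast
  ultimately show ?thesis unfolding strongly_measurable_def by (intro exI[of _ "\<lambda>n \<tau>. c *\<^sub>R \<sigma> n \<tau>"]) blast
qed

text \<open>The fixed factor comes first, so that \<open>pairing S h\<close> is a functional of the
  varying function.\<close>

definition pairing :: "'a::euclidean_space set \<Rightarrow> ('a \<Rightarrow> real) \<Rightarrow> ('a \<Rightarrow> real) \<Rightarrow> real" where
  "pairing S h x = (LINT \<xi>|lebesgue_on S. x \<xi> * h \<xi>)"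

lemma pairing_integrable: "x \<in> L2_on S \<Longrightarrow> h \<in> L2_on S \<Longrightarrow> integrable (lebesgue_on S) (\<lambda>\<xi>. x \<xi> * h \<xi>)"
  using L2_inner_integrable[of x "lebesgue_on S" h] by simp

lemma pairing_bound: "x \<in> L2_on S \<Longrightarrow> h \<in> L2_on S \<Longrightarrow> \<bar>pairing S h x\<bar> \<le> L2_on_norm S h * L2_on_norm S x"
  using L2_Cauchy_Schwarz[of x "lebesgue_on S" h] by (simp add: pairing_def mult.commute)

lemma pairing_add: "x \<in> L2_on S \<Longrightarrow> y \<in> L2_on S \<Longrightarrow> h \<in> L2_on S \<Longrightarrow> pairing S h (x + y) = pairing S h x + pairing S h y"
  using pairing_integrable[of x S h] pairing_integrable[of y S h] by (simp add: pairing_def distrib_right)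

lemma pairing_diff: "x \<in> L2_on S \<Longrightarrow> y \<in> L2_on S \<Longrightarrow> h \<in> L2_on S \<Longrightarrow> pairing S h (x - y) = pairing S h x - pairing S h y"
  using pairing_integrable[of x S h] pairing_integrable[of y S h] by (simp add: pairing_def left_diff_distrib)

lemma pairing_scaleR: "pairing S h (c *\<^sub>R x) = c * pairing S h x"
  by (simp add: pairing_def mult.assoc)

lemma pairing_dual_L2:
  assumes "h \<in> L2_on S" shows "pairing S h \<in> dual_on (L2_on S) (L2_on_norm S)"
  unfolding dual_on_def using assms pairing_bound pairing_add pairing_scaleR by blast

lemma Hs0_L2: "u \<in> Hs0 s \<Omega> \<Longrightarrow> u \<in> L2_space lebesgue"
  by (simp add: Hs0_def Hs_def)

lemma L2_on_norm_le_Hs_norm: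
  assumes "S \<in> sets lebesgue" "u \<in> L2_space lebesgue"
  shows "L2_on_norm S u \<le> Hs_norm s u"
  using L2_space_restrict(2)[OF assms] L2_norm_le_Hs_norm[of u s] by linarith

lemma pairing_dual_Hs0:
  assumes S: "S \<in> sets lebesgue" and h: "h \<in> L2_on S"
  shows "pairing S h \<in> dual_on (Hs0 s \<Omega>) (Hs_norm s)"
  unfolding dual_on_def
proof (intro CollectI conjI ballI allI exI)
  fix x y assume "x \<in> Hs0 s \<Omega>" "y \<in> Hs0 s \<Omega>"
  then show "pairing S h (x + y) = pairing S h x + pairing S h y"
    by (intro pairing_add h L2_space_restrict(1)[OF S] Hs0_L2)
next
  fix x assume x: "x \<in> Hs0 s \<Omega>"
  have "\<bar>pairing S h x\<bar> \<le> L2_on_norm S h * L2_on_norm S x"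
    by (intro pairing_bound h L2_space_restrict(1)[OF S] Hs0_L2[OF x])
  also have "\<dots> \<le> L2_on_norm S h * Hs_norm s x"
    by (intro mult_left_mono L2_on_norm_le_Hs_norm S Hs0_L2[OF x] L2_norm_nonneg)
  finally show "\<bar>pairing S h x\<bar> \<le> L2_on_norm S h * Hs_norm s x" .
qed (rule pairing_scaleR)

lemma pairing_integrable_L2:
  assumes f: "f \<in> bochner_L1 t (L2_on S) (L2_on_norm S)" and h: "h \<in> L2_on S"
  shows "integrable (time t) (\<lambda>\<tau>. pairing S h (f \<tau>))"
  by (rule bochner_L1_functional_integrable[OF f, of _ "L2_on_norm S h" "L2_on_norm S h"])
    (use h in \<open>auto intro!: pairing_bound L2_space_diff simp: pairing_diff[symmetric]\<close>)

lemma strongly_measurable_Hs0_L2: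
  assumes S: "S \<in> sets lebesgue" and f: "strongly_measurable M (Hs0 s \<Omega>) (Hs_norm s) f"
  shows "strongly_measurable M (L2_on S) (L2_on_norm S) f"
proof (rule strongly_measurable_weaken[OF f])
  show "Hs0 s \<Omega> \<subseteq> L2_on S" using Hs0_L2 L2_space_restrict(1)[OF S] by blast
  fix x y assume "x \<in> Hs0 s \<Omega>" "y \<in> Hs0 s \<Omega>"
  then have "x - y \<in> L2_space lebesgue" by (intro L2_space_diff Hs0_L2)
  then show "0 \<le> L2_on_norm S (x - y) \<and> L2_on_norm S (x - y) \<le> Hs_norm s (x - y)"
    using L2_on_norm_le_Hs_norm[OF S] L2_norm_nonneg by blast
qed

lemma bochner_L1_Hs0_L2:
  assumes S: "S \<in> sets lebesgue" and f: "f \<in> bochner_L1 t (Hs0 s \<Omega>) (Hs_norm s)"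
  shows "f \<in> bochner_L1 t (L2_on S) (L2_on_norm S)"
proof -
  have f': "strongly_measurable (time t) (Hs0 s \<Omega>) (Hs_norm s) f" "integrable (time t) (\<lambda>\<tau>. Hs_norm s (f \<tau>))"
    using f by (auto simp: bochner_L1_def)
  have m: "strongly_measurable (time t) (L2_on S) (L2_on_norm S) f" by (rule strongly_measurable_Hs0_L2[OF S f'(1)])
  have "(\<lambda>\<tau>. L2_on_norm S (f \<tau>)) \<in> borel_measurable (time t)"
    by (rule strongly_measurable_functional[OF m, of _ 1]) (simp add: L2_norm_triangle_diff)
  moreover have "AE \<tau> in time t. norm (L2_on_norm S (f \<tau>)) \<le> norm (Hs_norm s (f \<tau>))"
  proof -
    have "AE \<tau> in time t. f \<tau> \<in> Hs0 s \<Omega>" using f'(1) unfolding strongly_measurable_def by (auto elim!: eventually_mono)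
    then show ?thesis
      by eventually_elim (simp add: L2_norm_nonneg Hs_norm_nonneg L2_on_norm_le_Hs_norm[OF S Hs0_L2])
  qed
  ultimately have "integrable (time t) (\<lambda>\<tau>. L2_on_norm S (f \<tau>))"
    by (intro Bochner_Integration.integrable_bound[OF f'(2)])
  with m show ?thesis by (simp add: bochner_L1_def)
qed

subsection \<open>Uniqueness of weak time derivatives\<close>

lemma test_function_outside: "\<theta> \<in> test_functions U \<Longrightarrow> x \<notin> U \<Longrightarrow> \<theta> x = 0"
  by (elim test_functionsE) blast

lemma time_integral_test:
  fixes \<theta> g :: "real \<Rightarrow> real"
  assumes \<theta>: "\<theta> \<in> test_functions {0<..<t}" and t: "t \<le> T"
  shows "(LINT \<tau>|time T. \<theta> \<tau> * g \<tau>) = (LINT \<tau>|lebesgue. \<theta> \<tau> * g \<tau>)"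
proof -
  have e: "indicator {0..T} \<tau> *\<^sub>R (\<theta> \<tau> * g \<tau>) = \<theta> \<tau> * g \<tau>" for \<tau>
    using test_function_outside[OF \<theta>, of \<tau>] t by (cases "\<tau> \<in> {0..T}") auto
  show ?thesis by (subst integral_restrict_space) (simp, simp only: e)
qed

lemma fundamental_lemma_time:
  assumes g: "integrable (time t) g" and 0: "\<And>\<theta>. \<theta> \<in> test_functions {0<..<t} \<Longrightarrow> (LINT \<tau>|time t. \<theta> \<tau> * g \<tau>) = 0"
  shows "AE \<tau> in time t. g \<tau> = (0::real)"
proof -
  have gi: "integrable lebesgue (\<lambda>x. indicator {0..t} x *\<^sub>R g x)"
    using g by (subst (asm) integrable_restrict_space) auto
  have "AE x in lebesgue. x \<in> {0<..<t} \<longrightarrow> g x = 0"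
  proof (rule fundamental_lemma)
    fix a b :: real assume ab: "cbox a b \<subseteq> {0<..<t}"
    have "integrable lebesgue (\<lambda>x. indicator (cbox a b) x *\<^sub>R (indicator {0..t} x *\<^sub>R g x))"
      by (rule integrable_mult_indicator[OF _ gi]) simp
    moreover have e: "indicator (cbox a b) x *\<^sub>R (indicator {0..t} x *\<^sub>R g x) = indicator (cbox a b) x * g x" for x
    proof (cases "x \<in> cbox a b")
      case True
      then have "x \<in> {0<..<t}" using ab by blast
      then show ?thesis by simp
    qed simp
    ultimately show "integrable lebesgue (\<lambda>x. indicator (cbox a b) x * g x)" unfolding e by blast
  next
    fix \<theta> :: "real \<Rightarrow> real" assume \<theta>: "\<theta> \<in> test_functions {0<..<t}"
    show "(LINT x|lebesgue. \<theta> x * g x) = 0" using 0[OF \<theta>] time_integral_test[OF \<theta> order_refl] by simp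
  qed simp
  moreover have "AE x in lebesgue. x \<notin> {0, t}"
    using negligible_finite[of "{0, t}"] unfolding negligible_iff_null_sets by (intro AE_not_in) simp
  ultimately show ?thesis unfolding AE_lebesgue_on_iff[OF sets_time] by eventually_elim force
qed

text \<open>The functions take values in the closure of a countable set \<open>H\<close>, which suffices for testing.\<close>

lemma weak_deriv_unique:
  fixes v w :: "real \<Rightarrow> 'a::euclidean_space \<Rightarrow> real"
  assumes S: "S \<in> sets lebesgue"
    and v: "v \<in> bochner_L1 t (L2_on S) (L2_on_norm S)" and w: "w \<in> bochner_L1 t (L2_on S) (L2_on_norm S)"
    and eq: "\<And>h \<theta>. h \<in> L2_on S \<Longrightarrow> \<theta> \<in> test_functions {0<..<t} \<Longrightarrow>
      (LINT \<tau>|time t. \<theta> \<tau> * pairing S h (v \<tau>)) = (LINT \<tau>|time t. \<theta> \<tau> * pairing S h (w \<tau>))"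
  shows "AE \<tau> in time t. AE x in lebesgue_on S. v \<tau> x = w \<tau> x"
proof -
  let ?N = "L2_on_norm S"
  obtain \<sigma> where \<sigma>: "\<And>n. simple_function (time t) (\<sigma> n)" "\<And>n. \<sigma> n ` space (time t) \<subseteq> L2_on S"
    "AE \<tau> in time t. v \<tau> \<in> L2_on S \<and> (\<lambda>n. ?N (\<sigma> n \<tau> - v \<tau>)) \<longlonglongrightarrow> 0"
    using v unfolding bochner_L1_def strongly_measurable_def by blast
  obtain \<rho> where \<rho>: "\<And>n. simple_function (time t) (\<rho> n)" "\<And>n. \<rho> n ` space (time t) \<subseteq> L2_on S"
    "AE \<tau> in time t. w \<tau> \<in> L2_on S \<and> (\<lambda>n. ?N (\<rho> n \<tau> - w \<tau>)) \<longlonglongrightarrow> 0"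
    using w unfolding bochner_L1_def strongly_measurable_def by blast
  \<comment> \<open>All differences of values of the two sequences of simple functions: countably
    many, and they approximate \<open>v \<tau> - w \<tau>\<close> at almost every time.\<close>
  define H where "H = (\<Union>n. (\<lambda>(a, b). a - b) ` (\<sigma> n ` {0..t} \<times> \<rho> n ` {0..t}))"
  have fin: "finite (\<sigma> n ` {0..t})" "finite (\<rho> n ` {0..t})" for n
    using simple_functionD(1)[OF \<sigma>(1)[of n]] simple_functionD(1)[OF \<rho>(1)[of n]] by simp_all
  have "finite ((\<lambda>(a, b). a - b) ` (\<sigma> n ` {0..t} \<times> \<rho> n ` {0..t}))" for n
    by (rule finite_imageI[OF finite_cartesian_product[OF fin]])
  then have cH: "countable H" unfolding H_def by (intro countable_UN countableI_type countable_finite)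
  have HL: "h \<in> L2_on S" if hH: "h \<in> H" for h
  proof -
    obtain n \<tau> \<tau>' where h: "h = \<sigma> n \<tau> - \<rho> n \<tau>'" "\<tau> \<in> {0..t}" "\<tau>' \<in> {0..t}"
      using hH unfolding H_def by auto
    have "\<sigma> n \<tau> \<in> L2_on S" "\<rho> n \<tau>' \<in> L2_on S" using \<sigma>(2)[of n] \<rho>(2)[of n] h(2,3) by auto
    then show ?thesis unfolding h(1) by (rule L2_space_diff)
  qed
  have "AE \<tau> in time t. \<forall>h\<in>H. pairing S h (v \<tau>) - pairing S h (w \<tau>) = 0"
    unfolding AE_ball_countable[OF cH]
  proof
    fix h assume h: "h \<in> H"
    note iv = pairing_integrable_L2[OF v HL[OF h]] and iw = pairing_integrable_L2[OF w HL[OF h]]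
    show "AE \<tau> in time t. pairing S h (v \<tau>) - pairing S h (w \<tau>) = 0"
    proof (rule fundamental_lemma_time)
      show "integrable (time t) (\<lambda>\<tau>. pairing S h (v \<tau>) - pairing S h (w \<tau>))" using iv iw by simp
      fix \<theta> :: "real \<Rightarrow> real" assume \<theta>: "\<theta> \<in> test_functions {0<..<t}"
      obtain C where C: "C > 0" "\<And>x. norm (\<theta> x) \<le> C" using \<theta> by (rule bounded_test_function) blast
      have i: "integrable (time t) (\<lambda>\<tau>. \<theta> \<tau> * g \<tau>)" if g: "integrable (time t) g" for g :: "real \<Rightarrow> real"
      proof (rule Bochner_Integration.integrable_bound)
        show "integrable (time t) (\<lambda>\<tau>. C * g \<tau>)" using g by simp
        have "\<theta> \<in> borel_measurable (time t)"
          using borel_measurable_lebesgue_test_function[OF \<theta>] by (rule measurable_restrict_space1)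
        then show "(\<lambda>\<tau>. \<theta> \<tau> * g \<tau>) \<in> borel_measurable (time t)" using g by (intro borel_measurable_times) auto
        show "AE \<tau> in time t. norm (\<theta> \<tau> * g \<tau>) \<le> norm (C * g \<tau>)"
          unfolding norm_mult using C by (intro AE_I2 mult_right_mono) auto
      qed
      show "(LINT \<tau>|time t. \<theta> \<tau> * (pairing S h (v \<tau>) - pairing S h (w \<tau>))) = 0"
        using eq[OF HL[OF h] \<theta>] i[OF iv] i[OF iw] by (simp add: right_diff_distrib)
    qed
  qed
  then show ?thesis
    using \<sigma>(3) \<rho>(3) AE_space
  proof eventually_elim
    case (elim \<tau>)
    define d where "d = v \<tau> - w \<tau>"
    define h where "h n = \<sigma> n \<tau> - \<rho> n \<tau>" for n
    have \<tau>: "\<tau> \<in> {0..t}" using elim by simp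
    have L: "v \<tau> \<in> L2_on S" "w \<tau> \<in> L2_on S" "\<sigma> n \<tau> \<in> L2_on S" "\<rho> n \<tau> \<in> L2_on S" for n
      using elim \<sigma>(2)[of n] \<rho>(2)[of n] by auto
    have dL: "d \<in> L2_on S" and hL: "h n \<in> L2_on S" for n unfolding d_def h_def by (intro L2_space_diff L)+
    have hH: "h n \<in> H" for n using \<tau> unfolding H_def h_def by force
    have hd: "?N (h n - d) \<le> ?N (\<sigma> n \<tau> - v \<tau>) + ?N (\<rho> n \<tau> - w \<tau>)" for n
    proof -
      have "h n - d = (\<sigma> n \<tau> - v \<tau>) + (w \<tau> - \<rho> n \<tau>)" by (simp add: h_def d_def)
      then show ?thesis
        using L2_norm_triangle[OF L2_space_diff[OF L(3,1)] L2_space_diff[OF L(2,4)]]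
          L2_norm_minus_commute[of "lebesgue_on S" "w \<tau>"] by simp
    qed
    \<comment> \<open>Since \<open>d\<close> is orthogonal to \<open>h n\<close>, its squared norm
      equals its pairing with \<open>d - h n\<close>, which tends to 0.\<close>
    have le: "(?N d)\<^sup>2 \<le> ?N d * (?N (\<sigma> n \<tau> - v \<tau>) + ?N (\<rho> n \<tau> - w \<tau>))" for n
    proof -
      have z: "pairing S (h n) d = 0"
        using elim hH[of n] by (simp add: d_def pairing_diff[OF L(1,2) hL])
      have "(?N d)\<^sup>2 = pairing S d d" unfolding L2_norm_sq pairing_def by (simp add: power2_eq_square)
      also have "\<dots> = pairing S d d - pairing S d (h n)"
        using z by (simp add: pairing_def mult.commute)
      also have "\<dots> = pairing S d (d - h n)" by (rule pairing_diff[OF dL hL dL, symmetric])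
      also have "\<dots> \<le> ?N d * ?N (d - h n)" using pairing_bound[OF L2_space_diff[OF dL hL] dL] by (rule abs_le_D1)
      also have "\<dots> \<le> ?N d * (?N (\<sigma> n \<tau> - v \<tau>) + ?N (\<rho> n \<tau> - w \<tau>))"
        using hd[of n] L2_norm_minus_commute[of "lebesgue_on S" d] by (intro mult_left_mono L2_norm_nonneg) simp
      finally show ?thesis .
    qed
    have "(\<lambda>n. ?N d * (?N (\<sigma> n \<tau> - v \<tau>) + ?N (\<rho> n \<tau> - w \<tau>))) \<longlonglongrightarrow> ?N d * (0 + 0)"
      using elim by (intro tendsto_intros) auto
    then have "(?N d)\<^sup>2 \<le> ?N d * (0 + 0)" by (rule LIMSEQ_le_const) (use le in blast)
    then have "?N d = 0" by simp
    then have "AE x in lebesgue_on S. d x = 0" using L2_norm_eq_0_iff[OF dL] by simp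
    then show ?case by eventually_elim (simp add: d_def)
  qed
qed

lemma test_functions_time_mono:
  "t \<le> T \<Longrightarrow> \<theta> \<in> test_functions {0<..<t} \<Longrightarrow> \<theta> \<in> test_functions {0<..<T::real}"
  by (erule subsetD[OF test_functions_mono, rotated]) auto

lemma deriv_test_function:
  fixes \<theta> :: "real \<Rightarrow> real"
  assumes "\<theta> \<in> test_functions U" shows "deriv \<theta> = (\<lambda>x. frechet_derivative \<theta> (at x) 1)" "deriv \<theta> \<in> test_functions U"
proof -
  have "(\<theta> has_real_derivative frechet_derivative \<theta> (at x) 1) (at x)" for x
  proof -
    have D: "(\<theta> has_derivative frechet_derivative \<theta> (at x)) (at x)"
      by (rule has_frechet_derivative[OF test_function_differentiable[OF assms]])
    then interpret bounded_linear "frechet_derivative \<theta> (at x)" by (rule has_derivative_bounded_linear)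
    have "frechet_derivative \<theta> (at x) h = frechet_derivative \<theta> (at x) 1 * h" for h using scaleR[of h 1] by simp
    then have "frechet_derivative \<theta> (at x) = (*) (frechet_derivative \<theta> (at x) 1)" by (rule ext)
    then show ?thesis unfolding has_field_derivative_def by (rule has_derivative_eq_rhs[OF D])
  qed
  then show eq: "deriv \<theta> = (\<lambda>x. frechet_derivative \<theta> (at x) 1)" by (intro ext DERIV_imp_deriv)
  show "deriv \<theta> \<in> test_functions U" unfolding eq by (rule test_functions_partial[OF assms]) simp
qed

lemma weak_time_deriv_pairing:
  assumes S: "S \<in> sets lebesgue" and d: "weak_time_deriv T (Hs0 s \<Omega>) (Hs_norm s) u v" and t: "t \<le> T"
    and h: "h \<in> L2_on S" and \<theta>: "\<theta> \<in> test_functions {0<..<t}"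
  shows "(LINT \<tau>|time t. \<theta> \<tau> * pairing S h (v \<tau>)) = - (LINT \<tau>|time t. deriv \<theta> \<tau> * pairing S h (u \<tau>))"
proof -
  have "(LINT \<tau>|time T. deriv \<theta> \<tau> * pairing S h (u \<tau>)) = - (LINT \<tau>|time T. \<theta> \<tau> * pairing S h (v \<tau>))"
    using d pairing_dual_Hs0[OF S h] test_functions_time_mono[OF t \<theta>] unfolding weak_time_deriv_def by blast
  then show ?thesis
    using time_integral_test[OF \<theta> t] time_integral_test[OF \<theta> order_refl]
      time_integral_test[OF deriv_test_function(2)[OF \<theta>] t] time_integral_test[OF deriv_test_function(2)[OF \<theta>] order_refl]
    by simp
qed

lemma bochner_L1_time_mono:
  assumes "t \<le> T" "f \<in> bochner_L1 T X N" shows "f \<in> bochner_L1 t X N"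
proof -
  have "integrable (time T) (\<lambda>\<tau>. N (f \<tau>))" using assms by (simp add: bochner_L1_def)
  then have "integrable lebesgue (\<lambda>\<tau>. indicator {0..T} \<tau> *\<^sub>R N (f \<tau>))" by (subst (asm) integrable_restrict_space) auto
  then have "integrable lebesgue (\<lambda>\<tau>. indicator {0..t} \<tau> *\<^sub>R indicator {0..T} \<tau> *\<^sub>R N (f \<tau>))"
    by (rule integrable_mult_indicator[rotated]) simp
  also have "(\<lambda>\<tau>. indicator {0..t} \<tau> *\<^sub>R indicator {0..T} \<tau> *\<^sub>R N (f \<tau>)) = (\<lambda>\<tau>. indicator {0..t} \<tau> *\<^sub>R N (f \<tau>))"
    using assms(1) by (auto simp: fun_eq_iff split: split_indicator)
  finally have "integrable (time t) (\<lambda>\<tau>. N (f \<tau>))" by (subst integrable_restrict_space) auto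
  moreover have "strongly_measurable (time t) X N f"
    using assms(2) by (intro strongly_measurable_time_mono[OF assms(1)]) (simp add: bochner_L1_def)
  ultimately show ?thesis by (simp add: bochner_L1_def)
qed

lemma weak_time_deriv_Hs0_unique:
  assumes S: "S \<in> sets lebesgue"
    and v: "weak_time_deriv T (Hs0 s \<Omega>) (Hs_norm s) u v" and w: "weak_time_deriv T (Hs0 s \<Omega>) (Hs_norm s) u w"
  shows "AE \<tau> in time T. AE x in lebesgue_on S. v \<tau> x = w \<tau> x"
proof (rule weak_deriv_unique[OF S])
  show "v \<in> bochner_L1 T (L2_on S) (L2_on_norm S)" "w \<in> bochner_L1 T (L2_on S) (L2_on_norm S)"
    using v w by (auto simp: weak_time_deriv_def intro: bochner_L1_Hs0_L2[OF S])
qed (simp add: weak_time_deriv_pairing[OF S v order_refl] weak_time_deriv_pairing[OF S w order_refl])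

lemma weak_time_deriv_L2_pairing:
  assumes "weak_time_deriv t (L2_on S) (L2_on_norm S) u v" "h \<in> L2_on S" "\<theta> \<in> test_functions {0<..<t}"
  shows "(LINT \<tau>|time t. \<theta> \<tau> * pairing S h (v \<tau>)) = - (LINT \<tau>|time t. deriv \<theta> \<tau> * pairing S h (u \<tau>))"
  using assms pairing_dual_L2[OF assms(2)] unfolding weak_time_deriv_def by (simp add: minus_equation_iff)

lemma weak_time_deriv_L2_unique:
  assumes S: "S \<in> sets lebesgue"
    and v: "weak_time_deriv t (L2_on S) (L2_on_norm S) u v" and w: "weak_time_deriv t (L2_on S) (L2_on_norm S) u w"
  shows "AE \<tau> in time t. AE x in lebesgue_on S. v \<tau> x = w \<tau> x"
proof (rule weak_deriv_unique[OF S])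
  show "v \<in> bochner_L1 t (L2_on S) (L2_on_norm S)" "w \<in> bochner_L1 t (L2_on S) (L2_on_norm S)"
    using v w by (auto simp: weak_time_deriv_def)
qed (simp add: weak_time_deriv_L2_pairing[OF v] weak_time_deriv_L2_pairing[OF w])

text \<open>Testing the identity with \<open>u\<close> itself brings in \<open>time_deriv\<close> in
  L2 over the shorter interval, a choice independent of \<open>u'\<close>. Test functions on
  \<open>(0,t)\<close> are test functions on \<open>(0,T)\<close>, so both derivatives satisfy the
  same identities there.\<close>

lemma weak_time_deriv_Hs0_L2_unique:
  assumes S: "S \<in> sets lebesgue" and t: "t \<le> T"
    and v: "weak_time_deriv T (Hs0 s \<Omega>) (Hs_norm s) u v" and w: "weak_time_deriv t (L2_on S) (L2_on_norm S) u w"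
  shows "AE \<tau> in time t. AE x in lebesgue_on S. v \<tau> x = w \<tau> x"
proof (rule weak_deriv_unique[OF S])
  show "v \<in> bochner_L1 t (L2_on S) (L2_on_norm S)" "w \<in> bochner_L1 t (L2_on S) (L2_on_norm S)"
    using v w by (auto simp: weak_time_deriv_def intro: bochner_L1_Hs0_L2[OF S] bochner_L1_time_mono[OF t])
qed (simp add: weak_time_deriv_pairing[OF S v t] weak_time_deriv_L2_pairing[OF w])

lemma time_deriv_weak:
  "weak_time_deriv t X N u v \<Longrightarrow> weak_time_deriv t X N u (time_deriv t X N u)"
  unfolding time_deriv_def by (rule someI[of "weak_time_deriv t X N u"])

lemma bochner_H1_time_deriv:
  "u \<in> bochner_H1 t X N \<Longrightarrow> weak_time_deriv t X N u (time_deriv t X N u)"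
  unfolding bochner_H1_def using time_deriv_weak by blast


subsection \<open>The penalty\<close>

text \<open>The infimum is attained at the projection \<open>max r 0\<close>, so the regularization
  is the squared distance to the half line divided by \<open>2 \<epsilon>\<close>.\<close>

lemma penalty_eq:
  assumes \<epsilon>: "0 < \<epsilon>" shows "penalty \<epsilon> r = min r 0 / \<epsilon>"
proof -
  have my: "real_of_ereal (moreau_yosida \<epsilon> obstacle r) = (min r 0)\<^sup>2 / (2 * \<epsilon>)" for r
  proof -
    have "moreau_yosida \<epsilon> obstacle r = ereal ((min r 0)\<^sup>2 / (2 * \<epsilon>))"
      unfolding moreau_yosida_def
    proof (rule antisym)
      have "(INF y. ereal ((r - y)\<^sup>2 / (2 * \<epsilon>)) + obstacle y) \<le> ereal ((r - max r 0)\<^sup>2 / (2 * \<epsilon>)) + obstacle (max r 0)"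
        by (rule INF_lower) simp
      also have "\<dots> = ereal ((min r 0)\<^sup>2 / (2 * \<epsilon>))" by (simp add: obstacle_def max_def min_def)
      finally show "(INF y. ereal ((r - y)\<^sup>2 / (2 * \<epsilon>)) + obstacle y) \<le> ereal ((min r 0)\<^sup>2 / (2 * \<epsilon>))" .
      show "ereal ((min r 0)\<^sup>2 / (2 * \<epsilon>)) \<le> (INF y. ereal ((r - y)\<^sup>2 / (2 * \<epsilon>)) + obstacle y)"
      proof (rule INF_greatest)
        fix y
        show "ereal ((min r 0)\<^sup>2 / (2 * \<epsilon>)) \<le> ereal ((r - y)\<^sup>2 / (2 * \<epsilon>)) + obstacle y"
        proof (cases "0 \<le> y")
          case True
          have "\<bar>min r 0\<bar> \<le> \<bar>r - y\<bar>" using True by (auto simp: min_def)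
          then have "(min r 0)\<^sup>2 \<le> (r - y)\<^sup>2" by (rule abs_le_square_iff[THEN iffD1])
          then show ?thesis using True \<epsilon> by (simp add: obstacle_def divide_right_mono)
        qed (simp add: obstacle_def)
      qed
    qed
    then show ?thesis by simp
  qed
  have "((\<lambda>r. (min r 0)\<^sup>2 / (2 * \<epsilon>)) has_real_derivative min r 0 / \<epsilon>) (at r)"
  proof -
    consider "r < 0" | "r > 0" | "r = 0" by linarith
    then show ?thesis
    proof cases
      case 1
      have "((\<lambda>r. r\<^sup>2 / (2 * \<epsilon>)) has_real_derivative min r 0 / \<epsilon>) (at r)"
        using 1 DERIV_cdivide[OF DERIV_pow[of 2 r UNIV], of "2 * \<epsilon>"] by simp
      then show ?thesis
        by (rule has_field_derivative_transform_within_open[of _ _ _ "{..<0}"]) (use 1 in auto)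
    next
      case 2
      have "((\<lambda>r. 0) has_real_derivative min r 0 / \<epsilon>) (at r)" using 2 by simp
      then show ?thesis
        by (rule has_field_derivative_transform_within_open[of _ _ _ "{0<..}"]) (use 2 in auto)
    next
      case 3
      have lim: "((\<lambda>h. \<bar>h\<bar> / (2 * \<epsilon>)) \<longlongrightarrow> 0) (at 0)"
        by (intro tendsto_divide_zero tendsto_rabs_zero tendsto_ident_at)
      \<comment> \<open>At the kink the difference quotient is at most linear in \<open>h\<close>,
        so both one-sided derivatives vanish.\<close>
      have "norm ((min h 0)\<^sup>2 / (2 * \<epsilon>) / h) \<le> \<bar>h\<bar> / (2 * \<epsilon>)" for h
        using \<epsilon> by (auto simp: min_def power2_eq_square abs_mult)
      then have "((\<lambda>h. (min h 0)\<^sup>2 / (2 * \<epsilon>) / h) \<longlongrightarrow> 0) (at 0)"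
        by (intro Lim_null_comparison[OF always_eventually[OF allI] lim])
      then show ?thesis using 3 by (simp add: DERIV_def)
    qed
  qed
  then show ?thesis unfolding penalty_def my by (rule DERIV_imp_deriv)
qed

lemma penalty_nonpos: "0 < \<epsilon> \<Longrightarrow> penalty \<epsilon> r \<le> 0"
  by (simp add: penalty_eq divide_nonpos_pos)

lemma penalty_lipschitz:
  assumes "0 < \<epsilon>" shows "\<bar>penalty \<epsilon> r - penalty \<epsilon> q\<bar> \<le> (1 / \<epsilon>) * \<bar>r - q\<bar>"
proof -
  have "\<bar>min r 0 - min q 0\<bar> \<le> \<bar>r - q\<bar>" by (auto simp: min_def)
  then show ?thesis
    using assms by (simp add: penalty_eq diff_divide_distrib[symmetric] abs_divide divide_right_mono)
qed

lemma penalty_0: "0 < \<epsilon> \<Longrightarrow> penalty \<epsilon> 0 = 0" by (simp add: penalty_eq)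

lemma penalty_L2:
  assumes \<epsilon>: "0 < \<epsilon>" and w: "w \<in> L2_on S"
  shows "(\<lambda>x. penalty \<epsilon> (w x)) \<in> L2_on S"
proof (rule L2_space_dominated)
  show "(\<lambda>x. penalty \<epsilon> (w x)) \<in> borel_measurable (lebesgue_on S)"
    unfolding penalty_eq[OF \<epsilon>] using L2_spaceD(1)[OF w] by measurable
  show "integrable (lebesgue_on S) (\<lambda>x. (1 / \<epsilon>)\<^sup>2 * (norm (w x))\<^sup>2)"
    using L2_spaceD(2)[OF w] by simp
  show "AE x in lebesgue_on S. (norm (penalty \<epsilon> (w x)))\<^sup>2 \<le> (1 / \<epsilon>)\<^sup>2 * (norm (w x))\<^sup>2"
    unfolding power_mult_distrib[symmetric]
    by (intro AE_I2 power_mono norm_ge_zero)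
      (use penalty_lipschitz[OF \<epsilon>, of _ 0] in \<open>simp add: penalty_0[OF \<epsilon>]\<close>)
qed

text \<open>This is the form in which \<open>strongly_measurable_functional\<close> accepts the
  nonlinear penalty and makes the reaction measurable in time.\<close>

lemma penalty_pairing_lipschitz:
  assumes \<epsilon>: "0 < \<epsilon>" and v: "v \<in> L2_on S" and w: "w \<in> L2_on S" and h: "h \<in> L2_on S"
  shows "\<bar>pairing S h (\<lambda>x. penalty \<epsilon> (v x)) - pairing S h (\<lambda>x. penalty \<epsilon> (w x))\<bar>
    \<le> (1 / \<epsilon> * L2_on_norm S h) * L2_on_norm S (v - w)"
proof -
  note pv = pairing_integrable[OF penalty_L2[OF \<epsilon> v] h] and pw = pairing_integrable[OF penalty_L2[OF \<epsilon> w] h]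
  have "pairing S h (\<lambda>x. penalty \<epsilon> (v x)) - pairing S h (\<lambda>x. penalty \<epsilon> (w x)) =
      (LINT x|lebesgue_on S. (penalty \<epsilon> (v x) - penalty \<epsilon> (w x)) * h x)"
    using pv pw by (simp add: pairing_def left_diff_distrib)
  also have "\<bar>\<dots>\<bar> \<le> (LINT x|lebesgue_on S. (1 / \<epsilon>) * (norm ((v - w) x) * norm (h x)))"
  proof (rule integral_abs_le_integral)
    show "integrable (lebesgue_on S) (\<lambda>x. (1 / \<epsilon>) * (norm ((v - w) x) * norm (h x)))"
      by (intro integrable_mult_right L2_mult_integrable L2_space_diff v w h)
    show "AE x in lebesgue_on S. \<bar>(penalty \<epsilon> (v x) - penalty \<epsilon> (w x)) * h x\<bar> \<le> (1 / \<epsilon>) * (norm ((v - w) x) * norm (h x))"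
      unfolding abs_mult
    proof (rule AE_I2)
      fix x
      show "\<bar>penalty \<epsilon> (v x) - penalty \<epsilon> (w x)\<bar> * \<bar>h x\<bar> \<le> (1 / \<epsilon>) * (norm ((v - w) x) * norm (h x))"
        using mult_right_mono[OF penalty_lipschitz[OF \<epsilon>, of "v x" "w x"], of "\<bar>h x\<bar>"] by (simp add: mult.assoc)
    qed
  qed
  also have "\<dots> = (1 / \<epsilon>) * (LINT x|lebesgue_on S. norm ((v - w) x) * norm (h x))" by simp
  also have "\<dots> \<le> (1 / \<epsilon>) * (L2_on_norm S (v - w) * L2_on_norm S h)"
    using \<epsilon> by (intro mult_left_mono L2_Cauchy_Schwarz_norm L2_space_diff v w h) auto
  finally show ?thesis by (simp add: mult_ac)
qed

section \<open>Integrals over intervals with a moving end time\<close>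

lemma integral_time_diff:
  fixes g :: "real \<Rightarrow> real"
  assumes g: "integrable (time T) g" and r: "0 \<le> r" "r \<le> t" "t \<le> T"
  shows "integrable lebesgue (\<lambda>\<tau>. indicator {r<..t} \<tau> * g \<tau>)" "integrable (time t) g"
    "(LINT \<tau>|time t. g \<tau>) - (LINT \<tau>|time r. g \<tau>) = (LINT \<tau>|lebesgue. indicator {r<..t} \<tau> * g \<tau>)"
proof -
  have gT: "integrable lebesgue (\<lambda>\<tau>. indicator {0..T} \<tau> *\<^sub>R g \<tau>)"
    using g by (subst (asm) integrable_restrict_space) auto
  have sub: "integrable lebesgue (\<lambda>\<tau>. indicator A \<tau> *\<^sub>R g \<tau>)" if "A \<in> sets lebesgue" "A \<subseteq> {0..T}" for A
  proof -
    have "integrable lebesgue (\<lambda>\<tau>. indicator A \<tau> *\<^sub>R indicator {0..T} \<tau> *\<^sub>R g \<tau>)"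
      by (rule integrable_mult_indicator[OF that(1) gT])
    also have "(\<lambda>\<tau>. indicator A \<tau> *\<^sub>R indicator {0..T} \<tau> *\<^sub>R g \<tau>) = (\<lambda>\<tau>. indicator A \<tau> *\<^sub>R g \<tau>)"
      using that(2) by (auto simp: fun_eq_iff indicator_def)
    finally show ?thesis .
  qed
  have 1: "integrable lebesgue (\<lambda>\<tau>. indicator {0..t} \<tau> *\<^sub>R g \<tau>)" by (rule sub) (use r in auto)
  have 2: "integrable lebesgue (\<lambda>\<tau>. indicator {0..r} \<tau> *\<^sub>R g \<tau>)" by (rule sub) (use r in auto)
  show 3: "integrable lebesgue (\<lambda>\<tau>. indicator {r<..t} \<tau> * g \<tau>)" 
  proof -
    have "{r<..t} \<subseteq> {0..T}" using r by auto
    from sub[OF _ this] show ?thesis by simp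
  qed
  show "integrable (time t) g" using 1 by (subst integrable_restrict_space) auto
  have "(LINT \<tau>|time t. g \<tau>) - (LINT \<tau>|time r. g \<tau>) =
      (LINT \<tau>|lebesgue. indicator {0..t} \<tau> *\<^sub>R g \<tau>) - (LINT \<tau>|lebesgue. indicator {0..r} \<tau> *\<^sub>R g \<tau>)"
    by (subst (1 2) integral_restrict_space) auto
  also have "\<dots> = (LINT \<tau>|lebesgue. indicator {0..t} \<tau> *\<^sub>R g \<tau> - indicator {0..r} \<tau> *\<^sub>R g \<tau>)"
    using 1 2 by (rule Bochner_Integration.integral_diff[symmetric])
  also have "\<dots> = (LINT \<tau>|lebesgue. indicator {r<..t} \<tau> * g \<tau>)"
    using r by (intro Bochner_Integration.integral_cong refl) (auto simp: indicator_def)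
  finally show "(LINT \<tau>|time t. g \<tau>) - (LINT \<tau>|time r. g \<tau>) = (LINT \<tau>|lebesgue. indicator {r<..t} \<tau> * g \<tau>)" .
qed

lemma integral_time_diff_le:
  fixes g f :: "real \<Rightarrow> real"
  assumes g: "integrable (time T) g" and f: "integrable (time T) f" and r: "0 \<le> r" "r \<le> t" "t \<le> T"
    and le: "AE \<tau> in time T. \<bar>g \<tau>\<bar> \<le> f \<tau>"
  shows "\<bar>(LINT \<tau>|time t. g \<tau>) - (LINT \<tau>|time r. g \<tau>)\<bar> \<le> (LINT \<tau>|time t. f \<tau>) - (LINT \<tau>|time r. f \<tau>)"
  unfolding integral_time_diff(3)[OF g r] integral_time_diff(3)[OF f r]
proof (rule integral_abs_le_integral[OF integral_time_diff(1)[OF f r]])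
  show "AE \<tau> in lebesgue. \<bar>indicator {r<..t} \<tau> * g \<tau>\<bar> \<le> indicator {r<..t} \<tau> * f \<tau>"
    using le unfolding AE_lebesgue_on_iff[OF sets_time] by eventually_elim (use r in \<open>auto simp: indicator_def\<close>)
qed

text \<open>Dominated convergence, the intervals shrinking to the null set \<open>{0}\<close>. It
  removes every time integral from the identities at short times.\<close>

lemma integral_time_tendsto_0:
  fixes f :: "real \<Rightarrow> real"
  assumes f: "integrable (time T) f" and t: "\<And>n. 0 \<le> t n \<and> t n \<le> T" "t \<longlonglongrightarrow> 0"
  shows "(\<lambda>n. LINT \<tau>|time (t n). f \<tau>) \<longlonglongrightarrow> 0"
proof -
  have fT: "integrable lebesgue (\<lambda>\<tau>. indicator {0..T} \<tau> *\<^sub>R f \<tau>)"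
    using f by (subst (asm) integrable_restrict_space) auto
  have e: "(LINT \<tau>|time (t n). f \<tau>) = (LINT \<tau>|lebesgue. indicator {0..t n} \<tau> * (indicator {0..T} \<tau> *\<^sub>R f \<tau>))" for n
    using t(1)[of n] by (subst integral_restrict_space) (auto intro!: Bochner_Integration.integral_cong simp: indicator_def)
  have "(\<lambda>n. LINT \<tau>|lebesgue. indicator {0..t n} \<tau> * (indicator {0..T} \<tau> *\<^sub>R f \<tau>)) \<longlonglongrightarrow> (LINT \<tau>|(lebesgue :: real measure). 0)"
  proof (rule integral_dominated_convergence[where w = "\<lambda>\<tau>. norm (indicator {0..T} \<tau> *\<^sub>R f \<tau>)"])
    show "integrable lebesgue (\<lambda>\<tau>. norm (indicator {0..T} \<tau> *\<^sub>R f \<tau>))" using fT by (rule integrable_norm)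
    show "(\<lambda>\<tau>. indicator {0..t n} \<tau> * (indicator {0..T} \<tau> *\<^sub>R f \<tau>)) \<in> borel_measurable lebesgue" for n
      using fT by (intro borel_measurable_times borel_measurable_indicator) auto
    show "AE \<tau> in lebesgue. norm (indicator {0..t n} \<tau> * (indicator {0..T} \<tau> *\<^sub>R f \<tau>)) \<le> norm (indicator {0..T} \<tau> *\<^sub>R f \<tau>)" for n
      by (rule AE_I2) (auto simp: indicator_def)
    have "AE \<tau> in lebesgue. \<tau> \<notin> {0::real}"
      using negligible_sing[of "0::real"] unfolding negligible_iff_null_sets by (rule AE_not_in)
    then show "AE \<tau> in lebesgue. (\<lambda>n. indicator {0..t n} \<tau> * (indicator {0..T} \<tau> *\<^sub>R f \<tau>)) \<longlonglongrightarrow> 0"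
    proof eventually_elim
      case (elim \<tau>)
      have "\<forall>\<^sub>F n in sequentially. indicator {0..t n} \<tau> * (indicator {0..T} \<tau> *\<^sub>R f \<tau>) = 0"
      proof (cases "\<tau> < 0")
        case True then show ?thesis by simp
      next
        case False
        then have "0 < \<tau>" using elim by simp
        from order_tendstoD(2)[OF t(2) this] show ?thesis by eventually_elim simp
      qed
      then show ?case by (rule tendsto_eventually)
    qed
  qed simp
  then show ?thesis unfolding e by simp
qed

subsection \<open>The forms\<close>

text \<open>The operator bound results from taking \<open>A x *v \<eta>\<close> itself as the second
  vector in the upper estimate.\<close>

lemma elliptic_coefficientD:
  assumes "elliptic_coefficient lo hi A"
  shows "A \<in> borel_measurable lebesgue" "norm (A x *v \<eta>) \<le> hi * norm \<eta>"
proof -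
  show "A \<in> borel_measurable lebesgue" using assms by (simp add: elliptic_coefficient_def)
  have "(norm (A x *v \<eta>))\<^sup>2 \<le> hi * norm \<eta> * norm (A x *v \<eta>)"
    using assms unfolding elliptic_coefficient_def power2_norm_eq_inner by blast
  \<comment> \<open>This covers the case \<open>A x *v \<eta> = 0\<close>, where no factor can be
    cancelled; the upper estimates for \<open>\<eta>\<close> and \<open>- \<eta>\<close> together
    fix the sign.\<close>
  moreover have "0 \<le> hi * norm \<eta>"
  proof (cases "\<eta> = 0")
    case False
    have "- (hi * norm \<eta> * norm \<eta>) \<le> (A x *v \<eta>) \<bullet> \<eta>"
    proof -
      have "(A x *v \<eta>) \<bullet> (- \<eta>) \<le> hi * norm \<eta> * norm (- \<eta>)"
        using assms unfolding elliptic_coefficient_def by blast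
      then show ?thesis by simp
    qed
    moreover have "(A x *v \<eta>) \<bullet> \<eta> \<le> hi * norm \<eta> * norm \<eta>"
      using assms unfolding elliptic_coefficient_def by blast
    ultimately have "0 \<le> hi * norm \<eta> * norm \<eta>" by linarith
    then show ?thesis using False by (simp add: zero_le_mult_iff)
  qed simp
  ultimately show "norm (A x *v \<eta>) \<le> hi * norm \<eta>"
    by (cases "norm (A x *v \<eta>) = 0") (auto simp: power2_eq_square)
qed

lemma elliptic_L2:
  fixes A :: "real^'n \<Rightarrow> real^'n^'n"
  assumes A: "elliptic_coefficient lo hi A" and G: "G \<in> L2_space lebesgue" and hi: "0 \<le> hi"
  shows "(\<lambda>x. A x *v G x) \<in> L2_space lebesgue" "L2_norm lebesgue (\<lambda>x. A x *v G x) \<le> hi * L2_norm lebesgue G"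
proof -
  have le: "(norm (A x *v G x))\<^sup>2 \<le> hi\<^sup>2 * (norm (G x))\<^sup>2" for x
    using power_mono[OF elliptic_coefficientD(2)[OF A, of x "G x"] norm_ge_zero, of 2] by (simp add: power_mult_distrib)
  have i: "integrable lebesgue (\<lambda>x. hi\<^sup>2 * (norm (G x))\<^sup>2)" using L2_spaceD(2)[OF G] by simp
  have "(\<lambda>x. A x *v G x) \<in> borel_measurable lebesgue"
  proof (rule borel_measurable_continuous_Pair[OF elliptic_coefficientD(1)[OF A] L2_spaceD(1)[OF G]])
    show "continuous_on UNIV (\<lambda>x :: (real^'n^'n) \<times> (real^'n). fst x *v snd x)"
      unfolding matrix_vector_mult_def
      by (auto intro!: continuous_intros)
  qed
  then show L: "(\<lambda>x. A x *v G x) \<in> L2_space lebesgue" by (rule L2_space_dominated[OF _ i]) (use le in simp)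
  have "(L2_norm lebesgue (\<lambda>x. A x *v G x))\<^sup>2 \<le> (hi * L2_norm lebesgue G)\<^sup>2"
    unfolding power_mult_distrib L2_norm_sq using le L2_spaceD(2)[OF L] i
    by (subst integral_mult_right_zero[symmetric]) (rule integral_mono)
  then show "L2_norm lebesgue (\<lambda>x. A x *v G x) \<le> hi * L2_norm lebesgue G"
    by (rule power2_le_imp_le) (simp add: hi L2_norm_nonneg)
qed

text \<open>The integrand of \<open>frac_form\<close> at a single time, with the test function first
  so that the rest is a functional of the state.\<close>

definition form :: "real \<Rightarrow> (real^'n \<Rightarrow> real^'n^'n) \<Rightarrow> (real^'n \<Rightarrow> real) \<Rightarrow> (real^'n \<Rightarrow> real) \<Rightarrow> real" where
  "form s A \<psi> u = (LINT x|lebesgue. (A x *v frac_grad s u x) \<bullet> frac_grad s \<psi> x)"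

lemma form_bound:
  assumes A: "elliptic_coefficient lo hi A" and hi: "0 \<le> hi" and u: "u \<in> Hs s" and \<psi>: "\<psi> \<in> Hs s"
  shows "\<bar>form s A \<psi> u\<bar> \<le> hi * L2_norm lebesgue (frac_grad s \<psi>) * Hs_norm s u"
proof -
  note L = elliptic_L2[OF A frac_grad_Hs(1)[OF u] hi]
  have "\<bar>form s A \<psi> u\<bar> \<le> L2_norm lebesgue (\<lambda>x. A x *v frac_grad s u x) * L2_norm lebesgue (frac_grad s \<psi>)"
    unfolding form_def by (rule L2_Cauchy_Schwarz[OF L(1) frac_grad_Hs(1)[OF \<psi>]])
  also have "\<dots> \<le> (hi * Hs_norm s u) * L2_norm lebesgue (frac_grad s \<psi>)"
    using L(2) mult_left_mono[OF frac_grad_le_Hs_norm[of s u] hi] by (intro mult_right_mono L2_norm_nonneg) linarith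
  finally show ?thesis by (simp add: mult_ac)
qed

lemma form_diff:
  assumes A: "elliptic_coefficient lo hi A" and hi: "0 \<le> hi" and s: "0 < s" "s \<le> 1" and \<Omega>: "bounded \<Omega>"
    and u: "u \<in> Hs_vanishing s \<Omega>" and v: "v \<in> Hs_vanishing s \<Omega>" and \<psi>: "\<psi> \<in> Hs s"
  shows "form s A \<psi> u - form s A \<psi> v = form s A \<psi> (u - v)"
proof -
  note i = L2_inner_integrable[OF elliptic_L2(1)[OF A frac_grad_Hs(1)[OF Hs_vanishing_Hs] hi] frac_grad_Hs(1)[OF \<psi>]]
  have "form s A \<psi> (u - v) = (LINT x|lebesgue. (A x *v frac_grad s u x) \<bullet> frac_grad s \<psi> x - (A x *v frac_grad s v x) \<bullet> frac_grad s \<psi> x)"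
    unfolding form_def
  proof (rule integral_cong_AE_lebesgue)
    show "AE x in lebesgue. (A x *v frac_grad s (u - v) x) \<bullet> frac_grad s \<psi> x =
        (A x *v frac_grad s u x) \<bullet> frac_grad s \<psi> x - (A x *v frac_grad s v x) \<bullet> frac_grad s \<psi> x"
      using frac_grad_diff[OF s \<Omega> u v] by eventually_elim (simp add: matrix_vector_mult_diff_distrib inner_diff_left)
  qed
  then show ?thesis unfolding form_def using i[OF u] i[OF v] by simp
qed

subsection \<open>The energy space\<close>

lemma bochner_L2_scaleR:
  assumes f: "f \<in> bochner_L2 t X N" and X: "\<And>x. x \<in> X \<Longrightarrow> c *\<^sub>R x \<in> X"
    and N: "\<And>x. x \<in> X \<Longrightarrow> N (c *\<^sub>R x) = \<bar>c\<bar> * N x" "\<And>x y. x \<in> X \<Longrightarrow> y \<in> X \<Longrightarrow> N (c *\<^sub>R (x - y)) = \<bar>c\<bar> * N (x - y)"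
  shows "c *\<^sub>R f \<in> bochner_L2 t X N" "(LINT \<tau>|time t. (N ((c *\<^sub>R f) \<tau>))\<^sup>2) = c\<^sup>2 * (LINT \<tau>|time t. (N (f \<tau>))\<^sup>2)"
proof -
  have f': "strongly_measurable (time t) X N f" "integrable (time t) (\<lambda>\<tau>. (N (f \<tau>))\<^sup>2)"
    using f by (auto simp: bochner_L2_def)
  have "AE \<tau> in time t. f \<tau> \<in> X" using f'(1) unfolding strongly_measurable_def by (auto elim!: eventually_mono)
  then have ae: "AE \<tau> in time t. c\<^sup>2 * (N (f \<tau>))\<^sup>2 = (N ((c *\<^sub>R f) \<tau>))\<^sup>2"
    by eventually_elim (simp add: N power_mult_distrib)
  have "integrable (time t) (\<lambda>\<tau>. (N ((c *\<^sub>R f) \<tau>))\<^sup>2)"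
    using f'(2) by (intro integrable_cong_AE_lebesgue_on[OF sets_time ae]) simp
  moreover have "strongly_measurable (time t) X N (c *\<^sub>R f)"
    using strongly_measurable_scaleR[OF f'(1) X N(2)] by (simp add: scaleR_fun_def)
  ultimately show "c *\<^sub>R f \<in> bochner_L2 t X N" by (simp add: bochner_L2_def)
  show "(LINT \<tau>|time t. (N ((c *\<^sub>R f) \<tau>))\<^sup>2) = c\<^sup>2 * (LINT \<tau>|time t. (N (f \<tau>))\<^sup>2)"
    using integral_cong_AE_lebesgue_on[OF sets_time ae] by simp
qed

lemma weak_time_deriv_scaleR:
  assumes S: "S \<in> sets lebesgue" and d: "weak_time_deriv t (L2_on S) (L2_on_norm S) u v"
  shows "weak_time_deriv t (L2_on S) (L2_on_norm S) (c *\<^sub>R u) (c *\<^sub>R v)"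
proof -
  have b1: "c *\<^sub>R f \<in> bochner_L1 t (L2_on S) (L2_on_norm S)" if "f \<in> bochner_L1 t (L2_on S) (L2_on_norm S)" for f
  proof -
    have "strongly_measurable (time t) (L2_on S) (L2_on_norm S) (\<lambda>\<tau>. c *\<^sub>R f \<tau>)"
      using that by (intro strongly_measurable_scaleR) (auto simp: bochner_L1_def L2_norm_scaleR intro: L2_space_scaleR)
    then show ?thesis using that by (simp add: bochner_L1_def L2_norm_scaleR scaleR_fun_def[of c f])
  qed
  have sc: "(LINT \<tau>|time t. \<theta> \<tau> * F ((c *\<^sub>R f) \<tau>)) = c * (LINT \<tau>|time t. \<theta> \<tau> * F (f \<tau>))"
    if f: "f \<in> bochner_L1 t (L2_on S) (L2_on_norm S)" and F: "F \<in> dual_on (L2_on S) (L2_on_norm S)" for f F and \<theta> :: "real \<Rightarrow> real"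
  proof -
    have "AE \<tau> in time t. f \<tau> \<in> L2_on S"
      using f unfolding bochner_L1_def strongly_measurable_def by (auto elim!: eventually_mono)
    then have "AE \<tau> in time t. \<theta> \<tau> * F ((c *\<^sub>R f) \<tau>) = c * (\<theta> \<tau> * F (f \<tau>))"
      by eventually_elim (use F in \<open>simp add: dual_on_def\<close>)
    from integral_cong_AE_lebesgue_on[OF sets_time this] show ?thesis by simp
  qed
  have uv: "u \<in> bochner_L1 t (L2_on S) (L2_on_norm S)" "v \<in> bochner_L1 t (L2_on S) (L2_on_norm S)"
    using d by (auto simp: weak_time_deriv_def)
  show ?thesis
    unfolding weak_time_deriv_def
  proof (intro conjI ballI b1 uv)
    fix F and \<theta> :: "real \<Rightarrow> real"
    assume F: "F \<in> dual_on (L2_on S) (L2_on_norm S)" and \<theta>: "\<theta> \<in> test_functions {0<..<t}"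
    have "(LINT \<tau>|time t. deriv \<theta> \<tau> * F (u \<tau>)) = - (LINT \<tau>|time t. \<theta> \<tau> * F (v \<tau>))"
      using d F \<theta> unfolding weak_time_deriv_def by blast
    then show "(LINT \<tau>|time t. deriv \<theta> \<tau> * F ((c *\<^sub>R u) \<tau>)) = - (LINT \<tau>|time t. \<theta> \<tau> * F ((c *\<^sub>R v) \<tau>))"
      unfolding sc[OF uv(1) F] sc[OF uv(2) F] by simp
  qed
qed

text \<open>The derivatives of \<open>u\<close> and of its multiple are independent choices, so
  homogeneity holds up to null sets; this is enough for \<open>Vnorm\<close>.\<close>

lemma time_deriv_scaleR_AE:
  assumes S: "S \<in> sets lebesgue" and u: "u \<in> bochner_H1 t (L2_on S) (L2_on_norm S)"
  shows "AE \<tau> in time t. AE x in lebesgue_on S. time_deriv t (L2_on S) (L2_on_norm S) (c *\<^sub>R u) \<tau> x =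
    c * time_deriv t (L2_on S) (L2_on_norm S) u \<tau> x"
proof -
  note w = weak_time_deriv_scaleR[OF S bochner_H1_time_deriv[OF u], of c]
  from weak_time_deriv_L2_unique[OF S time_deriv_weak[OF w] w] show ?thesis by simp
qed

lemma dual_on_0: "F \<in> dual_on X N \<Longrightarrow> x \<in> X \<Longrightarrow> F 0 = 0"
  unfolding dual_on_def by (metis (mono_tags, lifting) mem_Collect_eq mult_zero_left scaleR_zero_left)

lemma weak_time_deriv_const:
  assumes x: "x \<in> X" and X0: "0 \<in> X" and N0: "N 0 = 0"
  shows "weak_time_deriv t X N (\<lambda>_. x) (\<lambda>_. 0)"
  unfolding weak_time_deriv_def
proof (intro conjI ballI bochner_const x X0 N0)
  fix F and \<theta> :: "real \<Rightarrow> real" assume F: "F \<in> dual_on X N" and \<theta>: "\<theta> \<in> test_functions {0<..<t}"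
  have "(LINT \<tau>|time t. deriv \<theta> \<tau> * F x) = (LINT \<tau>|lebesgue. deriv \<theta> \<tau> * F x)"
    by (rule time_integral_test[OF deriv_test_function(2)[OF \<theta>] order_refl])
  also have "\<dots> = (LINT \<tau>|lebesgue. deriv \<theta> \<tau>) * F x" by simp
  also have "(LINT \<tau>|lebesgue. deriv \<theta> \<tau>) = 0"
    unfolding deriv_test_function(1)[OF \<theta>] by (rule integral_partial_zero[OF \<theta>]) simp
  finally show "(LINT \<tau>|time t. deriv \<theta> \<tau> * F x) = - (LINT \<tau>|time t. \<theta> \<tau> * F 0)"
    by (simp add: dual_on_0[OF F x])
qed

lemma time_deriv_const_AE:
  assumes S: "S \<in> sets lebesgue" and x: "x \<in> L2_on S"
  shows "AE \<tau> in time t. AE \<xi> in lebesgue_on S. time_deriv t (L2_on S) (L2_on_norm S) (\<lambda>_. x) \<tau> \<xi> = 0"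
proof -
  have w: "weak_time_deriv t (L2_on S) (L2_on_norm S) (\<lambda>_. x) (\<lambda>_. 0)"
    by (rule weak_time_deriv_const[where N = "L2_on_norm S", OF x L2_space_0 L2_norm_0])
  from weak_time_deriv_L2_unique[OF S time_deriv_weak[OF w] w] show ?thesis by simp
qed

section \<open>The spaces \<open>Hs0\<close> and \<open>V\<close> over a fixed domain\<close>

locale fractional_domain =
  fixes \<Omega> :: "'a::euclidean_space set" and s :: real and k :: nat
  assumes open_dom: "open \<Omega>" and bounded_dom: "bounded \<Omega>" and s: "0 < s" "s \<le> 1" and k: "1 \<le> k"
    and emb: "negative_order_embeddings k \<Omega>"
begin

abbreviation "V \<equiv> Vspace s \<Omega>"
abbreviation "NV \<equiv> Vnorm s \<Omega>"
abbreviation "dt t \<equiv> time_deriv t (L2_on \<Omega>) (L2_on_norm \<Omega>)"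

lemma dom_sets: "\<Omega> \<in> sets lebesgue" using open_dom by simp

lemma test_Hs0: "\<psi> \<in> test_functions \<Omega> \<Longrightarrow> \<psi> \<in> Hs0 s \<Omega>"
  by (rule test_functions_subset_Hs0[OF open_dom bounded_dom emb s])

lemma Hs0_vanishing: "u \<in> Hs0 s \<Omega> \<Longrightarrow> u \<in> Hs_vanishing s \<Omega>"
  using Hs0_subset_vanishing[OF open_dom] by blast

lemma Hs0_Hs: "u \<in> Hs0 s \<Omega> \<Longrightarrow> u \<in> Hs s" by (simp add: Hs0_def)

lemma Hs0_L2_on: "u \<in> Hs0 s \<Omega> \<Longrightarrow> u \<in> L2_on \<Omega>"
  using L2_space_restrict(1)[OF dom_sets Hs0_L2] .

lemma Hs_vanishing_diff: "u \<in> Hs_vanishing s \<Omega> \<Longrightarrow> v \<in> Hs_vanishing s \<Omega> \<Longrightarrow> u - v \<in> Hs_vanishing s \<Omega>"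
  using Hs_vanishing_add(1)[OF s bounded_dom, of u "(-1) *\<^sub>R v"] Hs_vanishing_scaleR[of v s \<Omega> "-1"] by simp

lemma Hs0_diff_Hs: "u \<in> Hs0 s \<Omega> \<Longrightarrow> v \<in> Hs0 s \<Omega> \<Longrightarrow> u - v \<in> Hs s"
  by (rule Hs_vanishing_Hs[OF Hs_vanishing_diff[OF Hs0_vanishing Hs0_vanishing]])

lemma Hs0_0: "0 \<in> Hs0 s \<Omega>" by (rule test_Hs0[OF test_functions_0])

lemma Hs0_scaleR:
  assumes u: "u \<in> Hs0 s \<Omega>" shows "c *\<^sub>R u \<in> Hs0 s \<Omega>"
proof -
  obtain \<phi> where \<phi>: "\<And>n. \<phi> n \<in> test_functions \<Omega>" "(\<lambda>n. Hs_norm s (\<phi> n - u)) \<longlonglongrightarrow> 0"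
    using u by (auto simp: Hs0_def)
  have "Hs_norm s (c *\<^sub>R \<phi> n - c *\<^sub>R u) = \<bar>c\<bar> * Hs_norm s (\<phi> n - u)" for n
    using Hs_scaleR(3)[OF Hs0_diff_Hs[OF test_Hs0[OF \<phi>(1)] u], of c n] by (simp add: scaleR_diff_right)
  then have "(\<lambda>n. Hs_norm s (c *\<^sub>R \<phi> n - c *\<^sub>R u)) \<longlonglongrightarrow> 0" using \<phi>(2) by (auto intro: tendsto_mult_right_zero)
  then show ?thesis
    unfolding Hs0_def using Hs_scaleR(1)[OF Hs0_Hs[OF u]] test_functions_scaleR[OF \<phi>(1)]
    by (intro CollectI conjI exI[of _ "\<lambda>n. c *\<^sub>R \<phi> n"]) auto
qed

text \<open>Homogeneity of the norm is what \<open>dual_norm_bound\<close> requires to bound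
  evaluation at a given function.\<close>

lemma V_scaleR:
  assumes \<phi>: "\<phi> \<in> V t" shows "c *\<^sub>R \<phi> \<in> V t" "NV t (c *\<^sub>R \<phi>) = \<bar>c\<bar> * NV t \<phi>"
proof -
  let ?L = "L2_on \<Omega>" and ?N = "L2_on_norm \<Omega>"
  have H1: "\<phi> \<in> bochner_H1 t ?L ?N" and H: "\<phi> \<in> bochner_L2 t (Hs0 s \<Omega>) (Hs_norm s)"
    using \<phi> by (auto simp: Vspace_def)
  have tc: "time_continuous t ?L ?N \<phi>" and L: "\<phi> \<in> bochner_L2 t ?L ?N" using H1 by (auto simp: bochner_H1_def)
  obtain v where v: "v \<in> bochner_L2 t ?L ?N" "weak_time_deriv t ?L ?N \<phi> v" using H1 by (auto simp: bochner_H1_def)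
  note scL = bochner_L2_scaleR[where X = ?L and N = ?N, OF _ L2_space_scaleR L2_norm_scaleR L2_norm_scaleR]
  note scH = bochner_L2_scaleR[where X = "Hs0 s \<Omega>" and N = "Hs_norm s",
      OF H Hs0_scaleR Hs_scaleR(3)[OF Hs0_Hs] Hs_scaleR(3)[OF Hs0_diff_Hs]]
  have "time_continuous t ?L ?N (c *\<^sub>R \<phi>)"
    unfolding time_continuous_def
  proof (intro conjI ballI)
    fix \<tau> assume \<tau>: "\<tau> \<in> {0..t}"
    show "(c *\<^sub>R \<phi>) \<tau> \<in> ?L" using tc \<tau> by (auto simp: time_continuous_def intro: L2_space_scaleR)
    have "((\<lambda>r. \<bar>c\<bar> * ?N (\<phi> r - \<phi> \<tau>)) \<longlongrightarrow> 0) (at \<tau> within {0..t})"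
      using tc \<tau> by (intro tendsto_mult_right_zero) (auto simp: time_continuous_def)
    then show "((\<lambda>r. ?N ((c *\<^sub>R \<phi>) r - (c *\<^sub>R \<phi>) \<tau>)) \<longlongrightarrow> 0) (at \<tau> within {0..t})"
      by (simp add: L2_norm_scaleR flip: scaleR_diff_right)
  qed
  moreover have "c *\<^sub>R \<phi> \<in> bochner_L2 t ?L ?N" by (rule scL(1)[OF L])
  moreover have "c *\<^sub>R v \<in> bochner_L2 t ?L ?N" by (rule scL(1)[OF v(1)])
  moreover have "weak_time_deriv t ?L ?N (c *\<^sub>R \<phi>) (c *\<^sub>R v)" by (rule weak_time_deriv_scaleR[OF dom_sets v(2)])
  ultimately show "c *\<^sub>R \<phi> \<in> V t" unfolding Vspace_def bochner_H1_def using scH(1) by blast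
  have "(LINT \<tau>|time t. (?N (dt t (c *\<^sub>R \<phi>) \<tau>))\<^sup>2) = (LINT \<tau>|time t. c\<^sup>2 * (?N (dt t \<phi> \<tau>))\<^sup>2)"
  proof (rule integral_cong_AE_lebesgue_on[OF sets_time])
    show "AE \<tau> in time t. (?N (dt t (c *\<^sub>R \<phi>) \<tau>))\<^sup>2 = c\<^sup>2 * (?N (dt t \<phi> \<tau>))\<^sup>2"
      using time_deriv_scaleR_AE[OF dom_sets H1, of c]
    proof eventually_elim
      case (elim \<tau>)
      have "?N (dt t (c *\<^sub>R \<phi>) \<tau>) = ?N (c *\<^sub>R dt t \<phi> \<tau>)"
        by (rule L2_norm_cong_AE[OF dom_sets]) (use elim in simp)
      then show ?case by (simp add: L2_norm_scaleR power_mult_distrib)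
    qed
  qed
  then have "NV t (c *\<^sub>R \<phi>) = sqrt (c\<^sup>2 * ((bochner_H1_norm t ?L ?N \<phi>)\<^sup>2 + (LINT \<tau>|time t. (Hs_norm s (\<phi> \<tau>))\<^sup>2)))"
    using scH(2)[of c] scL(2)[OF L, of c]
    unfolding Vnorm_def bochner_H1_norm_def by (simp add: distrib_left)
  then show "NV t (c *\<^sub>R \<phi>) = \<bar>c\<bar> * NV t \<phi>" by (simp add: real_sqrt_mult Vnorm_def)
qed

lemma NV_nonneg: "0 \<le> NV t \<phi>" by (simp add: Vnorm_def)

text \<open>Evaluation belongs to the bidual, so weak convergence of the penalty functionals in the
  dual implies convergence at each test function.\<close>

lemma dual_evaluation:
  assumes \<phi>: "\<phi> \<in> V t"
  shows "(\<lambda>\<xi>. \<xi> \<phi>) \<in> dual_on (dual_on (V t) (NV t)) (dual_norm (V t) (NV t))"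
  unfolding dual_on_def[of "dual_on _ _"]
proof (intro CollectI conjI ballI allI exI)
  fix \<xi> assume \<xi>: "\<xi> \<in> dual_on (V t) (NV t)"
  show "\<bar>\<xi> \<phi>\<bar> \<le> NV t \<phi> * dual_norm (V t) (NV t) \<xi>"
    using dual_norm_bound[where X = "V t" and N = "NV t", OF \<xi> NV_nonneg \<phi> V_scaleR(1)[OF \<phi>] V_scaleR(2)[OF \<phi>]] by (simp add: mult.commute)
qed auto

lemma V_const:
  assumes \<psi>: "\<psi> \<in> Hs0 s \<Omega>"
  shows "(\<lambda>_. \<psi>) \<in> V t"
proof -
  have L: "\<psi> \<in> L2_on \<Omega>" by (rule Hs0_L2_on[OF \<psi>])
  have "weak_time_deriv t (L2_on \<Omega>) (L2_on_norm \<Omega>) (\<lambda>_. \<psi>) (\<lambda>_. 0)"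
    by (rule weak_time_deriv_const[where N = "L2_on_norm \<Omega>", OF L L2_space_0 L2_norm_0])
  moreover have "time_continuous t (L2_on \<Omega>) (L2_on_norm \<Omega>) (\<lambda>_. \<psi>)"
    unfolding time_continuous_def using L by (simp add: L2_norm_0)
  ultimately show ?thesis
    unfolding Vspace_def bochner_H1_def
    using bochner_const(2)[of \<psi> "L2_on \<Omega>" "L2_on_norm \<Omega>", OF L L2_norm_0] bochner_const(2)[of 0 "L2_on \<Omega>" "L2_on_norm \<Omega>", OF L2_space_0 L2_norm_0]
      bochner_const(2)[of \<psi> "Hs0 s \<Omega>" "Hs_norm s", OF \<psi> Hs_0(2)] by blast
qed

text \<open>It turns a uniform bound in \<open>Hs0\<close> into one in \<open>V\<close>, as needed
  to apply \<Xi> to the dominating sequence. The derivative part vanishes; the L2 part and the H^s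
  part give the 2.\<close>

lemma NV_const:
  assumes \<psi>: "\<psi> \<in> Hs0 s \<Omega>" and t: "0 \<le> t"
  shows "NV t (\<lambda>_. \<psi>) \<le> sqrt (2 * t) * Hs_norm s \<psi>"
proof -
  let ?N = "L2_on_norm \<Omega>"
  have "(LINT \<tau>|time t. (?N (dt t (\<lambda>_. \<psi>) \<tau>))\<^sup>2) = 0"
  proof (rule integral_eq_zero_AE)
    show "AE \<tau> in time t. (?N (dt t (\<lambda>_. \<psi>) \<tau>))\<^sup>2 = 0"
      using time_deriv_const_AE[OF dom_sets Hs0_L2_on[OF \<psi>]]
    proof eventually_elim
      case (elim \<tau>)
      have "?N (dt t (\<lambda>_. \<psi>) \<tau>) = ?N 0" by (rule L2_norm_cong_AE[OF dom_sets]) (use elim in simp)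
      then show ?case by (simp add: L2_norm_0)
    qed
  qed
  then have "NV t (\<lambda>_. \<psi>) = sqrt (t * (?N \<psi>)\<^sup>2 + t * (Hs_norm s \<psi>)\<^sup>2)"
    using t by (simp add: Vnorm_def bochner_H1_norm_def measure_time)
  also have "\<dots> \<le> sqrt (2 * t * (Hs_norm s \<psi>)\<^sup>2)"
  proof (rule real_sqrt_le_mono)
    have "(?N \<psi>)\<^sup>2 \<le> (Hs_norm s \<psi>)\<^sup>2"
      by (intro power_mono L2_on_norm_le_Hs_norm dom_sets Hs0_L2[OF \<psi>] L2_norm_nonneg)
    then show "t * (?N \<psi>)\<^sup>2 + t * (Hs_norm s \<psi>)\<^sup>2 \<le> 2 * t * (Hs_norm s \<psi>)\<^sup>2"
      using t mult_left_mono[of "(?N \<psi>)\<^sup>2" "(Hs_norm s \<psi>)\<^sup>2" t] by linarith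
  qed
  also have "\<dots> = sqrt (2 * t) * Hs_norm s \<psi>" by (simp add: real_sqrt_mult Hs_norm_nonneg)
  finally show ?thesis .
qed

lemma Hs_norm_continuous:
  assumes "x \<in> Hs0 s \<Omega>" "y \<in> Hs0 s \<Omega>"
  shows "\<bar>Hs_norm s x - Hs_norm s y\<bar> \<le> 1 * Hs_norm s (x - y)"
proof -
  have "Hs_norm s u \<le> Hs_norm s v + Hs_norm s (u - v)" if "u \<in> Hs0 s \<Omega>" "v \<in> Hs0 s \<Omega>" for u v
    using Hs_norm_triangle[OF s bounded_dom Hs_vanishing_diff[OF Hs0_vanishing[OF that(1)] Hs0_vanishing[OF that(2)]] Hs0_vanishing[OF that(2)]]
    by simp
  from this[OF assms] this[OF assms(2,1)] Hs_scaleR(3)[OF Hs0_diff_Hs[OF assms(2,1)], of "-1"]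
  show ?thesis by simp
qed

lemma Hs_norm_integrable:
  assumes "f \<in> bochner_L2 t (Hs0 s \<Omega>) (Hs_norm s)" shows "integrable (time t) (\<lambda>\<tau>. Hs_norm s (f \<tau>))"
  by (rule bochner_L2_functional_integrable[where G = "Hs_norm s" and C' = 1, OF assms Hs_norm_continuous])
    (simp_all add: Hs_norm_nonneg)

end


subsection \<open>The penalization limit\<close>

lemma AE_time_ex:
  assumes "AE \<tau> in time T. P \<tau>" "0 < \<delta>" "\<delta> \<le> T"
  shows "\<exists>\<tau>\<in>{0<..<\<delta>}. P \<tau>"
proof (rule ccontr)
  assume "\<not> ?thesis"
  then have none: "\<not> P \<tau>" if "\<tau> \<in> {0<..<\<delta>}" for \<tau> using that by blast
  from assms(1) have "AE \<tau> in lebesgue. \<tau> \<notin> {0<..<\<delta>}"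
    unfolding AE_lebesgue_on_iff[OF sets_time]
  proof eventually_elim
    case (elim \<tau>) then show ?case using none assms(3) by auto
  qed
  then have "{0<..<\<delta>} \<in> null_sets lebesgue"
    by (simp add: completion.null_sets_iff_AE)
  then have "emeasure lebesgue {0<..<\<delta>} = 0" by blast
  then show False using assms(2) by simp
qed

lemma obstacle_energy_nonneg: "0 \<le> obstacle_energy \<Omega> t u"
  by (simp add: obstacle_energy_def enn2ereal_nonneg)

lemma obstacle_energy_0: "obstacle_energy \<Omega> t 0 = 0"
  by (simp add: obstacle_energy_def obstacle_def e2ennreal_neg zero_ennreal.rep_eq)

text \<open>The inner integral of the energy is not known to be measurable in time. It is bounded
  below by a function of \<open>G (u \<tau>)\<close>, where \<open>G\<close> integrates the negative
  part: this is measurable in time and vanishes exactly for functions that are nonnegative almost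
  everywhere.\<close>

lemma obstacle_energy_finite_AE:
  fixes u :: "real \<Rightarrow> 'a::euclidean_space \<Rightarrow> real"
  assumes \<Omega>: "open \<Omega>" "bounded \<Omega>" and u: "strongly_measurable (time t) (L2_on \<Omega>) (L2_on_norm \<Omega>) u"
    and fin: "obstacle_energy \<Omega> t u \<noteq> \<infinity>"
  shows "AE \<tau> in time t. AE x in lebesgue_on \<Omega>. 0 \<le> u \<tau> x"
proof -
  let ?one = "\<lambda>x::'a. 1::real"
  \<comment> \<open>The penalty with parameter 1 is \<open>min r 0\<close>, so the Lipschitz
    estimate already proved for penalties gives measurability.\<close>
  define G where "G w = pairing \<Omega> ?one (\<lambda>x. penalty 1 (w x))" for w
  have "finite_measure (lebesgue_on \<Omega>)"
    using \<Omega> by (intro finite_measure_lebesgue_on) (simp add: bounded_set_imp_lmeasurable)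
  then have one: "?one \<in> L2_on \<Omega>" by (simp add: L2_space_def finite_measure.integrable_const)
  have Gm: "(\<lambda>\<tau>. G (u \<tau>)) \<in> borel_measurable (time t)"
  proof (rule strongly_measurable_functional[OF u])
    show "\<bar>G x - G y\<bar> \<le> (1 / 1 * L2_on_norm \<Omega> ?one) * L2_on_norm \<Omega> (x - y)"
      if "x \<in> L2_on \<Omega>" "y \<in> L2_on \<Omega>" for x y
      unfolding G_def by (rule penalty_pairing_lipschitz[OF zero_less_one that one])
  qed
  have G0: "G w = 0 \<longleftrightarrow> (AE x in lebesgue_on \<Omega>. 0 \<le> w x)" if w: "w \<in> L2_on \<Omega>" for w
  proof -
    have i: "integrable (lebesgue_on \<Omega>) (\<lambda>x. - min (w x) 0)"
      using pairing_integrable[OF penalty_L2[OF zero_less_one w] one] by (simp add: penalty_eq)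
    have "G w = 0 \<longleftrightarrow> (LINT x|lebesgue_on \<Omega>. - min (w x) 0) = 0"
      by (simp add: G_def pairing_def penalty_eq)
    also have "\<dots> \<longleftrightarrow> (AE x in lebesgue_on \<Omega>. - min (w x) 0 = 0)"
      by (rule integral_nonneg_eq_0_iff_AE[OF i]) simp
    also have "\<dots> \<longleftrightarrow> (AE x in lebesgue_on \<Omega>. 0 \<le> w x)"
      by (intro AE_cong) (auto simp: min_def)
    finally show ?thesis .
  qed
  define I where "I \<tau> = (\<integral>\<^sup>+x. e2ennreal (obstacle (u \<tau> x)) \<partial>lebesgue_on \<Omega>)" for \<tau>
  have ae: "AE \<tau> in time t. u \<tau> \<in> L2_on \<Omega>" using u unfolding strongly_measurable_def by (auto elim!: eventually_mono)
  have FI: "(if G (u \<tau>) = 0 then 0 else \<infinity>) \<le> I \<tau>" if w: "u \<tau> \<in> L2_on \<Omega>" for \<tau>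
  proof (cases "I \<tau> = \<infinity>")
    case False
    have e: "(\<lambda>x. e2ennreal (obstacle (u \<tau> x))) = (\<lambda>x. if 0 \<le> u \<tau> x then 0 else \<infinity>)"
      by (auto simp: obstacle_def e2ennreal_neg fun_eq_iff infinity_ennreal_def)
    have "(\<lambda>x. if 0 \<le> u \<tau> x then 0 else \<infinity> :: ennreal) \<in> borel_measurable (lebesgue_on \<Omega>)"
      using L2_spaceD(1)[OF w] by measurable
    then have "AE x in lebesgue_on \<Omega>. (if 0 \<le> u \<tau> x then 0 else \<infinity> :: ennreal) \<noteq> \<infinity>"
      using False nn_integral_PInf_AE[of "\<lambda>x. if 0 \<le> u \<tau> x then 0 else \<infinity>" "lebesgue_on \<Omega>"] unfolding I_def e by blast
    then have "AE x in lebesgue_on \<Omega>. 0 \<le> u \<tau> x"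
      by eventually_elim (auto split: if_splits)
    then show ?thesis using G0[OF w] by simp
  qed simp
  have "(\<integral>\<^sup>+\<tau>. (if G (u \<tau>) = 0 then 0 else \<infinity>) \<partial>time t) \<le> (\<integral>\<^sup>+\<tau>. I \<tau> \<partial>time t)"
    by (rule nn_integral_mono_AE) (use ae in eventually_elim, rule FI)
  moreover have "(\<integral>\<^sup>+\<tau>. I \<tau> \<partial>time t) \<noteq> \<infinity>"
    using fin unfolding obstacle_energy_def I_def by (auto simp: infinity_ennreal_def top_ennreal.rep_eq top_ereal_def)
  ultimately have "(\<integral>\<^sup>+\<tau>. (if G (u \<tau>) = 0 then 0 else \<infinity>) \<partial>time t) \<noteq> \<infinity>" by (auto simp: top_unique)
  then have "AE \<tau> in time t. (if G (u \<tau>) = 0 then 0 else \<infinity> :: ennreal) \<noteq> \<infinity>"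
    using Gm by (intro nn_integral_PInf_AE) measurable
  then show ?thesis using ae by eventually_elim (auto simp: G0 split: if_splits)
qed

locale penalization = fractional_domain \<Omega> s k for \<Omega> :: "(real^'n) set" and s k +
  fixes T \<nu> :: real and A B :: "real^'n \<Rightarrow> real^'n^'n" and a_lo a_hi b_lo b_hi :: real
    and w0 w1 g :: "real^'n \<Rightarrow> real" and u u' :: "real \<Rightarrow> real^'n \<Rightarrow> real"
    and \<xi> :: "(real \<Rightarrow> real^'n \<Rightarrow> real) \<Rightarrow> real" and \<Xi> :: "real \<Rightarrow> (real \<Rightarrow> real^'n \<Rightarrow> real) \<Rightarrow> real"
    and \<epsilon> :: "nat \<Rightarrow> real" and ue :: "nat \<Rightarrow> real \<Rightarrow> real^'n \<Rightarrow> real"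
  assumes T: "0 < T" and \<nu>: "0 < \<nu>" and A: "0 < a_hi" "elliptic_coefficient a_lo a_hi A"
    and B: "0 < b_hi" "elliptic_coefficient b_lo b_hi B"
    and w0: "w0 \<in> Hs0 s \<Omega>" and w1: "w1 \<in> L2_on \<Omega>" and g: "g \<in> L2_on \<Omega>"
    and sol: "weak_solution s \<Omega> T \<nu> A B w0 w1 g u u' \<xi> \<Xi>"
    and \<epsilon>: "\<And>n. 0 < \<epsilon> n" and ue: "\<And>n. ue n \<in> bochner_Linf T (Hs0 s \<Omega>) (Hs_norm s)"
    and conv: "\<And>t. t \<in> {0<..T} \<Longrightarrow>
      weakly_tends (dual_on (Vspace s \<Omega> t) (Vnorm s \<Omega> t)) (dual_norm (Vspace s \<Omega> t) (Vnorm s \<Omega> t))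
        (\<lambda>n. penalty_functional \<Omega> (\<epsilon> n) t (ue n)) (\<Xi> t)"
    and k_large: "2 * DIM(real^'n) + 2 \<le> k"
begin

abbreviation "N2 \<equiv> L2_on_norm \<Omega>"

lemma u_H1: "u \<in> bochner_H1 T (Hs0 s \<Omega>) (Hs_norm s)"
  and u_W: "u \<in> bochner_W1inf T (L2_on \<Omega>) N2"
  and u'_L2: "\<And>\<tau>. \<tau> \<in> {0..T} \<Longrightarrow> u' \<tau> \<in> L2_on \<Omega>"
  and u'_bochner: "u' \<in> bochner_L2 T (Hs0 s \<Omega>) (Hs_norm s)"
  and u'_deriv: "weak_time_deriv T (Hs0 s \<Omega>) (Hs_norm s) u u'"
  and u_0: "AE x in lebesgue. u 0 x = w0 x" and u'_0: "AE x in lebesgue_on \<Omega>. u' 0 x = w1 x"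
  and \<Xi>_beta: "\<And>t. t \<in> {0<..T} \<Longrightarrow> \<Xi> t \<in> beta_V s \<Omega> t u"
  and \<Xi>_identity: "\<And>t \<phi>. t \<in> {0<..T} \<Longrightarrow> \<phi> \<in> V t \<Longrightarrow> weak_identity s \<Omega> \<nu> A B w1 g t u u' \<phi> (\<Xi> t \<phi>)"
  using sol unfolding weak_solution_def deriv_representative_def by auto

lemma u_bochner: "u \<in> bochner_L2 T (Hs0 s \<Omega>) (Hs_norm s)"
  using u_H1 by (simp add: bochner_H1_def)

lemma u_Hs0: "\<tau> \<in> {0..T} \<Longrightarrow> u \<tau> \<in> Hs0 s \<Omega>"
  using u_H1 by (simp add: bochner_H1_def time_continuous_def)

lemma u_V: "t \<in> {0<..T} \<Longrightarrow> u \<in> V t" and \<Xi>_dual: "t \<in> {0<..T} \<Longrightarrow> \<Xi> t \<in> dual_on (V t) (NV t)"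
  using \<Xi>_beta unfolding beta_V_def by auto

lemma AE_u'_Hs0: "AE \<tau> in time T. u' \<tau> \<in> Hs0 s \<Omega>"
  using u'_bochner unfolding bochner_L2_def strongly_measurable_def by (auto elim!: eventually_mono)

lemma u_Hs_sq_integrable: "integrable (time T) (\<lambda>\<tau>. (Hs_norm s (u \<tau>))\<^sup>2)"
  and u'_Hs_sq_integrable: "integrable (time T) (\<lambda>\<tau>. (Hs_norm s (u' \<tau>))\<^sup>2)"
  using u_bochner u'_bochner by (auto simp: bochner_L2_def)

lemmas u_Hs_integrable = Hs_norm_integrable[OF u_bochner]
  and u'_Hs_integrable = Hs_norm_integrable[OF u'_bochner]

lemma dt_u:
  assumes "t \<in> {0<..T}" shows "AE \<tau> in time t. AE x in lebesgue_on \<Omega>. u' \<tau> x = dt t u \<tau> x"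
proof (rule weak_time_deriv_Hs0_L2_unique[OF dom_sets _ u'_deriv])
  show "weak_time_deriv t (L2_on \<Omega>) N2 u (dt t u)"
    using u_V[OF assms] by (intro bochner_H1_time_deriv) (simp add: Vspace_def)
qed (use assms in simp)

subsubsection \<open>The reaction\<close>

lemma \<Xi>_limit:
  assumes "t \<in> {0<..T}" "\<phi> \<in> V t"
  shows "(\<lambda>n. penalty_functional \<Omega> (\<epsilon> n) t (ue n) \<phi>) \<longlonglongrightarrow> \<Xi> t \<phi>"
  using bspec[OF conv[OF assms(1), unfolded weakly_tends_def, THEN conjunct2, THEN conjunct2] dual_evaluation[OF assms(2)]] .

lemma \<Xi>_nonpos:
  assumes t: "t \<in> {0<..T}" and \<phi>: "\<phi> \<in> V t" and pos: "AE \<tau> in time t. AE x in lebesgue_on \<Omega>. 0 \<le> \<phi> \<tau> x"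
  shows "\<Xi> t \<phi> \<le> 0"
proof (rule LIMSEQ_le_const2[OF \<Xi>_limit[OF t \<phi>]])
  have "penalty_functional \<Omega> (\<epsilon> n) t (ue n) \<phi> \<le> 0" for n
  proof -
    have "0 \<le> (LINT \<tau>|time t. - (LINT x|lebesgue_on \<Omega>. penalty (\<epsilon> n) (ue n \<tau> x) * \<phi> \<tau> x))"
    proof (rule integral_nonneg_AE)
      show "AE \<tau> in time t. 0 \<le> - (LINT x|lebesgue_on \<Omega>. penalty (\<epsilon> n) (ue n \<tau> x) * \<phi> \<tau> x)"
        using pos
      proof eventually_elim
        case (elim \<tau>)
        have "0 \<le> (LINT x|lebesgue_on \<Omega>. - (penalty (\<epsilon> n) (ue n \<tau> x) * \<phi> \<tau> x))"
          by (rule integral_nonneg_AE) (use elim in eventually_elim, simp add: mult_nonpos_nonneg penalty_nonpos[OF \<epsilon>])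
        then show ?case by simp
      qed
    qed
    then show ?thesis by (simp add: penalty_functional_def)
  qed
  then show "\<exists>N. \<forall>n\<ge>N. penalty_functional \<Omega> (\<epsilon> n) t (ue n) \<phi> \<le> 0" by blast
qed

lemma \<Xi>_u_nonneg:
  assumes t: "t \<in> {0<..T}" shows "0 \<le> \<Xi> t u"
proof -
  have "0 \<in> V t" using V_const[OF Hs0_0, of t] by (simp add: zero_fun_def)
  then have "obstacle_energy \<Omega> t u - obstacle_energy \<Omega> t 0 \<le> ereal (\<Xi> t (u - 0))"
    using \<Xi>_beta[OF t] unfolding beta_V_def by blast
  then have "obstacle_energy \<Omega> t u \<le> ereal (\<Xi> t u)" by (simp add: obstacle_energy_0)
  then have "0 \<le> ereal (\<Xi> t u)" using obstacle_energy_nonneg order_trans by blast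
  then show ?thesis by simp
qed

lemma u_nonneg: "AE \<tau> in time T. AE x in lebesgue_on \<Omega>. 0 \<le> u \<tau> x"
proof (rule obstacle_energy_finite_AE[OF open_dom bounded_dom])
  have tT: "T \<in> {0<..T}" using T by simp
  show "strongly_measurable (time T) (L2_on \<Omega>) N2 u"
    using u_bochner by (intro strongly_measurable_Hs0_L2[OF dom_sets]) (auto simp: bochner_L2_def)
  \<comment> \<open>In \<open>ereal\<close> the difference \<open>\<infinity> - \<infinity>\<close>
    is \<open>\<infinity>\<close>, so comparing \<open>u\<close> with itself already excludes
    infinite energy.\<close>
  have "obstacle_energy \<Omega> T u - obstacle_energy \<Omega> T u \<le> ereal (\<Xi> T (u - u))"
    using \<Xi>_beta[OF tT] u_V[OF tT] unfolding beta_V_def by blast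
  then show "obstacle_energy \<Omega> T u \<noteq> \<infinity>" by auto
qed

definition reaction :: "nat \<Rightarrow> (real^'n \<Rightarrow> real) \<Rightarrow> real \<Rightarrow> real" where
  "reaction n \<psi> \<tau> = pairing \<Omega> \<psi> (\<lambda>x. penalty (\<epsilon> n) (ue n \<tau> x))"

text \<open>Minus the reaction accumulated up to \<open>t\<close>. Nothing is assumed about \<Xi> at
  time 0, so the value there is set to that of an integral over a null interval.\<close>

definition \<mu> :: "real \<Rightarrow> (real^'n \<Rightarrow> real) \<Rightarrow> real" where
  "\<mu> t \<psi> = (if t = 0 then 0 else - \<Xi> t (\<lambda>_. \<psi>))"

lemma AE_ue_L2: "AE \<tau> in time T. ue n \<tau> \<in> L2_on \<Omega>"
proof -
  have "strongly_measurable (time T) (Hs0 s \<Omega>) (Hs_norm s) (ue n)"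
    using ue[of n] by (simp add: bochner_Linf_def)
  then have "AE \<tau> in time T. ue n \<tau> \<in> Hs0 s \<Omega>"
    unfolding strongly_measurable_def by (auto elim!: eventually_mono)
  then show ?thesis by eventually_elim (rule Hs0_L2_on)
qed

lemma reaction_integrable:
  assumes \<psi>: "\<psi> \<in> L2_on \<Omega>" shows "integrable (time T) (reaction n \<psi>)"
proof -
  obtain C where C: "AE \<tau> in time T. Hs_norm s (ue n \<tau>) \<le> C"
    and m: "strongly_measurable (time T) (Hs0 s \<Omega>) (Hs_norm s) (ue n)"
    using ue[of n] unfolding bochner_Linf_def by blast
  have AEH: "AE \<tau> in time T. ue n \<tau> \<in> Hs0 s \<Omega>"
    using m unfolding strongly_measurable_def by (auto elim!: eventually_mono)
  show ?thesis
  proof (rule Bochner_Integration.integrable_bound)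
    show "integrable (time T) (\<lambda>_. (1 / \<epsilon> n * N2 \<psi>) * C)" by (rule integrable_time_const)
    show "reaction n \<psi> \<in> borel_measurable (time T)"
      unfolding reaction_def[abs_def]
    proof (rule strongly_measurable_functional[OF strongly_measurable_Hs0_L2[OF dom_sets m],
          where G = "\<lambda>w. pairing \<Omega> \<psi> (\<lambda>x. penalty (\<epsilon> n) (w x))"])
      show "\<bar>pairing \<Omega> \<psi> (\<lambda>x. penalty (\<epsilon> n) (v x)) - pairing \<Omega> \<psi> (\<lambda>x. penalty (\<epsilon> n) (w x))\<bar>
          \<le> (1 / \<epsilon> n * N2 \<psi>) * N2 (v - w)" if "v \<in> L2_on \<Omega>" "w \<in> L2_on \<Omega>" for v w
        by (rule penalty_pairing_lipschitz[OF \<epsilon> that \<psi>])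
    qed
    show "AE \<tau> in time T. norm (reaction n \<psi> \<tau>) \<le> norm ((1 / \<epsilon> n * N2 \<psi>) * C)"
      using C AEH
    proof eventually_elim
      case (elim \<tau>)
      have "pairing \<Omega> \<psi> (\<lambda>x. penalty (\<epsilon> n) ((0 :: real^'n \<Rightarrow> real) x)) = 0"
        by (simp add: pairing_def penalty_0[OF \<epsilon>])
      then have "\<bar>reaction n \<psi> \<tau>\<bar> \<le> (1 / \<epsilon> n * N2 \<psi>) * N2 (ue n \<tau>)"
        using penalty_pairing_lipschitz[OF \<epsilon>[of n] Hs0_L2_on[OF elim(2)] L2_space_0 \<psi>] by (simp add: reaction_def)
      also have "\<dots> \<le> (1 / \<epsilon> n * N2 \<psi>) * C"
        using elim(1) L2_on_norm_le_Hs_norm[OF dom_sets Hs0_L2[OF elim(2)], of s] \<epsilon>[of n]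
        by (intro mult_left_mono mult_nonneg_nonneg L2_norm_nonneg) auto
      finally show ?case unfolding real_norm_def by (rule order_trans) (rule abs_ge_self)
    qed
  qed
qed

lemma reaction_limit:
  assumes \<psi>: "\<psi> \<in> Hs0 s \<Omega>" and t: "t \<in> {0..T}"
  shows "(\<lambda>n. LINT \<tau>|time t. reaction n \<psi> \<tau>) \<longlonglongrightarrow> - \<mu> t \<psi>"
proof (cases "t = 0")
  case True
  have "(LINT \<tau>|time t. reaction n \<psi> \<tau>) = 0" for n
    unfolding True by (rule integral_eq_zero_null_sets) simp
  then show ?thesis by (simp add: True \<mu>_def)
next
  case False
  then have t': "t \<in> {0<..T}" using t by auto
  show ?thesis
    using \<Xi>_limit[OF t' V_const[OF \<psi>]] False
    by (simp add: \<mu>_def penalty_functional_def reaction_def pairing_def)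
qed

text \<open>In the penalized problems the increment is the integral over \<open>(r,t]\<close> of a
  density of fixed sign times the test function, so pointwise domination is inherited. The limit is
  taken afterwards, at the two fixed times.\<close>

lemma \<mu>_dominated:
  assumes \<psi>: "\<psi> \<in> test_functions \<Omega>" and \<rho>: "\<rho> \<in> test_functions \<Omega>" and c: "\<And>x. \<bar>\<psi> x\<bar> \<le> c * \<rho> x"
    and r: "0 \<le> r" "r \<le> t" "t \<le> T"
  shows "\<bar>\<mu> t \<psi> - \<mu> r \<psi>\<bar> \<le> c * (\<mu> t \<rho> - \<mu> r \<rho>)"
proof -
  note \<psi>L = Hs0_L2_on[OF test_Hs0[OF \<psi>]] and \<rho>L = Hs0_L2_on[OF test_Hs0[OF \<rho>]]
  let ?I = "\<lambda>n \<psi> t. LINT \<tau>|time t. reaction n \<psi> \<tau>"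
  have tr: "t \<in> {0..T}" "r \<in> {0..T}" using r by auto
  have "\<bar>?I n \<psi> t - ?I n \<psi> r\<bar> \<le> c * (- ?I n \<rho> t - (- ?I n \<rho> r))" for n
  proof -
    have "\<bar>?I n \<psi> t - ?I n \<psi> r\<bar> \<le> (LINT \<tau>|time t. - c * reaction n \<rho> \<tau>) - (LINT \<tau>|time r. - c * reaction n \<rho> \<tau>)"
    proof (rule integral_time_diff_le[OF reaction_integrable[OF \<psi>L] _ r])
      show "integrable (time T) (\<lambda>\<tau>. - c * reaction n \<rho> \<tau>)"
        by (intro integrable_mult_right reaction_integrable[OF \<rho>L])
      show "AE \<tau> in time T. \<bar>reaction n \<psi> \<tau>\<bar> \<le> - c * reaction n \<rho> \<tau>"
        using AE_ue_L2[of n]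
      proof eventually_elim
        case (elim \<tau>)
        note p = penalty_L2[OF \<epsilon>[of n] elim]
        have "\<bar>reaction n \<psi> \<tau>\<bar> \<le> (LINT x|lebesgue_on \<Omega>. - c * (penalty (\<epsilon> n) (ue n \<tau> x) * \<rho> x))"
          unfolding reaction_def pairing_def
        proof (rule integral_abs_le_integral)
          show "integrable (lebesgue_on \<Omega>) (\<lambda>x. - c * (penalty (\<epsilon> n) (ue n \<tau> x) * \<rho> x))"
            by (intro integrable_mult_right pairing_integrable[OF p \<rho>L])
          show "AE x in lebesgue_on \<Omega>. \<bar>penalty (\<epsilon> n) (ue n \<tau> x) * \<psi> x\<bar> \<le> - c * (penalty (\<epsilon> n) (ue n \<tau> x) * \<rho> x)"
          proof (rule AE_I2)
            fix x
            have "(- penalty (\<epsilon> n) (ue n \<tau> x)) * \<bar>\<psi> x\<bar> \<le> (- penalty (\<epsilon> n) (ue n \<tau> x)) * (c * \<rho> x)"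
              using penalty_nonpos[OF \<epsilon>, of n] c by (intro mult_left_mono) auto
            then show "\<bar>penalty (\<epsilon> n) (ue n \<tau> x) * \<psi> x\<bar> \<le> - c * (penalty (\<epsilon> n) (ue n \<tau> x) * \<rho> x)"
              using penalty_nonpos[OF \<epsilon>, of n] by (simp add: abs_mult abs_of_nonpos mult_ac)
          qed
        qed
        then show ?case by (simp add: reaction_def pairing_def)
      qed
    qed
    then show ?thesis by (simp add: algebra_simps)
  qed
  moreover have "(\<lambda>n. \<bar>?I n \<psi> t - ?I n \<psi> r\<bar>) \<longlonglongrightarrow> \<bar>- \<mu> t \<psi> - (- \<mu> r \<psi>)\<bar>"
    by (intro tendsto_intros reaction_limit test_Hs0[OF \<psi>] tr)
  moreover have "(\<lambda>n. c * (- ?I n \<rho> t - (- ?I n \<rho> r))) \<longlonglongrightarrow> c * (- (- \<mu> t \<rho>) - (- (- \<mu> r \<rho>)))"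
    by (intro tendsto_intros reaction_limit test_Hs0[OF \<rho>] tr)
  ultimately have "\<bar>- \<mu> t \<psi> - (- \<mu> r \<psi>)\<bar> \<le> c * (- (- \<mu> t \<rho>) - (- (- \<mu> r \<rho>)))"
    by (intro LIMSEQ_le) auto
  then show ?thesis by (simp add: abs_minus_commute)
qed

lemma \<mu>_variation:
  obtains m C where "mono_on {0..T} m" "0 \<le> C" "\<And>(\<psi> :: real^'n \<Rightarrow> real) r t. \<psi> \<in> test_functions \<Omega> \<Longrightarrow> 0 \<le> r \<Longrightarrow> r \<le> t \<Longrightarrow> t \<le> T \<Longrightarrow>
    \<bar>\<mu> t \<psi> - \<mu> r \<psi>\<bar> \<le> C * Hk_norm k \<psi> * (m t - m r)"
proof -
  define d where "d = DIM(real^'n) + 2"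
  define \<rho> where "\<rho> = dominating_bump \<Omega> d"
  have \<rho>: "\<rho> N \<in> test_functions \<Omega>" for N by (simp add: \<rho>_def dominating_bump_test)
  have \<rho>0: "0 \<le> \<rho> N x" for N x by (simp add: \<rho>_def dominating_bump_nonneg)
  have \<rho>_le: "\<rho> N x \<le> \<rho> N' x" if "N \<le> N'" for N N' x using that by (simp add: \<rho>_def dominating_bump_mono)
  have \<mu>0: "\<mu> 0 \<psi> = 0" for \<psi> by (simp add: \<mu>_def)
  obtain C1 where C1: "\<And>N. Hs_norm s (\<rho> N) \<le> C1"
    using dominating_bump_Hs_norm[OF open_dom bounded_dom emb s d_def] unfolding \<rho>_def by blast
  obtain C where C: "0 \<le> C" "\<And>\<psi> :: real^'n \<Rightarrow> real. \<psi> \<in> test_functions \<Omega> \<Longrightarrow> \<exists>N. \<forall>x. \<bar>\<psi> x\<bar> \<le> C * Hk_norm k \<psi> * \<rho> N x"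
    using dominating_bump_dominates[OF open_dom bounded_dom, of d k] k_large unfolding \<rho>_def d_def by auto
  have mono_t: "\<mu> r (\<rho> N) \<le> \<mu> t (\<rho> N)" if "0 \<le> r" "r \<le> t" "t \<le> T" for r t N
    using \<mu>_dominated[OF \<rho> \<rho> _ that, of N 1 N] \<rho>0 by simp
  \<comment> \<open>Domination on the whole interval \<open>(0,t]\<close>, where the lower end
    contributes 0.\<close>
  have mono_N: "\<mu> t (\<rho> N) \<le> \<mu> t (\<rho> N')" if "0 \<le> t" "t \<le> T" "N \<le> N'" for t N N'
    using \<mu>_dominated[OF \<rho> \<rho> _ order_refl that(1,2), of N 1 N'] \<rho>0 \<rho>_le[OF that(3)] by (simp add: \<mu>0)
  have tT: "T \<in> {0<..T}" using T by simp
  have "\<exists>C2. \<forall>\<phi>\<in>V T. \<bar>\<Xi> T \<phi>\<bar> \<le> C2 * NV T \<phi>" using \<Xi>_dual[OF tT] unfolding dual_on_def by blast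
  then obtain C2 where C2: "\<And>\<phi>. \<phi> \<in> V T \<Longrightarrow> \<bar>\<Xi> T \<phi>\<bar> \<le> C2 * NV T \<phi>" by blast
  \<comment> \<open>A bound at the final time suffices, as \<open>mono_t\<close> carries it to the
    earlier ones. Its uniformity in \<open>N\<close> is the purpose of
    \<open>dominating_bump_Hs_norm\<close>.\<close>
  have bdT: "\<mu> T (\<rho> N) \<le> \<bar>C2\<bar> * (sqrt (2 * T) * C1)" for N
  proof -
    note H = test_Hs0[OF \<rho>[of N]]
    have "\<mu> T (\<rho> N) \<le> \<bar>\<Xi> T (\<lambda>_. \<rho> N)\<bar>" using T by (simp add: \<mu>_def)
    also have "\<dots> \<le> C2 * NV T (\<lambda>_. \<rho> N)" by (rule C2[OF V_const[OF H]])
    also have "\<dots> \<le> \<bar>C2\<bar> * NV T (\<lambda>_. \<rho> N)" by (intro mult_right_mono NV_nonneg) auto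
    also have "\<dots> \<le> \<bar>C2\<bar> * (sqrt (2 * T) * Hs_norm s (\<rho> N))" using T by (intro mult_left_mono NV_const[OF H]) auto
    also have "\<dots> \<le> \<bar>C2\<bar> * (sqrt (2 * T) * C1)" using T by (intro mult_left_mono C1) auto
    finally show ?thesis .
  qed
  define m where "m t = lim (\<lambda>N. \<mu> t (\<rho> N))" for t
  have m: "(\<lambda>N. \<mu> t (\<rho> N)) \<longlonglongrightarrow> m t" if "0 \<le> t" "t \<le> T" for t
  proof -
    have "incseq (\<lambda>N. \<mu> t (\<rho> N))" using mono_N[OF that] by (simp add: incseq_def)
    moreover have "\<mu> t (\<rho> N) \<le> \<bar>C2\<bar> * (sqrt (2 * T) * C1)" for N
      using mono_t[OF that order_refl, of N] bdT[of N] by linarith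
    ultimately have "convergent (\<lambda>N. \<mu> t (\<rho> N))"
      using incseq_convergent[of "\<lambda>N. \<mu> t (\<rho> N)"] convergentI by metis
    then show ?thesis by (simp add: m_def convergent_LIMSEQ_iff)
  qed
  show ?thesis
  proof (rule that[of m C])
    show "mono_on {0..T} m"
    proof (rule mono_onI)
      fix r t assume "r \<in> {0..T}" "t \<in> {0..T}" "r \<le> t"
      then show "m r \<le> m t" by (intro LIMSEQ_le[OF m m]) (auto intro: mono_t)
    qed
    show "0 \<le> C" by (rule C(1))
    fix \<psi> :: "real^'n \<Rightarrow> real" and r t assume \<psi>: "\<psi> \<in> test_functions \<Omega>" and r: "0 \<le> r" "r \<le> t" "t \<le> T"
    obtain N0 where N0: "\<And>x. \<bar>\<psi> x\<bar> \<le> C * Hk_norm k \<psi> * \<rho> N0 x" using C(2)[OF \<psi>] by blast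
    \<comment> \<open>The index at which domination starts depends on \<psi>. Since it persists for
      all larger \<open>N\<close>, letting \<open>N\<close> tend to infinity gives a bound with the
      same \<open>m\<close> for every \<psi>.\<close>
    have "\<bar>\<mu> t \<psi> - \<mu> r \<psi>\<bar> \<le> C * Hk_norm k \<psi> * (\<mu> t (\<rho> N) - \<mu> r (\<rho> N))" if "N \<ge> N0" for N
    proof (rule \<mu>_dominated[OF \<psi> \<rho> _ r])
      fix x
      have "C * Hk_norm k \<psi> * \<rho> N0 x \<le> C * Hk_norm k \<psi> * \<rho> N x"
        using C(1) Hk_norm_nonneg[of k \<psi>] \<rho>_le[OF that] by (intro mult_left_mono mult_nonneg_nonneg)
      then show "\<bar>\<psi> x\<bar> \<le> C * Hk_norm k \<psi> * \<rho> N x" using N0[of x] by linarith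
    qed
    moreover have "(\<lambda>N. C * Hk_norm k \<psi> * (\<mu> t (\<rho> N) - \<mu> r (\<rho> N))) \<longlonglongrightarrow> C * Hk_norm k \<psi> * (m t - m r)"
      using r by (intro tendsto_intros m) auto
    ultimately show "\<bar>\<mu> t \<psi> - \<mu> r \<psi>\<bar> \<le> C * Hk_norm k \<psi> * (m t - m r)"
      by (intro LIMSEQ_le_const) blast+
  qed
qed

subsubsection \<open>The derivative has bounded variation\<close>

lemma form_integrable:
  assumes C: "0 < hi" "elliptic_coefficient lo hi C" and v: "v \<in> bochner_L2 T (Hs0 s \<Omega>) (Hs_norm s)" and \<psi>: "\<psi> \<in> Hs0 s \<Omega>"
  shows "integrable (time T) (\<lambda>\<tau>. form s C \<psi> (v \<tau>))"
proof (rule bochner_L2_functional_integrable[OF v])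
  have hi: "0 \<le> hi" using C(1) by simp
  note \<psi>H = Hs0_Hs[OF \<psi>]
  fix x y assume x: "x \<in> Hs0 s \<Omega>" and y: "y \<in> Hs0 s \<Omega>"
  show "\<bar>form s C \<psi> x\<bar> \<le> (hi * L2_norm lebesgue (frac_grad s \<psi>)) * Hs_norm s x"
    by (rule form_bound[OF C(2) hi Hs0_Hs[OF x] \<psi>H])
  show "\<bar>form s C \<psi> x - form s C \<psi> y\<bar> \<le> (hi * L2_norm lebesgue (frac_grad s \<psi>)) * Hs_norm s (x - y)"
    unfolding form_diff[OF C(2) hi s bounded_dom Hs0_vanishing[OF x] Hs0_vanishing[OF y] \<psi>H]
    by (rule form_bound[OF C(2) hi Hs0_diff_Hs[OF x y] \<psi>H])
qed

text \<open>For a test function constant in time the term with its derivative disappears, and what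
  remains determines \<open>u' t\<close> at every single time. Bounded variation concerns every
  time, so an identity almost everywhere would not do.\<close>

lemma const_identity:
  assumes \<psi>: "\<psi> \<in> Hs0 s \<Omega>" and t: "t \<in> {0..T}"
  shows "pairing \<Omega> \<psi> (u' t) = pairing \<Omega> \<psi> w1 + \<mu> t \<psi> - (LINT \<tau>|time t. form s A \<psi> (u \<tau>))
    - \<nu> * (LINT \<tau>|time t. form s B \<psi> (u' \<tau>)) + t * pairing \<Omega> \<psi> g"
proof (cases "t = 0")
  case True
  have "(LINT \<tau>|time 0. f \<tau>) = 0" for f :: "real \<Rightarrow> real" by (rule integral_eq_zero_null_sets) simp
  moreover have "pairing \<Omega> \<psi> (u' 0) = pairing \<Omega> \<psi> w1"
    unfolding pairing_def by (rule integral_cong_AE_lebesgue_on[OF dom_sets]) (use u'_0 in eventually_elim, simp)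
  ultimately show ?thesis by (simp add: True \<mu>_def)
next
  case False
  then have t': "t \<in> {0<..T}" using t by auto
  have z: "(LINT \<tau>|time t. LINT x|lebesgue_on \<Omega>. u' \<tau> x * dt t (\<lambda>_. \<psi>) \<tau> x) = 0"
  proof (rule integral_eq_zero_AE)
    show "AE \<tau> in time t. (LINT x|lebesgue_on \<Omega>. u' \<tau> x * dt t (\<lambda>_. \<psi>) \<tau> x) = 0"
      using time_deriv_const_AE[OF dom_sets Hs0_L2_on[OF \<psi>]]
    proof eventually_elim
      case (elim \<tau>)
      show ?case by (rule integral_eq_zero_AE) (use elim in eventually_elim, simp)
    qed
  qed
  have "(LINT \<tau>|time t. LINT x|lebesgue_on \<Omega>. g x * \<psi> x) = t * pairing \<Omega> \<psi> g"
    using t' measure_time[of t] by (simp only: pairing_def lebesgue_integral_const space_lebesgue_on) simp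
  with \<Xi>_identity[OF t' V_const[OF \<psi>]] z show ?thesis
    using False unfolding weak_identity_def frac_form_def form_def pairing_def \<mu>_def if_not_P[OF False] by linarith
qed

lemma derivative_variation:
  obtains M where "mono_on {0..T} M" "\<And>(\<psi> :: real^'n \<Rightarrow> real) r t. \<psi> \<in> test_functions \<Omega> \<Longrightarrow> 0 \<le> r \<Longrightarrow> r \<le> t \<Longrightarrow> t \<le> T \<Longrightarrow>
    \<bar>pairing \<Omega> \<psi> (u' t) - pairing \<Omega> \<psi> (u' r)\<bar> \<le> Hk_norm k \<psi> * (M t - M r)"
proof -
  obtain m C where m: "mono_on {0..T} m" "0 \<le> C" "\<And>(\<psi> :: real^'n \<Rightarrow> real) r t. \<psi> \<in> test_functions \<Omega> \<Longrightarrow> 0 \<le> r \<Longrightarrow> r \<le> t \<Longrightarrow> t \<le> T \<Longrightarrow>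
      \<bar>\<mu> t \<psi> - \<mu> r \<psi>\<bar> \<le> C * Hk_norm k \<psi> * (m t - m r)" using \<mu>_variation by blast
  obtain D where D: "0 \<le> D" "\<And>\<psi> :: real^'n \<Rightarrow> real. \<psi> \<in> test_functions \<Omega> \<Longrightarrow> L2_norm lebesgue (frac_grad s \<psi>) \<le> D * Hk_norm k \<psi>"
    using frac_grad_le_Hk_norm[OF open_dom bounded_dom emb s k] by blast
  define IA where "IA t = (LINT \<tau>|time t. Hs_norm s (u \<tau>))" for t
  define IB where "IB t = (LINT \<tau>|time t. Hs_norm s (u' \<tau>))" for t
  \<comment> \<open>One nondecreasing summand for each source of variation: the reaction, the two
    forms through the integrated \<open>Hs_norm\<close> of \<open>u\<close> and \<open>u'\<close>,
    and the force.\<close>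
  define M where "M t = C * m t + (a_hi * D * IA t + \<nu> * b_hi * D * IB t) + t * N2 g" for t
  have IA: "IA r \<le> IA t" and IB: "IB r \<le> IB t" if "0 \<le> r" "r \<le> t" "t \<le> T" for r t
    using integral_time_diff_le[OF u_Hs_integrable u_Hs_integrable that]
      integral_time_diff_le[OF u'_Hs_integrable u'_Hs_integrable that]
    by (auto simp: IA_def IB_def Hs_norm_nonneg)
  show ?thesis
  proof (rule that[of M])
    show "mono_on {0..T} M"
    proof (rule mono_onI)
      fix r t assume rt: "r \<in> {0..T}" "t \<in> {0..T}" "r \<le> t"
      then have "m r \<le> m t" "IA r \<le> IA t" "IB r \<le> IB t"
        using mono_onD[OF m(1)] IA[of r t] IB[of r t] by auto
      then show "M r \<le> M t"
        unfolding M_def using m(2) A(1) B(1) D(1) \<nu> rt L2_norm_nonneg[of "lebesgue_on \<Omega>" g]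
        by (intro add_mono mult_left_mono mult_right_mono mult_nonneg_nonneg) auto
    qed
    fix \<psi> :: "real^'n \<Rightarrow> real" and r t assume \<psi>: "\<psi> \<in> test_functions \<Omega>" and r: "0 \<le> r" "r \<le> t" "t \<le> T"
    note \<psi>H = test_Hs0[OF \<psi>]
    let ?h = "Hk_norm k \<psi>"
    have form_le: "\<bar>(LINT \<tau>|time t. form s E \<psi> (v \<tau>)) - (LINT \<tau>|time r. form s E \<psi> (v \<tau>))\<bar>
        \<le> hi * D * ?h * ((LINT \<tau>|time t. Hs_norm s (v \<tau>)) - (LINT \<tau>|time r. Hs_norm s (v \<tau>)))"
      if E: "0 < hi" "elliptic_coefficient lo hi E" and v: "v \<in> bochner_L2 T (Hs0 s \<Omega>) (Hs_norm s)" for hi lo E v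
    proof -
      have "\<bar>(LINT \<tau>|time t. form s E \<psi> (v \<tau>)) - (LINT \<tau>|time r. form s E \<psi> (v \<tau>))\<bar>
          \<le> (LINT \<tau>|time t. hi * D * ?h * Hs_norm s (v \<tau>)) - (LINT \<tau>|time r. hi * D * ?h * Hs_norm s (v \<tau>))"
      proof (rule integral_time_diff_le[OF form_integrable[OF E v \<psi>H] _ r])
        show "integrable (time T) (\<lambda>\<tau>. hi * D * ?h * Hs_norm s (v \<tau>))"
          by (intro integrable_mult_right Hs_norm_integrable[OF v])
        have "AE \<tau> in time T. v \<tau> \<in> Hs0 s \<Omega>"
          using v unfolding bochner_L2_def strongly_measurable_def by (auto elim!: eventually_mono)
        then show "AE \<tau> in time T. \<bar>form s E \<psi> (v \<tau>)\<bar> \<le> hi * D * ?h * Hs_norm s (v \<tau>)"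
        proof eventually_elim
          case (elim \<tau>)
          have "\<bar>form s E \<psi> (v \<tau>)\<bar> \<le> hi * L2_norm lebesgue (frac_grad s \<psi>) * Hs_norm s (v \<tau>)"
            using E(1) by (intro form_bound[OF E(2) _ Hs0_Hs[OF elim] Hs0_Hs[OF \<psi>H]]) simp
          also have "\<dots> \<le> hi * (D * ?h) * Hs_norm s (v \<tau>)"
            using E(1) D(2)[OF \<psi>] by (intro mult_right_mono mult_left_mono Hs_norm_nonneg) auto
          finally show ?case by (simp add: mult.assoc)
        qed
      qed
      then show ?thesis by (simp add: right_diff_distrib)
    qed
    have fA: "\<bar>(LINT \<tau>|time t. form s A \<psi> (u \<tau>)) - (LINT \<tau>|time r. form s A \<psi> (u \<tau>))\<bar> \<le> a_hi * D * ?h * (IA t - IA r)"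
      unfolding IA_def by (rule form_le[OF A u_bochner])
    have fB: "\<bar>(LINT \<tau>|time t. form s B \<psi> (u' \<tau>)) - (LINT \<tau>|time r. form s B \<psi> (u' \<tau>))\<bar> \<le> b_hi * D * ?h * (IB t - IB r)"
      unfolding IB_def by (rule form_le[OF B u'_bochner])
    have gb: "\<bar>pairing \<Omega> \<psi> g\<bar> \<le> ?h * N2 g"
    proof -
      have "\<bar>pairing \<Omega> \<psi> g\<bar> \<le> N2 \<psi> * N2 g" by (rule pairing_bound[OF g Hs0_L2_on[OF \<psi>H]])
      also have "\<dots> \<le> ?h * N2 g"
        using L2_space_restrict(2)[OF dom_sets Hs0_L2[OF \<psi>H]] L2_partial_le_Hk_norm[of "[]" k \<psi>]
        by (intro mult_right_mono L2_norm_nonneg) simp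
      finally show ?thesis .
    qed
    have tT: "t \<in> {0..T}" "r \<in> {0..T}" using r by auto
    have factor: "C * h * (m1 - m2) + a * D * h * (I1 - I2) + \<nu> * (b * D * h * (J1 - J2)) + (t - r) * (h * G)
        = h * ((C * m1 + (a * D * I1 + \<nu> * b * D * J1) + t * G) - (C * m2 + (a * D * I2 + \<nu> * b * D * J2) + r * G))"
      for h m1 m2 a I1 I2 b J1 J2 G :: real by (simp add: algebra_simps)
    have eq: "pairing \<Omega> \<psi> (u' t) - pairing \<Omega> \<psi> (u' r) = (\<mu> t \<psi> - \<mu> r \<psi>)
        - ((LINT \<tau>|time t. form s A \<psi> (u \<tau>)) - (LINT \<tau>|time r. form s A \<psi> (u \<tau>)))
        - \<nu> * ((LINT \<tau>|time t. form s B \<psi> (u' \<tau>)) - (LINT \<tau>|time r. form s B \<psi> (u' \<tau>))) + (t - r) * pairing \<Omega> \<psi> g"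
      unfolding const_identity[OF \<psi>H tT(1)] const_identity[OF \<psi>H tT(2)] by (simp add: algebra_simps)
    have "\<bar>pairing \<Omega> \<psi> (u' t) - pairing \<Omega> \<psi> (u' r)\<bar> \<le> C * ?h * (m t - m r) + a_hi * D * ?h * (IA t - IA r)
        + \<nu> * (b_hi * D * ?h * (IB t - IB r)) + (t - r) * (?h * N2 g)"
    proof -
      have abs4: "\<bar>p - q - x + y\<bar> \<le> P + Q + X + Y" if "\<bar>p\<bar> \<le> P" "\<bar>q\<bar> \<le> Q" "\<bar>x\<bar> \<le> X" "\<bar>y\<bar> \<le> Y" for p q x y P Q X Y :: real
        using that by linarith
      show ?thesis
        unfolding eq
      proof (rule abs4[OF m(3)[OF \<psi> r] fA])
        show "\<bar>\<nu> * ((LINT \<tau>|time t. form s B \<psi> (u' \<tau>)) - (LINT \<tau>|time r. form s B \<psi> (u' \<tau>)))\<bar> \<le> \<nu> * (b_hi * D * ?h * (IB t - IB r))"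
          using mult_left_mono[OF fB, of \<nu>] \<nu> by (simp add: abs_mult)
        show "\<bar>(t - r) * pairing \<Omega> \<psi> g\<bar> \<le> (t - r) * (?h * N2 g)"
          using mult_left_mono[OF gb, of "t - r"] r by (simp add: abs_mult)
      qed
    qed
    also have "\<dots> = ?h * (M t - M r)" unfolding M_def by (rule factor)
    finally show "\<bar>pairing \<Omega> \<psi> (u' t) - pairing \<Omega> \<psi> (u' r)\<bar> \<le> ?h * (M t - M r)" .
  qed
qed

lemma as_distribution_pairing: "as_distribution \<Omega> f \<psi> = pairing \<Omega> \<psi> f"
  by (simp add: as_distribution_def pairing_def)

lemma as_distribution_H_neg:
  assumes "f \<in> L2_on \<Omega>" shows "as_distribution \<Omega> f \<in> H_neg k \<Omega>"
  using emb L2_space_subset_L1(1)[OF bounded_dom dom_sets assms]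
  unfolding negative_order_embeddings_def compactly_embedded_def by blast

lemma Hk_norm_0: "Hk_norm k (0 :: 'a::euclidean_space \<Rightarrow> real) = 0"
  using Hk_norm_scaleR[of "0 :: 'a \<Rightarrow> real" UNIV k 0, OF test_functions_0] by simp

lemma H_neg_norm_le:
  fixes F :: "(real^'n \<Rightarrow> real) \<Rightarrow> real"
  assumes "\<And>\<psi>. \<psi> \<in> test_functions \<Omega> \<Longrightarrow> \<bar>F \<psi>\<bar> \<le> Hk_norm k \<psi> * c" "0 \<le> c"
  shows "H_neg_norm k \<Omega> F \<le> c"
  unfolding H_neg_norm_def
proof (rule dual_norm_le[OF test_functions_0])
  show "Hk_norm k (0 :: real^'n \<Rightarrow> real) \<le> 1" by (simp add: Hk_norm_0)
qed (use assms in \<open>auto simp: mult.commute\<close>)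

text \<open>\<open>dual_norm\<close> is a supremum of reals, so even its sign depends on the
  supremum being over a bounded set.\<close>

lemma H_neg_norm_nonneg:
  assumes "F \<in> H_neg k \<Omega>" shows "0 \<le> H_neg_norm k \<Omega> F"
proof -
  have "\<bar>F 0\<bar> \<le> H_neg_norm k \<Omega> F"
    unfolding H_neg_norm_def
  proof (rule dual_norm_upper[OF assms[unfolded H_neg_def] Hk_norm_nonneg test_functions_0])
    show "Hk_norm k (0 :: real^'n \<Rightarrow> real) \<le> 1" by (simp add: Hk_norm_0)
  qed
  then show ?thesis by (rule order_trans[OF abs_ge_zero])
qed

lemma derivative_BV: "(\<lambda>\<tau>. as_distribution \<Omega> (u' \<tau>)) \<in> BV T (H_neg k \<Omega>) (H_neg_norm k \<Omega>)"
proof -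
  obtain M where M: "mono_on {0..T} M" "\<And>(\<psi> :: real^'n \<Rightarrow> real) r t. \<psi> \<in> test_functions \<Omega> \<Longrightarrow> 0 \<le> r \<Longrightarrow> r \<le> t \<Longrightarrow> t \<le> T \<Longrightarrow>
    \<bar>pairing \<Omega> \<psi> (u' t) - pairing \<Omega> \<psi> (u' r)\<bar> \<le> Hk_norm k \<psi> * (M t - M r)" using derivative_variation by blast
  have le: "H_neg_norm k \<Omega> (as_distribution \<Omega> (u' t) - as_distribution \<Omega> (u' r)) \<le> M t - M r"
    if "0 \<le> r" "r \<le> t" "t \<le> T" for r t
    using M(2)[OF _ that] mono_onD[OF M(1), of r t] that
    by (intro H_neg_norm_le) (auto simp: as_distribution_pairing)
  have "(\<Sum>i<n. H_neg_norm k \<Omega> (as_distribution \<Omega> (u' (p (Suc i))) - as_distribution \<Omega> (u' (p i)))) \<le> M T - M 0"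
    if p: "\<forall>i<n. p i \<le> p (Suc i)" "0 \<le> p 0" "p n \<le> T" for p n
  proof -
    have mono: "p i \<le> p j" if "i \<le> j" "j \<le> n" for i j
      using that by (induction j rule: dec_induct) (use p(1) in \<open>auto intro: order_trans\<close>)
    have pT: "0 \<le> p i" "p i \<le> T" if "i \<le> n" for i
      using mono[of 0 i] mono[of i n] that p(2,3) by auto
    have "(\<Sum>i<n. H_neg_norm k \<Omega> (as_distribution \<Omega> (u' (p (Suc i))) - as_distribution \<Omega> (u' (p i)))) \<le> (\<Sum>i<n. M (p (Suc i)) - M (p i))"
      using p(1) pT by (intro sum_mono le) auto
    also have "\<dots> = M (p n) - M (p 0)" by (rule sum_lessThan_telescope)
    also have "\<dots> \<le> M T - M 0"
      using mono_onD[OF M(1), of "p n" T] mono_onD[OF M(1), of 0 "p 0"] pT[of n] pT[of 0] T by (intro diff_mono) auto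
    finally show ?thesis .
  qed
  then have "finite_variation T (H_neg_norm k \<Omega>) (\<lambda>\<tau>. as_distribution \<Omega> (u' \<tau>))"
    unfolding finite_variation_def by blast
  then show ?thesis unfolding BV_def using as_distribution_H_neg[OF u'_L2] by blast
qed

subsubsection \<open>The initial velocity\<close>

text \<open>The values of \<open>u'\<close> lie in L2 at every time, but the bound is an essential
  one: it belongs to the derivative in \<open>bochner_W1inf\<close>, which agrees with
  \<open>u'\<close> off a null set. Each interval next to 0 meets the good times.\<close>

lemma good_times:
  obtains t C where "\<And>n. t n \<in> {0<..T}" "t \<longlonglongrightarrow> 0" "\<And>n. N2 (u' (t n)) \<le> C"
proof -
  obtain v where v: "v \<in> bochner_Linf T (L2_on \<Omega>) N2" "weak_time_deriv T (L2_on \<Omega>) N2 u v"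
    using u_W by (auto simp: bochner_W1inf_def)
  obtain C where C: "AE \<tau> in time T. N2 (v \<tau>) \<le> C" using v(1) unfolding bochner_Linf_def by blast
  have "AE \<tau> in time T. N2 (u' \<tau>) \<le> C"
    using C weak_time_deriv_Hs0_L2_unique[OF dom_sets order_refl u'_deriv v(2)]
  proof eventually_elim
    case (elim \<tau>)
    show ?case using elim(1) L2_norm_cong_AE[OF dom_sets elim(2)] by simp
  qed
  then have "\<exists>\<tau>\<in>{0<..<T / real (Suc n)}. N2 (u' \<tau>) \<le> C" for n
    by (rule AE_time_ex) (use T in \<open>auto simp: divide_le_eq\<close>)
  then obtain t where t: "\<And>n. t n \<in> {0<..<T / real (Suc n)}" "\<And>n. N2 (u' (t n)) \<le> C" by metis
  have T1: "T / real (Suc n) \<le> T" for n using T by (simp add: divide_le_eq)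
  have "t n \<in> {0<..T}" for n using t(1)[of n] T1[of n] by auto
  moreover have "t \<longlonglongrightarrow> 0"
  proof (rule tendsto_sandwich[OF _ _ tendsto_const LIMSEQ_Suc[OF lim_const_over_n]])
    show "\<forall>\<^sub>F n in sequentially. 0 \<le> t n" using t(1) by (intro always_eventually allI) (simp add: less_imp_le)
    show "\<forall>\<^sub>F n in sequentially. t n \<le> T / real (Suc n)" using t(1) by (intro always_eventually allI) (simp add: less_imp_le)
  qed
  ultimately show ?thesis using that t(2) by blast
qed

lemma initial_velocity:
  obtains z where "z \<in> L2_on \<Omega>"
    "((\<lambda>\<tau>. H_neg_norm k \<Omega> (as_distribution \<Omega> (u' \<tau>) - as_distribution \<Omega> z)) \<longlongrightarrow> 0) (at_right 0)"
    "\<And>\<psi>. \<psi> \<in> Hs0 s \<Omega> \<Longrightarrow> AE x in lebesgue. 0 \<le> \<psi> x \<Longrightarrow> pairing \<Omega> \<psi> w1 \<le> pairing \<Omega> \<psi> z"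
    "pairing \<Omega> w0 z \<le> pairing \<Omega> w0 w1"
proof -
  obtain t C where t: "\<And>n. t n \<in> {0<..T}" "t \<longlonglongrightarrow> 0" and C: "\<And>n. N2 (u' (t n)) \<le> C" using good_times by blast
  have t0: "\<And>n. 0 \<le> t n \<and> t n \<le> T" using t(1) by (simp add: less_imp_le)
  have tT: "t n \<in> {0..T}" for n using t0 by simp
  obtain z where z: "z \<in> L2_on \<Omega>"
    "\<And>h a. h \<in> L2_on \<Omega> \<Longrightarrow> \<forall>\<^sub>F n in sequentially. a \<le> pairing \<Omega> h (u' (t n)) \<Longrightarrow> a \<le> pairing \<Omega> h z"
    using L2_weak_cluster_point[OF bounded_dom dom_sets, of "\<lambda>n. u' (t n)" C] u'_L2[OF tT] C
    unfolding pairing_def by blast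
  \<comment> \<open>The cluster point inherits lower bounds that hold eventually, so errors tending
    to 0 are harmless; upper bounds follow by testing with \<open>- h\<close>.\<close>
  have zlim: "c \<le> pairing \<Omega> h z" if h: "h \<in> L2_on \<Omega>" and r: "r \<longlonglongrightarrow> 0" and le: "\<And>n. c - r n \<le> pairing \<Omega> h (u' (t n))" for h c r
  proof (rule field_le_epsilon)
    fix e :: real assume "0 < e"
    from order_tendstoD(2)[OF r this] have "\<forall>\<^sub>F n in sequentially. c - e \<le> pairing \<Omega> h (u' (t n))"
    proof eventually_elim
      case (elim n) then show ?case using le[of n] by linarith
    qed
    from z(2)[OF h this] show "c \<le> pairing \<Omega> h z + e" by simp
  qed
  show ?thesis
  proof (rule that[OF z(1)])
    obtain M where M: "mono_on {0..T} M" "\<And>(\<psi> :: real^'n \<Rightarrow> real) r t. \<psi> \<in> test_functions \<Omega> \<Longrightarrow> 0 \<le> r \<Longrightarrow> r \<le> t \<Longrightarrow> t \<le> T \<Longrightarrow>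
      \<bar>pairing \<Omega> \<psi> (u' t) - pairing \<Omega> \<psi> (u' r)\<bar> \<le> Hk_norm k \<psi> * (M t - M r)" using derivative_variation by blast
    \<comment> \<open>The right limit of \<open>M\<close> at 0. Only positive times enter, since
      \<open>u'\<close> may jump at 0.\<close>
    define L where "L = Inf (M ` {0<..T})"
    have "bdd_below (M ` {0<..T})"
      by (rule bdd_belowI2[of _ "M 0"]) (use mono_onD[OF M(1), of 0] T in auto)
    then have L: "L \<le> M \<tau>" if "\<tau> \<in> {0<..T}" for \<tau> unfolding L_def using that by (intro cInf_lower) auto
    have est: "H_neg_norm k \<Omega> (as_distribution \<Omega> (u' \<tau>) - as_distribution \<Omega> z) \<le> M \<tau> - L" if \<tau>: "\<tau> \<in> {0<..T}" for \<tau>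
    proof (rule H_neg_norm_le)
      \<comment> \<open>For fixed \<tau> the comparison time \<open>t n\<close> is sent to 0. This
        is one side of the estimate; the test function \<open>- \<psi>\<close> gives the
        other.\<close>
      have one: "pairing \<Omega> \<psi> (u' \<tau>) - Hk_norm k \<psi> * (M \<tau> - L) \<le> pairing \<Omega> \<psi> z" if \<psi>: "\<psi> \<in> test_functions \<Omega>" for \<psi> :: "real^'n \<Rightarrow> real"
      proof (rule z(2)[OF Hs0_L2_on[OF test_Hs0[OF \<psi>]]])
        have "\<forall>\<^sub>F n in sequentially. t n < \<tau>" using order_tendstoD(2)[OF t(2)] \<tau> by simp
        then show "\<forall>\<^sub>F n in sequentially. pairing \<Omega> \<psi> (u' \<tau>) - Hk_norm k \<psi> * (M \<tau> - L) \<le> pairing \<Omega> \<psi> (u' (t n))"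
        proof eventually_elim
          case (elim n)
          have "\<bar>pairing \<Omega> \<psi> (u' \<tau>) - pairing \<Omega> \<psi> (u' (t n))\<bar> \<le> Hk_norm k \<psi> * (M \<tau> - M (t n))"
            using \<tau> elim t0[of n] by (intro M(2)[OF \<psi>]) auto
          also have "\<dots> \<le> Hk_norm k \<psi> * (M \<tau> - L)" using L[OF t(1)[of n]] by (intro mult_left_mono Hk_norm_nonneg) simp
          finally show ?case by linarith
        qed
      qed
      fix \<psi> :: "real^'n \<Rightarrow> real" assume \<psi>: "\<psi> \<in> test_functions \<Omega>"
      have neg: "pairing \<Omega> ((-1) *\<^sub>R \<psi>) f = - pairing \<Omega> \<psi> f" for f by (simp add: pairing_def)
      show "\<bar>(as_distribution \<Omega> (u' \<tau>) - as_distribution \<Omega> z) \<psi>\<bar> \<le> Hk_norm k \<psi> * (M \<tau> - L)"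
        using one[OF \<psi>] one[OF test_functions_scaleR[OF \<psi>, of "-1"]] Hk_norm_scaleR[OF \<psi>, of k "-1"]
        unfolding neg by (simp add: as_distribution_pairing)
    qed (use L[OF \<tau>] in simp)
    show "((\<lambda>\<tau>. H_neg_norm k \<Omega> (as_distribution \<Omega> (u' \<tau>) - as_distribution \<Omega> z)) \<longlongrightarrow> 0) (at_right 0)"
    proof (rule tendstoI)
      fix e :: real assume "0 < e"
      have "L < L + e" using \<open>0 < e\<close> by simp
      then obtain t1 where t1: "t1 \<in> {0<..T}" "M t1 < L + e"
        unfolding L_def using T by (subst (asm) cInf_less_iff) (use \<open>bdd_below (M ` {0<..T})\<close> in auto)
      show "\<forall>\<^sub>F \<tau> in at_right 0. dist (H_neg_norm k \<Omega> (as_distribution \<Omega> (u' \<tau>) - as_distribution \<Omega> z)) 0 < e"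
      proof (rule eventually_at_rightI[of 0 t1])
        fix \<tau> assume "\<tau> \<in> {0<..<t1}"
        then have \<tau>: "\<tau> \<in> {0<..T}" "M \<tau> \<le> M t1" "\<tau> \<in> {0..T}"
          using t1(1) mono_onD[OF M(1), of \<tau> t1] by auto
        \<comment> \<open>The difference of distributions and the distribution of
          \<open>u' \<tau> - z\<close> are identified on test functions, which is all the dual norm
          sees; the second is known to lie in \<open>H_neg\<close>.\<close>
        have "0 \<le> H_neg_norm k \<Omega> (as_distribution \<Omega> (u' \<tau>) - as_distribution \<Omega> z)"
        proof -
          have "as_distribution \<Omega> (u' \<tau> - z) \<psi> = (as_distribution \<Omega> (u' \<tau>) - as_distribution \<Omega> z) \<psi>" if "\<psi> \<in> test_functions \<Omega>" for \<psi> :: "real^'n \<Rightarrow> real"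
            using pairing_diff[OF u'_L2[OF \<tau>(3)] z(1) Hs0_L2_on[OF test_Hs0[OF that]]] by (simp add: as_distribution_pairing)
          then have "H_neg_norm k \<Omega> (as_distribution \<Omega> (u' \<tau> - z)) = H_neg_norm k \<Omega> (as_distribution \<Omega> (u' \<tau>) - as_distribution \<Omega> z)"
            unfolding H_neg_norm_def dual_norm_def by (intro arg_cong[of _ _ Sup] image_cong) auto
          then show ?thesis
            using H_neg_norm_nonneg[OF as_distribution_H_neg[OF L2_space_diff[OF u'_L2[OF \<tau>(3)] z(1)]]] by simp
        qed
        then show "dist (H_neg_norm k \<Omega> (as_distribution \<Omega> (u' \<tau>) - as_distribution \<Omega> z)) 0 < e"
          using est[OF \<tau>(1)] \<tau>(2) t1(2) by (simp add: dist_real_def)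
      qed (use t1(1) in simp)
    qed
  next
    fix \<psi> assume \<psi>: "\<psi> \<in> Hs0 s \<Omega>" and pos: "AE x in lebesgue. 0 \<le> \<psi> x"
    have \<mu>pos: "0 \<le> \<mu> (t n) \<psi>" for n
    proof -
      have "AE x in lebesgue_on \<Omega>. 0 \<le> \<psi> x" using pos unfolding AE_lebesgue_on_iff[OF dom_sets] by (auto elim!: eventually_mono)
      then have "\<Xi> (t n) (\<lambda>_. \<psi>) \<le> 0" by (intro \<Xi>_nonpos[OF t(1) V_const[OF \<psi>]]) simp
      then show ?thesis by (simp add: \<mu>_def)
    qed
    \<comment> \<open>All terms of \<open>const_identity\<close> other than the two pairings with
      \<psi> of velocities and the reaction; they vanish with the length of the interval.\<close>
    let ?r = "\<lambda>n. (LINT \<tau>|time (t n). form s A \<psi> (u \<tau>)) + \<nu> * (LINT \<tau>|time (t n). form s B \<psi> (u' \<tau>)) - t n * pairing \<Omega> \<psi> g"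
    have "?r \<longlonglongrightarrow> 0 + \<nu> * 0 - 0 * pairing \<Omega> \<psi> g"
      by (intro tendsto_intros integral_time_tendsto_0[OF form_integrable[OF A u_bochner \<psi>] t0 t(2)]
          integral_time_tendsto_0[OF form_integrable[OF B u'_bochner \<psi>] t0 t(2)] t(2))
    then have "?r \<longlonglongrightarrow> 0" by simp
    then show "pairing \<Omega> \<psi> w1 \<le> pairing \<Omega> \<psi> z"
    proof (rule zlim[OF Hs0_L2_on[OF \<psi>]])
      show "pairing \<Omega> \<psi> w1 - ?r n \<le> pairing \<Omega> \<psi> (u' (t n))" for n
        unfolding const_identity[OF \<psi> tT] using \<mu>pos[of n] by linarith
    qed
  next
    \<comment> \<open>An integrable majorant of every integrand that occurs when the identity on
      \<open>(0,t)\<close> is tested with \<open>u\<close>.\<close>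
    define E where "E \<tau> = (Hs_norm s (u' \<tau>))\<^sup>2 + a_hi * (Hs_norm s (u \<tau>))\<^sup>2
      + \<nu> * b_hi * ((Hs_norm s (u \<tau>))\<^sup>2 + (Hs_norm s (u' \<tau>))\<^sup>2) + N2 g * Hs_norm s (u \<tau>)" for \<tau>
    have Ei: "integrable (time T) E"
      unfolding E_def[abs_def]
      by (intro Bochner_Integration.integrable_add integrable_mult_right u_Hs_sq_integrable u'_Hs_sq_integrable u_Hs_integrable)
    \<comment> \<open>The boundary term pairs \<open>u'\<close> with \<open>u\<close> at time
      \<open>t n\<close>. Replacing that factor by the initial value costs at most
      \<open>C * d n\<close>, where the bound along the good times enters.\<close>
    define d where "d n = N2 (u (t n) - u 0)" for n
    have d: "d \<longlonglongrightarrow> 0"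
    proof -
      have "((\<lambda>r. N2 (u r - u 0)) \<longlongrightarrow> 0) (at 0 within {0..T})"
        using u_W T unfolding bochner_W1inf_def time_continuous_def by simp
      moreover have "filterlim t (at 0 within {0..T}) sequentially"
        unfolding filterlim_at
      proof
        show "\<forall>\<^sub>F n in sequentially. t n \<in> {0..T} \<and> t n \<noteq> 0"
          by (rule always_eventually) (use t(1) in \<open>auto simp: less_le\<close>)
      qed (rule t(2))
      ultimately show ?thesis unfolding d_def by (rule filterlim_compose)
    qed
    have C0: "0 \<le> C" using C[of 0] L2_norm_nonneg[of "lebesgue_on \<Omega>" "u' (t 0)"] by linarith
    have step: "pairing \<Omega> w0 (u' (t n)) \<le> pairing \<Omega> w0 w1 + ((LINT \<tau>|time (t n). E \<tau>) + C * d n)" for n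
    proof -
      let ?t = "t n"
      have u0H: "u 0 \<in> Hs0 s \<Omega>" using u_Hs0[of 0] T by simp
      have utL: "u ?t \<in> L2_on \<Omega>" "u 0 \<in> L2_on \<Omega>" using Hs0_L2_on[OF u_Hs0[OF tT]] Hs0_L2_on[OF u0H] by auto
      have w0eq: "pairing \<Omega> w0 f = pairing \<Omega> (u 0) f" for f
        unfolding pairing_def
      proof (rule integral_cong_AE_lebesgue_on[OF dom_sets])
        show "AE x in lebesgue_on \<Omega>. f x * w0 x = f x * u 0 x"
          using u_0 unfolding AE_lebesgue_on_iff[OF dom_sets] by eventually_elim simp
      qed
      have EI: "integrable (time ?t) E" "AE \<tau> in time ?t. u' \<tau> \<in> Hs0 s \<Omega>"
        using integral_time_diff(2)[OF Ei order_refl, of ?t] t0[of n] AE_time_mono[OF _ AE_u'_Hs0] by auto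
      define p where "p = (LINT \<tau>|time ?t. LINT x|lebesgue_on \<Omega>. u' \<tau> x * dt ?t u \<tau> x)"
      define q where "q = frac_form s A ?t u u"
      define q' where "q' = frac_form s B ?t u' u"
      define w where "w = (LINT \<tau>|time ?t. LINT x|lebesgue_on \<Omega>. g x * u \<tau> x)"
      have id: "pairing \<Omega> (u ?t) (u' ?t) - pairing \<Omega> (u 0) w1 - p + \<Xi> ?t u + q + \<nu> * q' = w"
        using \<Xi>_identity[OF t(1) u_V[OF t(1)], of n]
        unfolding weak_identity_def pairing_def p_def q_def q'_def w_def .
      have i1: "integrable (time ?t) (\<lambda>\<tau>. (Hs_norm s (u' \<tau>))\<^sup>2)" "integrable (time ?t) (\<lambda>\<tau>. (Hs_norm s (u \<tau>))\<^sup>2)"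
        "integrable (time ?t) (\<lambda>\<tau>. Hs_norm s (u \<tau>))"
        using integral_time_diff(2)[OF u'_Hs_sq_integrable order_refl, of ?t]
          integral_time_diff(2)[OF u_Hs_sq_integrable order_refl, of ?t]
          integral_time_diff(2)[OF u_Hs_integrable order_refl, of ?t] t0[of n] by auto
      have uH: "u \<tau> \<in> Hs0 s \<Omega>" if "\<tau> \<in> space (time ?t)" for \<tau> using that t0[of n] by (intro u_Hs0) auto
      have "\<bar>p\<bar> \<le> (LINT \<tau>|time ?t. (Hs_norm s (u' \<tau>))\<^sup>2)"
        unfolding p_def
      proof (rule integral_abs_le_integral[OF i1(1)])
        show "AE \<tau> in time ?t. \<bar>LINT x|lebesgue_on \<Omega>. u' \<tau> x * dt ?t u \<tau> x\<bar> \<le> (Hs_norm s (u' \<tau>))\<^sup>2"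
          using dt_u[OF t(1)[of n]] EI(2)
        proof eventually_elim
          case (elim \<tau>)
          have "(LINT x|lebesgue_on \<Omega>. u' \<tau> x * dt ?t u \<tau> x) = pairing \<Omega> (u' \<tau>) (u' \<tau>)"
            unfolding pairing_def by (rule integral_cong_AE_lebesgue_on[OF dom_sets]) (use elim(1) in eventually_elim, simp)
          also have "\<bar>\<dots>\<bar> \<le> N2 (u' \<tau>) * N2 (u' \<tau>)" by (rule pairing_bound[OF Hs0_L2_on Hs0_L2_on]) (rule elim)+
          also have "\<dots> \<le> Hs_norm s (u' \<tau>) * Hs_norm s (u' \<tau>)"
            by (intro mult_mono L2_on_norm_le_Hs_norm dom_sets Hs0_L2[OF elim(2)] L2_norm_nonneg Hs_norm_nonneg)
          finally show ?case by (simp add: power2_eq_square)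
        qed
      qed
      moreover have "\<bar>q\<bar> \<le> (LINT \<tau>|time ?t. a_hi * (Hs_norm s (u \<tau>))\<^sup>2)"
        unfolding q_def frac_form_def form_def[symmetric]
      proof (rule integral_abs_le_integral[OF integrable_mult_right[OF i1(2)]])
        show "AE \<tau> in time ?t. \<bar>form s A (u \<tau>) (u \<tau>)\<bar> \<le> a_hi * (Hs_norm s (u \<tau>))\<^sup>2"
        proof (rule AE_I2)
          fix \<tau> assume "\<tau> \<in> space (time ?t)"
          note H = uH[OF this]
          have "\<bar>form s A (u \<tau>) (u \<tau>)\<bar> \<le> a_hi * L2_norm lebesgue (frac_grad s (u \<tau>)) * Hs_norm s (u \<tau>)"
            using A(1) by (intro form_bound[OF A(2) _ Hs0_Hs[OF H] Hs0_Hs[OF H]]) simp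
          also have "\<dots> \<le> a_hi * Hs_norm s (u \<tau>) * Hs_norm s (u \<tau>)"
            using A(1) by (intro mult_right_mono mult_left_mono frac_grad_le_Hs_norm Hs_norm_nonneg) auto
          finally show "\<bar>form s A (u \<tau>) (u \<tau>)\<bar> \<le> a_hi * (Hs_norm s (u \<tau>))\<^sup>2" by (simp add: power2_eq_square mult.assoc)
        qed
      qed
      moreover have "- \<nu> * q' \<le> \<nu> * (LINT \<tau>|time ?t. b_hi * ((Hs_norm s (u \<tau>))\<^sup>2 + (Hs_norm s (u' \<tau>))\<^sup>2))"
      proof -
        have "\<bar>q'\<bar> \<le> (LINT \<tau>|time ?t. b_hi * ((Hs_norm s (u \<tau>))\<^sup>2 + (Hs_norm s (u' \<tau>))\<^sup>2))"
          unfolding q'_def frac_form_def form_def[symmetric]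
        proof (rule integral_abs_le_integral)
          show "integrable (time ?t) (\<lambda>\<tau>. b_hi * ((Hs_norm s (u \<tau>))\<^sup>2 + (Hs_norm s (u' \<tau>))\<^sup>2))"
            by (intro integrable_mult_right Bochner_Integration.integrable_add i1)
          show "AE \<tau> in time ?t. \<bar>form s B (u \<tau>) (u' \<tau>)\<bar> \<le> b_hi * ((Hs_norm s (u \<tau>))\<^sup>2 + (Hs_norm s (u' \<tau>))\<^sup>2)"
            using EI(2) AE_space
          proof eventually_elim
            case (elim \<tau>)
            note H = uH[OF elim(2)]
            have "\<bar>form s B (u \<tau>) (u' \<tau>)\<bar> \<le> b_hi * L2_norm lebesgue (frac_grad s (u \<tau>)) * Hs_norm s (u' \<tau>)"
              using B(1) by (intro form_bound[OF B(2) _ Hs0_Hs[OF elim(1)] Hs0_Hs[OF H]]) simp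
            also have "\<dots> \<le> b_hi * Hs_norm s (u \<tau>) * Hs_norm s (u' \<tau>)"
              using B(1) by (intro mult_right_mono mult_left_mono frac_grad_le_Hs_norm Hs_norm_nonneg) auto
            also have "\<dots> \<le> b_hi * ((Hs_norm s (u \<tau>))\<^sup>2 + (Hs_norm s (u' \<tau>))\<^sup>2)"
            proof -
              have "0 \<le> Hs_norm s (u \<tau>) * Hs_norm s (u' \<tau>)" by (intro mult_nonneg_nonneg Hs_norm_nonneg)
              then have "Hs_norm s (u \<tau>) * Hs_norm s (u' \<tau>) \<le> (Hs_norm s (u \<tau>))\<^sup>2 + (Hs_norm s (u' \<tau>))\<^sup>2"
                using sum_squares_bound[of "Hs_norm s (u \<tau>)" "Hs_norm s (u' \<tau>)"] by linarith
              then show ?thesis using B(1) by (simp add: mult.assoc)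
            qed
            finally show ?case .
          qed
        qed
        from mult_left_mono[OF abs_le_D2[OF this], of \<nu>] \<nu> show ?thesis by simp
      qed
      moreover have "\<bar>w\<bar> \<le> (LINT \<tau>|time ?t. N2 g * Hs_norm s (u \<tau>))"
        unfolding w_def
      proof (rule integral_abs_le_integral[OF integrable_mult_right[OF i1(3)]])
        show "AE \<tau> in time ?t. \<bar>LINT x|lebesgue_on \<Omega>. g x * u \<tau> x\<bar> \<le> N2 g * Hs_norm s (u \<tau>)"
        proof (rule AE_I2)
          fix \<tau> assume "\<tau> \<in> space (time ?t)"
          note H = uH[OF this]
          have "\<bar>pairing \<Omega> (u \<tau>) g\<bar> \<le> N2 (u \<tau>) * N2 g" by (rule pairing_bound[OF g Hs0_L2_on[OF H]])
          also have "\<dots> \<le> Hs_norm s (u \<tau>) * N2 g"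
            by (intro mult_right_mono L2_on_norm_le_Hs_norm dom_sets Hs0_L2[OF H] L2_norm_nonneg)
          finally show "\<bar>LINT x|lebesgue_on \<Omega>. g x * u \<tau> x\<bar> \<le> N2 g * Hs_norm s (u \<tau>)"
            by (simp add: pairing_def mult.commute)
        qed
      qed
      moreover have "(LINT \<tau>|time ?t. E \<tau>) = (LINT \<tau>|time ?t. (Hs_norm s (u' \<tau>))\<^sup>2) + (LINT \<tau>|time ?t. a_hi * (Hs_norm s (u \<tau>))\<^sup>2)
          + \<nu> * (LINT \<tau>|time ?t. b_hi * ((Hs_norm s (u \<tau>))\<^sup>2 + (Hs_norm s (u' \<tau>))\<^sup>2)) + (LINT \<tau>|time ?t. N2 g * Hs_norm s (u \<tau>))"
        unfolding E_def using i1 by (simp add: mult.assoc)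
      ultimately have "pairing \<Omega> (u ?t) (u' ?t) \<le> pairing \<Omega> (u 0) w1 + (LINT \<tau>|time ?t. E \<tau>)"
        using id \<Xi>_u_nonneg[OF t(1)[of n]] by linarith
      moreover have "pairing \<Omega> (u 0) (u' ?t) - pairing \<Omega> (u ?t) (u' ?t) \<le> C * d n"
      proof -
        have "pairing \<Omega> (u 0) (u' ?t) - pairing \<Omega> (u ?t) (u' ?t) = pairing \<Omega> (u' ?t) (u 0 - u ?t)"
          using pairing_diff[OF utL(2,1) u'_L2[OF tT[of n]]] by (simp add: pairing_def mult.commute)
        also have "\<dots> \<le> N2 (u' ?t) * N2 (u 0 - u ?t)"
          using pairing_bound[OF L2_space_diff[OF utL(2,1)] u'_L2[OF tT[of n]]] by (rule abs_le_D1)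
        also have "\<dots> \<le> C * d n"
          unfolding d_def L2_norm_minus_commute[of _ "u 0"] by (intro mult_right_mono C L2_norm_nonneg)
        finally show ?thesis .
      qed
      ultimately show ?thesis unfolding w0eq by linarith
    qed
    have neg: "pairing \<Omega> ((-1) *\<^sub>R w0) f = - pairing \<Omega> w0 f" for f by (simp add: pairing_def)
    have r: "(\<lambda>n. (LINT \<tau>|time (t n). E \<tau>) + C * d n) \<longlonglongrightarrow> 0"
      using tendsto_add[OF integral_time_tendsto_0[OF Ei t0 t(2)] tendsto_mult_right_zero[OF d, of C]] by simp
    \<comment> \<open>An upper bound for the pairing with \<open>w0\<close> is a lower bound for the
      pairing with \<open>- w0\<close>, the kind that \<open>zlim\<close> transfers.\<close>
    have "- pairing \<Omega> w0 w1 \<le> pairing \<Omega> ((-1) *\<^sub>R w0) z"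
    proof (rule zlim[OF L2_space_scaleR[OF Hs0_L2_on[OF w0]] r])
      show "- pairing \<Omega> w0 w1 - ((LINT \<tau>|time (t n). E \<tau>) + C * d n) \<le> pairing \<Omega> ((-1) *\<^sub>R w0) (u' (t n))" for n
        unfolding neg using step[of n] by linarith
    qed
    then show "pairing \<Omega> w0 z \<le> pairing \<Omega> w0 w1" unfolding neg by simp
  qed
qed

lemma variational_inequality:
  assumes \<phi>: "\<phi> \<in> V T" and pos: "AE \<tau> in time T. AE x in lebesgue_on \<Omega>. 0 \<le> \<phi> \<tau> x"
    and T0: "AE x in lebesgue_on \<Omega>. \<phi> T x = 0"
    and du: "AE \<tau> in time T. AE x in lebesgue. du \<tau> x = u' \<tau> x"
  shows "(LINT x|lebesgue_on \<Omega>. w1 x * \<phi> 0 x) + (LINT \<tau>|time T. LINT x|lebesgue_on \<Omega>. g x * \<phi> \<tau> x)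
    \<le> - (LINT \<tau>|time T. LINT x|lebesgue_on \<Omega>. du \<tau> x * dt T \<phi> \<tau> x) + frac_form s A T u \<phi> + \<nu> * frac_form s B T du \<phi>"
proof -
  have tT: "T \<in> {0<..T}" using T by simp
  have "(LINT x|lebesgue_on \<Omega>. u' T x * \<phi> T x) = 0"
    by (rule integral_eq_zero_AE) (use T0 in eventually_elim, simp)
  \<comment> \<open>\<open>du\<close> is the derivative chosen by \<open>time_deriv\<close>,
    \<open>u'\<close> the representative of the weak solution; they are exchanged under the
    integrals, where null sets do not matter.\<close>
  moreover have "(LINT \<tau>|time T. LINT x|lebesgue_on \<Omega>. du \<tau> x * dt T \<phi> \<tau> x) =
      (LINT \<tau>|time T. LINT x|lebesgue_on \<Omega>. u' \<tau> x * dt T \<phi> \<tau> x)"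
  proof (rule integral_cong_AE_lebesgue_on[OF sets_time])
    show "AE \<tau> in time T. (LINT x|lebesgue_on \<Omega>. du \<tau> x * dt T \<phi> \<tau> x) = (LINT x|lebesgue_on \<Omega>. u' \<tau> x * dt T \<phi> \<tau> x)"
      using du
    proof eventually_elim
      case (elim \<tau>)
      show ?case
      proof (rule integral_cong_AE_lebesgue_on[OF dom_sets])
        show "AE x in lebesgue_on \<Omega>. du \<tau> x * dt T \<phi> \<tau> x = u' \<tau> x * dt T \<phi> \<tau> x"
          using elim unfolding AE_lebesgue_on_iff[OF dom_sets] by eventually_elim simp
      qed
    qed
  qed
  moreover have "frac_form s B T du \<phi> = frac_form s B T u' \<phi>"
    unfolding frac_form_def
  proof (rule integral_cong_AE_lebesgue_on[OF sets_time])
    show "AE \<tau> in time T. (LINT x|lebesgue. (B x *v frac_grad s (du \<tau>) x) \<bullet> frac_grad s (\<phi> \<tau>) x) =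
        (LINT x|lebesgue. (B x *v frac_grad s (u' \<tau>) x) \<bullet> frac_grad s (\<phi> \<tau>) x)"
      using du by eventually_elim (simp add: frac_grad_cong_AE)
  qed
  ultimately show ?thesis
    using \<Xi>_identity[OF tT \<phi>] \<Xi>_nonpos[OF tT \<phi> pos] unfolding weak_identity_def by simp
qed

lemma very_weak: "very_weak_solution k s \<Omega> T \<nu> A B w0 w1 g u"
proof -
  define du where "du = time_deriv T (Hs0 s \<Omega>) (Hs_norm s) u"
  have dw: "weak_time_deriv T (Hs0 s \<Omega>) (Hs_norm s) u du" unfolding du_def by (rule bochner_H1_time_deriv[OF u_H1])
  \<comment> \<open>Uniqueness is applied with \<open>S = UNIV\<close>: the fractional gradient
    depends on the values on the whole space, so equality on \<Omega> alone would not identify the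
    viscous terms.\<close>
  have du: "AE \<tau> in time T. AE x in lebesgue. du \<tau> x = u' \<tau> x"
    using weak_time_deriv_Hs0_unique[OF _ dw u'_deriv, of UNIV] unfolding lebesgue_on_UNIV_eq by simp
  obtain z where z: "z \<in> L2_on \<Omega>"
    "((\<lambda>\<tau>. H_neg_norm k \<Omega> (as_distribution \<Omega> (u' \<tau>) - as_distribution \<Omega> z)) \<longlongrightarrow> 0) (at_right 0)"
    "\<And>\<psi>. \<psi> \<in> Hs0 s \<Omega> \<Longrightarrow> AE x in lebesgue. 0 \<le> \<psi> x \<Longrightarrow> pairing \<Omega> \<psi> w1 \<le> pairing \<Omega> \<psi> z"
    "pairing \<Omega> w0 z \<le> pairing \<Omega> w0 w1" using initial_velocity by blast
  have dist: "AE \<tau> in time T. \<forall>\<psi>\<in>test_functions \<Omega>. as_distribution \<Omega> (u' \<tau>) \<psi> = as_distribution \<Omega> (du \<tau>) \<psi>"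
    using du
  proof eventually_elim
    case (elim \<tau>)
    show ?case
    proof
      fix \<psi> :: "real^'n \<Rightarrow> real" assume "\<psi> \<in> test_functions \<Omega>"
      show "as_distribution \<Omega> (u' \<tau>) \<psi> = as_distribution \<Omega> (du \<tau>) \<psi>"
        unfolding as_distribution_def
      proof (rule integral_cong_AE_lebesgue_on[OF dom_sets])
        show "AE x in lebesgue_on \<Omega>. u' \<tau> x * \<psi> x = du \<tau> x * \<psi> x"
          using elim unfolding AE_lebesgue_on_iff[OF dom_sets] by eventually_elim simp
      qed
    qed
  qed
  have init: "0 \<le> (LINT x|lebesgue_on \<Omega>. (z x - w1 x) * (\<psi> x - w0 x))"
    if \<psi>: "\<psi> \<in> Hs0 s \<Omega>" and pos: "AE x in lebesgue. 0 \<le> \<psi> x" for \<psi>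
  proof -
    note i = pairing_integrable[OF z(1) Hs0_L2_on[OF \<psi>]] pairing_integrable[OF z(1) Hs0_L2_on[OF w0]]
      pairing_integrable[OF w1 Hs0_L2_on[OF \<psi>]] pairing_integrable[OF w1 Hs0_L2_on[OF w0]]
    have "(LINT x|lebesgue_on \<Omega>. (z x - w1 x) * (\<psi> x - w0 x)) =
        (LINT x|lebesgue_on \<Omega>. (z x * \<psi> x - z x * w0 x) - (w1 x * \<psi> x - w1 x * w0 x))"
      by (simp add: algebra_simps)
    also have "\<dots> = (pairing \<Omega> \<psi> z - pairing \<Omega> w0 z) - (pairing \<Omega> \<psi> w1 - pairing \<Omega> w0 w1)"
      unfolding pairing_def using i by simp
    finally show ?thesis using z(3)[OF \<psi> pos] z(4) by simp
  qed
  have ineq: "(LINT x|lebesgue_on \<Omega>. w1 x * \<phi> 0 x) + (LINT \<tau>|time T. LINT x|lebesgue_on \<Omega>. g x * \<phi> \<tau> x)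
    \<le> - (LINT \<tau>|time T. LINT x|lebesgue_on \<Omega>. du \<tau> x * dt T \<phi> \<tau> x) + frac_form s A T u \<phi> + \<nu> * frac_form s B T du \<phi>"
    if \<phi>: "\<phi> \<in> V T" and pos: "AE \<tau> in time T. AE x in lebesgue_on \<Omega>. 0 \<le> \<phi> \<tau> x"
      and ex: "\<exists>\<delta>>0. \<forall>\<tau>\<in>{T-\<delta>..T} \<inter> {0..T}. AE x in lebesgue_on \<Omega>. \<phi> \<tau> x = 0" for \<phi>
  proof (rule variational_inequality[OF \<phi> pos _ du])
    show "AE x in lebesgue_on \<Omega>. \<phi> T x = 0" using ex T by auto
  qed
  show ?thesis
    unfolding very_weak_solution_def Let_def du_def[symmetric]
  proof (intro conjI ballI impI)
    show "\<exists>f\<in>BV T (H_neg k \<Omega>) (H_neg_norm k \<Omega>). \<exists>z\<in>L2_on \<Omega>.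
         (AE \<tau> in time T. \<forall>\<psi>\<in>test_functions \<Omega>. f \<tau> \<psi> = as_distribution \<Omega> (du \<tau>) \<psi>) \<and>
         ((\<lambda>\<tau>. H_neg_norm k \<Omega> (f \<tau> - as_distribution \<Omega> z)) \<longlongrightarrow> 0) (at_right 0) \<and>
         (\<forall>\<psi>\<in>Hs0 s \<Omega>. (AE x in lebesgue. 0 \<le> \<psi> x) \<longrightarrow>
            0 \<le> (LINT x|lebesgue_on \<Omega>. (z x - w1 x) * (\<psi> x - w0 x)))"
    proof (rule bexI[OF _ derivative_BV], rule bexI[OF _ z(1)], intro conjI ballI impI)
      show "AE \<tau> in time T. \<forall>\<psi>\<in>test_functions \<Omega>. as_distribution \<Omega> (u' \<tau>) \<psi> = as_distribution \<Omega> (du \<tau>) \<psi>"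
        by (rule dist)
    qed (rule z(2), rule init)
  qed (rule u_H1 u_nonneg u_0 ineq; blast)+
qed

end

theorem proposition7:
  shows "\<exists>K::nat. \<forall>k\<ge>K.
    \<forall>(\<Omega> :: (real^'n) set) T s \<nu> A B a_lo a_hi b_lo b_hi w0 w1 g u.
      open \<Omega> \<and> bounded \<Omega> \<and> lipschitz_boundary \<Omega> \<and> negative_order_embeddings k \<Omega> \<and>
      0 < T \<and> 0 < s \<and> s \<le> 1 \<and> 0 < \<nu> \<and>
      0 < a_lo \<and> 0 < a_hi \<and> elliptic_coefficient a_lo a_hi A \<and>
      0 < b_lo \<and> 0 < b_hi \<and> elliptic_coefficient b_lo b_hi B \<and> (\<forall>x. transpose (B x) = B x) \<and>
      w0 \<in> Hs0 s \<Omega> \<and> w1 \<in> L2_on \<Omega> \<and> g \<in> L2_on \<Omega> \<and>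
      penalization_weak_solution s \<Omega> T \<nu> A B w0 w1 g u \<longrightarrow>
      very_weak_solution k s \<Omega> T \<nu> A B w0 w1 g u"
proof (intro exI[of _ "2 * DIM(real^'n) + 2"] allI impI, elim conjE)
  fix k :: nat and \<Omega> :: "(real^'n) set" and T s \<nu> :: real and A B :: "real^'n \<Rightarrow> real^'n^'n" and a_lo a_hi b_lo b_hi :: real
    and w0 w1 g :: "real^'n \<Rightarrow> real" and u :: "real \<Rightarrow> real^'n \<Rightarrow> real"
  assume k: "2 * DIM(real^'n) + 2 \<le> k" and h: "open \<Omega>" "bounded \<Omega>" "negative_order_embeddings k \<Omega>" "0 < s" "s \<le> 1"
    "0 < T" "0 < \<nu>" "0 < a_hi" "elliptic_coefficient a_lo a_hi A" "0 < b_hi" "elliptic_coefficient b_lo b_hi B"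
    "w0 \<in> Hs0 s \<Omega>" "w1 \<in> L2_on \<Omega>" "g \<in> L2_on \<Omega>"
    and pen: "penalization_weak_solution s \<Omega> T \<nu> A B w0 w1 g u"
  obtain u' \<xi> \<Xi> \<epsilon> ue ue' where
    sol: "weak_solution s \<Omega> T \<nu> A B w0 w1 g u u' \<xi> \<Xi>"
    and \<epsilon>: "\<forall>n::nat. 0 < \<epsilon> n \<and> \<epsilon> n < 1"
    and ue: "\<forall>n. penalized_solution s \<Omega> T \<nu> A B w0 w1 g (\<epsilon> n) (ue n) (ue' n)"
    and conv: "\<forall>t\<in>{0<..T}.
      weakly_tends (dual_on (Vspace s \<Omega> t) (Vnorm s \<Omega> t)) (dual_norm (Vspace s \<Omega> t) (Vnorm s \<Omega> t))
        (\<lambda>n. penalty_functional \<Omega> (\<epsilon> n) t (ue n)) (\<Xi> t)"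
    using pen unfolding penalization_weak_solution_def by blast
  have ueL: "ue n \<in> bochner_Linf T (Hs0 s \<Omega>) (Hs_norm s)" for n
    using ue unfolding penalized_solution_def by blast
  interpret penalization \<Omega> s k T \<nu> A B a_lo a_hi b_lo b_hi w0 w1 g u u' \<xi> \<Xi> \<epsilon> ue
    by unfold_locales (use k h sol \<epsilon> ueL conv in auto)
  show "very_weak_solution k s \<Omega> T \<nu> A B w0 w1 g u" by (rule very_weak)
qed

end
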